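(* Let $F$ be a functor from pointed spaces to pointed spaces and let $X$ be a pointed space. If $F_X$ commutes with realizations, that is, the natural map $LF_X(Y)\to F_X(Y)$ is an equivalence for all spaces $Y$, then for every $n$ the natural map $P_n^{\mathrm{alg}}F(X)\to P_nF(X)$ is an equivalence.
   Context: Conventions. Spaces are compactly generated with nondegenerate basepoint; equivalence means weak homotopy equivalence. All functors are continuous homotopy functors (preserving weak equivalences) from pointed spaces to pointed spaces satisfying the limit axiom: $\operatorname{hocolim}F(X_\alpha)\simeq F(\operatorname{hocolim}X_\alpha)$ for filtered systems $\{X_\alpha\}$ of finite complexes. $LF$ is the homotopy left Kan extension of the restriction of $F$ to finite pointed sets: with $\mathcal S$ a small category of finite pointed sets, $LF(Y)$ is the realization of $[k]\mapsto\bigvee_{(C_0,\dots,C_k)}F(C_0)\wedge\big(\mathrm{Map}_{\mathcal S}(C_0,C_1)\times\cdots\times\mathrm{Map}_{\mathcal S}(C_{k-1},C_k)\times\mathrm{Map}(C_k,Y)\big)_+$. The natural map $LF(Y)\to F(Y)$ is induced by $y\wedge f\mapsto F(f)(y)$ for $y\in F(C_0)$, $f:C_0\to Y$. $F_X(-)=F(X\wedge -)$. $P_n$ is Goodwillie's universal $n$-excisive approximation, and $P_n^{\mathrm{alg}}F(X)=P_n(LF_X)(S^0)$. The natural map $P_n^{\mathrm{alg}}F(X)\to P_nF(X)$ is obtained by applying $P_n$ to $LF_X\to F_X$ and evaluating at $S^0$, using $P_n(F_X)(S^0)\simeq P_nF(X)$. *)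

theory Defs
  imports "HOL-Analysis.Analysis" "HOL-Homology.Simplices"
begin

section \<open>A universe for spaces\<close>

text \<open>
  HOL has no type of all topological spaces, so ``space'' means a topology whose carrier is a set
  of elements of a type of class \<open>universe\<close>; the cardinality of the type is a cardinal
  \<open>\<kappa>\<close> with \<open>\<kappa> ^ c = \<kappa>\<close>, where \<open>c\<close> is the cardinality of the continuum.
  Such types exist above any given type, and they
  are closed under all constructions below: smash products, joins with finite sets,
  realizations, finite homotopy limits and telescopes. A construction is first carried out on
  its natural underlying type and then transported along the injection \<open>enc\<close>.
\<close>

class universe =
  assumes ex_inj_real: "\<exists>e :: real \<Rightarrow> 'a. inj e"
    and ex_inj_fun: "\<exists>e :: (real \<Rightarrow> 'a) \<Rightarrow> 'a. inj e"

lemma universe_exists: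
  shows "\<exists>e :: 'a \<Rightarrow> (real \<times> 'a) set. inj e"
    and "\<exists>e :: real \<Rightarrow> (real \<times> 'a) set. inj e"
    and "\<exists>e :: (real \<Rightarrow> (real \<times> 'a) set) \<Rightarrow> (real \<times> 'a) set. inj e"
proof -
  have "inj (\<lambda>a::'a. {(0::real, a)})" by (auto intro: injI)
  then show "\<exists>e :: 'a \<Rightarrow> (real \<times> 'a) set. inj e" by blast
  have "inj (\<lambda>r::real. {(r, undefined::'a)})" by (auto intro: injI)
  then show "\<exists>e :: real \<Rightarrow> (real \<times> 'a) set. inj e" by blast
  have "|UNIV \<times> UNIV :: (real \<times> real) set| =o |UNIV :: real set|"
    by (rule card_of_Times_same_infinite) (simp add: infinite_UNIV_char_0)
  then obtain p :: "real \<times> real \<Rightarrow> real" where "bij_betw p (UNIV \<times> UNIV) UNIV"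
    using card_of_ordIso by blast
  then have p: "inj p" by (simp add: bij_betw_def)
  let ?e = "\<lambda>f :: real \<Rightarrow> (real \<times> 'a) set. {(p (r, s), a) | r s a. (s, a) \<in> f r}"
  have "inj ?e"
  proof (rule injI)
    fix f g assume eq: "?e f = ?e g"
    have mem: "(s, a) \<in> h r \<longleftrightarrow> (p (r, s), a) \<in> ?e h" for h r s a
      by (auto simp: inj_eq[OF p])
    have "(s, a) \<in> f r \<longleftrightarrow> (s, a) \<in> g r" for r s a
    proof -
      have "(s, a) \<in> f r \<longleftrightarrow> (p (r, s), a) \<in> ?e f" by (rule mem)
      also have "\<dots> \<longleftrightarrow> (p (r, s), a) \<in> ?e g" by (rule arg_cong[OF eq])
      also have "\<dots> \<longleftrightarrow> (s, a) \<in> g r" by (rule mem[symmetric])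
      finally show ?thesis .
    qed
    then have "f r = g r" for r by (auto simp: set_eq_iff)
    then show "f = g" by (rule ext)
  qed
  then show "\<exists>e :: (real \<Rightarrow> (real \<times> 'a) set) \<Rightarrow> (real \<times> 'a) set. inj e" by blast
qed

definition enc :: "'b \<Rightarrow> 'u::universe" where
  "enc = (SOME e. inj e)"

definition dec :: "'u::universe \<Rightarrow> 'b" where
  "dec = inv_into UNIV enc"

section \<open>Pointed spaces\<close>

type_synonym 'u pspace = "'u topology \<times> 'u"

text \<open>The final topology on \<open>q ` topspace T\<close>; used for quotients (with \<open>q\<close> choosing
  representatives) and for transport along \<open>enc\<close>.\<close>

definition coinduced :: "'a topology \<Rightarrow> ('a \<Rightarrow> 'b) \<Rightarrow> 'b topology" where
  "coinduced T q = topology (\<lambda>V. V \<subseteq> q ` topspace T \<and> openin T {x \<in> topspace T. q x \<in> V})"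

lemma openin_coinduced:
  "openin (coinduced T q) V \<longleftrightarrow> V \<subseteq> q ` topspace T \<and> openin T {x \<in> topspace T. q x \<in> V}"
proof -
  have "istopology (\<lambda>V. V \<subseteq> q ` topspace T \<and> openin T {x \<in> topspace T. q x \<in> V})"
    unfolding istopology_def
  proof (intro conjI allI impI; (elim conjE)?)
    fix S R assume a: "openin T {x \<in> topspace T. q x \<in> S}" "openin T {x \<in> topspace T. q x \<in> R}"
      "S \<subseteq> q ` topspace T"
    show "S \<inter> R \<subseteq> q ` topspace T" using a by blast
    have "{x \<in> topspace T. q x \<in> S \<inter> R}
        = {x \<in> topspace T. q x \<in> S} \<inter> {x \<in> topspace T. q x \<in> R}" by blast
    then show "openin T {x \<in> topspace T. q x \<in> S \<inter> R}" using a by (simp add: openin_Int)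
  next
    fix \<K> assume a: "\<forall>K\<in>\<K>. K \<subseteq> q ` topspace T \<and> openin T {x \<in> topspace T. q x \<in> K}"
    then show "\<Union> \<K> \<subseteq> q ` topspace T" by blast
    have "{x \<in> topspace T. q x \<in> \<Union> \<K>} = (\<Union>K\<in>\<K>. {x \<in> topspace T. q x \<in> K})" by blast
    then show "openin T {x \<in> topspace T. q x \<in> \<Union> \<K>}" using a by auto
  qed
  then show ?thesis by (simp add: coinduced_def)
qed

abbreviation unit_interval :: "real topology" where
  "unit_interval \<equiv> top_of_set {0..1}"

definition kprod :: "'a topology \<Rightarrow> 'b topology \<Rightarrow> ('a \<times> 'b) topology" where
  "kprod A B = kification (prod_topology A B)"

text \<open>The basepoint is nondegenerate if its inclusion is an NDR pair.\<close>

definition nondegenerate :: "'u pspace \<Rightarrow> bool" where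
  "nondegenerate X \<longleftrightarrow> (\<exists>u h. continuous_map (fst X) unit_interval u
     \<and> {x \<in> topspace (fst X). u x = 0} = {snd X}
     \<and> continuous_map (prod_topology (fst X) unit_interval) (fst X) h
     \<and> (\<forall>x\<in>topspace (fst X). h (x, 0) = x)
     \<and> (\<forall>t\<in>{0..1}. h (snd X, t) = snd X)
     \<and> (\<forall>x\<in>topspace (fst X). u x < 1 \<longrightarrow> h (x, 1) = snd X))"

text \<open>``Compactly generated'' is meant in Steenrod's sense: a Hausdorff k-space.\<close>

definition pointed_space :: "'u pspace \<Rightarrow> bool" where
  "pointed_space X \<longleftrightarrow> snd X \<in> topspace (fst X) \<and> Hausdorff_space (fst X) \<and> k_space (fst X)
     \<and> nondegenerate X"

text \<open>Maps are extensional, so that a map is determined by its values on the carrier.\<close>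

definition mapspace :: "'a topology \<Rightarrow> 'b topology \<Rightarrow> ('a \<Rightarrow> 'b) topology" where
  "mapspace A B = topology_generated_by
     {{f \<in> extensional (topspace A). continuous_map A B f \<and> f ` K \<subseteq> V} | K V.
        compactin A K \<and> openin B V}"

definition pmaps :: "'u pspace \<Rightarrow> 'u pspace \<Rightarrow> ('u \<Rightarrow> 'u) set" where
  "pmaps X Y = {f \<in> extensional (topspace (fst X)).
     continuous_map (fst X) (fst Y) f \<and> f (snd X) = snd Y}"

definition pmapspace :: "'u pspace \<Rightarrow> 'u pspace \<Rightarrow> ('u \<Rightarrow> 'u) topology" where
  "pmapspace X Y = kification (subtopology (mapspace (fst X) (fst Y)) (pmaps X Y))"

section \<open>Weak homotopy equivalences\<close>

definition cube :: "nat \<Rightarrow> (nat \<Rightarrow> real) topology" where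
  "cube n = product_topology (\<lambda>_. unit_interval) {..<n}"

definition cube_boundary :: "nat \<Rightarrow> (nat \<Rightarrow> real) set" where
  "cube_boundary n = {t \<in> topspace (cube n). \<exists>i<n. t i = 0 \<or> t i = 1}"

definition sphere_maps :: "nat \<Rightarrow> 'a topology \<Rightarrow> 'a \<Rightarrow> ((nat \<Rightarrow> real) \<Rightarrow> 'a) set" where
  "sphere_maps n X x = {g. continuous_map (cube n) X g \<and> g ` cube_boundary n \<subseteq> {x}}"

definition sphere_htpy ::
    "nat \<Rightarrow> 'a topology \<Rightarrow> 'a \<Rightarrow> (((nat \<Rightarrow> real) \<Rightarrow> 'a) \<times> ((nat \<Rightarrow> real) \<Rightarrow> 'a)) set" where
  "sphere_htpy n X x = {(g, h). g \<in> sphere_maps n X x \<and> h \<in> sphere_maps n X x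
     \<and> homotopic_with (\<lambda>k. k ` cube_boundary n \<subseteq> {x}) (cube n) X g h}"

text \<open>For \<open>n = 0\<close> this is the set of path components, for \<open>n > 0\<close> the underlying set of the
  homotopy group. The group structure is not needed, since a bijective homomorphism is an
  isomorphism.\<close>

definition pi_set :: "nat \<Rightarrow> 'a topology \<Rightarrow> 'a \<Rightarrow> ((nat \<Rightarrow> real) \<Rightarrow> 'a) set set" where
  "pi_set n X x = sphere_maps n X x // sphere_htpy n X x"

definition pi_map :: "nat \<Rightarrow> 'b topology \<Rightarrow> ('a \<Rightarrow> 'b) \<Rightarrow> 'a
    \<Rightarrow> ((nat \<Rightarrow> real) \<Rightarrow> 'a) set \<Rightarrow> ((nat \<Rightarrow> real) \<Rightarrow> 'b) set" where
  "pi_map n Y f x c = (\<Union>g\<in>c. sphere_htpy n Y (f x) `` {f \<circ> g})"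

definition weak_equivalence :: "'a topology \<Rightarrow> 'b topology \<Rightarrow> ('a \<Rightarrow> 'b) \<Rightarrow> bool" where
  "weak_equivalence X Y f \<longleftrightarrow> continuous_map X Y f
     \<and> (topspace X = {} \<longrightarrow> topspace Y = {})
     \<and> (\<forall>n. \<forall>x\<in>topspace X. bij_betw (pi_map n Y f x) (pi_set n X x) (pi_set n Y (f x)))"

section \<open>Categories and functors to pointed spaces\<close>

record ('o, 'm) category =
  Obj :: "'o set"
  Hom :: "'o \<Rightarrow> 'o \<Rightarrow> 'm set"
  Idn :: "'o \<Rightarrow> 'm"
  Cmp :: "'o \<Rightarrow> 'o \<Rightarrow> 'o \<Rightarrow> 'm \<Rightarrow> 'm \<Rightarrow> 'm"

text \<open>\<open>Cmp C x y z b a\<close> is the composite of \<open>a : x \<rightarrow> y\<close> and \<open>b : y \<rightarrow> z\<close>.\<close>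

definition is_category :: "('o, 'm) category \<Rightarrow> bool" where
  "is_category C \<longleftrightarrow>
     (\<forall>x\<in>Obj C. Idn C x \<in> Hom C x x)
   \<and> (\<forall>x\<in>Obj C. \<forall>y\<in>Obj C. \<forall>a\<in>Hom C x y. Cmp C x x y a (Idn C x) = a \<and> Cmp C x y y (Idn C y) a = a)
   \<and> (\<forall>x\<in>Obj C. \<forall>y\<in>Obj C. \<forall>z\<in>Obj C. \<forall>a\<in>Hom C x y. \<forall>b\<in>Hom C y z. Cmp C x y z b a \<in> Hom C x z)
   \<and> (\<forall>w\<in>Obj C. \<forall>x\<in>Obj C. \<forall>y\<in>Obj C. \<forall>z\<in>Obj C. \<forall>a\<in>Hom C w x. \<forall>b\<in>Hom C x y. \<forall>c\<in>Hom C y z.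
        Cmp C w x z (Cmp C x y z c b) a = Cmp C w y z c (Cmp C w x y b a))"

definition filtered :: "('o, 'm) category \<Rightarrow> bool" where
  "filtered C \<longleftrightarrow> Obj C \<noteq> {}
   \<and> (\<forall>x\<in>Obj C. \<forall>y\<in>Obj C. \<exists>z\<in>Obj C. Hom C x z \<noteq> {} \<and> Hom C y z \<noteq> {})
   \<and> (\<forall>x\<in>Obj C. \<forall>y\<in>Obj C. \<forall>a\<in>Hom C x y. \<forall>b\<in>Hom C x y.
        \<exists>z\<in>Obj C. \<exists>c\<in>Hom C y z. Cmp C x y z c a = Cmp C x y z c b)"

definition Spaces :: "('u pspace, 'u \<Rightarrow> 'u) category" where
  "Spaces = \<lparr>Obj = Collect pointed_space, Hom = pmaps,
     Idn = (\<lambda>X. \<lambda>x\<in>topspace (fst X). x),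
     Cmp = (\<lambda>X Y Z g f. compose (topspace (fst X)) g f)\<rparr>"

record ('o, 'm, 'u) pfunctor =
  ob :: "'o \<Rightarrow> 'u pspace"
  mor :: "'o \<Rightarrow> 'o \<Rightarrow> 'm \<Rightarrow> 'u \<Rightarrow> 'u"

definition is_functor :: "('o, 'm) category \<Rightarrow> ('o, 'm, 'u) pfunctor \<Rightarrow> bool" where
  "is_functor C D \<longleftrightarrow>
     (\<forall>x\<in>Obj C. pointed_space (ob D x))
   \<and> (\<forall>x\<in>Obj C. \<forall>y\<in>Obj C. \<forall>a\<in>Hom C x y. mor D x y a \<in> pmaps (ob D x) (ob D y))
   \<and> (\<forall>x\<in>Obj C. mor D x x (Idn C x) = Idn Spaces (ob D x))
   \<and> (\<forall>x\<in>Obj C. \<forall>y\<in>Obj C. \<forall>z\<in>Obj C. \<forall>a\<in>Hom C x y. \<forall>b\<in>Hom C y z.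
        mor D x z (Cmp C x y z b a)
          = Cmp Spaces (ob D x) (ob D y) (ob D z) (mor D y z b) (mor D x y a))"

type_synonym 'u space_functor = "('u pspace, 'u \<Rightarrow> 'u, 'u) pfunctor"

definition after_functor :: "'u space_functor \<Rightarrow> ('o, 'm, 'u) pfunctor \<Rightarrow> ('o, 'm, 'u) pfunctor" where
  "after_functor F D = \<lparr>ob = (\<lambda>x. ob F (ob D x)),
     mor = (\<lambda>x y a. mor F (ob D x) (ob D y) (mor D x y a))\<rparr>"

section \<open>The bar construction\<close>

text \<open>A \<open>k\<close>-simplex of the nerve is a functor from the poset \<open>{0..k}\<close>: objects \<open>p i\<close> and
  arrows \<open>c i j : p i \<rightarrow> p j\<close> for \<open>i \<le> j \<le> k\<close>.\<close>

type_synonym ('o, 'm) chain = "(nat \<Rightarrow> 'o) \<times> (nat \<Rightarrow> nat \<Rightarrow> 'm)"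

definition nerve :: "('o, 'm) category \<Rightarrow> nat \<Rightarrow> ('o, 'm) chain set" where
  "nerve J k = {(p, c). p \<in> {..k} \<rightarrow>\<^sub>E Obj J
     \<and> (\<forall>i j. \<not> (i \<le> j \<and> j \<le> k) \<longrightarrow> c i j = undefined)
     \<and> (\<forall>i j. i \<le> j \<and> j \<le> k \<longrightarrow> c i j \<in> Hom J (p i) (p j))
     \<and> (\<forall>i\<le>k. c i i = Idn J (p i))
     \<and> (\<forall>i j l. i \<le> j \<and> j \<le> l \<and> l \<le> k \<longrightarrow> c i l = Cmp J (p i) (p j) (p l) (c j l) (c i j))}"

definition chain_pull :: "nat \<Rightarrow> (nat \<Rightarrow> nat) \<Rightarrow> ('o, 'm) chain \<Rightarrow> ('o, 'm) chain" where
  "chain_pull m \<theta> s = ((\<lambda>i\<in>{..m}. fst s (\<theta> i)),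
     (\<lambda>i j. if i \<le> j \<and> j \<le> m then snd s (\<theta> i) (\<theta> j) else undefined))"

text \<open>For \<open>D\<close> covariant with values in pointed spaces and \<open>W\<close> contravariant with values in
  unpointed spaces, the bar construction is the realization of the simplicial space
  \<open>[k] \<mapsto> \<Or>(p 0 \<rightarrow> \<dots> \<rightarrow> p k) D (p 0) \<and> W (p k)\<^sub>+\<close>, where \<open>\<Or>\<close> is a wedge. As \<open>D \<and> W\<^sub>+\<close> is
  \<open>D \<times> W\<close> with \<open>* \<times> W\<close> collapsed, a point of level \<open>k\<close> is either the basepoint \<open>None\<close>
  or \<open>Some (s, y, w)\<close> with \<open>y \<noteq> *\<close>.\<close>

type_synonym ('o, 'm, 'u, 'w) bar_elt = "(('o, 'm) chain \<times> 'u \<times> 'w) option"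

definition wedge_pt :: "('o, 'm, 'u) pfunctor \<Rightarrow> ('o, 'm) chain \<times> 'u \<times> 'w
    \<Rightarrow> ('o, 'm, 'u, 'w) bar_elt" where
  "wedge_pt D = (\<lambda>(s, y, w). if y = snd (ob D (fst s 0)) then None else Some (s, y, w))"

definition bar_level :: "('o, 'm) category \<Rightarrow> ('o, 'm, 'u) pfunctor \<Rightarrow> ('o \<Rightarrow> 'w topology)
    \<Rightarrow> nat \<Rightarrow> ('o, 'm, 'u, 'w) bar_elt topology" where
  "bar_level J D W k = coinduced
     (sum_topology (\<lambda>s. kprod (fst (ob D (fst s 0))) (W (fst s k))) (nerve J k)) (wedge_pt D)"

text \<open>The simplicial operator \<open>\<theta>\<^sup>*\<close> for monotone \<open>\<theta> : {0..m} \<rightarrow> {0..k}\<close>.\<close>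

definition bar_pull :: "('o, 'm, 'u) pfunctor \<Rightarrow> ('o \<Rightarrow> 'o \<Rightarrow> 'm \<Rightarrow> 'w \<Rightarrow> 'w)
    \<Rightarrow> nat \<Rightarrow> nat \<Rightarrow> (nat \<Rightarrow> nat) \<Rightarrow> ('o, 'm, 'u, 'w) bar_elt \<Rightarrow> ('o, 'm, 'u, 'w) bar_elt" where
  "bar_pull D Wm m k \<theta> v = (case v of None \<Rightarrow> None
     | Some ((p, c), y, w) \<Rightarrow> wedge_pt D (chain_pull m \<theta> (p, c),
         mor D (p 0) (p (\<theta> 0)) (c 0 (\<theta> 0)) y, Wm (p (\<theta> m)) (p k) (c (\<theta> m) k) w))"

definition simplex_top :: "nat \<Rightarrow> (nat \<Rightarrow> real) topology" where
  "simplex_top k = subtopology (powertop_real UNIV) (standard_simplex k)"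

definition simplex_push :: "nat \<Rightarrow> (nat \<Rightarrow> nat) \<Rightarrow> (nat \<Rightarrow> real) \<Rightarrow> nat \<Rightarrow> real" where
  "simplex_push m \<theta> t = (\<lambda>j. \<Sum>i | i \<le> m \<and> \<theta> i = j. t i)"

definition realization_rel :: "(nat \<Rightarrow> 'b topology) \<Rightarrow> (nat \<Rightarrow> nat \<Rightarrow> (nat \<Rightarrow> nat) \<Rightarrow> 'b \<Rightarrow> 'b)
    \<Rightarrow> nat \<times> 'b \<times> (nat \<Rightarrow> real) \<Rightarrow> nat \<times> 'b \<times> (nat \<Rightarrow> real) \<Rightarrow> bool" where
  "realization_rel Z pull = (\<lambda>a b. \<exists>m k \<theta> z t. mono_on {..m} \<theta> \<and> \<theta> ` {..m} \<subseteq> {..k}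
     \<and> z \<in> topspace (Z k) \<and> t \<in> standard_simplex m
     \<and> a = (m, pull m k \<theta> z, t) \<and> b = (k, z, simplex_push m \<theta> t))"

text \<open>Points of the realization are represented by a chosen element of their equivalence
  class.\<close>

definition realization_pt :: "(nat \<Rightarrow> 'b topology) \<Rightarrow> (nat \<Rightarrow> nat \<Rightarrow> (nat \<Rightarrow> nat) \<Rightarrow> 'b \<Rightarrow> 'b)
    \<Rightarrow> nat \<times> 'b \<times> (nat \<Rightarrow> real) \<Rightarrow> 'u::universe" where
  "realization_pt Z pull a = enc (SOME b. equivclp (realization_rel Z pull) a b)"

definition realization :: "(nat \<Rightarrow> 'b topology) \<Rightarrow> (nat \<Rightarrow> nat \<Rightarrow> (nat \<Rightarrow> nat) \<Rightarrow> 'b \<Rightarrow> 'b)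
    \<Rightarrow> 'u::universe topology" where
  "realization Z pull = coinduced
     (sum_topology (\<lambda>k. kprod (Z k) (simplex_top k)) UNIV) (realization_pt Z pull)"

definition bar_pt :: "('o, 'm) category \<Rightarrow> ('o, 'm, 'u) pfunctor \<Rightarrow> ('o \<Rightarrow> 'w topology)
    \<Rightarrow> ('o \<Rightarrow> 'o \<Rightarrow> 'm \<Rightarrow> 'w \<Rightarrow> 'w) \<Rightarrow> nat \<times> ('o, 'm, 'u, 'w) bar_elt \<times> (nat \<Rightarrow> real)
    \<Rightarrow> 'u::universe" where
  "bar_pt J D W Wm = realization_pt (bar_level J D W) (bar_pull D Wm)"

definition bar_construction :: "('o, 'm) category \<Rightarrow> ('o, 'm, 'u) pfunctor \<Rightarrow> ('o \<Rightarrow> 'w topology)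
    \<Rightarrow> ('o \<Rightarrow> 'o \<Rightarrow> 'm \<Rightarrow> 'w \<Rightarrow> 'w) \<Rightarrow> 'u::universe pspace" where
  "bar_construction J D W Wm = (realization (bar_level J D W) (bar_pull D Wm),
     bar_pt J D W Wm (0, None, (\<lambda>i. if i = 0 then 1 else 0)))"

section \<open>Homotopy colimits of small diagrams and the standing assumptions on functors\<close>

definition point_ob :: "'o \<Rightarrow> unit topology" where
  "point_ob = (\<lambda>_. discrete_topology UNIV)"

definition point_mor :: "'o \<Rightarrow> 'o \<Rightarrow> 'm \<Rightarrow> unit \<Rightarrow> unit" where
  "point_mor = (\<lambda>_ _ _ w. w)"

definition hocolim :: "('o, 'm) category \<Rightarrow> ('o, 'm, 'u::universe) pfunctor \<Rightarrow> 'u pspace" where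
  "hocolim J D = bar_construction J D point_ob point_mor"

text \<open>The natural map \<open>hocolim (F D) \<rightarrow> F (hocolim D)\<close>: a point of a chain \<open>s\<close> and a
  \<open>t\<close> in the simplex give \<open>D (p 0) \<rightarrow> hocolim D\<close>, \<open>x \<mapsto> [s, x, t]\<close>, to which \<open>F\<close> is applied.\<close>

definition hocolim_assembly :: "('o, 'm) category \<Rightarrow> 'u::universe space_functor
    \<Rightarrow> ('o, 'm, 'u) pfunctor \<Rightarrow> 'u \<Rightarrow> 'u" where
  "hocolim_assembly J F D a =
     (case (dec a :: nat \<times> ('o, 'm, 'u, unit) bar_elt \<times> (nat \<Rightarrow> real)) of
        (k, None, t) \<Rightarrow> snd (ob F (hocolim J D))
      | (k, Some (s, y, w), t) \<Rightarrow>
          mor F (ob D (fst s 0)) (hocolim J D)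
            (\<lambda>x\<in>topspace (fst (ob D (fst s 0))).
               bar_pt J D point_ob point_mor (k, wedge_pt D (s, x, w), t)) y)"

text \<open>A finite CW complex (characteristic maps are defined on cubes) whose basepoint is a
  vertex.\<close>

definition finite_complex :: "'u pspace \<Rightarrow> bool" where
  "finite_complex X \<longleftrightarrow> Hausdorff_space (fst X) \<and>
     (\<exists>(N::nat) d \<Phi>. let cell = (\<lambda>i. \<Phi> i ` (topspace (cube (d i)) - cube_boundary (d i))) in
        (\<forall>i<N. continuous_map (cube (d i)) (fst X) (\<Phi> i)
             \<and> inj_on (\<Phi> i) (topspace (cube (d i)) - cube_boundary (d i))
             \<and> \<Phi> i ` cube_boundary (d i) \<subseteq> (\<Union>j\<in>{j. j < N \<and> d j < d i}. cell j))
      \<and> disjoint_family_on cell {..<N}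
      \<and> (\<Union>i<N. cell i) = topspace (fst X)
      \<and> (\<exists>i<N. d i = 0 \<and> snd X \<in> cell i))"

definition continuous_functor :: "'u space_functor \<Rightarrow> bool" where
  "continuous_functor F \<longleftrightarrow> (\<forall>X Y. pointed_space X \<and> pointed_space Y \<longrightarrow>
     continuous_map (pmapspace X Y) (pmapspace (ob F X) (ob F Y)) (mor F X Y))"

definition homotopy_functor :: "'u space_functor \<Rightarrow> bool" where
  "homotopy_functor F \<longleftrightarrow> (\<forall>X Y f. pointed_space X \<and> pointed_space Y \<and> f \<in> pmaps X Y
     \<and> weak_equivalence (fst X) (fst Y) f
     \<longrightarrow> weak_equivalence (fst (ob F X)) (fst (ob F Y)) (mor F X Y f))"

definition limit_axiom :: "'u::universe space_functor \<Rightarrow> bool" where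
  "limit_axiom F \<longleftrightarrow> (\<forall>(J :: ('u, 'u) category) D. is_category J \<and> filtered J \<and> is_functor J D
     \<and> (\<forall>j\<in>Obj J. finite_complex (ob D j))
     \<longrightarrow> weak_equivalence (fst (hocolim J (after_functor F D))) (fst (ob F (hocolim J D)))
           (hocolim_assembly J F D))"

definition admissible :: "'u::universe space_functor \<Rightarrow> bool" where
  "admissible F \<longleftrightarrow> is_functor Spaces F \<and> continuous_functor F \<and> homotopy_functor F \<and> limit_axiom F"

section \<open>Smash products and \<open>F\<^sub>X\<close>\<close>

definition smash_pt :: "'u pspace \<Rightarrow> 'u pspace \<Rightarrow> 'u \<Rightarrow> 'u \<Rightarrow> 'u::universe" where
  "smash_pt X Y x y = enc (if x = snd X \<or> y = snd Y then None else Some (x, y))"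

definition smash :: "'u::universe pspace \<Rightarrow> 'u pspace \<Rightarrow> 'u pspace" where
  "smash X Y = (coinduced (kprod (fst X) (fst Y)) (\<lambda>(x, y). smash_pt X Y x y),
     enc (None :: ('u \<times> 'u) option))"

definition smash_functor :: "'u::universe pspace \<Rightarrow> 'u space_functor" where
  "smash_functor X = \<lparr>ob = smash X,
     mor = (\<lambda>Y Y' g. \<lambda>a\<in>topspace (fst (smash X Y)).
       (case dec a of None \<Rightarrow> snd (smash X Y') | Some (x, y) \<Rightarrow> smash_pt X Y' x (g y)))\<rparr>"

definition smash_shift :: "'u::universe space_functor \<Rightarrow> 'u pspace \<Rightarrow> 'u space_functor" where
  "smash_shift F X = after_functor F (smash_functor X)"

section \<open>The left Kan extension \<open>LF\<close>\<close>

text \<open>The skeleton of finite pointed sets \<open>{0..n}\<close> with basepoint \<open>0\<close>.\<close>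

definition Fin :: "(nat, nat \<Rightarrow> nat) category" where
  "Fin = \<lparr>Obj = UNIV, Hom = (\<lambda>m n. {f \<in> {..m} \<rightarrow>\<^sub>E {..n}. f 0 = 0}),
     Idn = (\<lambda>m. \<lambda>i\<in>{..m}. i), Cmp = (\<lambda>l m n g f. compose {..l} g f)\<rparr>"

definition finite_set_ob :: "(nat, nat \<Rightarrow> nat, 'u::universe) pfunctor" where
  "finite_set_ob = \<lparr>ob = (\<lambda>n. (discrete_topology (enc ` {..n}), enc (0::nat))),
     mor = (\<lambda>m n f. \<lambda>x\<in>enc ` {..m}. enc (f (dec x)))\<rparr>"

definition fin_maps :: "'u pspace \<Rightarrow> nat \<Rightarrow> (nat \<Rightarrow> 'u) topology" where
  "fin_maps Y n = kification
     (subtopology (product_topology (\<lambda>_. fst Y) {..n}) {g. g 0 = snd Y})"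

definition fin_maps_pull :: "nat \<Rightarrow> nat \<Rightarrow> (nat \<Rightarrow> nat) \<Rightarrow> (nat \<Rightarrow> 'u) \<Rightarrow> nat \<Rightarrow> 'u" where
  "fin_maps_pull m n f g = compose {..m} g f"

definition LKan_pt :: "'u space_functor \<Rightarrow> 'u pspace
    \<Rightarrow> nat \<times> (nat, nat \<Rightarrow> nat, 'u, nat \<Rightarrow> 'u) bar_elt \<times> (nat \<Rightarrow> real) \<Rightarrow> 'u::universe" where
  "LKan_pt F Y = bar_pt Fin (after_functor F finite_set_ob) (fin_maps Y) fin_maps_pull"

definition LKan :: "'u::universe space_functor \<Rightarrow> 'u space_functor" where
  "LKan F = (let L = (\<lambda>Y. bar_construction Fin (after_functor F finite_set_ob) (fin_maps Y)
       fin_maps_pull) in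
     \<lparr>ob = L,
      mor = (\<lambda>Y Y' f. \<lambda>a\<in>topspace (fst (L Y)).
        (case dec a of (k, v, t) \<Rightarrow> LKan_pt F Y'
           (k, map_option (\<lambda>(s, y, g). (s, y, compose {..fst s k} f g)) v, t)))\<rparr>)"

text \<open>The natural map \<open>LF (Y) \<rightarrow> F (Y)\<close>: the augmentation composes the arrows of the chain and
  evaluates \<open>y \<and> f \<mapsto> F(f)(y)\<close>.\<close>

definition LKan_counit :: "'u::universe space_functor \<Rightarrow> 'u pspace \<Rightarrow> 'u \<Rightarrow> 'u" where
  "LKan_counit F Y a =
     (case (dec a :: nat \<times> (nat, nat \<Rightarrow> nat, 'u, nat \<Rightarrow> 'u) bar_elt \<times> (nat \<Rightarrow> real)) of
        (k, None, t) \<Rightarrow> snd (ob F Y)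
      | (k, Some ((p, c), y, g), t) \<Rightarrow>
          mor F (ob finite_set_ob (p 0)) Y (\<lambda>x\<in>enc ` {..p 0}. g (c 0 k (dec x))) y)"

section \<open>Goodwillie's \<open>T\<^sub>n\<close> and \<open>P\<^sub>n\<close>\<close>

text \<open>The join of a pointed space \<open>X\<close> with a finite set \<open>U\<close>, formed in pointed spaces: reduced
  cones on \<open>X\<close>, one for each element of \<open>U\<close>, glued along \<open>X\<close>. It is obtained from
  \<open>X \<times> cone_star U\<close>, where \<open>cone_star U\<close> is the cone on \<open>U\<close>, by collapsing the tips of the cone and
  the basepoint of \<open>X\<close>. (For nondegenerate basepoints the quotient map from the unreduced join is
  an equivalence.)\<close>

definition cone_star :: "nat set \<Rightarrow> (nat \<Rightarrow> real) topology" where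
  "cone_star U = subtopology (powertop_real UNIV)
     (insert (\<lambda>_. 0) {(\<lambda>i. if i = u then r else 0) | u r. u \<in> U \<and> 0 \<le> r \<and> r \<le> 1})"

definition join_pt :: "'u pspace \<Rightarrow> 'u \<Rightarrow> (nat \<Rightarrow> real) \<Rightarrow> 'u::universe" where
  "join_pt X x s = enc (if x = snd X \<or> (\<exists>u. s u = 1) then None else Some (x, s))"

definition pjoin :: "'u::universe pspace \<Rightarrow> nat set \<Rightarrow> 'u pspace" where
  "pjoin X U = (coinduced (kprod (fst X) (cone_star U)) (\<lambda>(x, s). join_pt X x s),
     enc (None :: ('u \<times> (nat \<Rightarrow> real)) option))"

text \<open>The map \<open>X * U \<rightarrow> Y * V\<close> induced by \<open>f : X \<rightarrow> Y\<close> and \<open>U \<subseteq> V\<close> (the set \<open>V\<close> does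
  not enter the formula).\<close>

definition join_map :: "'u::universe pspace \<Rightarrow> nat set \<Rightarrow> 'u pspace \<Rightarrow> ('u \<Rightarrow> 'u) \<Rightarrow> 'u \<Rightarrow> 'u" where
  "join_map X U Y f = (\<lambda>a\<in>topspace (fst (pjoin X U)).
     (case dec a of None \<Rightarrow> enc (None :: ('u \<times> (nat \<Rightarrow> real)) option)
      | Some (x, s) \<Rightarrow> join_pt Y (f x) s))"

definition join_incl :: "'u::universe pspace \<Rightarrow> 'u \<Rightarrow> 'u" where
  "join_incl X = (\<lambda>x\<in>topspace (fst X). join_pt X x (\<lambda>_. 0))"

definition nonempty_subsets :: "nat \<Rightarrow> nat set set" where
  "nonempty_subsets n = {U. U \<subseteq> {..n} \<and> U \<noteq> {}}"

definition simplex_face :: "nat set \<Rightarrow> (nat \<Rightarrow> real) set" where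
  "simplex_face U = {t. (\<forall>i. 0 \<le> t i) \<and> (\<forall>i. i \<notin> U \<longrightarrow> t i = 0) \<and> sum t U = 1}"

text \<open>The homotopy limit of a punctured \<open>(n+1)\<close>-cube \<open>G\<close> is the space of natural
  transformations \<open>simplex_face U \<rightarrow> G U\<close>. This is the formula of Bousfield and Kan, in which
  the nerve of the poset of nonempty subsets of \<open>U\<close>, being the barycentric subdivision, is identified
  with the simplex spanned by \<open>U\<close>.\<close>

definition cube_holim :: "nat \<Rightarrow> (nat set \<Rightarrow> 'u pspace) \<Rightarrow> (nat set \<Rightarrow> nat set \<Rightarrow> 'u \<Rightarrow> 'u)
    \<Rightarrow> 'u::universe pspace" where
  "cube_holim n G g =
     (coinduced (kification (subtopology
        (product_topology (\<lambda>U. mapspace (subtopology (powertop_real UNIV) (simplex_face U)) (fst (G U)))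
           (nonempty_subsets n))
        {\<phi>. \<forall>U\<in>nonempty_subsets n. \<forall>V\<in>nonempty_subsets n. U \<subseteq> V \<longrightarrow>
               (\<forall>t\<in>simplex_face U. \<phi> V t = g U V (\<phi> U t))})) enc,
      enc (\<lambda>U\<in>nonempty_subsets n. \<lambda>t\<in>simplex_face U. snd (G U)))"

definition cube_map :: "nat \<Rightarrow> (nat set \<Rightarrow> 'u \<Rightarrow> 'u) \<Rightarrow> 'u \<Rightarrow> 'u::universe" where
  "cube_map n h a = enc (\<lambda>U\<in>nonempty_subsets n. \<lambda>t\<in>simplex_face U. h U (dec a U t))"

definition goodwillie_T :: "nat \<Rightarrow> 'u::universe space_functor \<Rightarrow> 'u space_functor" where
  "goodwillie_T n F = (let TF = (\<lambda>X. cube_holim n (\<lambda>U. ob F (pjoin X U))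
                 (\<lambda>U V. mor F (pjoin X U) (pjoin X V) (join_map X U X id))) in
     \<lparr>ob = TF,
      mor = (\<lambda>X Y f. \<lambda>a\<in>topspace (fst (TF X)).
        cube_map n (\<lambda>U. mor F (pjoin X U) (pjoin Y U) (join_map X U Y f)) a)\<rparr>)"

definition T_unit :: "nat \<Rightarrow> 'u::universe space_functor \<Rightarrow> 'u pspace \<Rightarrow> 'u \<Rightarrow> 'u" where
  "T_unit n F X y =
     enc (\<lambda>U\<in>nonempty_subsets n. \<lambda>t\<in>simplex_face U. mor F X (pjoin X U) (join_incl X) y)"

text \<open>The homotopy colimit of a sequence is the mapping telescope; the end \<open>(k, x, 1)\<close> of each
  cylinder is identified with \<open>(k + 1, z\<^sub>k x, 0)\<close>.\<close>

definition telescope_pt :: "(nat \<Rightarrow> 'u \<Rightarrow> 'u) \<Rightarrow> nat \<times> 'u \<times> real \<Rightarrow> 'u::universe" where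
  "telescope_pt z = (\<lambda>(k, x, t). enc (if t = 1 then (Suc k, z k x, 0) else (k, x, t)))"

definition telescope :: "(nat \<Rightarrow> 'u pspace) \<Rightarrow> (nat \<Rightarrow> 'u \<Rightarrow> 'u) \<Rightarrow> 'u::universe pspace" where
  "telescope Z z =
     (coinduced (sum_topology (\<lambda>k. kprod (fst (Z k)) unit_interval) UNIV) (telescope_pt z),
      telescope_pt z (0, snd (Z 0), 0))"

definition telescope_map :: "(nat \<Rightarrow> 'u \<Rightarrow> 'u) \<Rightarrow> (nat \<Rightarrow> 'u \<Rightarrow> 'u) \<Rightarrow> 'u \<Rightarrow> 'u::universe" where
  "telescope_map z' h a = (case dec a of (k, x, t) \<Rightarrow> telescope_pt z' (k, h k x, t))"

abbreviation T_iter :: "nat \<Rightarrow> nat \<Rightarrow> 'u::universe space_functor \<Rightarrow> 'u space_functor" where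
  "T_iter n k F \<equiv> (goodwillie_T n ^^ k) F"

abbreviation T_seq :: "nat \<Rightarrow> 'u::universe space_functor \<Rightarrow> 'u pspace \<Rightarrow> nat \<Rightarrow> 'u \<Rightarrow> 'u" where
  "T_seq n F X \<equiv> (\<lambda>k. T_unit n (T_iter n k F) X)"

definition goodwillie_P :: "nat \<Rightarrow> 'u::universe space_functor \<Rightarrow> 'u space_functor" where
  "goodwillie_P n F = (let PF = (\<lambda>X. telescope (\<lambda>k. ob (T_iter n k F) X) (T_seq n F X)) in
     \<lparr>ob = PF,
      mor = (\<lambda>X Y f. \<lambda>a\<in>topspace (fst (PF X)).
        telescope_map (T_seq n F Y) (\<lambda>k. mor (T_iter n k F) X Y f) a)\<rparr>)"

text \<open>The effect of \<open>T\<^sub>n\<^sup>k\<close> and \<open>P\<^sub>n\<close> on a natural transformation \<open>\<eta>\<close>.\<close>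

fun T_iter_trans :: "nat \<Rightarrow> nat \<Rightarrow> ('u pspace \<Rightarrow> 'u \<Rightarrow> 'u) \<Rightarrow> 'u::universe pspace \<Rightarrow> 'u \<Rightarrow> 'u" where
  "T_iter_trans n 0 \<eta> X = \<eta> X"
| "T_iter_trans n (Suc k) \<eta> X = cube_map n (\<lambda>U. T_iter_trans n k \<eta> (pjoin X U))"

definition P_trans :: "nat \<Rightarrow> 'u::universe space_functor \<Rightarrow> ('u pspace \<Rightarrow> 'u \<Rightarrow> 'u)
    \<Rightarrow> 'u pspace \<Rightarrow> 'u \<Rightarrow> 'u" where
  "P_trans n G \<eta> X = telescope_map (T_seq n G X) (\<lambda>k. T_iter_trans n k \<eta> X)"

section \<open>Algebraic approximation\<close>

definition S0 :: "'u::universe pspace" where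
  "S0 = ob finite_set_ob 1"

text \<open>The canonical homeomorphisms \<open>X \<and> (A * U) \<cong> (X \<and> A) * U\<close> and \<open>X \<and> S\<^sup>0 \<cong> X\<close>.\<close>

definition join_assoc :: "'u::universe pspace \<Rightarrow> 'u pspace \<Rightarrow> nat set \<Rightarrow> 'u \<Rightarrow> 'u" where
  "join_assoc X A U = (\<lambda>a\<in>topspace (fst (smash X (pjoin A U))).
     (case dec a of None \<Rightarrow> snd (pjoin (smash X A) U)
      | Some (x, b :: 'u) \<Rightarrow> (case dec b of None \<Rightarrow> snd (pjoin (smash X A) U)
          | Some (y, s) \<Rightarrow> join_pt (smash X A) (smash_pt X A x y) s)))"

definition smash_unit :: "'u::universe pspace \<Rightarrow> 'u \<Rightarrow> 'u" where
  "smash_unit X = (\<lambda>a\<in>topspace (fst (smash X S0)).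
     (case dec a of None \<Rightarrow> snd X | Some (x, b :: 'u) \<Rightarrow> x))"

text \<open>The natural identification \<open>T\<^sub>n\<^sup>k(F\<^sub>X)(A) \<rightarrow> T\<^sub>n\<^sup>kF(X \<and> A)\<close>, and the resulting one
  \<open>P\<^sub>n(F\<^sub>X)(S\<^sup>0) \<rightarrow> P\<^sub>nF(X \<and> S\<^sup>0) \<rightarrow> P\<^sub>nF(X)\<close>.\<close>

fun T_iter_shift :: "nat \<Rightarrow> nat \<Rightarrow> 'u::universe space_functor \<Rightarrow> 'u pspace \<Rightarrow> 'u pspace
    \<Rightarrow> 'u \<Rightarrow> 'u" where
  "T_iter_shift n 0 F X A = id"
| "T_iter_shift n (Suc k) F X A = cube_map n (\<lambda>U.
     mor (T_iter n k F) (smash X (pjoin A U)) (pjoin (smash X A) U) (join_assoc X A U)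
       \<circ> T_iter_shift n k F X (pjoin A U))"

definition P_shift :: "nat \<Rightarrow> 'u::universe space_functor \<Rightarrow> 'u pspace \<Rightarrow> 'u \<Rightarrow> 'u" where
  "P_shift n F X = mor (goodwillie_P n F) (smash X S0) X (smash_unit X)
     \<circ> telescope_map (T_seq n F (smash X S0)) (\<lambda>k. T_iter_shift n k F X S0)"

definition P_alg :: "nat \<Rightarrow> 'u::universe space_functor \<Rightarrow> 'u pspace \<Rightarrow> 'u pspace" where
  "P_alg n F X = ob (goodwillie_P n (LKan (smash_shift F X))) S0"

definition P_alg_map :: "nat \<Rightarrow> 'u::universe space_functor \<Rightarrow> 'u pspace \<Rightarrow> 'u \<Rightarrow> 'u" where
  "P_alg_map n F X = P_shift n F X
     \<circ> P_trans n (smash_shift F X) (LKan_counit (smash_shift F X)) S0"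

end

theory Submission
  imports Defs
begin

text \<open>
  A map is a weak equivalence iff it has the relative lifting property, up to homotopy, for the
  pairs of a cube and its boundary. In this form weak equivalences are inherited by homotopy limits
  of punctured cubes (lift on one simplex after the other, in the order of dimension) and by mapping
  telescopes (a map from a cube can be pushed up to a single stage, by compactness). Hence
  \<open>T\<^sub>n\<close>, its iterates and \<open>P\<^sub>n\<close> turn the natural equivalence \<open>LF\<^sub>X \<rightarrow> F\<^sub>X\<close> into an
  equivalence \<open>P\<^sub>n (LF\<^sub>X) S\<^sup>0 \<rightarrow> P\<^sub>n (F\<^sub>X) S\<^sup>0\<close>. The identification
  \<open>P\<^sub>n (F\<^sub>X) S\<^sup>0 \<rightarrow> P\<^sub>n F X\<close> comes from the homeomorphisms \<open>X \<and> (A * U) \<cong> (X \<and> A) * U\<close>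
  and \<open>X \<and> S\<^sup>0 \<cong> X\<close>, so it is an equivalence for every functor.
\<close>

text \<open>The homotopy groups of a homotopy limit are not a function of those of its vertices,
  whereas by the exponential law a lifting problem for it is a family of lifting problems for the
  vertices. These are not independent: the homotopies already chosen on smaller faces are not
  constant, so lifting must be available with a prescribed homotopy on the boundary
  (\<open>hel\<close>), and for products of a cube with a simplex. A second obstacle is the
  point-set setting. Functors are evaluated at smash products and joins, which therefore must be
  shown to be Hausdorff k-spaces with nondegenerate basepoint. The values of \<open>LKan\<close> and
  \<open>T_iter\<close> enter only as topological spaces: what the constructions pass on is
  \<open>k_functor\<close>, functoriality at points of the carrier together with k-space values.
  Homotopy limits and telescopes are built with \<open>kification\<close>, and maps into a
  k-ification are recognised on k-spaces. Finally, points are encoded by chosen representatives, so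
  every formula through \<open>dec\<close> has to respect the identifications.\<close>

abbreviation cyl :: "'a topology \<Rightarrow> (real \<times> 'a) topology" where
  "cyl C \<equiv> prod_topology unit_interval C"

abbreviation cyl_boundary :: "'a topology \<Rightarrow> 'a set \<Rightarrow> (real \<times> 'a) set" where
  "cyl_boundary C B \<equiv> {0..1} \<times> B \<union> {0, 1} \<times> topspace C"

section \<open>Continuity of real-valued and piecewise maps\<close>

lemma continuous_map_unit_interval:
  "continuous_map Z unit_interval f \<longleftrightarrow>
     continuous_map Z euclideanreal f \<and> (\<forall>z\<in>topspace Z. 0 \<le> f z \<and> f z \<le> 1)"
  by (auto simp: continuous_map_in_subtopology Pi_iff)

lemma continuous_map_unit_interval_real:
  "continuous_map Z unit_interval f \<Longrightarrow> continuous_map Z euclideanreal f"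
  by (simp add: continuous_map_unit_interval)

lemma prod_subtopology_right:
  "prod_topology A (subtopology C B) = subtopology (prod_topology A C) (topspace A \<times> B)"
  using prod_topology_subtopology_eu by (metis prod_topology_subtopology subtopology_topspace)

lemma continuous_map_closed_cases:
  assumes S: "closedin Z S" and T: "closedin Z T" and ST: "topspace Z \<subseteq> S \<union> T"
    and f: "continuous_map (subtopology Z S) Y f" and g: "continuous_map (subtopology Z T) Y g"
    and eq: "\<And>z. z \<in> S \<Longrightarrow> z \<in> T \<Longrightarrow> f z = g z"
  shows "continuous_map Z Y (\<lambda>z. if z \<in> S then f z else g z)"
proof (rule pasting_lemma_closed[where I = UNIV and T = "\<lambda>b. if b then S else T"
      and f = "\<lambda>b. if b then f else g"])
  show "\<exists>j. j \<in> UNIV \<and> x \<in> (if j then S else T) \<and>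
      (if x \<in> S then f x else g x) = (if j then f else g) x" if "x \<in> topspace Z" for x
    using that ST by (cases "x \<in> S") auto
qed (use assms in \<open>auto split: if_splits\<close>)

lemma closedin_real_le:
  assumes "continuous_map Z euclideanreal f" "continuous_map Z euclideanreal g"
  shows "closedin Z {z \<in> topspace Z. f z \<le> g z}"
proof -
  have "continuous_map Z euclideanreal (\<lambda>z. g z - f z)"
    using assms by (intro continuous_intros)
  then have "closedin Z {z \<in> topspace Z. g z - f z \<in> {0..}}"
    by (rule closedin_continuous_map_preimage) auto
  then show ?thesis by (simp add: le_diff_eq)
qed

lemma continuous_map_le_cases:
  assumes p: "continuous_map Z euclideanreal p" and q: "continuous_map Z euclideanreal q"
    and f: "continuous_map (subtopology Z {z \<in> topspace Z. p z \<le> q z}) Y f"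
    and g: "continuous_map (subtopology Z {z \<in> topspace Z. q z \<le> p z}) Y g"
    and eq: "\<And>z. z \<in> topspace Z \<Longrightarrow> p z = q z \<Longrightarrow> f z = g z"
  shows "continuous_map Z Y (\<lambda>z. if p z \<le> q z then f z else g z)"
proof -
  have "continuous_map Z Y
      (\<lambda>z. if z \<in> {z \<in> topspace Z. p z \<le> q z} then f z else g z)"
    by (rule continuous_map_closed_cases[OF closedin_real_le[OF p q] closedin_real_le[OF q p]])
      (use f g eq in auto)
  then show ?thesis by (rule continuous_map_eq) auto
qed

section \<open>Homotopy extension\<close>

text \<open>The homotopy extension property, encoded by a retraction of the cylinder onto its base and
  sides.\<close>

definition hep_pair :: "'a topology \<Rightarrow> 'a set \<Rightarrow> bool" where
  "hep_pair C B \<longleftrightarrow> closedin C B \<and> (\<exists>r. continuous_map (cyl C) (cyl C) r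
     \<and> (\<forall>z\<in>topspace (cyl C). fst (r z) = 0 \<or> snd (r z) \<in> B)
     \<and> (\<forall>x\<in>topspace C. r (0, x) = (0, x)) \<and> (\<forall>t\<in>{0..1}. \<forall>x\<in>B. r (t, x) = (t, x)))"

lemma closedin_base_and_sides:
  assumes "closedin C B"
  shows "closedin (cyl C) ({0} \<times> topspace C)" "closedin (cyl C) ({0..1} \<times> B)"
    "closedin (cyl C) ({1} \<times> topspace C)"
  by (intro closedin_prod_Times_iff[THEN iffD2] disjI2 conjI assms closedin_topspace;
      simp add: closed_subset closedin_topspace)+

text \<open>\<open>h\<close> on the base and \<open>K\<close> on the sides agree where they meet,
  and both pieces are closed, so they paste to a map on their union \<open>J\<close>; composing with
  the retraction of the cylinder onto \<open>J\<close> extends it.\<close>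

lemma homotopy_extension:
  assumes CB: "hep_pair C B" and h: "continuous_map C Y h"
    and K: "continuous_map (cyl (subtopology C B)) Y K"
    and eq: "\<And>x. x \<in> B \<Longrightarrow> K (0, x) = h x"
  obtains H where "continuous_map (cyl C) Y H" "\<And>x. x \<in> topspace C \<Longrightarrow> H (0, x) = h x"
    "\<And>t x. t \<in> {0..1} \<Longrightarrow> x \<in> B \<Longrightarrow> H (t, x) = K (t, x)"
proof -
  obtain r where B: "closedin C B" and r: "continuous_map (cyl C) (cyl C) r"
    and r1: "\<And>z. z \<in> topspace (cyl C) \<Longrightarrow> fst (r z) = 0 \<or> snd (r z) \<in> B"
    and r2: "\<And>x. x \<in> topspace C \<Longrightarrow> r (0, x) = (0, x)"
    and r3: "\<And>t x. t \<in> {0..1} \<Longrightarrow> x \<in> B \<Longrightarrow> r (t, x) = (t, x)"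
    using CB unfolding hep_pair_def by blast
  define J where "J = {0::real} \<times> topspace C \<union> {0..1} \<times> B"
  have sub: "B \<subseteq> topspace C" using B by (rule closedin_subset)
  note cl = closedin_base_and_sides[OF B]
  have "continuous_map (subtopology (cyl C) J) Y
      (\<lambda>z. if z \<in> {0} \<times> topspace C then (h \<circ> snd) z else K z)"
  proof (rule continuous_map_closed_cases)
    show "closedin (subtopology (cyl C) J) ({0} \<times> topspace C)"
      "closedin (subtopology (cyl C) J) ({0..1} \<times> B)"
      using cl by (auto simp: closedin_subset_topspace J_def)
    show "topspace (subtopology (cyl C) J) \<subseteq> {0} \<times> topspace C \<union> {0..1} \<times> B"
      by (auto simp: J_def)
    show "continuous_map (subtopology (subtopology (cyl C) J) ({0} \<times> topspace C)) Y (h \<circ> snd)"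
      by (intro continuous_map_compose[OF _ h] continuous_map_from_subtopology continuous_map_snd)
    have "subtopology (subtopology (cyl C) J) ({0..1} \<times> B) = cyl (subtopology C B)"
      by (simp add: prod_subtopology_right subtopology_subtopology J_def Int_absorb1)
    then show "continuous_map (subtopology (subtopology (cyl C) J) ({0..1} \<times> B)) Y K"
      using K by simp
  qed (auto simp: eq)
  moreover have "continuous_map (cyl C) (subtopology (cyl C) J) r"
  proof -
    have "r z \<in> J" if z: "z \<in> topspace (cyl C)" for z
    proof -
      have "r z \<in> topspace (cyl C)" using r z by (rule continuous_map_image_subset_topspace[THEN subsetD, OF _ imageI])
      then show ?thesis using r1[OF z] by (cases "r z") (auto simp: J_def)
    qed
    with r show ?thesis by (auto simp: continuous_map_in_subtopology)
  qed
  ultimately have "continuous_map (cyl C) Y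
      ((\<lambda>z. if z \<in> {0} \<times> topspace C then (h \<circ> snd) z else K z) \<circ> r)"
    by (rule continuous_map_compose[rotated])
  then show ?thesis
    by (rule that) (use r2 r3 eq sub in auto)
qed

lemma hep_pair_homeomorphic:
  assumes C: "hep_pair C B" and p: "homeomorphic_maps C C' p q" and B': "p ` B = B'"
  shows "hep_pair C' B'"
proof -
  obtain r where B: "closedin C B" and r: "continuous_map (cyl C) (cyl C) r"
    and r1: "\<And>z. z \<in> topspace (cyl C) \<Longrightarrow> fst (r z) = 0 \<or> snd (r z) \<in> B"
    and r2: "\<And>x. x \<in> topspace C \<Longrightarrow> r (0, x) = (0, x)"
    and r3: "\<And>t x. t \<in> {0..1} \<Longrightarrow> x \<in> B \<Longrightarrow> r (t, x) = (t, x)"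
    using C unfolding hep_pair_def by blast
  have pc: "continuous_map C C' p" and qc: "continuous_map C' C q"
    and qp: "\<And>x. x \<in> topspace C \<Longrightarrow> q (p x) = x" and pq: "\<And>y. y \<in> topspace C' \<Longrightarrow> p (q y) = y"
    using p by (auto simp: homeomorphic_maps_def)
  have qin: "\<And>y. y \<in> topspace C' \<Longrightarrow> q y \<in> topspace C"
    using qc by (auto simp: continuous_map_def)
  have "homeomorphic_map C C' p" using p by (metis homeomorphic_map_maps)
  then have "closedin C' B'"
    using B B' closedin_subset[OF B] homeomorphic_map_closedness by blast
  define r' where "r' = (\<lambda>z. (fst (r (fst z, q (snd z))), p (snd (r (fst z, q (snd z))))))"
  have "continuous_map (cyl C') (cyl C) (\<lambda>z. (fst z, q (snd z)))"
    by (intro continuous_map_pairedI continuous_map_fst continuous_map_snd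
        continuous_map_compose[OF continuous_map_snd qc, unfolded o_def])
  then have rc: "continuous_map (cyl C') (cyl C) (\<lambda>z. r (fst z, q (snd z)))"
    using continuous_map_compose[OF _ r] by (fastforce simp: o_def)
  have "continuous_map (cyl C') (cyl C') r'"
    unfolding r'_def
    by (intro continuous_map_pairedI continuous_map_compose[OF rc continuous_map_fst, unfolded o_def]
        continuous_map_compose[OF continuous_map_compose[OF rc continuous_map_snd] pc, unfolded o_def])
  moreover have "fst (r' z) = 0 \<or> snd (r' z) \<in> B'" if "z \<in> topspace (cyl C')" for z
    using r1[of "(fst z, q (snd z))"] that qin B' by (auto simp: r'_def)
  moreover have "r' (0, y) = (0, y)" if "y \<in> topspace C'" for y
    using that by (simp add: r'_def r2 qin pq)
  moreover have "r' (t, y) = (t, y)" if "t \<in> {0..1}" "y \<in> B'" for t y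
    using that B' closedin_subset[OF B] by (auto simp: r'_def r3 qp subset_iff)
  ultimately show ?thesis
    unfolding hep_pair_def using \<open>closedin C' B'\<close> by blast
qed

section \<open>Cubes\<close>

lemma topspace_cube: "topspace (cube n) = (\<Pi>\<^sub>E i\<in>{..<n}. {0..1})"
  by (simp add: cube_def)

lemma compact_space_cube: "compact_space (cube n)"
  unfolding cube_def compact_space_product_topology
  by (simp add: compact_space_subtopology)

lemma Hausdorff_space_cube: "Hausdorff_space (cube n)"
  unfolding cube_def Hausdorff_space_product_topology by (simp add: Hausdorff_space_subtopology)

lemma cube_boundary_subset: "cube_boundary n \<subseteq> topspace (cube n)"
  by (auto simp: cube_boundary_def)

lemma continuous_map_cube_component:
  assumes "i < n" shows "continuous_map (cube n) euclideanreal (\<lambda>x. x i)"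
proof -
  have "continuous_map (cube n) unit_interval (\<lambda>x. x i)"
    unfolding cube_def using assms by (intro continuous_map_product_projection) auto
  then show ?thesis by (rule continuous_map_unit_interval_real)
qed

lemma continuous_map_into_cube:
  assumes "\<And>i. i < n \<Longrightarrow> continuous_map Z euclideanreal (\<lambda>z. f z i)"
    and "\<And>z i. z \<in> topspace Z \<Longrightarrow> i < n \<Longrightarrow> 0 \<le> f z i \<and> f z i \<le> 1"
    and "\<And>z. z \<in> topspace Z \<Longrightarrow> f z \<in> extensional {..<n}"
  shows "continuous_map Z (cube n) f"
  using assms unfolding cube_def continuous_map_componentwise
  by (auto simp: continuous_map_in_subtopology Pi_iff)

text \<open>Sup-norm distance to the centre (1/2, ..., 1/2), scaled so that on the cube the boundary
  is the level set 1. The recursion, in place of a maximum over a set, gives 0 in dimension 0 and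
  makes continuity an induction.\<close>

primrec cube_radius :: "nat \<Rightarrow> (nat \<Rightarrow> real) \<Rightarrow> real" where
  "cube_radius 0 x = 0"
| "cube_radius (Suc n) x = max (cube_radius n x) \<bar>2 * x n - 1\<bar>"

lemma cube_radius_ge: "i < n \<Longrightarrow> \<bar>2 * x i - 1\<bar> \<le> cube_radius n x"
  by (induction n) (auto simp: less_Suc_eq)

lemma cube_radius_attained: "cube_radius n x = 0 \<or> (\<exists>i<n. cube_radius n x = \<bar>2 * x i - 1\<bar>)"
  by (induction n) (auto simp: max_def less_Suc_eq)

lemma cube_radius_le_1:
  assumes "x \<in> topspace (cube n)" shows "cube_radius n x \<le> 1"
proof -
  have "0 \<le> x i \<and> x i \<le> 1" if "i < n" for i
    using assms that by (auto simp: topspace_cube PiE_iff)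
  then have "\<bar>2 * x i - 1\<bar> \<le> 1" if "i < n" for i
    using that by (auto simp: abs_le_iff)
  then show ?thesis using cube_radius_attained[of n x] by auto
qed

lemma cube_radius_boundary: "x \<in> cube_boundary n \<Longrightarrow> cube_radius n x = 1"
  using cube_radius_ge[of _ n x] cube_radius_le_1[of x n] by (force simp: cube_boundary_def)

lemma continuous_map_cube_radius: "m \<le> n \<Longrightarrow> continuous_map (cube n) euclideanreal (cube_radius m)"
proof (induction m)
  case (Suc m)
  then show ?case
    by (auto intro!: continuous_intros continuous_map_cube_component)
next
  case 0
  have "cube_radius 0 = (\<lambda>_. 0)" by (rule ext) simp
  then show ?case by simp
qed

text \<open>Projection from the point \<open>(2, (1/2, \<dots>, 1/2))\<close> retracts the cylinder onto its base
  and sides.\<close>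

lemma hep_pair_cube: "hep_pair (cube n) (cube_boundary n)"
proof -
  \<comment> \<open>With \<open>p\<close> the projection point, \<open>z\<close> is sent to
    \<open>p + (z - p) / M z\<close>. The ray from \<open>p\<close> leaves the cylinder through a
    side if \<open>cube_radius\<close> is the larger entry, and through the base if
    \<open>(2 - fst z) / 2\<close> is. Height 2 for \<open>p\<close> keeps the second entry at least
    1/2, so that the division is safe. On base and sides \<open>M\<close> is 1, hence these are
    fixed.\<close>
  define M where "M = (\<lambda>z::real \<times> (nat \<Rightarrow> real). max (cube_radius n (snd z)) ((2 - fst z) / 2))"
  define r where "r = (\<lambda>z. (2 - (2 - fst z) / M z,
     \<lambda>i\<in>{..<n}. 1/2 + (snd z i - 1/2) / M z))"
  have M: "1/2 \<le> M z" "M z \<le> 1" if "z \<in> topspace (cyl (cube n))" for z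
    using that cube_radius_le_1[of "snd z" n] by (auto simp: M_def le_max_iff_disj field_simps)
  have M0: "M z \<noteq> 0" if "z \<in> topspace (cyl (cube n))" for z
    using M(1)[OF that] by auto
  have fc: "continuous_map (cyl (cube n)) euclideanreal fst"
    by (rule continuous_map_unit_interval_real[OF continuous_map_fst])
  have sc: "continuous_map (cyl (cube n)) euclideanreal (\<lambda>z. snd z i)" if "i < n" for i
    using continuous_map_compose[OF continuous_map_snd continuous_map_cube_component[OF that]]
    by (simp add: o_def)
  have Mc: "continuous_map (cyl (cube n)) euclideanreal M"
    unfolding M_def
    by (intro continuous_intros fc continuous_map_compose[OF continuous_map_snd
          continuous_map_cube_radius[OF order_refl], unfolded o_def]) auto
  have bd: "0 \<le> 1/2 + (x i - 1/2) / M (t, x) \<and> 1/2 + (x i - 1/2) / M (t, x) \<le> 1"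
    if z: "(t, x) \<in> topspace (cyl (cube n))" and i: "i < n" for t x i
  proof -
    have "\<bar>2 * x i - 1\<bar> \<le> M (t, x)" using cube_radius_ge[OF i, of x] by (simp add: M_def)
    moreover have "M (t, x) > 0" using M(1)[OF z] by simp
    ultimately show ?thesis by (auto simp: field_simps abs_le_iff)
  qed
  have bt: "0 \<le> 2 - (2 - t) / M (t, x) \<and> 2 - (2 - t) / M (t, x) \<le> 1"
    if z: "(t, x) \<in> topspace (cyl (cube n))" for t x
  proof -
    have "(2 - t) / 2 \<le> M (t, x)" by (simp add: M_def)
    moreover have "M (t, x) > 0" "M (t, x) \<le> 1" "0 \<le> t" "t \<le> 1" using M[OF z] z by auto
    ultimately show ?thesis by (auto simp: field_simps)
  qed
  have "continuous_map (cyl (cube n)) (cyl (cube n)) r"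
    unfolding r_def
  proof (intro continuous_map_pairedI continuous_map_into_cube)
    show "continuous_map (cyl (cube n)) unit_interval (\<lambda>z. 2 - (2 - fst z) / M z)"
      unfolding continuous_map_unit_interval using bt M0
      by (auto intro!: continuous_intros fc Mc)
    show "continuous_map (cyl (cube n)) euclideanreal
        (\<lambda>z. (\<lambda>i\<in>{..<n}. 1/2 + (snd z i - 1/2) / M z) i)" if "i < n" for i
      using that M0 by (auto intro!: continuous_intros sc Mc)
  qed (use bd in \<open>auto simp: split_beta\<close>)
  moreover have "fst (r z) = 0 \<or> snd (r z) \<in> cube_boundary n" if z: "z \<in> topspace (cyl (cube n))" for z
  proof (cases "cube_radius n (snd z) \<le> (2 - fst z) / 2")
    case True
    then have "M z = (2 - fst z) / 2" by (simp add: M_def)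
    then have "2 - fst z = 2 * M z" by simp
    then have "(2 - fst z) / M z = 2" using M0[OF z] by simp
    then show ?thesis by (simp add: r_def)
  next
    case False
    then have Mz: "M z = cube_radius n (snd z)" by (simp add: M_def)
    then obtain i where i: "i < n" "M z = \<bar>2 * snd z i - 1\<bar>"
      using cube_radius_attained[of n "snd z"] M0[OF z] by auto
    have "1/2 + (snd z i - 1/2) / M z = 0 \<or> 1/2 + (snd z i - 1/2) / M z = 1"
      using i(2) M0[OF z] by (auto simp: abs_if field_simps split: if_splits)
    moreover have "snd (r z) \<in> topspace (cube n)"
      using bd z by (cases z) (auto simp: r_def topspace_cube)
    ultimately show ?thesis using i by (auto simp: cube_boundary_def r_def)
  qed
  moreover have "r (0, x) = (0, x)" if "x \<in> topspace (cube n)" for x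
  proof -
    have "M (0, x) = 1" using cube_radius_le_1[OF that] by (simp add: M_def)
    then show ?thesis using that by (auto simp: r_def topspace_cube fun_eq_iff PiE_iff extensional_def)
  qed
  moreover have "r (t, x) = (t, x)" if "t \<in> {0..1}" "x \<in> cube_boundary n" for t x
  proof -
    have "M (t, x) = 1" using cube_radius_boundary that by (simp add: M_def)
    then show ?thesis using that cube_boundary_subset[of n]
      by (auto simp: r_def topspace_cube fun_eq_iff PiE_iff extensional_def subset_iff)
  qed
  moreover have "closedin (cube n) (cube_boundary n)"
  proof -
    have "cube_boundary n = (\<Union>i<n. {x \<in> topspace (cube n). x i \<in> {0, 1}})"
      by (auto simp: cube_boundary_def)
    moreover have "closedin (cube n) {x \<in> topspace (cube n). x i \<in> {0, 1}}" if "i < n" for i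
      by (rule closedin_continuous_map_preimage[OF continuous_map_cube_component[OF that]])
        (simp add: closed_def[symmetric] finite_imp_closed)
    ultimately show ?thesis by (simp only:) (rule closedin_Union; auto)
  qed
  ultimately show ?thesis unfolding hep_pair_def by blast
qed

section \<open>The cylinder on a cube is a cube, with the last coordinate as parameter\<close>

definition cube_split :: "nat \<Rightarrow> (nat \<Rightarrow> real) \<Rightarrow> real \<times> (nat \<Rightarrow> real)" where
  "cube_split n x = (x n, restrict x {..<n})"

definition cube_join :: "nat \<Rightarrow> real \<times> (nat \<Rightarrow> real) \<Rightarrow> nat \<Rightarrow> real" where
  "cube_join n z = (snd z)(n := fst z)"

lemma homeomorphic_maps_cube_split:
  "homeomorphic_maps (cube (Suc n)) (cyl (cube n)) (cube_split n) (cube_join n)"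
  unfolding homeomorphic_maps_def
proof (intro conjI ballI)
  show "continuous_map (cube (Suc n)) (cyl (cube n)) (cube_split n)"
    unfolding cube_split_def
    by (intro continuous_map_pairedI continuous_map_into_cube)
      (auto simp: continuous_map_unit_interval topspace_cube PiE_iff intro: continuous_map_cube_component)
  show "continuous_map (cyl (cube n)) (cube (Suc n)) (cube_join n)"
  proof (rule continuous_map_into_cube)
    fix i assume i: "i < Suc n"
    show "continuous_map (cyl (cube n)) euclideanreal (\<lambda>z. cube_join n z i)"
    proof (cases "i = n")
      case True
      then show ?thesis
        by (simp add: cube_join_def continuous_map_unit_interval_real[OF continuous_map_fst])
    next
      case False
      then have "i < n" using i by simp
      from continuous_map_compose[OF continuous_map_snd continuous_map_cube_component[OF this]] False
      show ?thesis by (simp add: cube_join_def o_def)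
    qed
  next
    fix z assume z: "z \<in> topspace (cyl (cube n))"
    then have "fst z \<in> {0..1}" "snd z \<in> topspace (cube n)" by auto
    then have z': "0 \<le> fst z" "fst z \<le> 1" "\<And>i. i < n \<Longrightarrow> 0 \<le> snd z i \<and> snd z i \<le> 1"
      "\<And>i. \<not> i < n \<Longrightarrow> snd z i = undefined"
      by (simp_all add: topspace_cube PiE_iff extensional_def)
    then show "cube_join n z \<in> extensional {..<Suc n}"
      by (simp add: cube_join_def extensional_def)
    show "0 \<le> cube_join n z i \<and> cube_join n z i \<le> 1" if "i < Suc n" for i
      using that z' by (cases "i = n") (auto simp: cube_join_def)
  qed
  show "cube_join n (cube_split n x) = x" if "x \<in> topspace (cube (Suc n))" for x
  proof
    fix i
    have "i \<noteq> n \<Longrightarrow> \<not> i < n \<Longrightarrow> x i = undefined"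
      using that by (simp add: topspace_cube PiE_iff extensional_def)
    then show "cube_join n (cube_split n x) i = x i"
      by (cases "i = n"; cases "i < n") (simp_all add: cube_join_def cube_split_def)
  qed
  show "cube_split n (cube_join n z) = z" if "z \<in> topspace (cyl (cube n))" for z
  proof -
    have "restrict ((snd z)(n := fst z)) {..<n} = restrict (snd z) {..<n}"
      by (rule restrict_ext) simp
    also have "\<dots> = snd z"
    proof (rule extensional_restrict)
      have "snd z \<in> topspace (cube n)" using that by auto
      then show "snd z \<in> extensional {..<n}" by (simp add: topspace_cube PiE_iff)
    qed
    finally show ?thesis by (simp add: cube_split_def cube_join_def)
  qed
qed

lemma cube_split_boundary:
  "cube_split n ` cube_boundary (Suc n) = cyl_boundary (cube n) (cube_boundary n)"
proof
  show "cube_split n ` cube_boundary (Suc n) \<subseteq> cyl_boundary (cube n) (cube_boundary n)"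
    by (auto simp: cube_split_def cube_boundary_def topspace_cube PiE_iff less_Suc_eq)
  show "cyl_boundary (cube n) (cube_boundary n) \<subseteq> cube_split n ` cube_boundary (Suc n)"
  proof
    fix z assume z: "z \<in> cyl_boundary (cube n) (cube_boundary n)"
    then have zt: "z \<in> topspace (cyl (cube n))" using cube_boundary_subset[of n] by auto
    have "cube_join n z \<in> topspace (cube (Suc n))"
      using homeomorphic_maps_cube_split[of n] zt
      by (auto simp: homeomorphic_maps_def continuous_map_def simp del: topspace_prod_topology)
    then have "cube_join n z \<in> cube_boundary (Suc n)"
      using z by (auto simp: cube_boundary_def cube_join_def less_Suc_eq)
    moreover have "cube_split n (cube_join n z) = z"
      using homeomorphic_maps_cube_split[of n] zt by (auto simp: homeomorphic_maps_def)
    ultimately show "z \<in> cube_split n ` cube_boundary (Suc n)" by force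
  qed
qed

lemma hep_pair_cyl_cube: "hep_pair (cyl (cube n)) (cyl_boundary (cube n) (cube_boundary n))"
  by (rule hep_pair_homeomorphic[OF hep_pair_cube homeomorphic_maps_cube_split cube_split_boundary])

section \<open>Relative lifting\<close>

text \<open>The compression criterion for relative homotopy groups, for a map \<open>f\<close> in
  place of an inclusion: strict on the side of \<open>a\<close>, and up to a homotopy that is
  stationary on \<open>B\<close> on the side of \<open>b\<close>.\<close>

definition solv :: "('x \<Rightarrow> 'y) \<Rightarrow> 'x topology \<Rightarrow> 'y topology \<Rightarrow> 'a topology \<Rightarrow> 'a set
    \<Rightarrow> ('a \<Rightarrow> 'x) \<Rightarrow> ('a \<Rightarrow> 'y) \<Rightarrow> bool" where
  "solv f X Y C B a b \<longleftrightarrow> (\<exists>A H. continuous_map C X A \<and> (\<forall>x\<in>B. A x = a x)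
     \<and> continuous_map (cyl C) Y H \<and> (\<forall>t\<in>{0..1}. \<forall>x\<in>B. H (t, x) = b x)
     \<and> (\<forall>x\<in>topspace C. H (0, x) = f (A x) \<and> H (1, x) = b x))"

definition lifting :: "('x \<Rightarrow> 'y) \<Rightarrow> 'x topology \<Rightarrow> 'y topology \<Rightarrow> 'a topology \<Rightarrow> 'a set \<Rightarrow> bool" where
  "lifting f X Y C B \<longleftrightarrow> (\<forall>a b. continuous_map (subtopology C B) X a \<longrightarrow> continuous_map C Y b
     \<longrightarrow> (\<forall>x\<in>B. f (a x) = b x) \<longrightarrow> solv f X Y C B a b)"

text \<open>May's homotopy extension and lifting property.\<close>

definition hel :: "('x \<Rightarrow> 'y) \<Rightarrow> 'x topology \<Rightarrow> 'y topology \<Rightarrow> 'a topology \<Rightarrow> 'a set \<Rightarrow> bool" where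
  "hel f X Y C B \<longleftrightarrow> (\<forall>a b K. continuous_map (subtopology C B) X a \<longrightarrow> continuous_map C Y b
     \<longrightarrow> continuous_map (cyl (subtopology C B)) Y K \<longrightarrow> (\<forall>x\<in>B. K (0, x) = f (a x) \<and> K (1, x) = b x)
     \<longrightarrow> (\<exists>A H. continuous_map C X A \<and> (\<forall>x\<in>B. A x = a x)
         \<and> continuous_map (cyl C) Y H \<and> (\<forall>t\<in>{0..1}. \<forall>x\<in>B. H (t, x) = K (t, x))
         \<and> (\<forall>x\<in>topspace C. H (0, x) = f (A x) \<and> H (1, x) = b x)))"

lemma helE:
  assumes "hel f X Y C B" "continuous_map (subtopology C B) X a" "continuous_map C Y b"
    "continuous_map (cyl (subtopology C B)) Y K"
    "\<And>x. x \<in> B \<Longrightarrow> K (0, x) = f (a x)" "\<And>x. x \<in> B \<Longrightarrow> K (1, x) = b x"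
  obtains A H where "continuous_map C X A" "\<And>x. x \<in> B \<Longrightarrow> A x = a x"
    "continuous_map (cyl C) Y H" "\<And>t x. t \<in> {0..1} \<Longrightarrow> x \<in> B \<Longrightarrow> H (t, x) = K (t, x)"
    "\<And>x. x \<in> topspace C \<Longrightarrow> H (0, x) = f (A x)" "\<And>x. x \<in> topspace C \<Longrightarrow> H (1, x) = b x"
proof -
  from assms(1)[unfolded hel_def, THEN spec, THEN spec, THEN spec, THEN mp, THEN mp, THEN mp,
      THEN mp, OF assms(2-4)] assms(5,6) that show ?thesis by metis
qed

lemma hel_imp_lifting:
  assumes "hel f X Y C B" shows "lifting f X Y C B"
  unfolding lifting_def
proof (intro allI impI)
  fix a b assume a: "continuous_map (subtopology C B) X a" and b: "continuous_map C Y b"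
    and eq: "\<forall>x\<in>B. f (a x) = b x"
  have "continuous_map (cyl (subtopology C B)) Y (b \<circ> snd)"
    by (intro continuous_map_compose[OF continuous_map_snd] continuous_map_from_subtopology b)
  then obtain A H where "continuous_map C X A" "\<And>x. x \<in> B \<Longrightarrow> A x = a x"
    "continuous_map (cyl C) Y H" "\<And>t x. t \<in> {0..1} \<Longrightarrow> x \<in> B \<Longrightarrow> H (t, x) = (b \<circ> snd) (t, x)"
    "\<And>x. x \<in> topspace C \<Longrightarrow> H (0, x) = f (A x)" "\<And>x. x \<in> topspace C \<Longrightarrow> H (1, x) = b x"
    by (rule helE[OF assms a b]) (use eq in auto)
  then show "solv f X Y C B a b" unfolding solv_def by (intro exI[of _ A] exI[of _ H]) auto
qed

section \<open>Concatenation and reparametrisation of homotopies\<close>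

definition path_cat :: "(real \<times> 'a \<Rightarrow> 'b) \<Rightarrow> (real \<times> 'a \<Rightarrow> 'b) \<Rightarrow> real \<times> 'a \<Rightarrow> 'b" where
  "path_cat H K = (\<lambda>(t, x). if t \<le> 1/2 then H (2 * t, x) else K (2 * t - 1, x))"

lemma continuous_map_cyl_fst: "continuous_map (cyl C) euclideanreal fst"
  by (rule continuous_map_unit_interval_real[OF continuous_map_fst])

lemma continuous_map_reparam:
  assumes H: "continuous_map (cyl C) Y H" and p: "continuous_map Z euclideanreal p"
    and q: "continuous_map Z C q" and 01: "\<And>z. z \<in> topspace Z \<Longrightarrow> 0 \<le> p z \<and> p z \<le> 1"
  shows "continuous_map Z Y (\<lambda>z. H (p z, q z))"
proof -
  have "continuous_map Z (cyl C) (\<lambda>z. (p z, q z))"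
    by (intro continuous_map_pairedI q) (use p 01 in \<open>simp add: continuous_map_unit_interval\<close>)
  from continuous_map_compose[OF this H] show ?thesis by (simp add: o_def)
qed

lemma continuous_map_path_cat:
  assumes H: "continuous_map (cyl C) Y H" and K: "continuous_map (cyl C) Y K"
    and eq: "\<And>x. x \<in> topspace C \<Longrightarrow> H (1, x) = K (0, x)"
  shows "continuous_map (cyl C) Y (path_cat H K)"
proof -
  have half: "H (2 * t, x) = K (2 * t - 1, x)" if "t * 2 = 1" "x \<in> topspace C" for t x
  proof -
    have "2 * t = 1" using that(1) by simp
    then show ?thesis using eq[OF that(2)] by simp
  qed
  have "continuous_map (cyl C) Y
    (\<lambda>z. if fst z \<le> 1/2 then H (2 * fst z, snd z) else K (2 * fst z - 1, snd z))"
    by (rule continuous_map_le_cases)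
      (auto intro!: continuous_intros continuous_map_reparam[OF H] continuous_map_reparam[OF K]
        continuous_map_from_subtopology[OF continuous_map_cyl_fst] continuous_map_cyl_fst
        dest: half)
  then show ?thesis by (simp add: path_cat_def split_beta')
qed

lemma continuous_map_const_reparam:
  assumes "continuous_map (cyl C) Y H" "t \<in> {0..1}"
  shows "continuous_map C Y (\<lambda>x. H (t, x))"
  by (rule continuous_map_reparam[OF assms(1)]) (use assms(2) in auto)

text \<open>Two paths in the unit interval with the same ends are homotopic rel ends by linear
  interpolation. Over \<open>B\<close> this moves \<open>W\<close> from the time \<open>p\<close> to
  the time \<open>q\<close>; the homotopy extension property of the cylinder relative to its whole
  boundary extends the motion, while base and top stay put.\<close>

lemma homotopy_improve:
  assumes CC: "hep_pair (cyl C) (cyl_boundary C B)" and BC: "closedin C B"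
    and W: "continuous_map (cyl C) Y W" and \<Gamma>: "continuous_map (cyl (subtopology C B)) Y \<Gamma>"
    and p: "continuous_map unit_interval unit_interval p" and q: "continuous_map unit_interval unit_interval q"
    and pq: "p 0 = q 0" "p 1 = q 1"
    and WB: "\<And>t x. t \<in> {0..1} \<Longrightarrow> x \<in> B \<Longrightarrow> W (t, x) = \<Gamma> (p t, x)"
  obtains W' where "continuous_map (cyl C) Y W'"
    "\<And>x. x \<in> topspace C \<Longrightarrow> W' (0, x) = W (0, x) \<and> W' (1, x) = W (1, x)"
    "\<And>t x. t \<in> {0..1} \<Longrightarrow> x \<in> B \<Longrightarrow> W' (t, x) = \<Gamma> (q t, x)"
proof -
  \<comment> \<open>The homotopy to be extended lives on an interval times \<open>D\<close>: on the
    part \<open>S\<close> over the sides it interpolates the time at which \<Gamma> is read, on the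
    part \<open>T\<close> over the two ends it is constant.\<close>
  define D where "D = cyl_boundary C B"
  define S where "S = {0..1::real} \<times> {0..1::real} \<times> B"
  define T where "T = {0..1::real} \<times> {0, 1::real} \<times> topspace C"
  let ?Z = "cyl (subtopology (cyl C) D)"
  define P where "P = (\<lambda>z. if z \<in> S
      then \<Gamma> ((1 - fst z) * p (fst (snd z)) + fst z * q (fst (snd z)), snd (snd z)) else W (snd z))"
  have cl: "closedin (cyl C) ({0..1} \<times> B)" "closedin (cyl C) ({0, 1} \<times> topspace C)"
    using BC closedin_base_and_sides[OF BC] by (auto simp: insert_Times_insert)
      (metis Sigma_Un_distrib1 closedin_Un insert_is_Un)
  have clS: "closedin ?Z S" and clT: "closedin ?Z T"
    unfolding S_def T_def
    by (auto simp: closedin_prod_Times_iff D_def intro!: closedin_subset_topspace cl)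
  have SB: "subtopology ?Z S = subtopology (cyl (cyl (subtopology C B))) S"
    by (simp add: prod_subtopology_right subtopology_subtopology)
      (rule arg_cong[where f = "subtopology _"], auto simp: S_def D_def)
  have snds: "continuous_map ?Z (cyl C) snd"
    by (rule continuous_map_into_fulltopology[OF continuous_map_snd])
  have pr: "continuous_map unit_interval euclideanreal p" "continuous_map unit_interval euclideanreal q"
    using p q by (auto intro: continuous_map_unit_interval_real)
  have p01: "0 \<le> p t \<and> p t \<le> 1 \<and> 0 \<le> q t \<and> q t \<le> 1" if "0 \<le> t" "t \<le> 1" for t
    using p q that by (auto simp: continuous_map_unit_interval)
  have "continuous_map ?Z Y P"
    unfolding P_def
  proof (rule continuous_map_closed_cases[OF clS clT])
    show "topspace ?Z \<subseteq> S \<union> T" by (auto simp: S_def T_def D_def)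
    have "continuous_map (cyl (cyl (subtopology C B))) Y
      (\<lambda>z. \<Gamma> ((1 - fst z) * p (fst (snd z)) + fst z * q (fst (snd z)), snd (snd z)))"
    proof (rule continuous_map_reparam[OF \<Gamma>])
      let ?Z' = "cyl (cyl (subtopology C B))"
      have 1: "continuous_map ?Z' unit_interval (\<lambda>z. fst (snd z))"
        by (intro continuous_map_compose[OF continuous_map_snd continuous_map_fst, unfolded o_def])
      show "continuous_map ?Z' euclideanreal
          (\<lambda>z. (1 - fst z) * p (fst (snd z)) + fst z * q (fst (snd z)))"
        by (intro continuous_intros continuous_map_cyl_fst
            continuous_map_compose[OF 1 pr(1), unfolded o_def]
            continuous_map_compose[OF 1 pr(2), unfolded o_def])
      show "continuous_map ?Z' (subtopology C B) (\<lambda>z. snd (snd z))"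
        by (intro continuous_map_compose[OF continuous_map_snd continuous_map_snd, unfolded o_def])
      fix z assume "z \<in> topspace ?Z'"
      then have "0 \<le> fst z" "fst z \<le> 1" "0 \<le> fst (snd z)" "fst (snd z) \<le> 1" by auto
      then have "0 \<le> (1 - fst z) * p (fst (snd z))" "0 \<le> fst z * q (fst (snd z))"
         "(1 - fst z) * p (fst (snd z)) \<le> (1 - fst z) * 1" "fst z * q (fst (snd z)) \<le> fst z * 1"
        using p01[of "fst (snd z)"] by (auto intro!: mult_nonneg_nonneg mult_left_mono simp del: mult_1_right)
      then show "0 \<le> (1 - fst z) * p (fst (snd z)) + fst z * q (fst (snd z))
        \<and> (1 - fst z) * p (fst (snd z)) + fst z * q (fst (snd z)) \<le> 1" by simp
    qed
    then show "continuous_map (subtopology ?Z S) Y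
      (\<lambda>z. \<Gamma> ((1 - fst z) * p (fst (snd z)) + fst z * q (fst (snd z)), snd (snd z)))"
      unfolding SB by (rule continuous_map_from_subtopology)
    show "continuous_map (subtopology ?Z T) Y (\<lambda>z. W (snd z))"
      using continuous_map_compose[OF snds W] by (auto simp: o_def intro: continuous_map_from_subtopology)
    show "\<Gamma> ((1 - fst z) * p (fst (snd z)) + fst z * q (fst (snd z)), snd (snd z)) = W (snd z)"
      if "z \<in> S" "z \<in> T" for z
      using that by (cases z) (auto simp: S_def T_def WB pq algebra_simps)
  qed
  moreover have "P (0, w) = W w" if "w \<in> D" for w
    using that by (cases w) (auto simp: P_def S_def WB)
  ultimately obtain H where H: "continuous_map (cyl (cyl C)) Y H"
    "\<And>t x. t \<in> {0..1} \<Longrightarrow> x \<in> D \<Longrightarrow> H (t, x) = P (t, x)"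
    using homotopy_extension[OF CC W] unfolding D_def by metis
  show ?thesis
  proof (rule that)
    show "continuous_map (cyl C) Y (\<lambda>w. H (1, w))"
      by (rule continuous_map_const_reparam[OF H(1)]) simp
    show "H (1, t, x) = \<Gamma> (q t, x)" if "t \<in> {0..1}" "x \<in> B" for t x
      using that by (subst H(2)) (auto simp: D_def P_def S_def)
    fix x assume x: "x \<in> topspace C"
    show "H (1, 0, x) = W (0, x) \<and> H (1, 1, x) = W (1, x)"
    proof (cases "x \<in> B")
      case True
      then show ?thesis using x pq WB by (subst (1 2) H(2)) (auto simp: D_def P_def S_def)
    next
      case False
      then show ?thesis using x by (subst (1 2) H(2)) (auto simp: D_def P_def S_def)
    qed
  qed
qed

text \<open>Dragging \<open>b\<close> backwards along \<open>K\<close> gives a square that commutes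
  strictly. Its solution, followed by the drag in reverse, has the right ends, but over
  \<open>B\<close> it waits before it runs through \<open>K\<close>; \<open>homotopy_improve\<close>
  removes the waiting.\<close>

lemma lifting_imp_hel:
  assumes C: "hep_pair C B" and CC: "hep_pair (cyl C) (cyl_boundary C B)"
    and l: "lifting f X Y C B" and f: "continuous_map X Y f"
  shows "hel f X Y C B"
  unfolding hel_def
proof (intro allI impI)
  fix a b K
  assume a: "continuous_map (subtopology C B) X a" and b: "continuous_map C Y b"
    and K: "continuous_map (cyl (subtopology C B)) Y K"
    and eq: "\<forall>x\<in>B. K (0, x) = f (a x) \<and> K (1, x) = b x"
  have cl: "closedin C B" using C by (simp add: hep_pair_def)
  have "continuous_map (cyl (subtopology C B)) Y (\<lambda>z. K (1 - fst z, snd z))"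
    by (rule continuous_map_reparam[OF K]) (auto intro!: continuous_intros continuous_map_cyl_fst)
  then obtain G where G: "continuous_map (cyl C) Y G" "\<And>x. x \<in> topspace C \<Longrightarrow> G (0, x) = b x"
    "\<And>t x. t \<in> {0..1} \<Longrightarrow> x \<in> B \<Longrightarrow> G (t, x) = K (1 - t, x)"
    using homotopy_extension[OF C b, of "\<lambda>z. K (1 - fst z, snd z)"] eq by auto
  have "continuous_map C Y (\<lambda>x. G (1, x))"
    by (rule continuous_map_const_reparam[OF G(1)]) simp
  moreover have "\<forall>x\<in>B. f (a x) = G (1, x)" using eq G(3) by auto
  ultimately have "solv f X Y C B a (\<lambda>x. G (1, x))"
    using l a unfolding lifting_def by blast
  then obtain A L where A: "continuous_map C X A" "\<forall>x\<in>B. A x = a x"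
    and L: "continuous_map (cyl C) Y L" "\<And>t x. t\<in>{0..1} \<Longrightarrow> x\<in>B \<Longrightarrow> L (t, x) = G (1, x)"
      "\<And>x. x\<in>topspace C \<Longrightarrow> L (0, x) = f (A x) \<and> L (1, x) = G (1, x)"
    unfolding solv_def by auto
  define G' where "G' = (\<lambda>z. G (1 - fst z, snd z))"
  have G': "continuous_map (cyl C) Y G'" unfolding G'_def
    by (rule continuous_map_reparam[OF G(1)]) (auto intro!: continuous_intros continuous_map_cyl_fst)
  have W: "continuous_map (cyl C) Y (path_cat L G')"
    by (rule continuous_map_path_cat[OF L(1) G']) (auto simp: L(3) G'_def)
  obtain H where H: "continuous_map (cyl C) Y H"
    "\<And>x. x \<in> topspace C \<Longrightarrow> H (0, x) = path_cat L G' (0, x) \<and> H (1, x) = path_cat L G' (1, x)"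
    "\<And>t x. t \<in> {0..1} \<Longrightarrow> x \<in> B \<Longrightarrow> H (t, x) = K (t, x)"
  \<comment> \<open>Over \<open>B\<close> the first half, \<open>L\<close>, rests at
    \<open>G (1, x) = K (0, x)\<close>, and the second half runs through \<open>K\<close> at double
    speed; hence this time function.\<close>
  proof (rule homotopy_improve[OF CC cl W K, where q = id and p = "\<lambda>t. max 0 (2 * t - 1)"])
    show "continuous_map unit_interval unit_interval (\<lambda>t. max 0 (2 * t - 1))"
      by (auto simp: continuous_map_in_subtopology intro!: continuous_intros)
    show "path_cat L G' (t, x) = K (max 0 (2 * t - 1), x)" if "t \<in> {0..1}" "x \<in> B" for t x
    proof (cases "t \<le> 1/2")
      case True
      then have "max 0 (2 * t - 1) = 0" by simp
      then show ?thesis using that True by (simp add: path_cat_def L(2) G(3))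
    next
      case False
      then have "max 0 (2 * t - 1) = 2 * t - 1" by simp
      then show ?thesis using that False by (simp add: path_cat_def G'_def G(3))
    qed
  qed auto
  show "\<exists>A H. continuous_map C X A \<and> (\<forall>x\<in>B. A x = a x)
         \<and> continuous_map (cyl C) Y H \<and> (\<forall>t\<in>{0..1}. \<forall>x\<in>B. H (t, x) = K (t, x))
         \<and> (\<forall>x\<in>topspace C. H (0, x) = f (A x) \<and> H (1, x) = b x)"
    by (rule exI[of _ A], rule exI[of _ H])
      (use A H L(3) G(2) in \<open>auto simp: path_cat_def G'_def\<close>)
qed

text \<open>Whether a square is solvable depends only on the homotopy class of its left side.\<close>

lemma solv_deform_pair:
  assumes C: "hep_pair C B" and CC: "hep_pair (cyl C) (cyl_boundary C B)"
    and f: "continuous_map X Y f"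
    and b: "continuous_map C Y b"
    and eq: "\<And>x. x \<in> B \<Longrightarrow> f (\<alpha> (0, x)) = b x"
    and \<alpha>: "continuous_map (cyl (subtopology C B)) X \<alpha>"
    and \<beta>: "continuous_map (cyl C) Y \<beta>" "\<And>x. x \<in> topspace C \<Longrightarrow> \<beta> (0, x) = b x"
      "\<And>t x. t \<in> {0..1} \<Longrightarrow> x \<in> B \<Longrightarrow> \<beta> (t, x) = f (\<alpha> (t, x))"
    and s: "solv f X Y C B (\<lambda>x. \<alpha> (1, x)) (\<lambda>x. \<beta> (1, x))"
  shows "solv f X Y C B (\<lambda>x. \<alpha> (0, x)) b"
proof -
  have cl: "closedin C B" using C by (simp add: hep_pair_def)
  have f\<alpha>: "continuous_map (cyl (subtopology C B)) Y (f \<circ> \<alpha>)"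
    by (rule continuous_map_compose[OF \<alpha> f])
  from s obtain A L where A: "continuous_map C X A" "\<And>x. x\<in>B \<Longrightarrow> A x = \<alpha> (1, x)"
    and L: "continuous_map (cyl C) Y L" "\<And>t x. t\<in>{0..1} \<Longrightarrow> x\<in>B \<Longrightarrow> L (t, x) = \<beta> (1, x)"
      "\<And>x. x\<in>topspace C \<Longrightarrow> L (0, x) = f (A x) \<and> L (1, x) = \<beta> (1, x)"
    unfolding solv_def by auto
  \<comment> \<open>\<open>G\<close> drags the solution \<open>A\<close> of the end square back
    along \<alpha>; its final map \<open>G (1, x)\<close> will solve the original square.\<close>
  have "continuous_map (cyl (subtopology C B)) X (\<lambda>z. \<alpha> (1 - fst z, snd z))"
    by (rule continuous_map_reparam[OF \<alpha>]) (auto intro!: continuous_intros continuous_map_cyl_fst)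
  then obtain G where G: "continuous_map (cyl C) X G" "\<And>x. x \<in> topspace C \<Longrightarrow> G (0, x) = A x"
    "\<And>t x. t \<in> {0..1} \<Longrightarrow> x \<in> B \<Longrightarrow> G (t, x) = \<alpha> (1 - t, x)"
    using homotopy_extension[OF C A(1), of "\<lambda>z. \<alpha> (1 - fst z, snd z)"] A(2) by auto
  define G' where "G' = (\<lambda>z. f (G (1 - fst z, snd z)))"
  have fG: "continuous_map (cyl C) Y (f \<circ> G)" by (rule continuous_map_compose[OF G(1) f])
  have "continuous_map (cyl C) Y (\<lambda>z. (f \<circ> G) (1 - fst z, snd z))"
    by (rule continuous_map_reparam[OF fG]) (auto intro!: continuous_intros continuous_map_cyl_fst)
  then have G': "continuous_map (cyl C) Y G'" by (simp add: G'_def)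
  define \<beta>' where "\<beta>' = (\<lambda>z. \<beta> (1 - fst z, snd z))"
  have \<beta>': "continuous_map (cyl C) Y \<beta>'" unfolding \<beta>'_def
    by (rule continuous_map_reparam[OF \<beta>(1)]) (auto intro!: continuous_intros continuous_map_cyl_fst)
  let ?V = "path_cat (path_cat G' L) \<beta>'"
  have V0: "continuous_map (cyl C) Y (path_cat G' L)"
    by (rule continuous_map_path_cat[OF G' L(1)]) (auto simp: L(3) G'_def G(2))
  have V: "continuous_map (cyl C) Y ?V"
    by (rule continuous_map_path_cat[OF V0 \<beta>']) (auto simp: L(3) path_cat_def \<beta>'_def)
  obtain H where H: "continuous_map (cyl C) Y H"
    "\<And>x. x \<in> topspace C \<Longrightarrow> H (0, x) = ?V (0, x) \<and> H (1, x) = ?V (1, x)"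
    "\<And>t x. t \<in> {0..1} \<Longrightarrow> x \<in> B \<Longrightarrow> H (t, x) = (f \<circ> \<alpha>) ((\<lambda>_. 0) t, x)"
  \<comment> \<open>Over \<open>B\<close> the concatenation runs through
    \<open>f \<circ> \<alpha>\<close> in the first quarter (\<open>G'\<close> is nested in two
    concatenations), waits during \<open>L\<close>, and runs back in the second half. As a path in
    the interval this is a loop at 0, so it can be replaced by the constant path.\<close>
  proof (rule homotopy_improve[OF CC cl V f\<alpha>, where q = "\<lambda>_. 0" and p = "\<lambda>t. min (4 * t) (min 1 (2 - 2 * t))"])
    show "continuous_map unit_interval unit_interval (\<lambda>t. min (4 * t) (min 1 (2 - 2 * t)))"
      by (auto simp: continuous_map_in_subtopology intro!: continuous_intros)
    show "?V (t, x) = (f \<circ> \<alpha>) (min (4 * t) (min 1 (2 - 2 * t)), x)" if "t \<in> {0..1}" "x \<in> B" for t x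
    proof -
      consider "t \<le> 1/4" | "1/4 < t" "t \<le> 1/2" | "1/2 < t" by linarith
      then show ?thesis
      proof cases
        case 1
        then have "min (4 * t) (min 1 (2 - 2 * t)) = 4 * t" by simp
        then show ?thesis using that 1 by (simp add: path_cat_def G'_def G(3))
      next
        case 2
        then have "min (4 * t) (min 1 (2 - 2 * t)) = 1" by simp
        then show ?thesis using that 2 by (simp add: path_cat_def L(2) \<beta>(3))
      next
        case 3
        then have "min (4 * t) (min 1 (2 - 2 * t)) = 2 - 2 * t" by simp
        then show ?thesis using that 3 by (simp add: path_cat_def \<beta>'_def \<beta>(3))
      qed
    qed
  qed auto
  have "continuous_map C X (\<lambda>x. G (1, x))"
    by (rule continuous_map_const_reparam[OF G(1)]) simp
  then show ?thesis
    unfolding solv_def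
    by (intro exI[of _ "\<lambda>x. G (1, x)"] exI[of _ H])
      (use H G(3) L(3) \<beta>(2) eq in \<open>auto simp: path_cat_def G'_def \<beta>'_def\<close>)
qed

text \<open>The homotopy extension property supplies a deformation of \<open>b\<close> over the
  given one of the left side. What remains is to solve the end square for an unknown
  \<beta>.\<close>

lemma solv_deform:
  assumes C: "hep_pair C B" and CC: "hep_pair (cyl C) (cyl_boundary C B)"
    and f: "continuous_map X Y f"
    and b: "continuous_map C Y b"
    and eq: "\<And>x. x \<in> B \<Longrightarrow> f (\<alpha> (0, x)) = b x"
    and \<alpha>: "continuous_map (cyl (subtopology C B)) X \<alpha>"
    and step: "\<And>\<beta>. continuous_map (cyl C) Y \<beta> \<Longrightarrow> (\<And>x. x \<in> topspace C \<Longrightarrow> \<beta> (0, x) = b x)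
       \<Longrightarrow> (\<And>t x. t \<in> {0..1} \<Longrightarrow> x \<in> B \<Longrightarrow> f (\<alpha> (t, x)) = \<beta> (t, x))
       \<Longrightarrow> solv f X Y C B (\<lambda>x. \<alpha> (1, x)) (\<lambda>x. \<beta> (1, x))"
  shows "solv f X Y C B (\<lambda>x. \<alpha> (0, x)) b"
proof -
  have "continuous_map (cyl (subtopology C B)) Y (f \<circ> \<alpha>)"
    by (rule continuous_map_compose[OF \<alpha> f])
  then obtain \<beta> where \<beta>: "continuous_map (cyl C) Y \<beta>" "\<And>x. x \<in> topspace C \<Longrightarrow> \<beta> (0, x) = b x"
    "\<And>t x. t \<in> {0..1} \<Longrightarrow> x \<in> B \<Longrightarrow> \<beta> (t, x) = (f \<circ> \<alpha>) (t, x)"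
    using homotopy_extension[OF C b, of "f \<circ> \<alpha>"] eq by auto
  show ?thesis
    by (rule solv_deform_pair[OF C CC f b eq \<alpha> \<beta>(1,2)]) (use \<beta> step in auto)
qed

section \<open>Transport of lifting along relative homeomorphisms\<close>

lemma quotient_map_factor:
  assumes q: "quotient_map C C' q" and A: "continuous_map C X A"
    and eq: "\<And>x y. x \<in> topspace C \<Longrightarrow> y \<in> topspace C \<Longrightarrow> q x = q y \<Longrightarrow> A x = A y"
  shows "\<exists>A'. continuous_map C' X A' \<and> (\<forall>x\<in>topspace C. A' (q x) = A x)"
proof (rule quotient_map_lift_exists[OF q A])
  show "A x = A y" if "x \<in> topspace C" "y \<in> topspace C" "q x = q y" for x y
    using that by (rule eq)
qed blast

text \<open>Distinct points identified by \<open>q\<close> lie in \<open>B\<close>, where the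
  solution upstairs equals the given data pulled back along \<open>q\<close>; hence lift and
  homotopy descend. For the homotopy, the cylinder on a quotient is the quotient of the cylinder
  because the interval is locally compact.\<close>

lemma hel_quotient:
  assumes h: "hel f X Y C B" and q: "quotient_map C C' q" and B': "q ` B = B'" and sub: "B \<subseteq> topspace C"
    and inj: "\<And>x y. x \<in> topspace C \<Longrightarrow> y \<in> topspace C \<Longrightarrow> q x = q y \<Longrightarrow> x = y \<or> (x \<in> B \<and> y \<in> B)"
  shows "hel f X Y C' B'"
  unfolding hel_def
proof (intro allI impI)
  fix a b K
  assume a: "continuous_map (subtopology C' B') X a" and b: "continuous_map C' Y b"
    and K: "continuous_map (cyl (subtopology C' B')) Y K"
    and eq: "\<forall>x\<in>B'. K (0, x) = f (a x) \<and> K (1, x) = b x"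
  have qc: "continuous_map C C' q" and im: "q ` topspace C = topspace C'"
    using q by (auto simp: quotient_imp_continuous_map quotient_imp_surjective_map)
  have qB: "continuous_map (subtopology C B) (subtopology C' B') q"
    using qc B' by (auto simp: continuous_map_in_subtopology continuous_map_from_subtopology)
  have cq: "quotient_map (cyl C) (cyl C') (\<lambda>(t, x). (t, q x))"
    by (rule quotient_map_prod_right[OF _ _ q])
      (auto simp: Hausdorff_space_subtopology compact_imp_locally_compact_space compact_space_subtopology)
  have "continuous_map (subtopology C B) X (a \<circ> q)" by (rule continuous_map_compose[OF qB a])
  moreover have "continuous_map C Y (b \<circ> q)" by (rule continuous_map_compose[OF qc b])
  moreover have "continuous_map (cyl (subtopology C B)) Y (\<lambda>z. K (fst z, q (snd z)))"
    by (rule continuous_map_reparam[OF K])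
      (auto intro!: continuous_map_cyl_fst continuous_map_compose[OF continuous_map_snd qB, unfolded o_def])
  ultimately obtain A H where A: "continuous_map C X A" "\<And>x. x\<in>B \<Longrightarrow> A x = (a \<circ> q) x"
    and H: "continuous_map (cyl C) Y H"
      "\<And>t x. t\<in>{0..1} \<Longrightarrow> x\<in>B \<Longrightarrow> H (t, x) = (\<lambda>z. K (fst z, q (snd z))) (t, x)"
      "\<And>x. x\<in>topspace C \<Longrightarrow> H (0, x) = f (A x)" "\<And>x. x\<in>topspace C \<Longrightarrow> H (1, x) = (b \<circ> q) x"
    by (rule helE[OF h]) (use B' eq in auto)
  have "A x = A y" if "x \<in> topspace C" "y \<in> topspace C" "q x = q y" for x y
    using inj[OF that] A(2) that(3) by auto
  from quotient_map_factor[OF q A(1) this]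
  obtain A' where A': "continuous_map C' X A'" "\<And>x. x \<in> topspace C \<Longrightarrow> A' (q x) = A x"
    by blast
  have "H z = H w" if "z \<in> topspace (cyl C)" "w \<in> topspace (cyl C)"
      "(\<lambda>(t, x). (t, q x)) z = (\<lambda>(t, x). (t, q x)) w" for z w
    using that inj[of "snd z" "snd w"] H(2) by (cases z; cases w) auto
  from quotient_map_factor[OF cq H(1) this]
  obtain H' where H': "continuous_map (cyl C') Y H'"
      "\<And>z. z \<in> topspace (cyl C) \<Longrightarrow> H' ((\<lambda>(t, x). (t, q x)) z) = H z"
    by blast
  have H'q: "H' (t, q x) = H (t, x)" if "t \<in> {0..1}" "x \<in> topspace C" for t x
    using H'(2)[of "(t, x)"] that by simp
  show "\<exists>A H. continuous_map C' X A \<and> (\<forall>x\<in>B'. A x = a x)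
         \<and> continuous_map (cyl C') Y H \<and> (\<forall>t\<in>{0..1}. \<forall>x\<in>B'. H (t, x) = K (t, x))
         \<and> (\<forall>x\<in>topspace C'. H (0, x) = f (A x) \<and> H (1, x) = b x)"
  proof (intro exI[of _ A'] exI[of _ H'] conjI ballI)
    show "A' x = a x" if "x \<in> B'" for x
      using that B' sub A'(2) A(2) by auto
    show "H' (t, x) = K (t, x)" if "t \<in> {0..1}" "x \<in> B'" for t x
      using that B' sub H'q H(2) by auto
    fix x assume "x \<in> topspace C'"
    then obtain y where "y \<in> topspace C" "x = q y" using im by auto
    then show "H' (0, x) = f (A' x)" "H' (1, x) = b x" using H'q H(3,4) A'(2) by auto
  qed (use A' H' in auto)
qed

lemma hel_homeomorphic:
  assumes "hel f X Y C B" "homeomorphic_maps C C' p q" "p ` B = B'" "B \<subseteq> topspace C"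
  shows "hel f X Y C' B'"
proof (rule hel_quotient[OF assms(1) _ assms(3,4)])
  show "quotient_map C C' p"
    using assms(2) homeomorphic_map_def homeomorphic_map_maps by metis
  show "x = y \<or> x \<in> B \<and> y \<in> B" if "x \<in> topspace C" "y \<in> topspace C" "p x = p y" for x y
    using assms(2) that by (metis homeomorphic_maps_def)
qed

lemma hel_cyl_cube:
  assumes "hel f X Y (cube (Suc n)) (cube_boundary (Suc n))"
  shows "hel f X Y (cyl (cube n)) (cyl_boundary (cube n) (cube_boundary n))"
  by (rule hel_homeomorphic[OF assms homeomorphic_maps_cube_split cube_split_boundary cube_boundary_subset])

lemma homeomorphic_maps_sym_cube:
  "homeomorphic_maps (cyl (cube n)) (cube (Suc n)) (cube_join n) (cube_split n)"
  using homeomorphic_maps_cube_split homeomorphic_maps_sym by metis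

lemma cube_join_boundary:
  "cube_join n ` cyl_boundary (cube n) (cube_boundary n) = cube_boundary (Suc n)"
proof -
  have "cube_join n (cube_split n x) = x" if "x \<in> cube_boundary (Suc n)" for x
    using that homeomorphic_maps_cube_split[of n] cube_boundary_subset[of "Suc n"]
    unfolding homeomorphic_maps_def by blast
  then show ?thesis unfolding cube_split_boundary[symmetric] image_image by simp
qed

lemma hel_cube_Suc:
  assumes "hel f X Y (cyl (cube n)) (cyl_boundary (cube n) (cube_boundary n))"
  shows "hel f X Y (cube (Suc n)) (cube_boundary (Suc n))"
  by (rule hel_homeomorphic[OF assms homeomorphic_maps_sym_cube cube_join_boundary])
    (use cube_boundary_subset[of n] in auto)

lemma hep_pair_cyl_cyl_cube:
  "hep_pair (cyl (cyl (cube n))) (cyl_boundary (cyl (cube n)) (cyl_boundary (cube n) (cube_boundary n)))"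
proof (rule hep_pair_homeomorphic[OF hep_pair_cyl_cube[of "Suc n"]])
  note h = homeomorphic_maps_cube_split[of n]
  show "homeomorphic_maps (cyl (cube (Suc n))) (cyl (cyl (cube n)))
      (\<lambda>(t, x). (t, cube_split n x)) (\<lambda>(t, x). (t, cube_join n x))"
    by (rule homeomorphic_maps_prod[THEN iffD2], rule disjI2, rule conjI[OF _ h])
      (simp add: homeomorphic_maps_def)
  have im: "cube_split n ` topspace (cube (Suc n)) = topspace (cyl (cube n))"
    using h homeomorphic_imp_surjective_map homeomorphic_map_maps by metis
  have "(\<lambda>(t, x). (t, g x)) ` (S \<times> T) = S \<times> g ` T" for g :: "(nat \<Rightarrow> real) \<Rightarrow> real \<times> (nat \<Rightarrow> real)"
      and S :: "real set" and T
    using image_paired_Times[of "\<lambda>t. t" g S T] by simp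
  then show "(\<lambda>(t, x). (t, cube_split n x)) ` cyl_boundary (cube (Suc n)) (cube_boundary (Suc n))
     = cyl_boundary (cyl (cube n)) (cyl_boundary (cube n) (cube_boundary n))"
    by (simp only: image_Un im cube_split_boundary)
qed

section \<open>Weak equivalences by relative lifting\<close>

lemma sphere_htpy_iff:
  "(g, h) \<in> sphere_htpy n X x \<longleftrightarrow> g \<in> sphere_maps n X x \<and> h \<in> sphere_maps n X x \<and>
     (\<exists>H. continuous_map (cyl (cube n)) X H \<and> (\<forall>u\<in>topspace (cube n). H (0, u) = g u \<and> H (1, u) = h u)
        \<and> (\<forall>t\<in>{0..1}. \<forall>u\<in>cube_boundary n. H (t, u) = x))"
proof -
  have "homotopic_with (\<lambda>k. k ` cube_boundary n \<subseteq> {x}) (cube n) X g h \<longleftrightarrow>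
     (\<exists>H. continuous_map (cyl (cube n)) X H \<and> (\<forall>u\<in>topspace (cube n). H (0, u) = g u)
        \<and> (\<forall>u\<in>topspace (cube n). H (1, u) = h u)
        \<and> (\<forall>t\<in>{0..1}. (\<lambda>u. H (t, u)) ` cube_boundary n \<subseteq> {x}))"
    by (rule homotopic_with) (use cube_boundary_subset[of n] in \<open>force simp: image_subset_iff subset_iff\<close>)
  then show ?thesis unfolding sphere_htpy_def by (simp add: image_subset_iff ball_conj_distrib conj_assoc)
qed

lemma equiv_sphere_htpy: "equiv (sphere_maps n X x) (sphere_htpy n X x)"
proof (rule equivI)
  show "refl_on (sphere_maps n X x) (sphere_htpy n X x)"
    by (auto simp: refl_on_def sphere_htpy_def sphere_maps_def)
  show "sym (sphere_htpy n X x)"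
    by (auto simp: sym_def sphere_htpy_def homotopic_with_sym)
  show "trans (sphere_htpy n X x)"
    unfolding trans_def sphere_htpy_def by (auto intro: homotopic_with_trans)
  show "sphere_htpy n X x \<subseteq> sphere_maps n X x \<times> sphere_maps n X x"
    by (auto simp: sphere_htpy_def)
qed

lemma sphere_maps_compose:
  "continuous_map X Y f \<Longrightarrow> g \<in> sphere_maps n X x \<Longrightarrow> f \<circ> g \<in> sphere_maps n Y (f x)"
  by (auto simp: sphere_maps_def intro: continuous_map_compose)

lemma sphere_htpy_compose:
  assumes "continuous_map X Y f" "(g, h) \<in> sphere_htpy n X x"
  shows "(f \<circ> g, f \<circ> h) \<in> sphere_htpy n Y (f x)"
  using assms unfolding sphere_htpy_def
  by (auto intro!: sphere_maps_compose homotopic_with_compose_continuous_map_left)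

lemma pi_map_class:
  assumes f: "continuous_map X Y f" and g: "g \<in> sphere_maps n X x"
  shows "pi_map n Y f x (sphere_htpy n X x `` {g}) = sphere_htpy n Y (f x) `` {f \<circ> g}"
proof -
  have c: "sphere_htpy n Y (f x) `` {f \<circ> k} = sphere_htpy n Y (f x) `` {f \<circ> g}"
    if "k \<in> sphere_htpy n X x `` {g}" for k
  proof -
    have "(f \<circ> g, f \<circ> k) \<in> sphere_htpy n Y (f x)"
      using that by (intro sphere_htpy_compose[OF f]) simp
    from equiv_class_eq[OF equiv_sphere_htpy this] show ?thesis by (rule sym)
  qed
  have "g \<in> sphere_htpy n X x `` {g}"
    by (rule equiv_class_self[OF equiv_sphere_htpy g])
  then have "(\<Union>k\<in>sphere_htpy n X x `` {g}. sphere_htpy n Y (f x) `` {f \<circ> g})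
      = sphere_htpy n Y (f x) `` {f \<circ> g}"
    by (intro UN_constant[THEN trans]) auto
  then show ?thesis unfolding pi_map_def by (simp only: c cong: SUP_cong)
qed

text \<open>Removes the quotient sets: later arguments use homotopy groups only through representing
  maps and homotopies between them.\<close>

lemma bij_betw_pi_map_iff:
  assumes f: "continuous_map X Y f"
  shows "bij_betw (pi_map n Y f x) (pi_set n X x) (pi_set n Y (f x)) \<longleftrightarrow>
     (\<forall>g\<in>sphere_maps n X x. \<forall>h\<in>sphere_maps n X x.
        (f \<circ> g, f \<circ> h) \<in> sphere_htpy n Y (f x) \<longrightarrow> (g, h) \<in> sphere_htpy n X x)
   \<and> (\<forall>k\<in>sphere_maps n Y (f x). \<exists>g\<in>sphere_maps n X x. (f \<circ> g, k) \<in> sphere_htpy n Y (f x))"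
    (is "_ \<longleftrightarrow> ?inj \<and> ?surj")
proof -
  let ?cX = "\<lambda>g. sphere_htpy n X x `` {g}" and ?cY = "\<lambda>g. sphere_htpy n Y (f x) `` {g}"
  have eqX: "?cX g = ?cX h \<longleftrightarrow> (g, h) \<in> sphere_htpy n X x"
    if "g \<in> sphere_maps n X x" "h \<in> sphere_maps n X x" for g h
    using eq_equiv_class_iff[OF equiv_sphere_htpy that] .
  have eqY: "?cY g = ?cY h \<longleftrightarrow> (g, h) \<in> sphere_htpy n Y (f x)"
    if "g \<in> sphere_maps n Y (f x)" "h \<in> sphere_maps n Y (f x)" for g h
    using eq_equiv_class_iff[OF equiv_sphere_htpy that] .
  have X: "pi_set n X x = ?cX ` sphere_maps n X x" and Y: "pi_set n Y (f x) = ?cY ` sphere_maps n Y (f x)"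
    by (auto simp: pi_set_def quotient_def)
  have "inj_on (pi_map n Y f x) (pi_set n X x) \<longleftrightarrow>
      (\<forall>g\<in>sphere_maps n X x. \<forall>h\<in>sphere_maps n X x. ?cY (f \<circ> g) = ?cY (f \<circ> h) \<longrightarrow> ?cX g = ?cX h)"
    unfolding X inj_on_def by (simp add: pi_map_class[OF f])
  also have "\<dots> \<longleftrightarrow> ?inj"
    using eqX eqY sphere_maps_compose[OF f] by (metis (no_types, lifting))
  finally have i: "inj_on (pi_map n Y f x) (pi_set n X x) \<longleftrightarrow> ?inj" .
  have "pi_map n Y f x ` pi_set n X x = (\<lambda>g. ?cY (f \<circ> g)) ` sphere_maps n X x"
    unfolding X image_image by (intro image_cong refl pi_map_class[OF f])
  moreover have "(\<lambda>g. ?cY (f \<circ> g)) ` sphere_maps n X x \<subseteq> pi_set n Y (f x)"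
    unfolding Y using sphere_maps_compose[OF f] by blast
  ultimately have "pi_map n Y f x ` pi_set n X x = pi_set n Y (f x) \<longleftrightarrow>
      ?cY ` sphere_maps n Y (f x) \<subseteq> (\<lambda>g. ?cY (f \<circ> g)) ` sphere_maps n X x"
    unfolding Y by (metis subset_antisym order_refl)
  also have "\<dots> \<longleftrightarrow>
      (\<forall>k\<in>sphere_maps n Y (f x). \<exists>g\<in>sphere_maps n X x. ?cY k = ?cY (f \<circ> g))"
    by (simp only: image_subset_iff image_iff)
  also have "\<dots> \<longleftrightarrow> ?surj"
  proof (intro ball_cong bex_cong refl)
    fix k g assume "k \<in> sphere_maps n Y (f x)" "g \<in> sphere_maps n X x"
    then show "?cY k = ?cY (f \<circ> g) \<longleftrightarrow> (f \<circ> g, k) \<in> sphere_htpy n Y (f x)"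
      unfolding eq_commute[of "?cY k"] by (intro eqY sphere_maps_compose[OF f])
  qed
  finally show ?thesis unfolding bij_betw_def i by simp
qed

text \<open>Surjectivity is lifting for a cube with constant left side. Injectivity is lifting for
  the cylinder on the cube, which is a cube of the next dimension: the two spheres form its ends,
  and the homotopy between their images is the right side. Dimension 0 takes care of empty
  spaces.\<close>

lemma lifting_imp_weak_equivalence:
  assumes f: "continuous_map X Y f" and l: "\<And>n. lifting f X Y (cube n) (cube_boundary n)"
  shows "weak_equivalence X Y f"
proof -
  have h: "hel f X Y (cube n) (cube_boundary n)" for n
    by (rule lifting_imp_hel[OF hep_pair_cube hep_pair_cyl_cube l f])
  have "topspace Y = {}" if "topspace X = {}"
  proof (rule ccontr)
    assume "topspace Y \<noteq> {}"
    then obtain y where y: "y \<in> topspace Y" by blast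
    have b: "cube_boundary 0 = {}" by (simp add: cube_boundary_def)
    have "solv f X Y (cube 0) (cube_boundary 0) undefined (\<lambda>_. y)"
      using l[of 0] y unfolding lifting_def b by auto
    then obtain A where "continuous_map (cube 0) X A" unfolding solv_def by blast
    then have "A ` topspace (cube 0) \<subseteq> {}"
      using that by (metis continuous_map_image_subset_topspace)
    then show False by (simp add: topspace_cube)
  qed
  moreover have "bij_betw (pi_map n Y f x) (pi_set n X x) (pi_set n Y (f x))" if x: "x \<in> topspace X" for n x
    unfolding bij_betw_pi_map_iff[OF f]
  proof (intro conjI ballI impI)
    fix k assume "k \<in> sphere_maps n Y (f x)"
    then have k: "continuous_map (cube n) Y k" "\<And>u. u \<in> cube_boundary n \<Longrightarrow> k u = f x"
      by (auto simp: sphere_maps_def)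
    have "solv f X Y (cube n) (cube_boundary n) (\<lambda>_. x) k"
      using l[of n] k x unfolding lifting_def by auto
    then obtain A H where A: "continuous_map (cube n) X A" "\<And>u. u\<in>cube_boundary n \<Longrightarrow> A u = x"
      and H: "continuous_map (cyl (cube n)) Y H" "\<And>t u. t\<in>{0..1} \<Longrightarrow> u\<in>cube_boundary n \<Longrightarrow> H (t, u) = k u"
      "\<And>u. u \<in> topspace (cube n) \<Longrightarrow> H (0, u) = f (A u) \<and> H (1, u) = k u"
      unfolding solv_def by auto
    have AS: "A \<in> sphere_maps n X x" using A by (auto simp: sphere_maps_def)
    moreover have "(f \<circ> A, k) \<in> sphere_htpy n Y (f x)"
      unfolding sphere_htpy_iff
      using sphere_maps_compose[OF f AS] \<open>k \<in> sphere_maps n Y (f x)\<close> H k(2)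
      by (auto intro!: exI[of _ H])
    ultimately show "\<exists>g\<in>sphere_maps n X x. (f \<circ> g, k) \<in> sphere_htpy n Y (f x)" by blast
  next
    fix g h assume gh: "g \<in> sphere_maps n X x" "h \<in> sphere_maps n X x" 
      and "(f \<circ> g, f \<circ> h) \<in> sphere_htpy n Y (f x)"
    then obtain H where H: "continuous_map (cyl (cube n)) Y H"
      "\<And>u. u\<in>topspace (cube n) \<Longrightarrow> H (0, u) = f (g u) \<and> H (1, u) = f (h u)"
      "\<And>t u. t\<in>{0..1} \<Longrightarrow> u\<in>cube_boundary n \<Longrightarrow> H (t, u) = f x"
      unfolding sphere_htpy_iff by auto
    have gh': "continuous_map (cube n) X g" "continuous_map (cube n) X h"
      "\<And>u. u \<in> cube_boundary n \<Longrightarrow> g u = x" "\<And>u. u \<in> cube_boundary n \<Longrightarrow> h u = x"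
      using gh by (auto simp: sphere_maps_def)
    let ?D = "cyl_boundary (cube n) (cube_boundary n)"
    \<comment> \<open>Constant on the sides, \<open>g\<close> on the base and \<open>h\<close> on
      the top. These agree on overlaps because both spheres are constant at \<open>x\<close> on the
      boundary of the cube.\<close>
    define a where "a = (\<lambda>z. if z \<in> {0..1::real} \<times> cube_boundary n then x
       else if z \<in> {0} \<times> topspace (cube n) then g (snd z) else h (snd z))"
    let ?Z = "subtopology (cyl (cube n)) ?D"
    note cl = closedin_base_and_sides[of "cube n" "cube_boundary n"]
    have cB: "closedin (cube n) (cube_boundary n)" using hep_pair_cube by (auto simp: hep_pair_def)
    have s: "continuous_map ?Z X (\<lambda>z. g (snd z))" "continuous_map ?Z X (\<lambda>z. h (snd z))"
      using gh'(1,2) by (auto intro!: continuous_map_from_subtopology 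
          continuous_map_compose[OF continuous_map_snd, unfolded o_def])
    have "continuous_map ?Z X a"
      unfolding a_def
    proof (rule continuous_map_closed_cases)
      show "closedin ?Z ({0..1} \<times> cube_boundary n)"
        by (intro closedin_subset_topspace cl cB) auto
      show "closedin ?Z ({0} \<times> topspace (cube n) \<union> {1} \<times> topspace (cube n))"
        by (intro closedin_subset_topspace closedin_Un cl cB) auto
      let ?V = "subtopology ?Z ({0} \<times> topspace (cube n) \<union> {1} \<times> topspace (cube n))"
      show "continuous_map ?V X (\<lambda>z. if z \<in> {0} \<times> topspace (cube n) then g (snd z) else h (snd z))"
      proof (rule continuous_map_closed_cases)
        show "closedin ?V ({0} \<times> topspace (cube n))" "closedin ?V ({1} \<times> topspace (cube n))"
          unfolding subtopology_subtopology by (intro closedin_subset_topspace cl cB; auto)+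
      qed (auto intro!: continuous_map_from_subtopology[of ?V] continuous_map_from_subtopology[of ?Z] s)
    qed (use gh' x in auto)
    moreover have "\<forall>z\<in>?D. f (a z) = H z"
      using H(2,3) cube_boundary_subset[of n] by (auto simp: a_def)
    ultimately have "solv f X Y (cyl (cube n)) ?D a H"
      using hel_imp_lifting[OF hel_cyl_cube[OF h]] H(1) unfolding lifting_def by blast
    then obtain A where A: "continuous_map (cyl (cube n)) X A" "\<And>z. z \<in> ?D \<Longrightarrow> A z = a z"
      unfolding solv_def by blast
    show "(g, h) \<in> sphere_htpy n X x"
      unfolding sphere_htpy_iff
      using gh A cube_boundary_subset[of n] gh'(3,4) by (intro conjI exI[of _ A]) (auto simp: a_def)
  qed
  ultimately show ?thesis unfolding weak_equivalence_def using f by blast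
qed

section \<open>Lifting from bijections on homotopy groups\<close>

lemma closedin_cube_boundary: "closedin (cube n) (cube_boundary n)"
  using hep_pair_cube by (auto simp: hep_pair_def)

text \<open>The case of a square whose left side is constant on all faces but one. The first lift is
  corrected by an element of \<open>\<pi>\<^sub>n\<^sub>+\<^sub>1\<close> that comes from the surjectivity.\<close>

lemma weak_equivalence_solv_one_face:
  assumes w: "weak_equivalence X Y f"
    and a: "continuous_map (subtopology (cyl (cube n)) (cyl_boundary (cube n) (cube_boundary n))) X a"
    and b: "continuous_map (cyl (cube n)) Y b"
    and eq: "\<And>z. z \<in> cyl_boundary (cube n) (cube_boundary n) \<Longrightarrow> f (a z) = b z"
    and c0: "\<And>u. u \<in> topspace (cube n) \<Longrightarrow> a (0, u) = x0"
    and cB: "\<And>t u. t \<in> {0..1} \<Longrightarrow> u \<in> cube_boundary n \<Longrightarrow> a (t, u) = x0"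
  shows "solv f X Y (cyl (cube n)) (cyl_boundary (cube n) (cube_boundary n)) a b"
proof -
  let ?C = "cube n" and ?B = "cube_boundary n"
  let ?D = "cyl_boundary ?C ?B"
  have f: "continuous_map X Y f" using w by (simp add: weak_equivalence_def)
  have BC: "u \<in> topspace ?C" if "u \<in> ?B" for u using that cube_boundary_subset by blast
  define u0 where "u0 = (\<lambda>i\<in>{..<n}. 0::real)"
  have u0: "u0 \<in> topspace ?C" by (auto simp: u0_def topspace_cube)
  have x0: "x0 \<in> topspace X"
  proof -
    have "a (0, u0) \<in> topspace X"
      using a u0 by (auto simp: continuous_map_def Pi_iff)
    then show ?thesis using c0[OF u0] by simp
  qed
  have bij: "bij_betw (pi_map m Y f x0) (pi_set m X x0) (pi_set m Y (f x0))" for m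
    using w x0 by (simp add: weak_equivalence_def)
  note inj = bij[unfolded bij_betw_pi_map_iff[OF f], THEN conjunct1, rule_format]
    and surj = bij[unfolded bij_betw_pi_map_iff[OF f], THEN conjunct2, rule_format]
  define g where "g = (\<lambda>u. a (1, u))"
  have "continuous_map ?C (subtopology (cyl ?C) ?D) (\<lambda>u. (1, u))"
    by (auto simp: continuous_map_in_subtopology intro!: continuous_map_pairedI)
  from continuous_map_compose[OF this a] have g: "continuous_map ?C X g" by (simp add: o_def g_def)
  have gS: "g \<in> sphere_maps n X x0" and kS: "(\<lambda>_. x0) \<in> sphere_maps n X x0"
    using g x0 cB by (auto simp: sphere_maps_def g_def)
  have b0: "b (0, u) = f x0" if "u \<in> topspace ?C" for u using eq[of "(0, u)"] c0 that by simp
  have b1: "b (1, u) = f (g u)" if "u \<in> topspace ?C" for u using eq[of "(1, u)"] that by (simp add: g_def)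
  have bB: "b (t, u) = f x0" if "t \<in> {0..1}" "u \<in> ?B" for t u using eq[of "(t, u)"] that cB by simp
  \<comment> \<open>\<open>b\<close> is itself a homotopy rel boundary from the constant map to
    \<open>f \<circ> g\<close>, so injectivity yields a null-homotopy \<open>G\<close> of
    \<open>g\<close> in \<open>X\<close>. It has the required boundary values, but its image
    \<open>F\<close> need not be homotopic to \<open>b\<close>.\<close>
  have "(f \<circ> (\<lambda>_. x0), f \<circ> g) \<in> sphere_htpy n Y (f x0)"
    unfolding sphere_htpy_iff
    by (intro conjI sphere_maps_compose[OF f] gS kS exI[of _ b]) (use b b0 b1 bB in auto)
  then have "((\<lambda>_. x0), g) \<in> sphere_htpy n X x0"
    using inj[OF kS gS] by simp
  then obtain G where G: "continuous_map (cyl ?C) X G"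
    "\<And>u. u \<in> topspace ?C \<Longrightarrow> G (0, u) = x0" "\<And>u. u \<in> topspace ?C \<Longrightarrow> G (1, u) = g u"
    "\<And>t u. t \<in> {0..1} \<Longrightarrow> u \<in> ?B \<Longrightarrow> G (t, u) = x0"
    unfolding sphere_htpy_iff by auto
  define F where "F = f \<circ> G"
  have F: "continuous_map (cyl ?C) Y F" unfolding F_def by (rule continuous_map_compose[OF G(1) f])
  have F0: "F (0, u) = f x0" and F1: "F (1, u) = f (g u)" if "u \<in> topspace ?C" for u
    using that G by (auto simp: F_def)
  have FB: "F (t, u) = f x0" if "t \<in> {0..1}" "u \<in> ?B" for t u
    using that G by (auto simp: F_def)
  define F' where "F' = (\<lambda>z. F (1 - fst z, snd z))"
  have F': "continuous_map (cyl ?C) Y F'" unfolding F'_def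
    by (rule continuous_map_reparam[OF F]) (auto intro!: continuous_intros continuous_map_cyl_fst)
  \<comment> \<open>The difference of \<open>b\<close> and \<open>F\<close>. It is constant on the
    whole boundary of the cylinder, thus a sphere of dimension \<open>Suc n\<close>, and
    surjectivity lifts it up to homotopy to \<open>k\<close>.\<close>
  define D where "D = path_cat b F'"
  have D: "continuous_map (cyl ?C) Y D" unfolding D_def
    by (rule continuous_map_path_cat[OF b F']) (simp add: F'_def b1 F1)
  have DB: "D z = f x0" if "z \<in> ?D" for z
    using that BC by (auto simp: D_def path_cat_def F'_def b0 F0 bB FB)
  let ?s = "cube_split n" and ?j = "cube_join n"
  note hm = homeomorphic_maps_cube_split[of n, unfolded homeomorphic_maps_def]
  have sc: "continuous_map (cube (Suc n)) (cyl ?C) ?s" and jc: "continuous_map (cyl ?C) (cube (Suc n)) ?j"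
    and sj: "\<And>z. z \<in> topspace (cyl ?C) \<Longrightarrow> ?s (?j z) = z"
    using hm by blast+
  have sB: "?s v \<in> ?D" if "v \<in> cube_boundary (Suc n)" for v
    using cube_split_boundary[of n] that by blast
  have jB: "?j z \<in> cube_boundary (Suc n)" if "z \<in> ?D" for z
    using cube_join_boundary[of n] that by blast
  have "D \<circ> ?s \<in> sphere_maps (Suc n) Y (f x0)"
    using continuous_map_compose[OF sc D] DB sB by (auto simp: sphere_maps_def)
  from surj[OF this] obtain k where k: "k \<in> sphere_maps (Suc n) X x0"
    and "(f \<circ> k, D \<circ> ?s) \<in> sphere_htpy (Suc n) Y (f x0)" by blast
  then obtain L where L: "continuous_map (cyl (cube (Suc n))) Y L"
    "\<And>v. v \<in> topspace (cube (Suc n)) \<Longrightarrow> L (0, v) = f (k v) \<and> L (1, v) = D (?s v)"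
    "\<And>t v. t \<in> {0..1} \<Longrightarrow> v \<in> cube_boundary (Suc n) \<Longrightarrow> L (t, v) = f x0"
    unfolding sphere_htpy_iff by auto
  define k' where "k' = k \<circ> ?j"
  have k': "continuous_map (cyl ?C) X k'" and k'B: "\<And>z. z \<in> ?D \<Longrightarrow> k' z = x0"
  proof -
    have k2: "continuous_map (cube (Suc n)) X k" "\<And>v. v \<in> cube_boundary (Suc n) \<Longrightarrow> k v = x0"
      using k by (auto simp: sphere_maps_def)
    show "continuous_map (cyl ?C) X k'" unfolding k'_def by (rule continuous_map_compose[OF jc k2(1)])
    show "k' z = x0" if "z \<in> ?D" for z using k2(2)[OF jB[OF that]] by (simp add: k'_def)
  qed
  have jT: "?j z \<in> topspace (cube (Suc n))" if "z \<in> topspace (cyl ?C)" for z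
    using jc that unfolding continuous_map_def by blast
  define L' where "L' = (\<lambda>z. L (fst z, ?j (snd z)))"
  have L': "continuous_map (cyl (cyl ?C)) Y L'"
    unfolding L'_def
    by (rule continuous_map_reparam[OF L(1)])
      (auto intro!: continuous_map_cyl_fst continuous_map_compose[OF continuous_map_snd jc, unfolded o_def])
  have L'0: "L' (0, z) = f (k' z)" and L'1: "L' (1, z) = D z" if "z \<in> topspace (cyl ?C)" for z
    using L(2)[OF jT[OF that]] sj[OF that] by (auto simp: L'_def k'_def)
  have L'B: "L' (t, z) = f x0" if "t \<in> {0..1}" "z \<in> ?D" for t z
    using L(3) jB that by (auto simp: L'_def)
  \<comment> \<open>Adding \<open>k'\<close> corrects the first lift: the image of \<open>A\<close>
    is homotopic to \<open>D\<close> followed by \<open>F\<close>, that is, to \<open>b\<close>,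
    then \<open>F\<close> reversed, then \<open>F\<close>.\<close>
  define A where "A = path_cat k' G"
  have A: "continuous_map (cyl ?C) X A" unfolding A_def
    by (rule continuous_map_path_cat[OF k' G(1)]) (simp add: k'B G)
  have AB: "A z = a z" if "z \<in> ?D" for z
    using that BC by (auto simp: A_def path_cat_def k'B G c0 cB g_def)
  have tc: "continuous_map (cyl (cyl ?C)) euclideanreal (\<lambda>z. fst (snd z))"
    using continuous_map_compose[OF continuous_map_snd continuous_map_cyl_fst] by (simp add: o_def)
  have uc: "continuous_map (cyl (cyl ?C)) ?C (\<lambda>z. snd (snd z))"
    using continuous_map_compose[OF continuous_map_snd continuous_map_snd] by (simp add: o_def)
  have scc: "continuous_map (cyl (cyl ?C)) euclideanreal fst" by (rule continuous_map_cyl_fst)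
  \<comment> \<open>The first half moves from \<open>f \<circ> k'\<close> to the difference
    \<open>D\<close>, the second half stays at \<open>F\<close>.\<close>
  define H1 where "H1 = (\<lambda>z. if fst (snd z) \<le> 1/2 then L' (fst z, (2 * fst (snd z), snd (snd z)))
     else F (2 * fst (snd z) - 1, snd (snd z)))"
  have H1: "continuous_map (cyl (cyl ?C)) Y H1"
    unfolding H1_def
  proof (rule continuous_map_le_cases[OF tc])
    let ?S = "subtopology (cyl (cyl ?C)) {z \<in> topspace (cyl (cyl ?C)). fst (snd z) \<le> 1/2}"
    have "continuous_map ?S unit_interval (\<lambda>z. 2 * fst (snd z))"
      unfolding continuous_map_unit_interval
      by (auto intro!: continuous_intros continuous_map_from_subtopology tc)
    moreover have "continuous_map ?S ?C (\<lambda>z. snd (snd z))"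
      by (rule continuous_map_from_subtopology[OF uc])
    ultimately have "continuous_map ?S (cyl ?C) (\<lambda>z. (2 * fst (snd z), snd (snd z)))"
      by (rule continuous_map_pairedI)
    then show "continuous_map ?S Y (\<lambda>z. L' (fst z, (2 * fst (snd z), snd (snd z))))"
      by (rule continuous_map_reparam[OF L' continuous_map_from_subtopology[OF scc]]) auto
    show "continuous_map (subtopology (cyl (cyl ?C)) {z \<in> topspace (cyl (cyl ?C)). 1/2 \<le> fst (snd z)}) Y
        (\<lambda>z. F (2 * fst (snd z) - 1, snd (snd z)))"
      by (rule continuous_map_reparam[OF F])
        (auto intro!: continuous_map_from_subtopology tc uc continuous_intros)
    fix z assume z: "z \<in> topspace (cyl (cyl ?C))" "fst (snd z) = 1/2"
    then have e: "2 * fst (snd z) = 1" by simp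
    have "fst z \<in> {0..1}" "snd (snd z) \<in> topspace ?C" using z(1) by auto
    then show "L' (fst z, (2 * fst (snd z), snd (snd z))) = F (2 * fst (snd z) - 1, snd (snd z))"
      unfolding e by (simp add: L'B F0)
  qed simp
  \<comment> \<open>Cancels \<open>F\<close> reversed against \<open>F\<close>: the excursion from
    time 1 down to 0 and back is cut off below at \<open>fst z\<close>. The nesting of
    \<open>D\<close> inside \<open>A\<close> leaves \<open>b\<close> the first quarter.\<close>
  define H2 where "H2 = (\<lambda>z. if fst (snd z) \<le> 1/4 then b (4 * fst (snd z), snd (snd z))
     else F (max (fst z) (max (2 - 4 * fst (snd z)) (2 * fst (snd z) - 1)), snd (snd z)))"
  have H2: "continuous_map (cyl (cyl ?C)) Y H2"
    unfolding H2_def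
  proof (rule continuous_map_le_cases[OF tc])
    show "continuous_map (subtopology (cyl (cyl ?C)) {z \<in> topspace (cyl (cyl ?C)). fst (snd z) \<le> 1/4}) Y
        (\<lambda>z. b (4 * fst (snd z), snd (snd z)))"
      by (rule continuous_map_reparam[OF b])
        (auto intro!: continuous_map_from_subtopology tc uc continuous_intros)
    show "continuous_map (subtopology (cyl (cyl ?C)) {z \<in> topspace (cyl (cyl ?C)). 1/4 \<le> fst (snd z)}) Y
        (\<lambda>z. F (max (fst z) (max (2 - 4 * fst (snd z)) (2 * fst (snd z) - 1)), snd (snd z)))"
      by (rule continuous_map_reparam[OF F])
        (auto intro!: continuous_map_from_subtopology scc tc uc continuous_intros simp: le_max_iff_disj)
    fix z assume z: "z \<in> topspace (cyl (cyl ?C))" "fst (snd z) = 1/4"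
    then have e: "4 * fst (snd z) = 1" "max (fst z) (max (2 - 4 * fst (snd z)) (2 * fst (snd z) - 1)) = 1"
      by auto
    have "snd (snd z) \<in> topspace ?C" using z(1) by auto
    then show "b (4 * fst (snd z), snd (snd z))
       = F (max (fst z) (max (2 - 4 * fst (snd z)) (2 * fst (snd z) - 1)), snd (snd z))"
      unfolding e(2) unfolding e(1) by (simp add: b1 F1)
  qed simp
  \<comment> \<open>Reparametrises \<open>b\<close>, from running in the first quarter and then
    resting, to unit speed.\<close>
  define H3 where "H3 = (\<lambda>z. b ((1 - fst z) * min 1 (4 * fst (snd z)) + fst z * fst (snd z), snd (snd z)))"
  have conv: "0 \<le> (1 - s) * min 1 (4 * t) + s * t \<and> (1 - s) * min 1 (4 * t) + s * t \<le> 1"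
    if "0 \<le> s" "s \<le> 1" "0 \<le> t" "t \<le> 1" for s t :: real
  proof -
    have "(1 - s) * min 1 (4 * t) \<le> (1 - s) * 1" "s * t \<le> s * 1"
      using that by (intro mult_left_mono; simp)+
    moreover have "0 \<le> (1 - s) * min 1 (4 * t)" "0 \<le> s * t" using that by (auto intro!: mult_nonneg_nonneg)
    ultimately show ?thesis by simp
  qed
  have H3: "continuous_map (cyl (cyl ?C)) Y H3"
    unfolding H3_def
  proof (rule continuous_map_reparam[OF b])
    fix z assume "z \<in> topspace (cyl (cyl ?C))"
    then have "0 \<le> fst z" "fst z \<le> 1" "0 \<le> fst (snd z)" "fst (snd z) \<le> 1" by auto
    then show "0 \<le> (1 - fst z) * min 1 (4 * fst (snd z)) + fst z * fst (snd z)
        \<and> (1 - fst z) * min 1 (4 * fst (snd z)) + fst z * fst (snd z) \<le> 1"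
      by (rule conv)
  qed (auto intro!: continuous_intros scc tc uc)
  have c12: "H1 (1, z) = H2 (0, z)" if z: "z \<in> topspace (cyl ?C)" for z
  proof -
    obtain t u where tu: "z = (t, u)" "0 \<le> t" "t \<le> 1" "u \<in> topspace ?C" using z by auto
    consider "t \<le> 1/4" | "1/4 < t" "t \<le> 1/2" | "1/2 < t" by linarith
    then show ?thesis
    proof cases
      case 1
      then show ?thesis using tu by (simp add: H1_def H2_def L'1 D_def path_cat_def)
    next
      case 2
      then have "max 0 (max (2 - 4 * t) (2 * t - 1)) = 2 - 4 * t" by auto
      then show ?thesis using tu 2 by (simp add: H1_def H2_def L'1 D_def path_cat_def F'_def)
    next
      case 3
      then have "max 0 (max (2 - 4 * t) (2 * t - 1)) = 2 * t - 1" by auto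
      then show ?thesis using tu 3 by (simp add: H1_def H2_def)
    qed
  qed
  have c23: "H2 (1, z) = H3 (0, z)" if z: "z \<in> topspace (cyl ?C)" for z
  proof -
    obtain t u where tu: "z = (t, u)" "0 \<le> t" "t \<le> 1" "u \<in> topspace ?C" using z by auto
    show ?thesis
    proof (cases "t \<le> 1/4")
      case True
      then have "min 1 (4 * t) = 4 * t" by auto
      then show ?thesis using tu True by (simp add: H2_def H3_def)
    next
      case False
      then have "max 1 (max (2 - 4 * t) (2 * t - 1)) = 1" "min 1 (4 * t) = 1" using tu by auto
      then show ?thesis using tu False by (simp add: H2_def H3_def b1 F1)
    qed
  qed
  let ?V = "path_cat (path_cat H1 H2) H3"
  have V: "continuous_map (cyl (cyl ?C)) Y ?V"
    by (intro continuous_map_path_cat H1 H2 H3) (auto simp: c12 path_cat_def c23)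
  have HB: "H1 (s, z) = b z \<and> H2 (s, z) = b z \<and> H3 (s, z) = b z" if s: "s \<in> {0..1}" and z: "z \<in> ?D" for s z
  proof -
    obtain t u where tu: "z = (t, u)" by (cases z)
    consider "t = 0" "u \<in> topspace ?C" | "t = 1" "u \<in> topspace ?C" | "t \<in> {0..1}" "u \<in> ?B" using z tu by auto
    then show ?thesis
    proof cases
      case 1
      then show ?thesis using s tu by (simp add: H1_def H2_def H3_def L'B b0)
    next
      case 2
      have "max s 1 = 1" using s by simp
      then show ?thesis using s 2 tu by (simp add: H1_def H2_def H3_def F1 b1)
    next
      case 3
      have "max s (max (2 - 4 * t) (2 * t - 1)) \<in> {0..1}" if "\<not> t \<le> 1/4" using s 3(1) that by (auto simp: le_max_iff_disj)
      then show ?thesis using s 3 tu conv[of s t]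
        by (auto simp: H1_def H2_def H3_def bB FB L'B)
    qed
  qed
  have VB: "?V (s, z) = b z" if "s \<in> {0..1}" "z \<in> ?D" for s z
    using HB[OF _ that(2)] that(1) by (auto simp: path_cat_def)
  have V0: "?V (0, z) = f (A z)" if z: "z \<in> topspace (cyl ?C)" for z
  proof -
    obtain t u where tu: "z = (t, u)" "0 \<le> t" "t \<le> 1" "u \<in> topspace ?C" using z by auto
    show ?thesis
      using tu by (simp add: path_cat_def H1_def A_def L'0 F_def)
  qed
  have V1: "?V (1, z) = b z" for z by (simp add: path_cat_def H3_def)
  show ?thesis
    unfolding solv_def
    by (intro exI[of _ A] exI[of _ ?V] conjI A V ballI AB VB V0 V1)
qed

lemma solv_cong:
  assumes "solv f X Y C B a b" "\<And>x. x \<in> B \<Longrightarrow> a x = a' x"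
  shows "solv f X Y C B a' b"
  using assms unfolding solv_def by metis

text \<open>The union of all faces of the cylinder but the top is contractible, so that the left side of
  a square can be deformed to be constant there.\<close>

lemma weak_equivalence_lifting_cyl:
  assumes w: "weak_equivalence X Y f"
  shows "lifting f X Y (cyl (cube n)) (cyl_boundary (cube n) (cube_boundary n))"
  unfolding lifting_def
proof (intro allI impI)
  fix a b
  let ?C = "cube n" and ?B = "cube_boundary n"
  let ?D = "cyl_boundary ?C ?B"
  let ?Z = "subtopology (cyl ?C) ?D"
  assume a: "continuous_map ?Z X a" and b: "continuous_map (cyl ?C) Y b" and eq: "\<forall>z\<in>?D. f (a z) = b z"
  have f: "continuous_map X Y f" using w by (simp add: weak_equivalence_def)
  have BC: "u \<in> topspace ?C" if "u \<in> ?B" for u using that cube_boundary_subset by blast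
  obtain r where r: "continuous_map (cyl ?C) (cyl ?C) r"
    and r1: "\<And>z. z \<in> topspace (cyl ?C) \<Longrightarrow> fst (r z) = 0 \<or> snd (r z) \<in> ?B"
    and r2: "\<And>x. x \<in> topspace ?C \<Longrightarrow> r (0, x) = (0, x)"
    and r3: "\<And>t x. t \<in> {0..1} \<Longrightarrow> x \<in> ?B \<Longrightarrow> r (t, x) = (t, x)"
    using hep_pair_cube[of n] unfolding hep_pair_def by blast
  define J where "J = {0::real} \<times> topspace ?C \<union> {0..1} \<times> ?B"
  have rJ: "r z \<in> J" if z: "z \<in> topspace (cyl ?C)" for z
  proof -
    have "r z \<in> topspace (cyl ?C)" using r z unfolding continuous_map_def by blast
    then show ?thesis using r1[OF z] by (cases "r z") (auto simp: J_def)
  qed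
  define u0 where "u0 = (\<lambda>i\<in>{..<n}. 0::real)"
  have u0: "u0 \<in> topspace ?C" by (auto simp: u0_def topspace_cube)
  \<comment> \<open>Linear contraction of the cylinder to the corner \<open>(0, u0)\<close> of its
    base. Followed by the retraction \<open>r\<close>, it contracts the union \<open>J\<close> of
    base and sides inside itself; \<open>P\<close> carries this over to \<open>a\<close>.\<close>
  define c where "c = (\<lambda>z::real \<times> real \<times> (nat \<Rightarrow> real). ((1 - fst z) * fst (snd z), \<lambda>i\<in>{..<n}. (1 - fst z) * snd (snd z) i))"
  have tc: "continuous_map (cyl (cyl ?C)) euclideanreal (\<lambda>z. fst (snd z))"
    using continuous_map_compose[OF continuous_map_snd continuous_map_cyl_fst] by (simp add: o_def)
  have uc: "continuous_map (cyl (cyl ?C)) euclideanreal (\<lambda>z. snd (snd z) i)" if "i < n" for i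
    using continuous_map_compose[OF continuous_map_compose[OF continuous_map_snd continuous_map_snd]
        continuous_map_cube_component[OF that]] by (simp add: o_def)
  have prod01: "0 \<le> (1 - s) * t \<and> (1 - s) * t \<le> 1" if "0 \<le> s" "s \<le> 1" "0 \<le> t" "t \<le> 1" for s t :: real
    using that mult_le_one[of "1 - s" t] by simp
  have cc: "continuous_map (cyl (cyl ?C)) (cyl ?C) c"
    unfolding c_def
  proof (intro continuous_map_pairedI continuous_map_into_cube)
    show "continuous_map (cyl (cyl ?C)) unit_interval (\<lambda>z. (1 - fst z) * fst (snd z))"
      by (auto simp: continuous_map_unit_interval prod01
          intro!: continuous_intros continuous_map_cyl_fst tc)
    show "continuous_map (cyl (cyl ?C)) euclideanreal (\<lambda>z. (\<lambda>i\<in>{..<n}. (1 - fst z) * snd (snd z) i) i)"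
      if "i < n" for i
      using that by (auto intro!: continuous_intros continuous_map_cyl_fst uc)
    fix z i assume z: "z \<in> topspace (cyl (cyl ?C))" and i: "i < n"
    then have "0 \<le> fst z" "fst z \<le> 1" "snd (snd z) \<in> topspace ?C" by auto
    then have "0 \<le> fst z" "fst z \<le> 1" "0 \<le> snd (snd z) i" "snd (snd z) i \<le> 1"
      using i by (simp_all add: topspace_cube PiE_iff)
    then show "0 \<le> (\<lambda>i\<in>{..<n}. (1 - fst z) * snd (snd z) i) i \<and> (\<lambda>i\<in>{..<n}. (1 - fst z) * snd (snd z) i) i \<le> 1"
      using i prod01 by simp
  qed simp
  have c0: "c (0, z) = z" if "z \<in> topspace (cyl ?C)" for z
  proof -
    have "snd z \<in> extensional {..<n}" using that by (cases z) (simp add: topspace_cube PiE_iff)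
    then show ?thesis by (cases z) (simp add: c_def extensional_restrict)
  qed
  have c1: "c (1, z) = (0, u0)" for z by (simp add: c_def u0_def)
  define P where "P = a \<circ> (r \<circ> c)"
  have rc: "continuous_map (cyl (cyl ?C)) ?Z (r \<circ> c)"
  proof -
    have "r (c z) \<in> ?D" if "z \<in> topspace (cyl (cyl ?C))" for z
    proof -
      have "c z \<in> topspace (cyl ?C)" using cc that unfolding continuous_map_def by blast
      then show ?thesis using rJ[of "c z"] by (auto simp: J_def)
    qed
    then show ?thesis using continuous_map_compose[OF cc r] by (auto simp: continuous_map_in_subtopology)
  qed
  have P: "continuous_map (cyl (cyl ?C)) X P"
    unfolding P_def by (rule continuous_map_compose[OF rc a])
  have P0: "P (0, z) = a z" if "z \<in> J" for z
  proof -
    have "z \<in> topspace (cyl ?C)" using that BC by (auto simp: J_def)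
    moreover have "r z = z" using that r2 r3 by (auto simp: J_def)
    ultimately show ?thesis by (simp add: P_def c0)
  qed
  have P1: "P (1, z) = a (0, u0)" for z by (simp add: P_def c1 r2 u0)
  have "continuous_map ?C ?Z (\<lambda>u. (1, u))"
    by (auto simp: continuous_map_in_subtopology intro!: continuous_map_pairedI)
  from continuous_map_compose[OF this a] have g: "continuous_map ?C X (\<lambda>u. a (1, u))" by (simp add: o_def)
  \<comment> \<open>On the top face the contraction moves only the rim, which lies in
    \<open>J\<close>. The homotopy extension property of the cube carries the motion over the rest
    of the top face.\<close>
  have K: "continuous_map (cyl (subtopology ?C ?B)) X (\<lambda>z. P (fst z, (1, snd z)))"
    by (rule continuous_map_reparam[OF P])
      (auto intro!: continuous_map_cyl_fst continuous_map_pairedI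
        continuous_map_into_fulltopology[OF continuous_map_snd])
  obtain H where H: "continuous_map (cyl ?C) X H" "\<And>u. u \<in> topspace ?C \<Longrightarrow> H (0, u) = a (1, u)"
     "\<And>s u. s \<in> {0..1} \<Longrightarrow> u \<in> ?B \<Longrightarrow> H (s, u) = P (s, (1, u))"
    by (rule homotopy_extension[OF hep_pair_cube g K]) (use P0 in \<open>auto simp: J_def\<close>)
  define \<alpha> where "\<alpha> = (\<lambda>z. if z \<in> {0..1::real} \<times> J then P z else H (fst z, snd (snd z)))"
  note cl = closedin_base_and_sides[OF closedin_cube_boundary[of n]]
  have clJ: "closedin ?Z J" "closedin ?Z ({1} \<times> topspace ?C)"
    unfolding J_def by (auto intro!: closedin_subset_topspace closedin_Un cl)
  have \<alpha>: "continuous_map (cyl ?Z) X \<alpha>"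
    unfolding \<alpha>_def
  proof (rule continuous_map_closed_cases)
    show "closedin (cyl ?Z) ({0..1} \<times> J)" "closedin (cyl ?Z) ({0..1} \<times> ({1} \<times> topspace ?C))"
      using clJ by (simp_all add: closedin_prod_Times_iff)
    show "topspace (cyl ?Z) \<subseteq> {0..1} \<times> J \<union> {0..1} \<times> ({1} \<times> topspace ?C)"
      by (auto simp: J_def)
    have "continuous_map (cyl ?Z) X P"
      using P by (simp add: prod_subtopology_right continuous_map_from_subtopology)
    then show "continuous_map (subtopology (cyl ?Z) ({0..1} \<times> J)) X P"
      by (rule continuous_map_from_subtopology)
    have "continuous_map (cyl ?Z) ?C (\<lambda>z. snd (snd z))"
      using continuous_map_compose[OF continuous_map_snd continuous_map_subtopology_snd] by (simp add: o_def)
    then have "continuous_map (cyl ?Z) X (\<lambda>z. H (fst z, snd (snd z)))"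
      by (intro continuous_map_reparam[OF H(1)] continuous_map_cyl_fst) auto
    then show "continuous_map (subtopology (cyl ?Z) ({0..1} \<times> ({1} \<times> topspace ?C))) X
        (\<lambda>z. H (fst z, snd (snd z)))"
      by (rule continuous_map_from_subtopology)
  qed (auto simp: J_def H)
  have \<alpha>0: "\<alpha> (0, z) = a z" if "z \<in> ?D" for z
    using that P0 H(2) by (cases z) (auto simp: \<alpha>_def J_def)
  have "solv f X Y (cyl ?C) ?D (\<lambda>z. \<alpha> (0, z)) b"
  proof (rule solv_deform[OF hep_pair_cyl_cube hep_pair_cyl_cyl_cube f b _ \<alpha>])
    show "f (\<alpha> (0, z)) = b z" if "z \<in> ?D" for z using eq \<alpha>0 that by auto
    fix \<beta> assume \<beta>: "continuous_map (cyl (cyl ?C)) Y \<beta>"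
      and f\<alpha>: "\<And>t z. t \<in> {0..1} \<Longrightarrow> z \<in> ?D \<Longrightarrow> f (\<alpha> (t, z)) = \<beta> (t, z)"
    show "solv f X Y (cyl ?C) ?D (\<lambda>z. \<alpha> (1, z)) (\<lambda>z. \<beta> (1, z))"
    proof (rule weak_equivalence_solv_one_face[OF w])
      show "continuous_map ?Z X (\<lambda>z. \<alpha> (1, z))" by (rule continuous_map_const_reparam[OF \<alpha>]) simp
      show "continuous_map (cyl ?C) Y (\<lambda>z. \<beta> (1, z))" by (rule continuous_map_const_reparam[OF \<beta>]) simp
      show "f (\<alpha> (1, z)) = \<beta> (1, z)" if "z \<in> ?D" for z by (rule f\<alpha>) (use that in auto)
      show "\<alpha> (1, 0, u) = a (0, u0)" if "u \<in> topspace ?C" for u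
        using that by (simp add: \<alpha>_def J_def P1)
      show "\<alpha> (1, t, u) = a (0, u0)" if "t \<in> {0..1}" "u \<in> ?B" for t u
        using that by (simp add: \<alpha>_def J_def P1)
    qed
  qed
  then show "solv f X Y (cyl ?C) ?D a b" by (rule solv_cong) (rule \<alpha>0)
qed

text \<open>In dimension 0 the right side is a point of \<open>Y\<close> and the claim is
  surjectivity on path components; a basepoint in \<open>X\<close> exists because the definition
  excludes an empty \<open>X\<close> over a nonempty \<open>Y\<close>. In positive dimension the
  cube is a cylinder.\<close>

lemma weak_equivalence_hel:
  assumes w: "weak_equivalence X Y f"
  shows "hel f X Y (cube n) (cube_boundary n)"
proof (cases n)
  case 0
  have f: "continuous_map X Y f" using w by (simp add: weak_equivalence_def)
  have b0: "cube_boundary 0 = {}" by (simp add: cube_boundary_def)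
  have "lifting f X Y (cube 0) (cube_boundary 0)"
    unfolding lifting_def
  proof (intro allI impI)
    fix a b assume b: "continuous_map (cube 0) Y b"
    have "b (\<lambda>_. undefined) \<in> topspace Y"
      using b by (auto simp: continuous_map_def topspace_cube)
    then obtain x where x: "x \<in> topspace X" using w unfolding weak_equivalence_def by blast
    have "b \<in> sphere_maps 0 Y (f x)" using b by (simp add: sphere_maps_def b0)
    then obtain g where "g \<in> sphere_maps 0 X x" "(f \<circ> g, b) \<in> sphere_htpy 0 Y (f x)"
      using w x bij_betw_pi_map_iff[OF f] unfolding weak_equivalence_def by blast
    then show "solv f X Y (cube 0) (cube_boundary 0) a b"
      unfolding solv_def sphere_htpy_iff b0 by (auto simp: sphere_maps_def)
  qed
  then show ?thesis
    unfolding 0 by (rule lifting_imp_hel[OF hep_pair_cube hep_pair_cyl_cube _ f])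
next
  case (Suc m)
  have f: "continuous_map X Y f" using w by (simp add: weak_equivalence_def)
  show ?thesis
    unfolding Suc
    by (intro hel_cube_Suc lifting_imp_hel hep_pair_cyl_cube hep_pair_cyl_cyl_cube f
        weak_equivalence_lifting_cyl w)
qed

lemma weak_equivalence_iff_lifting:
  "weak_equivalence X Y f \<longleftrightarrow> continuous_map X Y f \<and> (\<forall>n. lifting f X Y (cube n) (cube_boundary n))"
proof
  assume "weak_equivalence X Y f"
  moreover from this have "continuous_map X Y f" unfolding weak_equivalence_def by blast
  ultimately show "continuous_map X Y f \<and> (\<forall>n. lifting f X Y (cube n) (cube_boundary n))"
    using hel_imp_lifting[OF weak_equivalence_hel] by blast
next
  assume "continuous_map X Y f \<and> (\<forall>n. lifting f X Y (cube n) (cube_boundary n))"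
  then show "weak_equivalence X Y f" by (intro lifting_imp_weak_equivalence) auto
qed

text \<open>The square for \<open>g\<close> is solved first, with left side
  \<open>f \<circ> a\<close>. Its solution extends \<open>f \<circ> a\<close> strictly and can
  therefore serve as the right side of a square for \<open>f\<close>; the two homotopies are
  concatenated.\<close>

lemma weak_equivalence_compose:
  assumes f: "weak_equivalence X Y f" and g: "weak_equivalence Y Z g"
  shows "weak_equivalence X Z (g \<circ> f)"
proof (rule lifting_imp_weak_equivalence)
  have fc: "continuous_map X Y f" and gc: "continuous_map Y Z g"
    using f g by (auto simp: weak_equivalence_def)
  show "continuous_map X Z (g \<circ> f)" by (rule continuous_map_compose[OF fc gc])
  show "lifting (g \<circ> f) X Z (cube n) (cube_boundary n)" for n
    unfolding lifting_def
  proof (intro allI impI)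
    fix a b assume a: "continuous_map (subtopology (cube n) (cube_boundary n)) X a"
      and b: "continuous_map (cube n) Z b" and eq: "\<forall>x\<in>cube_boundary n. (g \<circ> f) (a x) = b x"
    have "continuous_map (subtopology (cube n) (cube_boundary n)) Y (f \<circ> a)"
      by (rule continuous_map_compose[OF a fc])
    then have "solv g Y Z (cube n) (cube_boundary n) (f \<circ> a) b"
      using g b eq unfolding weak_equivalence_iff_lifting lifting_def by simp
    then obtain A H where A: "continuous_map (cube n) Y A" "\<And>x. x\<in>cube_boundary n \<Longrightarrow> A x = f (a x)"
      and H: "continuous_map (cyl (cube n)) Z H" "\<And>t x. t\<in>{0..1} \<Longrightarrow> x\<in>cube_boundary n \<Longrightarrow> H (t, x) = b x"
        "\<And>x. x \<in> topspace (cube n) \<Longrightarrow> H (0, x) = g (A x) \<and> H (1, x) = b x"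
      unfolding solv_def by auto
    have "solv f X Y (cube n) (cube_boundary n) a A"
      using f a A unfolding weak_equivalence_iff_lifting lifting_def by simp
    then obtain A' H' where A': "continuous_map (cube n) X A'" "\<And>x. x\<in>cube_boundary n \<Longrightarrow> A' x = a x"
      and H': "continuous_map (cyl (cube n)) Y H'" "\<And>t x. t\<in>{0..1} \<Longrightarrow> x\<in>cube_boundary n \<Longrightarrow> H' (t, x) = A x"
        "\<And>x. x \<in> topspace (cube n) \<Longrightarrow> H' (0, x) = f (A' x) \<and> H' (1, x) = A x"
      unfolding solv_def by auto
    have gH: "continuous_map (cyl (cube n)) Z (g \<circ> H')" by (rule continuous_map_compose[OF H'(1) gc])
    have "continuous_map (cyl (cube n)) Z (path_cat (g \<circ> H') H)"
      by (rule continuous_map_path_cat[OF gH H(1)]) (simp add: H H')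
    then show "solv (g \<circ> f) X Z (cube n) (cube_boundary n) a b"
      unfolding solv_def
      by (intro exI[of _ A'] exI[of _ "path_cat (g \<circ> H') H"])
        (use A A' H H' eq in \<open>auto simp: path_cat_def\<close>)
  qed
qed

text \<open>The right side is lifted by the inverse, with constant homotopy.\<close>

lemma homeomorphic_weak_equivalence:
  assumes "homeomorphic_maps X Y f g"
  shows "weak_equivalence X Y f"
proof (rule lifting_imp_weak_equivalence)
  have f: "continuous_map X Y f" and g: "continuous_map Y X g"
    and gf: "\<And>x. x \<in> topspace X \<Longrightarrow> g (f x) = x" and fg: "\<And>y. y \<in> topspace Y \<Longrightarrow> f (g y) = y"
    using assms by (auto simp: homeomorphic_maps_def)
  show "continuous_map X Y f" by (rule f)
  show "lifting f X Y (cube n) (cube_boundary n)" for n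
    unfolding lifting_def
  proof (intro allI impI)
    fix a b assume a: "continuous_map (subtopology (cube n) (cube_boundary n)) X a"
      and b: "continuous_map (cube n) Y b" and eq: "\<forall>x\<in>cube_boundary n. f (a x) = b x"
    have bT: "b x \<in> topspace Y" if "x \<in> topspace (cube n)" for x
      using b that unfolding continuous_map_def by blast
    have aT: "a x \<in> topspace X" if "x \<in> cube_boundary n" for x
      using a that cube_boundary_subset[of n] unfolding continuous_map_def by auto
    have "g (b x) = a x" if "x \<in> cube_boundary n" for x
      using eq that gf[OF aT[OF that]] by metis
    moreover have "continuous_map (cyl (cube n)) Y (b \<circ> snd)"
      by (rule continuous_map_compose[OF continuous_map_snd b])
    ultimately show "solv f X Y (cube n) (cube_boundary n) a b"
      unfolding solv_def
      by (intro exI[of _ "g \<circ> b"] exI[of _ "b \<circ> snd"]) (use b g bT fg in \<open>auto intro: continuous_map_compose\<close>)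
  qed
qed

section \<open>Encodings in the universe\<close>

lemma inj_enc:
  fixes e :: "'b \<Rightarrow> 'u::universe"
  assumes "inj e" shows "inj (enc :: 'b \<Rightarrow> 'u)"
  unfolding enc_def by (rule someI[of inj]) (rule assms)

lemma dec_enc:
  assumes "inj (enc :: 'b \<Rightarrow> 'u::universe)" shows "dec (enc x :: 'u) = (x :: 'b)"
  unfolding dec_def using assms by (rule inv_f_f)

text \<open>\<open>enc\<close> is a choice of an injection whenever one exists, so its injectivity
  reduces to the existence of any injection. The \<open>itself\<close> arguments make this a
  relation between two types, provable along the structure of the second.\<close>

definition encodable :: "'u itself \<Rightarrow> 'b itself \<Rightarrow> bool" where
  "encodable _ _ \<longleftrightarrow> (\<exists>e :: 'b \<Rightarrow> 'u. inj e)"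

lemma encodable_inj_enc: "encodable TYPE('u::universe) TYPE('b) \<Longrightarrow> inj (enc :: 'b \<Rightarrow> 'u)"
  unfolding encodable_def using inj_enc by blast

lemma encodable_trans:
  assumes "inj (h :: 'b \<Rightarrow> 'c)" "encodable TYPE('u) TYPE('c)" shows "encodable TYPE('u) TYPE('b)"
  using assms unfolding encodable_def by (metis inj_compose)

lemma encodable_self: "encodable TYPE('u) TYPE('u)"
  unfolding encodable_def by (rule exI[of _ id]) simp

lemma encodable_real: "encodable TYPE('u::universe) TYPE(real)"
  unfolding encodable_def by (rule ex_inj_real)

text \<open>Precomposition with a left inverse of \<open>d\<close> turns functions on
  \<open>'d\<close> into functions on the reals, for which the class \<open>universe\<close>
  provides an injection.\<close>

lemma encodable_fun:
  assumes "inj (d :: 'd \<Rightarrow> real)" "encodable TYPE('u::universe) TYPE('c)"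
  shows "encodable TYPE('u) TYPE('d \<Rightarrow> 'c)"
proof -
  obtain e :: "'c \<Rightarrow> 'u" where e: "inj e" using assms(2) by (auto simp: encodable_def)
  have "inj (\<lambda>(f :: 'd \<Rightarrow> 'c) r. e (f (inv_into UNIV d r)))"
  proof (rule injI)
    fix f g :: "'d \<Rightarrow> 'c" assume eq: "(\<lambda>r. e (f (inv_into UNIV d r))) = (\<lambda>r. e (g (inv_into UNIV d r)))"
    have "e (f x) = e (g x)" for x
      using fun_cong[OF eq, of "d x"] inv_f_f[OF assms(1)] by simp
    then show "f = g" using e by (auto simp: inj_eq)
  qed
  then show ?thesis
    by (rule encodable_trans) (unfold encodable_def, rule ex_inj_fun)
qed

text \<open>A pair is a function on \<open>bool\<close>, which embeds into the reals.\<close>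

lemma encodable_prod:
  assumes "encodable TYPE('u::universe) TYPE('b)" "encodable TYPE('u) TYPE('c)"
  shows "encodable TYPE('u) TYPE('b \<times> 'c)"
proof -
  obtain e :: "'b \<Rightarrow> 'u" and e' :: "'c \<Rightarrow> 'u" where e: "inj e" "inj e'"
    using assms by (auto simp: encodable_def)
  have "inj (\<lambda>(x, y) b. if b then e x else e' y)"
  proof (rule injI, clarify)
    fix x y x' y'
    assume "(\<lambda>b. if b then e x else e' y) = (\<lambda>b. if b then e x' else e' y')"
    from fun_cong[OF this, of True] fun_cong[OF this, of False] show "x = x' \<and> y = y'"
      using e by (simp add: inj_eq)
  qed
  moreover have "inj (\<lambda>b :: bool. if b then 1 else 0 :: real)" by (auto simp: inj_on_def)
  ultimately show ?thesis using encodable_trans encodable_fun encodable_self by blast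
qed

lemma encodable_option:
  assumes "encodable TYPE('u::universe) TYPE('b)"
  shows "encodable TYPE('u) TYPE('b option)"
proof -
  have "inj (\<lambda>x :: 'b option. case x of None \<Rightarrow> (0 :: real, undefined) | Some b \<Rightarrow> (1, b))"
    by (auto simp: inj_on_def split: option.splits)
  then show ?thesis using encodable_trans encodable_prod[OF encodable_real assms] by blast
qed

lemma inj_nat_real: "inj (real :: nat \<Rightarrow> real)"
  by (rule inj_of_nat)

lemma ex_inj_nat_set_real: "\<exists>d :: nat set \<Rightarrow> real. inj d"
  using nat_sets_eqpoll_reals unfolding eqpoll_def by (auto simp: bij_betw_def)

text \<open>A sequence of reals is a sequence of sets of natural numbers, hence a set of pairs of
  numbers, hence a real.\<close>

lemma ex_inj_nat_fun_real: "\<exists>d :: (nat \<Rightarrow> real) \<Rightarrow> real. inj d"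
proof -
  obtain d :: "nat set \<Rightarrow> real" and c :: "real \<Rightarrow> nat set" where d: "inj d" and c: "inj c"
    using nat_sets_eqpoll_reals ex_inj_nat_set_real eqpoll_sym unfolding eqpoll_def bij_betw_def
    by metis
  let ?h = "\<lambda>f :: nat \<Rightarrow> real. {prod_encode (i, j) | i j. j \<in> c (f i)}"
  have "inj ?h"
  proof (rule injI, rule ext)
    fix f g i assume eq: "?h f = ?h g"
    have "j \<in> c (f i) \<longleftrightarrow> prod_encode (i, j) \<in> ?h f" and "j \<in> c (g i) \<longleftrightarrow> prod_encode (i, j) \<in> ?h g" for j
      by auto
    then have "c (f i) = c (g i)" unfolding eq by blast
    then show "f i = g i" using c by (simp add: inj_eq)
  qed
  then show ?thesis using d inj_compose by blast
qed

lemma encodable_nat_fun: 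
  "encodable TYPE('u::universe) TYPE('c) \<Longrightarrow> encodable TYPE('u) TYPE(nat \<Rightarrow> 'c)"
  by (rule encodable_fun[OF inj_nat_real])

lemma encodable_nat: "encodable TYPE('u::universe) TYPE(nat)"
  by (rule encodable_trans[OF inj_nat_real encodable_real])

text \<open>These are the points of a homotopy limit of a punctured cube. Both of their argument
  types, sets of numbers and barycentric coordinates, embed into the reals.\<close>

lemma encodable_cube_points: "encodable TYPE('u::universe) TYPE(nat set \<Rightarrow> (nat \<Rightarrow> real) \<Rightarrow> 'u)"
proof -
  obtain d :: "nat set \<Rightarrow> real" and c :: "(nat \<Rightarrow> real) \<Rightarrow> real" where d: "inj d" and c: "inj c"
    using ex_inj_nat_set_real ex_inj_nat_fun_real by blast
  show ?thesis by (rule encodable_fun[OF d encodable_fun[OF c encodable_self]])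
qed

section \<open>The compact-open topology\<close>

lemma quotient_map_coinduced: "quotient_map T (coinduced T q) q"
proof -
  have "openin (coinduced T q) (q ` topspace T)"
    unfolding openin_coinduced by (simp add: Collect_conj_eq[symmetric] cong: conj_cong)
  then have "topspace (coinduced T q) = q ` topspace T"
    using openin_coinduced[of T q "topspace (coinduced T q)"] openin_subset by blast
  then show ?thesis unfolding quotient_map_def by (auto simp: openin_coinduced)
qed

lemma topspace_coinduced: "topspace (coinduced T q) = q ` topspace T"
  using quotient_map_coinduced quotient_imp_surjective_map by metis

lemma continuous_map_coinduced: "continuous_map T (coinduced T q) q"
  by (rule quotient_imp_continuous_map[OF quotient_map_coinduced])

lemma continuous_map_from_coinduced:
  "continuous_map (coinduced T q) Y f \<longleftrightarrow> continuous_map T Y (f \<circ> q)"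
  using continuous_compose_quotient_map_eq[OF quotient_map_coinduced] by metis

lemma topspace_mapspace:
  "topspace (mapspace A B) = {f \<in> extensional (topspace A). continuous_map A B f}"
proof -
  let ?S = "{{f \<in> extensional (topspace A). continuous_map A B f \<and> f ` K \<subseteq> V} | K V.
        compactin A K \<and> openin B V}"
  \<comment> \<open>The empty compact set imposes no condition, so the whole mapping space is itself
    a subbasic open set.\<close>
  have "{f \<in> extensional (topspace A). continuous_map A B f \<and> f ` {} \<subseteq> {}} \<in> ?S"
    by (rule CollectI) (use compactin_empty openin_empty in blast)
  then have "\<Union> ?S = {f \<in> extensional (topspace A). continuous_map A B f}"
    by auto
  then show ?thesis by (simp add: mapspace_def topology_generated_by_topspace)
qed

text \<open>Tube lemma: the parameters whose map fails to send \<open>K\<close> into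
  \<open>V\<close> form the projection of a closed subset of \<open>Z\<close> times
  \<open>K\<close>, and projecting along a compact factor is a closed map.\<close>

lemma continuous_map_curry:
  assumes F: "continuous_map (prod_topology Z A) B F"
  shows "continuous_map Z (mapspace A B) (\<lambda>z. \<lambda>a\<in>topspace A. F (z, a))"
  unfolding mapspace_def
proof (rule continuous_on_generated_topo)
  have c: "continuous_map A B (\<lambda>a\<in>topspace A. F (z, a))" if "z \<in> topspace Z" for z
  proof -
    have "continuous_map A (prod_topology Z A) (\<lambda>a. (z, a))"
      using that by (intro continuous_map_pairedI) auto
    from continuous_map_compose[OF this F] show ?thesis by (simp add: o_def)
  qed
  let ?\<phi> = "\<lambda>z. \<lambda>a\<in>topspace A. F (z, a)"
  fix U assume "U \<in> {{f \<in> extensional (topspace A). continuous_map A B f \<and> f ` K \<subseteq> V} | K V.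
        compactin A K \<and> openin B V}"
  then obtain K V where U: "U = {f \<in> extensional (topspace A). continuous_map A B f \<and> f ` K \<subseteq> V}"
    and K: "compactin A K" and V: "openin B V" by blast
  have KA: "K \<subseteq> topspace A" by (rule compactin_subset_topspace[OF K])
  let ?P = "prod_topology Z (subtopology A K)"
  have FK: "continuous_map ?P B F"
    using F by (simp add: prod_subtopology_right continuous_map_from_subtopology)
  have TP: "topspace ?P = topspace Z \<times> K" using KA by auto
  have "closedin ?P {p \<in> topspace ?P. F p \<in> topspace B - V}"
    by (rule closedin_continuous_map_preimage[OF FK]) (use V in blast)
  then have cl: "closedin Z (fst ` {p \<in> topspace ?P. F p \<in> topspace B - V})"
    using closed_map_fst[of "subtopology A K" Z] K
    by (simp add: closed_map_def compact_space_subtopology)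
  have "?\<phi> -` U \<inter> topspace Z = topspace Z - fst ` {p \<in> topspace ?P. F p \<in> topspace B - V}"
    unfolding set_eq_iff
  proof
    fix z
    have "z \<in> ?\<phi> -` U \<longleftrightarrow> (\<forall>a\<in>K. F (z, a) \<in> V)" if z: "z \<in> topspace Z"
    proof -
      have "?\<phi> z ` K = (\<lambda>a. F (z, a)) ` K" using KA by (intro image_cong) auto
      then have "?\<phi> z ` K \<subseteq> V \<longleftrightarrow> (\<forall>a\<in>K. F (z, a) \<in> V)" by (simp only: image_subset_iff)
      then show ?thesis using c[OF z] by (simp only: U vimage_eq mem_Collect_eq restrict_extensional simp_thms)
    qed
    moreover have "z \<in> fst ` {p \<in> topspace ?P. F p \<in> topspace B - V} \<longleftrightarrow> (\<exists>a\<in>K. F (z, a) \<notin> V)"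
      if z: "z \<in> topspace Z"
    proof -
      have "F (z, a) \<in> topspace B" if "a \<in> K" for a
        using FK z that TP unfolding continuous_map_def by auto
      then show ?thesis using z unfolding TP by force
    qed
    ultimately show "z \<in> ?\<phi> -` U \<inter> topspace Z
        \<longleftrightarrow> z \<in> topspace Z - fst ` {p \<in> topspace ?P. F p \<in> topspace B - V}"
      by blast
  qed
  then show "openin Z (?\<phi> -` U \<inter> topspace Z)" using cl by (simp add: closedin_def)
next
  have c: "continuous_map A B (\<lambda>a\<in>topspace A. F (z, a))" if "z \<in> topspace Z" for z
  proof -
    have "continuous_map A (prod_topology Z A) (\<lambda>a. (z, a))"
      using that by (intro continuous_map_pairedI) auto
    from continuous_map_compose[OF this F] show ?thesis by (simp add: o_def)
  qed
  have "(\<lambda>z. \<lambda>a\<in>topspace A. F (z, a)) ` topspace Z \<subseteq> topspace (mapspace A B)"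
    unfolding topspace_mapspace using c by auto
  then show "(\<lambda>z. \<lambda>a\<in>topspace A. F (z, a)) ` topspace Z \<subseteq> 
      \<Union> {{f \<in> extensional (topspace A). continuous_map A B f \<and> f ` K \<subseteq> V} | K V.
        compactin A K \<and> openin B V}"
    by (simp only: mapspace_def topology_generated_by_topspace)
qed

text \<open>Local compactness of \<open>A\<close>: if a map takes \<open>a\<close> into
  \<open>V\<close>, it takes a compact neighbourhood \<open>K\<close> of \<open>a\<close> into
  \<open>V\<close>, and sending \<open>K\<close> into \<open>V\<close> is an open condition on
  maps.\<close>

lemma continuous_map_uncurry:
  assumes A: "compact_space A" "Hausdorff_space A" and \<phi>: "continuous_map Z (mapspace A B) \<phi>"
  shows "continuous_map (prod_topology Z A) B (\<lambda>(z, a). \<phi> z a)"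
proof -
  have \<phi>c: "continuous_map A B (\<phi> z)" "\<phi> z \<in> extensional (topspace A)" if "z \<in> topspace Z" for z
    using \<phi> that topspace_mapspace[of A B] unfolding continuous_map_def by auto
  have nb: "neighbourhood_base_of (compactin A) A"
    using A by (simp add: compact_imp_locally_compact_space flip: locally_compact_space_neighbourhood_base)
  have "openin (prod_topology Z A) {p \<in> topspace (prod_topology Z A). (\<lambda>(z, a). \<phi> z a) p \<in> V}"
    if V: "openin B V" for V
  proof (subst openin_subopen, intro ballI)
    fix p assume "p \<in> {p \<in> topspace (prod_topology Z A). (\<lambda>(z, a). \<phi> z a) p \<in> V}"
    then obtain z a where p: "p = (z, a)" "z \<in> topspace Z" "a \<in> topspace A" "\<phi> z a \<in> V" by auto
    have "openin A {x \<in> topspace A. \<phi> z x \<in> V}"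
      by (rule openin_continuous_map_preimage[OF \<phi>c(1)[OF p(2)] V])
    then obtain W K where WK: "openin A W" "compactin A K" "a \<in> W" "W \<subseteq> K" "K \<subseteq> {x \<in> topspace A. \<phi> z x \<in> V}"
      using nb p unfolding neighbourhood_base_of by (metis (no_types, lifting) mem_Collect_eq)
    define N where "N = {f \<in> extensional (topspace A). continuous_map A B f \<and> f ` K \<subseteq> V}"
    have "openin (mapspace A B) N"
      unfolding mapspace_def N_def using WK(2) V by (intro topology_generated_by_Basis) blast
    then have "openin Z {z \<in> topspace Z. \<phi> z \<in> N}"
      by (rule openin_continuous_map_preimage[OF \<phi>])
    then have "openin (prod_topology Z A) ({z \<in> topspace Z. \<phi> z \<in> N} \<times> W)"
      using WK(1) by (simp add: openin_prod_Times_iff)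
    moreover have "p \<in> {z \<in> topspace Z. \<phi> z \<in> N} \<times> W"
      using p WK \<phi>c[OF p(2)] by (auto simp: N_def)
    moreover have "{z \<in> topspace Z. \<phi> z \<in> N} \<times> W
        \<subseteq> {p \<in> topspace (prod_topology Z A). (\<lambda>(z, a). \<phi> z a) p \<in> V}"
      using WK by (auto simp: N_def dest: openin_subset)
    ultimately show "\<exists>T. openin (prod_topology Z A) T \<and> p \<in> T
        \<and> T \<subseteq> {p \<in> topspace (prod_topology Z A). (\<lambda>(z, a). \<phi> z a) p \<in> V}" by blast
  qed
  moreover have "\<phi> z a \<in> topspace B" if "z \<in> topspace Z" "a \<in> topspace A" for z a
    using \<phi>c(1)[OF that(1)] that(2) unfolding continuous_map_def by blast
  ultimately show ?thesis unfolding continuous_map_def by auto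
qed

section \<open>Faces of simplices\<close>

abbreviation face_top :: "nat set \<Rightarrow> (nat \<Rightarrow> real) topology" where
  "face_top U \<equiv> subtopology (powertop_real UNIV) (simplex_face U)"

definition face_boundary :: "nat set \<Rightarrow> (nat \<Rightarrow> real) set" where
  "face_boundary U = {t \<in> simplex_face U. \<exists>i\<in>U. t i = 0}"

text \<open>By the exponential law, a map from \<open>cube m\<close> to a homotopy limit is a
  compatible family of maps on these cells. In a lifting problem the values on
  \<open>cell_boundary\<close> are prescribed: over the boundary of the cube by the left side, over
  the boundary of the simplex by the smaller faces.\<close>

abbreviation cell :: "nat \<Rightarrow> nat set \<Rightarrow> ((nat \<Rightarrow> real) \<times> (nat \<Rightarrow> real)) topology" where
  "cell m U \<equiv> prod_topology (cube m) (face_top U)"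

definition cell_boundary :: "nat \<Rightarrow> nat set \<Rightarrow> ((nat \<Rightarrow> real) \<times> (nat \<Rightarrow> real)) set" where
  "cell_boundary m U = cube_boundary m \<times> simplex_face U \<union> topspace (cube m) \<times> face_boundary U"

lemma continuous_map_powertop_component: "continuous_map (powertop_real UNIV) euclideanreal (\<lambda>t. t i)"
  by (rule continuous_map_product_projection) simp

lemma continuous_map_face_component: "continuous_map (face_top U) euclideanreal (\<lambda>t. t i)"
  by (rule continuous_map_from_subtopology[OF continuous_map_powertop_component])

lemma continuous_map_into_face:
  assumes "\<And>i. continuous_map Z euclideanreal (\<lambda>z. f z i)"
    and "\<And>z. z \<in> topspace Z \<Longrightarrow> f z \<in> simplex_face U"
  shows "continuous_map Z (face_top U) f"
  using assms by (auto simp: continuous_map_in_subtopology continuous_map_componentwise_UNIV)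

lemma simplex_face_01:
  assumes "finite U" "t \<in> simplex_face U" shows "0 \<le> t i" "t i \<le> 1"
proof -
  show "0 \<le> t i" using assms(2) by (simp add: simplex_face_def)
  show "t i \<le> 1"
  proof (cases "i \<in> U")
    case True
    then have "t i \<le> sum t U" using assms by (intro member_le_sum) (auto simp: simplex_face_def)
    then show ?thesis using assms(2) by (simp add: simplex_face_def)
  qed (use assms(2) in \<open>simp add: simplex_face_def\<close>)
qed

lemma closedin_simplex_face:
  assumes "finite U" shows "closedin (powertop_real UNIV) (simplex_face U)"
proof -
  have "simplex_face U = (\<Inter>i. {t. t i \<in> (if i \<in> U then {0..} else {0})}) \<inter> {t. sum t U \<in> {1}}"
    unfolding simplex_face_def by (auto split: if_splits) (metis order_refl)
  moreover have "closedin (powertop_real UNIV) {t. t i \<in> (if i \<in> U then {0..} else {0})}" for i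
    using closedin_continuous_map_preimage[OF continuous_map_powertop_component,
        of "if i \<in> U then {0..} else {0}" i] by simp
  moreover have "closedin (powertop_real UNIV) {t. sum t U \<in> {1}}"
    using closedin_continuous_map_preimage[OF continuous_map_sum[OF assms
          continuous_map_powertop_component], of "{1}"] by simp
  ultimately show ?thesis by (auto intro!: closedin_Int closedin_INT)
qed

lemma compact_space_face:
  assumes "finite U" shows "compact_space (face_top U)"
proof -
  have "compactin (powertop_real UNIV) (simplex_face U)"
  proof (rule closed_compactin)
    show "compactin (powertop_real UNIV) (UNIV \<rightarrow>\<^sub>E {0..1})" by (simp add: compactin_PiE)
    show "simplex_face U \<subseteq> UNIV \<rightarrow>\<^sub>E {0..1}" using simplex_face_01[OF assms] by (auto simp: PiE_iff)
  qed (rule closedin_simplex_face[OF assms])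
  then show ?thesis by (rule compact_space_subtopology)
qed

lemma Hausdorff_space_face: "Hausdorff_space (face_top U)"
  by (intro Hausdorff_space_subtopology) (simp add: Hausdorff_space_product_topology)

lemma simplex_face_mono: "finite V \<Longrightarrow> U \<subseteq> V \<Longrightarrow> simplex_face U \<subseteq> simplex_face V"
proof
  fix t assume V: "finite V" "U \<subseteq> V" and t: "t \<in> simplex_face U"
  have "sum t U = sum t V" using V t by (intro sum.mono_neutral_left) (auto simp: simplex_face_def)
  then show "t \<in> simplex_face V" using V t by (auto simp: simplex_face_def)
qed

text \<open>The support of \<open>t\<close> spans the smallest face containing \<open>t\<close>.
  This canonical face is what defines maps on the boundary of a simplex below.\<close>

lemma simplex_face_support:
  assumes U: "finite U" and t: "t \<in> simplex_face U"
  defines "S \<equiv> {i. t i \<noteq> 0}"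
  shows "S \<subseteq> U" "S \<noteq> {}" "t \<in> simplex_face S"
proof -
  show SU: "S \<subseteq> U" using t by (auto simp: S_def simplex_face_def)
  have "sum t S = sum t U" using U SU by (intro sum.mono_neutral_left) (auto simp: S_def)
  then have 1: "sum t S = 1" using t by (simp add: simplex_face_def)
  then show "S \<noteq> {}" by auto
  show "t \<in> simplex_face S" using t 1 by (auto simp: S_def simplex_face_def)
qed

lemma face_boundary_subset: "face_boundary U \<subseteq> simplex_face U"
  by (auto simp: face_boundary_def)

lemma cell_boundary_subset: "cell_boundary m U \<subseteq> topspace (cell m U)"
  using cube_boundary_subset[of m] face_boundary_subset[of U] by (auto simp: cell_boundary_def)

text \<open>The simplex on \<open>insert v U\<close> is the cone on the simplex on \<open>U\<close>, so a cell of dimension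
  one more in the cube direction maps onto it, injectively outside the boundary.\<close>

lemma hel_cell:
  assumes h: "\<And>m. hel f X Y (cube m) (cube_boundary m)" and U: "finite U" "U \<noteq> {}"
  shows "hel f X Y (cell m U) (cell_boundary m U)"
  using U
proof (induction U arbitrary: m rule: finite_ne_induct)
  case (singleton u)
  define e where "e = (\<lambda>i. if i = u then 1 else 0 :: real)"
  have e: "simplex_face {u} = {e}" by (auto simp: simplex_face_def e_def fun_eq_iff)
  \<comment> \<open>The coordinate of the only point is 1, not 0: a vertex has no boundary, and its
    cell is the cube.\<close>
  have b: "face_boundary {u} = {}" by (auto simp: face_boundary_def e) (simp add: e_def)
  have q: "quotient_map (cube m) (cell m {u}) (\<lambda>x. (x, e))"
  proof (rule T1_Spaces.continuous_imp_quotient_map)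
    show "continuous_map (cube m) (cell m {u}) (\<lambda>x. (x, e))"
      by (intro continuous_map_pairedI) (auto simp: e)
    show "Hausdorff_space (cell m {u})"
      by (simp add: Hausdorff_space_prod_topology Hausdorff_space_cube Hausdorff_space_face)
  qed (auto simp: compact_space_cube e)
  show ?case
    by (rule hel_quotient[OF h q]) (auto simp: cell_boundary_def b e cube_boundary_def)
next
  case (insert v U)
  \<comment> \<open>The last cube coordinate \<open>x m\<close> becomes the barycentric coordinate
    of \<open>v\<close>, and the other coordinates are scaled by the remaining weight. Over the
    vertex \<open>v\<close>, where \<open>x m = 1\<close>, the whole simplex on \<open>U\<close> is
    collapsed.\<close>
  define q where "q = (\<lambda>(x, t). (restrict x {..<m}, \<lambda>i. if i = v then x m else (1 - x m) * t i :: real))"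
  let ?C = "cell (Suc m) U" and ?C' = "cell m (insert v U)"
  have C: "topspace ?C = topspace (cube (Suc m)) \<times> simplex_face U"
    "topspace ?C' = topspace (cube m) \<times> simplex_face (insert v U)" by auto
  have xm: "0 \<le> x i \<and> x i \<le> 1" if "x \<in> topspace (cube (Suc m))" "i \<le> m" for x i
    using that by (auto simp: topspace_cube PiE_iff)
  have qf: "(\<lambda>i. if i = v then x m else (1 - x m) * t i) \<in> simplex_face (insert v U)"
    if x: "x \<in> topspace (cube (Suc m))" and t: "t \<in> simplex_face U" for x t
  proof -
    have "(\<Sum>i\<in>U. if i = v then x m else (1 - x m) * t i) = (1 - x m) * sum t U"
      unfolding sum_distrib_left using insert.hyps by (intro sum.cong) auto
    then show ?thesis
      using xm[OF x, of m] t insert.hyps by (auto simp: simplex_face_def)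
  qed
  have qc: "continuous_map ?C ?C' q"
    unfolding q_def split_beta'
  proof (intro continuous_map_pairedI continuous_map_into_cube continuous_map_into_face)
    have c: "continuous_map ?C euclideanreal (\<lambda>z. fst z i)" if "i \<le> m" for i
      using continuous_map_compose[OF continuous_map_fst continuous_map_cube_component[of i "Suc m"]] that
      by (simp add: o_def)
    have d: "continuous_map ?C euclideanreal (\<lambda>z. snd z i)" for i
      using continuous_map_compose[OF continuous_map_snd continuous_map_face_component] by (simp add: o_def)
    show "continuous_map ?C euclideanreal (\<lambda>z. restrict (fst z) {..<m} i)" if "i < m" for i
      using c that by simp
    show "continuous_map ?C euclideanreal (\<lambda>z. if i = v then fst z m else (1 - fst z m) * snd z i)" for i
      by (cases "i = v") (auto intro!: continuous_intros c d)
    show "0 \<le> restrict (fst z) {..<m} i \<and> restrict (fst z) {..<m} i \<le> 1"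
      if "z \<in> topspace ?C" "i < m" for z i
      using that xm[of "fst z" i] unfolding C by auto
    show "(\<lambda>i. if i = v then fst z m else (1 - fst z m) * snd z i) \<in> simplex_face (insert v U)"
      if "z \<in> topspace ?C" for z using that qf unfolding C by auto
  qed simp
  have surj: "\<exists>x t. x \<in> topspace (cube (Suc m)) \<and> t \<in> simplex_face U \<and> q (x, t) = (y, s)"
    if y: "y \<in> topspace (cube m)" and s: "s \<in> simplex_face (insert v U)" for y s
  proof -
    have s01: "0 \<le> s i" "s i \<le> 1" for i using simplex_face_01[OF _ s] insert.hyps by auto
    have ssum: "s v + sum s U = 1" using s insert.hyps by (simp add: simplex_face_def)
    define x where "x = cube_join m (s v, y)"
    have x: "x \<in> topspace (cube (Suc m))"
      using s01 y homeomorphic_maps_cube_split[of m] unfolding x_def homeomorphic_maps_def continuous_map_def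
      by auto
    have xv: "x m = s v" "restrict x {..<m} = y"
      using y by (auto simp: x_def cube_join_def topspace_cube fun_eq_iff PiE_iff extensional_def)
    show ?thesis
    \<comment> \<open>At the cone point every point of the base is a preimage; a vertex
      \<open>u\<close> of the base is taken.\<close>
    proof (cases "s v = 1")
      case True
      then have "sum s U = 0" using ssum by simp
      then have s0: "s i = 0" if "i \<in> U" for i
        using that insert.hyps s01 by (simp add: sum_nonneg_eq_0_iff)
      obtain u where u: "u \<in> U" using insert.hyps by blast
      have "(\<lambda>i. if i = u then 1 else 0) \<in> simplex_face U"
        using u insert.hyps by (auto simp: simplex_face_def)
      moreover have "s i = (if i = v then 1 else 0)" for i
        using s s0 True by (auto simp: simplex_face_def)
      ultimately show ?thesis
        using x xv True by (intro exI[of _ x] exI[of _ "\<lambda>i. if i = u then 1 else 0"]) (auto simp: q_def fun_eq_iff)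
    next
      case False
      then have sv: "1 - s v > 0" using s01[of v] by simp
      define t where "t = (\<lambda>i. if i = v then 0 else s i / (1 - s v))"
      have "sum t U = sum s U / (1 - s v)"
        unfolding sum_divide_distrib t_def using insert.hyps by (intro sum.cong) auto
      then have "t \<in> simplex_face U"
        using sv s01 s ssum by (auto simp: simplex_face_def t_def)
      moreover have "q (x, t) = (y, s)"
        using xv sv by (auto simp: q_def t_def fun_eq_iff)
      ultimately show ?thesis using x by blast
    qed
  qed
  have q: "quotient_map ?C ?C' q"
  proof (rule T1_Spaces.continuous_imp_quotient_map[OF qc])
    show "compact_space ?C"
      by (simp add: compact_space_prod_topology compact_space_cube compact_space_face insert.hyps)
    show "Hausdorff_space ?C'"
      by (simp add: Hausdorff_space_prod_topology Hausdorff_space_cube Hausdorff_space_face)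
    show "q ` topspace ?C = topspace ?C'"
    proof
      show "q ` topspace ?C \<subseteq> topspace ?C'" using qc by (rule continuous_map_image_subset_topspace)
      show "topspace ?C' \<subseteq> q ` topspace ?C"
      proof
        fix z assume "z \<in> topspace ?C'"
        then obtain y s where "z = (y, s)" "y \<in> topspace (cube m)" "s \<in> simplex_face (insert v U)"
          unfolding C by blast
        then show "z \<in> q ` topspace ?C" using surj[of y s] unfolding C by force
      qed
    qed
  qed
  \<comment> \<open>The end \<open>x m = 0\<close> is the face opposite to \<open>v\<close>. The end
    \<open>x m = 1\<close> is the vertex \<open>v\<close>, which lies in the boundary because
    \<open>U\<close> is nonempty.\<close>
  have memB: "q (x, t) \<in> cell_boundary m (insert v U) \<longleftrightarrow> (x, t) \<in> cell_boundary (Suc m) U"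
    if x: "x \<in> topspace (cube (Suc m))" and t: "t \<in> simplex_face U" for x t
  proof -
    obtain u where u: "u \<in> U" using insert.hyps by blast
    have "restrict x {..<m} \<in> topspace (cube m)" using xm[OF x] by (auto simp: topspace_cube)
    then have "q (x, t) \<in> cell_boundary m (insert v U) \<longleftrightarrow>
        (\<exists>i<m. x i = 0 \<or> x i = 1) \<or> x m = 0 \<or> (\<exists>i\<in>U. x m = 1 \<or> t i = 0)"
      using qf[OF x t] insert.hyps
      by (auto simp: q_def cell_boundary_def cube_boundary_def face_boundary_def)
    also have "\<dots> \<longleftrightarrow> (\<exists>i<Suc m. x i = 0 \<or> x i = 1) \<or> (\<exists>i\<in>U. t i = 0)"
      using u by (auto simp: less_Suc_eq)
    also have "\<dots> \<longleftrightarrow> (x, t) \<in> cell_boundary (Suc m) U"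
      using x t by (auto simp: cell_boundary_def cube_boundary_def face_boundary_def)
    finally show ?thesis .
  qed
  show ?case
  proof (rule hel_quotient[OF insert.IH q])
    show "q ` cell_boundary (Suc m) U = cell_boundary m (insert v U)"
    proof
      show "q ` cell_boundary (Suc m) U \<subseteq> cell_boundary m (insert v U)"
        using memB cell_boundary_subset[of "Suc m" U] unfolding C by auto
      show "cell_boundary m (insert v U) \<subseteq> q ` cell_boundary (Suc m) U"
      proof
        fix z assume z: "z \<in> cell_boundary m (insert v U)"
        then have "z \<in> topspace (cube m) \<times> simplex_face (insert v U)"
          using cell_boundary_subset[of m "insert v U"] unfolding C by blast
        then obtain x t where "x \<in> topspace (cube (Suc m))" "t \<in> simplex_face U" "q (x, t) = z"
          using surj[of "fst z" "snd z"] by (cases z) auto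
        then show "z \<in> q ` cell_boundary (Suc m) U" using memB z by blast
      qed
    qed
    show "cell_boundary (Suc m) U \<subseteq> topspace ?C" by (rule cell_boundary_subset)
    fix p p' assume p: "p \<in> topspace ?C" "p' \<in> topspace ?C" "q p = q p'"
    obtain x t x' t' where xt: "p = (x, t)" "p' = (x', t')" by (cases p, cases p')
    have xs: "x \<in> topspace (cube (Suc m))" "x' \<in> topspace (cube (Suc m))" "t \<in> simplex_face U" "t' \<in> simplex_face U"
      using p xt unfolding C by auto
    have eq: "restrict x {..<m} = restrict x' {..<m}" "x m = x' m"
      "\<And>i. i \<noteq> v \<Longrightarrow> (1 - x m) * t i = (1 - x' m) * t' i"
    proof -
      have q2: "snd (q p) i = snd (q p') i" for i using p(3) by simp
      show "restrict x {..<m} = restrict x' {..<m}" using p(3) xt by (simp add: q_def)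
      show "x m = x' m" using q2[of v] xt by (simp add: q_def)
      show "(1 - x m) * t i = (1 - x' m) * t' i" if "i \<noteq> v" for i
        using q2[of i] xt that by (simp add: q_def)
    qed
    have "x i = x' i" for i
    proof -
      consider "i < m" | "i = m" | "i > m" by linarith
      then show ?thesis
      proof cases
        case 1
        then show ?thesis using fun_cong[OF eq(1), of i] by simp
      next
        case 3
        then show ?thesis using xs by (simp add: topspace_cube PiE_iff extensional_def)
      qed (use eq in auto)
    qed
    then have xx: "x = x'" by blast
    show "p = p' \<or> p \<in> cell_boundary (Suc m) U \<and> p' \<in> cell_boundary (Suc m) U"
    proof (cases "x m = 1")
      case True
      then have "x \<in> cube_boundary (Suc m)" using xs by (auto simp: cube_boundary_def)
      then show ?thesis using xx xt xs by (auto simp: cell_boundary_def)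
    next
      case False
      have "t i = t' i" for i
      proof (cases "i = v")
        case True
        then show ?thesis using xs insert.hyps by (simp add: simplex_face_def)
      qed (use eq False in auto)
      then show ?thesis using xx xt by auto
    qed
  qed
qed

section \<open>Homotopy limits of punctured cubes\<close>

lemma continuous_map_in_topspace: "continuous_map X Y f \<Longrightarrow> x \<in> topspace X \<Longrightarrow> f x \<in> topspace Y"
  unfolding continuous_map_def by blast

lemma finite_nonempty_subset: "U \<in> nonempty_subsets n \<Longrightarrow> finite U"
  by (auto simp: nonempty_subsets_def intro: finite_subset)

lemma nonempty_subsets_subset: "U \<in> nonempty_subsets n \<Longrightarrow> V \<subseteq> U \<Longrightarrow> V \<noteq> {} \<Longrightarrow> V \<in> nonempty_subsets n"
  by (auto simp: nonempty_subsets_def)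

abbreviation holim_points :: "nat \<Rightarrow> (nat set \<Rightarrow> 'u pspace) \<Rightarrow> (nat set \<Rightarrow> nat set \<Rightarrow> 'u \<Rightarrow> 'u)
    \<Rightarrow> (nat set \<Rightarrow> (nat \<Rightarrow> real) \<Rightarrow> 'u) topology" where
  "holim_points n G g \<equiv> subtopology
     (product_topology (\<lambda>U. mapspace (face_top U) (fst (G U))) (nonempty_subsets n))
     {\<phi>. \<forall>U\<in>nonempty_subsets n. \<forall>V\<in>nonempty_subsets n. U \<subseteq> V \<longrightarrow>
               (\<forall>t\<in>simplex_face U. \<phi> V t = g U V (\<phi> U t))}"

lemma inj_enc_cube_points: "inj (enc :: (nat set \<Rightarrow> (nat \<Rightarrow> real) \<Rightarrow> 'u) \<Rightarrow> 'u::universe)"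
  by (rule encodable_inj_enc[OF encodable_cube_points])

text \<open>One half of the exponential law, by currying over each simplex. On a k-space the
  k-ification in the target may be ignored.\<close>

lemma continuous_map_into_holim:
  fixes G :: "nat set \<Rightarrow> 'u::universe pspace"
  assumes Z: "k_space Z"
    and c: "\<And>U. U \<in> nonempty_subsets n \<Longrightarrow> continuous_map (prod_topology Z (face_top U)) (fst (G U)) (a U)"
    and compat: "\<And>U V z t. U \<in> nonempty_subsets n \<Longrightarrow> V \<in> nonempty_subsets n \<Longrightarrow> U \<subseteq> V \<Longrightarrow> z \<in> topspace Z
      \<Longrightarrow> t \<in> simplex_face U \<Longrightarrow> a V (z, t) = g U V (a U (z, t))"
  shows "continuous_map Z (fst (cube_holim n G g))
      (\<lambda>z. enc (\<lambda>U\<in>nonempty_subsets n. \<lambda>t\<in>simplex_face U. a U (z, t)))"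
proof -
  let ?\<phi> = "\<lambda>z. \<lambda>U\<in>nonempty_subsets n. \<lambda>t\<in>simplex_face U. a U (z, t)"
  have "continuous_map Z (product_topology (\<lambda>U. mapspace (face_top U) (fst (G U))) (nonempty_subsets n)) ?\<phi>"
    unfolding continuous_map_componentwise
  proof (intro conjI ballI)
    fix U assume U: "U \<in> nonempty_subsets n"
    from continuous_map_curry[OF c[OF U]]
    show "continuous_map Z (mapspace (face_top U) (fst (G U))) (\<lambda>z. ?\<phi> z U)" using U by simp
  qed auto
  moreover have "?\<phi> z \<in> {\<phi>. \<forall>U\<in>nonempty_subsets n. \<forall>V\<in>nonempty_subsets n. U \<subseteq> V \<longrightarrow>
               (\<forall>t\<in>simplex_face U. \<phi> V t = g U V (\<phi> U t))}" if "z \<in> topspace Z" for z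
  proof (intro CollectI ballI impI)
    fix U V t assume UV: "U \<in> nonempty_subsets n" "V \<in> nonempty_subsets n" "U \<subseteq> V" and t: "t \<in> simplex_face U"
    have "t \<in> simplex_face V" using simplex_face_mono[OF finite_nonempty_subset[OF UV(2)] UV(3)] t by blast
    then show "?\<phi> z V t = g U V (?\<phi> z U t)" using compat[OF UV that t] UV(1,2) t by simp
  qed
  ultimately have "continuous_map Z (kification (holim_points n G g)) ?\<phi>"
    unfolding continuous_map_into_kification[OF Z] continuous_map_in_subtopology by (intro conjI Pi_I) blast+
  from continuous_map_compose[OF this continuous_map_coinduced] show ?thesis
    unfolding cube_holim_def by (simp add: o_def)
qed

text \<open>The topology is transported along the injection \<open>enc\<close>, so
  \<open>dec\<close> is a continuous inverse on the image; k-ification refines the topology, hence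
  \<open>dec\<close> is also continuous to the space before k-ification.\<close>

lemma continuous_map_holim_dec:
  fixes G :: "nat set \<Rightarrow> 'u::universe pspace"
  assumes p: "continuous_map Z (fst (cube_holim n G g)) p"
  shows "continuous_map Z (holim_points n G g) (dec \<circ> p)"
    and "\<And>z. z \<in> topspace Z \<Longrightarrow> enc (dec (p z) :: nat set \<Rightarrow> (nat \<Rightarrow> real) \<Rightarrow> 'u) = p z"
proof -
  let ?T = "kification (holim_points n G g)"
  have de: "(dec :: 'u \<Rightarrow> _) \<circ> enc = (id :: (nat set \<Rightarrow> (nat \<Rightarrow> real) \<Rightarrow> 'u) \<Rightarrow> _)"
    by (rule ext) (simp add: dec_enc[OF inj_enc_cube_points])
  have "continuous_map ?T (holim_points n G g) id"
    by (rule continuous_map_from_kification) simp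
  then have "continuous_map (coinduced ?T (enc :: _ \<Rightarrow> 'u)) (holim_points n G g) dec"
    unfolding continuous_map_from_coinduced de .
  then show "continuous_map Z (holim_points n G g) (dec \<circ> p)"
    using p unfolding cube_holim_def by (auto intro: continuous_map_compose)
  fix z assume "z \<in> topspace Z"
  then have "p z \<in> enc ` topspace ?T"
    using p unfolding cube_holim_def continuous_map_def by (auto simp: topspace_coinduced)
  then show "enc (dec (p z) :: nat set \<Rightarrow> (nat \<Rightarrow> real) \<Rightarrow> 'u) = p z"
    by (elim imageE) (simp add: dec_enc[OF inj_enc_cube_points])
qed

lemma holim_pointsD:
  assumes "\<phi> \<in> topspace (holim_points n G g)"
  shows "\<phi> = (\<lambda>U\<in>nonempty_subsets n. \<lambda>t\<in>simplex_face U. \<phi> U t)"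
    and "\<And>U V t. U \<in> nonempty_subsets n \<Longrightarrow> V \<in> nonempty_subsets n \<Longrightarrow> U \<subseteq> V
      \<Longrightarrow> t \<in> simplex_face U \<Longrightarrow> \<phi> V t = g U V (\<phi> U t)"
proof -
  have "\<phi> \<in> extensional (nonempty_subsets n)" "\<And>U. U \<in> nonempty_subsets n \<Longrightarrow> \<phi> U \<in> extensional (simplex_face U)"
    using assms by (auto simp: topspace_mapspace PiE_iff)
  then show "\<phi> = (\<lambda>U\<in>nonempty_subsets n. \<lambda>t\<in>simplex_face U. \<phi> U t)"
    by (auto simp: fun_eq_iff extensional_def)
next
  fix U V t
  assume "U \<in> nonempty_subsets n" "V \<in> nonempty_subsets n" "U \<subseteq> V" "t \<in> simplex_face U"
  then show "\<phi> V t = g U V (\<phi> U t)"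
    using assms unfolding topspace_subtopology by blast
qed

text \<open>The other half of the exponential law. Uncurrying is possible because the simplices are
  compact Hausdorff.\<close>

lemma continuous_map_from_holim:
  fixes G :: "nat set \<Rightarrow> 'u::universe pspace"
  assumes p: "continuous_map Z (fst (cube_holim n G g)) p"
  shows "\<And>U. U \<in> nonempty_subsets n \<Longrightarrow>
      continuous_map (prod_topology Z (face_top U)) (fst (G U)) (\<lambda>(z, t). dec (p z) U t)"
    and "\<And>U V z t. U \<in> nonempty_subsets n \<Longrightarrow> V \<in> nonempty_subsets n \<Longrightarrow> U \<subseteq> V \<Longrightarrow> z \<in> topspace Z
      \<Longrightarrow> t \<in> simplex_face U \<Longrightarrow> dec (p z) V t = g U V (dec (p z) U t)"
    and "\<And>z. z \<in> topspace Z \<Longrightarrow>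
      p z = enc (\<lambda>U\<in>nonempty_subsets n. \<lambda>t\<in>simplex_face U. dec (p z) U t :: 'u)"
proof -
  note d = continuous_map_holim_dec[OF p]
  have T: "dec (p z) \<in> topspace (holim_points n G g)" if "z \<in> topspace Z" for z
    using continuous_map_in_topspace[OF d(1) that] by (simp only: comp_apply)
  show "continuous_map (prod_topology Z (face_top U)) (fst (G U)) (\<lambda>(z, t). dec (p z) U t)"
    if U: "U \<in> nonempty_subsets n" for U
  proof -
    have "continuous_map Z (product_topology (\<lambda>U. mapspace (face_top U) (fst (G U))) (nonempty_subsets n))
        (dec \<circ> p)"
      by (rule continuous_map_into_fulltopology[OF d(1)])
    from continuous_map_compose[OF this continuous_map_product_projection[OF U]]
    have "continuous_map Z (mapspace (face_top U) (fst (G U))) (\<lambda>z. dec (p z) U)" by (simp add: o_def)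
    then show ?thesis
      by (rule continuous_map_uncurry[OF compact_space_face[OF finite_nonempty_subset[OF U]]
            Hausdorff_space_face])
  qed
  show "dec (p z) V t = g U V (dec (p z) U t)"
    if "U \<in> nonempty_subsets n" "V \<in> nonempty_subsets n" "U \<subseteq> V" "z \<in> topspace Z" "t \<in> simplex_face U" for U V z t
    using holim_pointsD(2)[OF T] that by blast
  show "p z = enc (\<lambda>U\<in>nonempty_subsets n. \<lambda>t\<in>simplex_face U. dec (p z) U t :: 'u)" if "z \<in> topspace Z" for z
    using holim_pointsD(1)[OF T[OF that]] d(2)[OF that] by metis
qed

text \<open>Only the values on points matter, so the maps need not be extensional.\<close>

definition punctured_cube :: "nat \<Rightarrow> (nat set \<Rightarrow> 'u pspace) \<Rightarrow> (nat set \<Rightarrow> nat set \<Rightarrow> 'u \<Rightarrow> 'u) \<Rightarrow> bool" where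
  "punctured_cube n G g \<longleftrightarrow>
     (\<forall>U\<in>nonempty_subsets n. \<forall>V\<in>nonempty_subsets n. U \<subseteq> V \<longrightarrow> continuous_map (fst (G U)) (fst (G V)) (g U V))
   \<and> (\<forall>U\<in>nonempty_subsets n. \<forall>x\<in>topspace (fst (G U)). g U U x = x)
   \<and> (\<forall>U\<in>nonempty_subsets n. \<forall>V\<in>nonempty_subsets n. \<forall>W\<in>nonempty_subsets n. U \<subseteq> V \<longrightarrow> V \<subseteq> W \<longrightarrow>
        (\<forall>x\<in>topspace (fst (G U)). g V W (g U V x) = g U W x))"

lemma finite_proper_subsets: "finite U \<Longrightarrow> finite {V. V \<subset> U \<and> V \<noteq> {}}"
  by (rule finite_subset[of _ "Pow U"]) auto

lemma face_boundary_eq: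
  assumes "finite U" shows "face_boundary U = (\<Union>V\<in>{V. V \<subset> U \<and> V \<noteq> {}}. simplex_face V)"
proof
  show "face_boundary U \<subseteq> (\<Union>V\<in>{V. V \<subset> U \<and> V \<noteq> {}}. simplex_face V)"
  proof
    fix t assume t: "t \<in> face_boundary U"
    then have "t \<in> simplex_face U" "{i. t i \<noteq> 0} \<noteq> U" by (auto simp: face_boundary_def)
    then show "t \<in> (\<Union>V\<in>{V. V \<subset> U \<and> V \<noteq> {}}. simplex_face V)"
      using simplex_face_support[OF assms, of t] by blast
  qed
  show "(\<Union>V\<in>{V. V \<subset> U \<and> V \<noteq> {}}. simplex_face V) \<subseteq> face_boundary U"
  proof
    fix t assume "t \<in> (\<Union>V\<in>{V. V \<subset> U \<and> V \<noteq> {}}. simplex_face V)"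
    then obtain V where V: "V \<subset> U" "V \<noteq> {}" "t \<in> simplex_face V" by blast
    then obtain i where i: "i \<in> U" "i \<notin> V" by blast
    have "t \<in> simplex_face U" using simplex_face_mono[OF assms, of V] V by blast
    then show "t \<in> face_boundary U" using i V by (auto simp: face_boundary_def simplex_face_def)
  qed
qed

lemma closedin_face:
  assumes "finite U" "V \<subseteq> U" shows "closedin (face_top U) (simplex_face V)"
  using assms finite_subset[OF assms(2,1)]
  by (intro closedin_subset_topspace closedin_simplex_face simplex_face_mono) auto

text \<open>The region is a finite union of closed pieces, one over \<open>Q\<close> and one for
  each proper face. Comparing with \<open>a\<close> over \<open>Q\<close>, and elsewhere with the
  value on the face spanned by the support of \<open>t\<close>, reduces agreement on overlaps to
  \<open>ab\<close> and \<open>bb\<close>. The parameter space \<open>Z\<close> is left open: lifts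
  are pasted over a cube and homotopies over its cylinder.\<close>

lemma paste_cell_boundary:
  assumes U: "finite U"
    and Q: "closedin Z Q"
    and a: "continuous_map (prod_topology (subtopology Z Q) (face_top U)) Y a"
    and b: "\<And>V. V \<subset> U \<Longrightarrow> V \<noteq> {} \<Longrightarrow> continuous_map (prod_topology Z (face_top V)) Y (b V)"
    and ab: "\<And>V z t. V \<subset> U \<Longrightarrow> V \<noteq> {} \<Longrightarrow> z \<in> Q \<Longrightarrow> t \<in> simplex_face V \<Longrightarrow> b V (z, t) = a (z, t)"
    and bb: "\<And>V W z t. V \<subseteq> W \<Longrightarrow> W \<subset> U \<Longrightarrow> V \<noteq> {} \<Longrightarrow> z \<in> topspace Z \<Longrightarrow> t \<in> simplex_face V
        \<Longrightarrow> b W (z, t) = b V (z, t)"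
  shows "continuous_map (subtopology (prod_topology Z (face_top U))
        (Q \<times> simplex_face U \<union> topspace Z \<times> face_boundary U)) Y
      (\<lambda>(z, t). if z \<in> Q then a (z, t) else b {i. t i \<noteq> 0} (z, t))"
proof -
  let ?B = "Q \<times> simplex_face U \<union> topspace Z \<times> face_boundary U"
  let ?C = "subtopology (prod_topology Z (face_top U)) ?B"
  \<comment> \<open>\<open>None\<close> indexes the piece over \<open>Q\<close>, and
    \<open>Some V\<close> the piece over the face \<open>V\<close>.\<close>
  let ?I = "insert None (Some ` {V. V \<subset> U \<and> V \<noteq> {}})"
  define T where "T = (\<lambda>i. case i of None \<Rightarrow> Q \<times> simplex_face U | Some V \<Rightarrow> topspace Z \<times> simplex_face V)"
  define f where "f = (\<lambda>i. case i of None \<Rightarrow> a | Some V \<Rightarrow> b V)"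
  have VU: "simplex_face V \<subseteq> simplex_face U" if "V \<subset> U" for V
    using simplex_face_mono[OF U] that by blast
  have supp: "{i. t i \<noteq> 0} \<noteq> {} \<and> {i. t i \<noteq> 0} \<subseteq> V \<and> t \<in> simplex_face {i. t i \<noteq> 0}"
    if "V \<subset> U" "t \<in> simplex_face V" for V t
    using simplex_face_support[OF _ that(2)] finite_subset[of V U] U that(1) by auto
  have bs: "b V (z, t) = b {i. t i \<noteq> 0} (z, t)" if "V \<subset> U" "z \<in> topspace Z" "t \<in> simplex_face V" for V z t
    using supp[OF that(1,3)] that by (intro bb) auto
  show ?thesis
  proof (rule pasting_lemma_closed[where I = ?I and T = T and f = f])
    show "finite ?I" using finite_proper_subsets[OF U] by simp
    have fb: "face_boundary U = (\<Union>V\<in>{V. V \<subset> U \<and> V \<noteq> {}}. simplex_face V)"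
      by (rule face_boundary_eq[OF U])
    have TB: "T i \<subseteq> ?B" if "i \<in> ?I" for i
    proof (cases i)
      case None
      then show ?thesis by (auto simp: T_def)
    next
      case (Some V)
      then have "V \<subset> U" "V \<noteq> {}" using that by auto
      then have "simplex_face V \<subseteq> face_boundary U" unfolding fb by blast
      then show ?thesis by (auto simp: T_def Some)
    qed
    show "closedin ?C (T i)" if "i \<in> ?I" for i
    proof (rule closedin_subset_topspace[OF _ TB[OF that]])
      show "closedin (prod_topology Z (face_top U)) (T i)"
      proof (cases i)
        case None
        then show ?thesis
          unfolding T_def using Q closedin_face[OF U subset_refl] by (simp add: closedin_prod_Times_iff)
      next
        case (Some V)
        then have "V \<subseteq> U" using that by blast
        then show ?thesis
          unfolding T_def Some using closedin_face[OF U, of V] by (simp add: closedin_prod_Times_iff)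
      qed
    qed
    have sub: "subtopology ?C (T i) = subtopology (prod_topology Z (face_top U)) (T i)" if "i \<in> ?I" for i
      using TB[OF that] by (simp add: subtopology_subtopology Int_absorb1)
    have face_sub: "subtopology (face_top U) (simplex_face V) = face_top V" if "V \<subset> U" for V
      using VU[OF that] by (simp add: subtopology_subtopology Int_absorb1)
    show "continuous_map (subtopology ?C (T i)) Y (f i)" if i: "i \<in> ?I" for i
    proof (cases i)
      case None
      have "subtopology (prod_topology Z (face_top U)) (Q \<times> simplex_face U)
          = prod_topology (subtopology Z Q) (face_top U)"
        by (simp add: subtopology_Times subtopology_subtopology)
      then show ?thesis using a unfolding sub[OF i] by (simp add: T_def f_def None)
    next
      case (Some V)
      then have V: "V \<subset> U" "V \<noteq> {}" using i by auto
      have "subtopology (prod_topology Z (face_top U)) (topspace Z \<times> simplex_face V)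
          = prod_topology Z (face_top V)"
        by (simp add: subtopology_Times face_sub[OF V(1)])
      then show ?thesis using b[OF V] unfolding sub[OF i] by (simp add: T_def f_def Some)
    qed
    show "f i x = f j x" if "i \<in> ?I" "j \<in> ?I" "x \<in> topspace ?C \<inter> T i \<inter> T j" for i j x
    proof -
      obtain z t where x: "x = (z, t)" by (cases x)
      have i: "i = None \<or> (\<exists>V. i = Some V \<and> V \<subset> U \<and> V \<noteq> {})" and j: "j = None \<or> (\<exists>V. j = Some V \<and> V \<subset> U \<and> V \<noteq> {})"
        using that by auto
      show ?thesis
      proof (cases "z \<in> Q")
        case True
        have "f k x = a x" if "k = None \<or> (\<exists>V. k = Some V \<and> V \<subset> U \<and> V \<noteq> {})" "x \<in> T k" for k
          using that(1)
        proof (elim disjE exE conjE)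
          fix V assume V: "k = Some V" "V \<subset> U" "V \<noteq> {}"
          then have "t \<in> simplex_face V" using that(2) x by (simp add: T_def)
          then show ?thesis using ab[OF V(2,3) True] x V(1) by (simp add: f_def)
        qed (simp add: f_def)
        then have "f i x = a x" "f j x = a x" using i j that by blast+
        then show ?thesis by simp
      next
        case False
        have "f k x = b {i. t i \<noteq> 0} x" if "k = None \<or> (\<exists>V. k = Some V \<and> V \<subset> U \<and> V \<noteq> {})" "x \<in> T k" for k
          using that(1)
        proof (elim disjE exE conjE)
          fix V assume V: "k = Some V" "V \<subset> U" "V \<noteq> {}"
          then have "t \<in> simplex_face V" "z \<in> topspace Z" using that(2) x by (simp_all add: T_def)
          then show ?thesis using bs[OF V(2)] x V(1) by (simp add: f_def)
        qed (use that(2) False x in \<open>simp add: T_def\<close>)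
        then have "f i x = b {i. t i \<noteq> 0} x" "f j x = b {i. t i \<noteq> 0} x" using i j that by blast+
        then show ?thesis by simp
      qed
    qed
    show "\<exists>j. j \<in> ?I \<and> x \<in> T j \<and> (\<lambda>(z, t). if z \<in> Q then a (z, t) else b {i. t i \<noteq> 0} (z, t)) x = f j x"
      if xC: "x \<in> topspace ?C" for x
    proof -
      obtain z t where x: "x = (z, t)" by (cases x)
      show ?thesis
      proof (cases "z \<in> Q")
        case True
        then show ?thesis using that x face_boundary_subset[of U]
          by (intro exI[of _ None]) (auto simp: T_def f_def)
      next
        case False
        then obtain V where V: "V \<subset> U" "V \<noteq> {}" "t \<in> simplex_face V" "z \<in> topspace Z"
          using xC x unfolding fb by auto
        then show ?thesis using False x bs[of V z t] by (intro exI[of _ "Some V"]) (auto simp: T_def f_def)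
      qed
    qed
  qed
qed

lemma continuous_map_cube_map:
  fixes G H :: "nat set \<Rightarrow> 'u::universe pspace"
  assumes ec: "\<And>U. U \<in> nonempty_subsets n \<Longrightarrow> continuous_map (fst (G U)) (fst (H U)) (e U)"
    and nat: "\<And>U V x. U \<in> nonempty_subsets n \<Longrightarrow> V \<in> nonempty_subsets n \<Longrightarrow> U \<subseteq> V
      \<Longrightarrow> x \<in> topspace (fst (G U)) \<Longrightarrow> e V (g U V x) = h U V (e U x)"
  shows "continuous_map (fst (cube_holim n G g)) (fst (cube_holim n H h)) (cube_map n e)"
proof -
  let ?N = "nonempty_subsets n"
  define T where "T = kification (holim_points n G g)"
  note p = continuous_map_from_holim[where Z = T and p = enc and G = G and g = g and n = n]
  have ce: "continuous_map T (fst (cube_holim n G g)) enc"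
    unfolding cube_holim_def T_def by (simp add: continuous_map_coinduced)
  have "continuous_map T (fst (cube_holim n H h))
      (\<lambda>\<phi>. enc (\<lambda>U\<in>?N. \<lambda>t\<in>simplex_face U. (e U \<circ> (\<lambda>(\<phi>, t). dec (enc \<phi> :: 'u) U t)) (\<phi>, t)))"
  proof (rule continuous_map_into_holim)
    show "continuous_map (prod_topology T (face_top U)) (fst (H U)) (e U \<circ> (\<lambda>(\<phi>, t). dec (enc \<phi> :: 'u) U t))"
      if "U \<in> ?N" for U
      by (rule continuous_map_compose[OF p(1)[OF ce that] ec[OF that]])
    fix U V \<phi> t assume UV: "U \<in> ?N" "V \<in> ?N" "U \<subseteq> V" "\<phi> \<in> topspace T" "t \<in> simplex_face U"
    have "dec (enc \<phi> :: 'u) U t \<in> topspace (fst (G U))"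
      using continuous_map_in_topspace[OF p(1)[OF ce UV(1)], of "(\<phi>, t)"] UV(4,5) by simp
    then show "(e V \<circ> (\<lambda>(\<phi>, t). dec (enc \<phi> :: 'u) V t)) (\<phi>, t) = h U V ((e U \<circ> (\<lambda>(\<phi>, t). dec (enc \<phi> :: 'u) U t)) (\<phi>, t))"
      using p(2)[OF ce UV] nat[OF UV(1-3)] by simp
  qed (simp add: T_def)
  then show ?thesis
    unfolding cube_holim_def[of n G] fst_conv continuous_map_from_coinduced T_def[symmetric]
    by (simp add: cube_map_def o_def)
qed

text \<open>On the boundary of a cell the homotopy inherited from the smaller faces is not constant,
  so plain lifting is not enough and \<open>hel_cell\<close> is applied. Naturality of
  \<open>e\<close> ensures that the inherited homotopy starts at the image of the inherited
  lift.\<close>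

theorem weak_equivalence_cube_map:
  fixes G H :: "nat set \<Rightarrow> 'u::universe pspace"
  assumes G: "punctured_cube n G g" and H: "punctured_cube n H h"
    and e: "\<And>U. U \<in> nonempty_subsets n \<Longrightarrow> weak_equivalence (fst (G U)) (fst (H U)) (e U)"
    and nat: "\<And>U V x. U \<in> nonempty_subsets n \<Longrightarrow> V \<in> nonempty_subsets n \<Longrightarrow> U \<subseteq> V
      \<Longrightarrow> x \<in> topspace (fst (G U)) \<Longrightarrow> e V (g U V x) = h U V (e U x)"
  shows "weak_equivalence (fst (cube_holim n G g)) (fst (cube_holim n H h)) (cube_map n e)"
proof (rule lifting_imp_weak_equivalence)
  let ?N = "nonempty_subsets n"
  have ec: "continuous_map (fst (G U)) (fst (H U)) (e U)" if "U \<in> ?N" for U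
    using e[OF that] by (simp add: weak_equivalence_def)
  have gc: "continuous_map (fst (G U)) (fst (G V)) (g U V)" and hc: "continuous_map (fst (H U)) (fst (H V)) (h U V)"
    if "U \<in> ?N" "V \<in> ?N" "U \<subseteq> V" for U V
    using G H that by (auto simp: punctured_cube_def)
  have gid: "x \<in> topspace (fst (G U)) \<Longrightarrow> g U U x = x" and hid: "y \<in> topspace (fst (H U)) \<Longrightarrow> h U U y = y"
    if "U \<in> ?N" for U x y
    using G H that by (auto simp: punctured_cube_def)
  have ggg: "x \<in> topspace (fst (G U)) \<Longrightarrow> g V W (g U V x) = g U W x"
    and hhh: "y \<in> topspace (fst (H U)) \<Longrightarrow> h V W (h U V y) = h U W y"
    if "W \<in> ?N" "U \<subseteq> V" "V \<subseteq> W" "U \<noteq> {}" for U V W x y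
    using G H that nonempty_subsets_subset[of W n] unfolding punctured_cube_def by (metis (no_types, lifting) order_trans subset_empty)+
  show "continuous_map (fst (cube_holim n G g)) (fst (cube_holim n H h)) (cube_map n e)"
    by (rule continuous_map_cube_map; (rule ec | rule nat); assumption)
  fix m
  show "lifting (cube_map n e) (fst (cube_holim n G g)) (fst (cube_holim n H h)) (cube m) (cube_boundary m)"
    unfolding lifting_def
  proof (intro allI impI)
    fix a b
    let ?B = "subtopology (cube m) (cube_boundary m)"
    assume a: "continuous_map ?B (fst (cube_holim n G g)) a" and b: "continuous_map (cube m) (fst (cube_holim n H h)) b"
      and eq: "\<forall>x\<in>cube_boundary m. cube_map n e (a x) = b x"
    have BT: "topspace ?B = cube_boundary m" using cube_boundary_subset[of m] by auto
    define a' b' :: "nat set \<Rightarrow> (nat \<Rightarrow> real) \<times> (nat \<Rightarrow> real) \<Rightarrow> 'u"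
      where "a' = (\<lambda>U (z, t). dec (a z) U t)" and "b' = (\<lambda>U (z, t). dec (b z) U t)"
    note aa = continuous_map_from_holim[OF a, folded a'_def] and bb = continuous_map_from_holim[OF b, folded b'_def]
    have a'c: "continuous_map (prod_topology ?B (face_top U)) (fst (G U)) (a' U)" if "U \<in> ?N" for U
      using aa(1)[OF that] by (simp add: a'_def)
    have b'c: "continuous_map (cell m U) (fst (H U)) (b' U)" if "U \<in> ?N" for U
      using bb(1)[OF that] by (simp add: b'_def)
    have a'V: "a' V (z, t) = g U V (a' U (z, t))" if "U \<in> ?N" "V \<in> ?N" "U \<subseteq> V" "z \<in> cube_boundary m" "t \<in> simplex_face U" for U V z t
      using aa(2)[OF that(1-3)] that(4,5) unfolding BT by (simp add: a'_def)
    have b'V: "b' V (z, t) = h U V (b' U (z, t))" if "U \<in> ?N" "V \<in> ?N" "U \<subseteq> V" "z \<in> topspace (cube m)" "t \<in> simplex_face U" for U V z t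
      using bb(2)[OF that] by (simp add: b'_def)
    have ab: "e U (a' U (z, t)) = b' U (z, t)" if "U \<in> ?N" "z \<in> cube_boundary m" "t \<in> simplex_face U" for U z t
    proof -
      have "(dec (b z) :: nat set \<Rightarrow> (nat \<Rightarrow> real) \<Rightarrow> 'u) U t = dec (cube_map n e (a z)) U t"
        using eq that by simp
      also have "\<dots> = e U (dec (a z) U t)"
        unfolding cube_map_def dec_enc[OF inj_enc_cube_points] using that by simp
      finally show ?thesis by (simp add: a'_def b'_def)
    qed
    \<comment> \<open>\<open>P\<close> says that a lift and a homotopy solve the problem over the
      face \<open>U\<close>; \<open>R\<close> says that the solutions on the subfaces of
      \<open>U\<close> are compatible with the one on \<open>U\<close>.\<close>
    define P where "P = (\<lambda>U A K. continuous_map (cell m U) (fst (G U)) A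
        \<and> (\<forall>z\<in>cube_boundary m. \<forall>t\<in>simplex_face U. A (z, t) = a' U (z, t))
        \<and> continuous_map (cyl (cell m U)) (fst (H U)) K
        \<and> (\<forall>s\<in>{0..1}. \<forall>z\<in>cube_boundary m. \<forall>t\<in>simplex_face U. K (s, (z, t)) = b' U (z, t))
        \<and> (\<forall>z\<in>topspace (cube m). \<forall>t\<in>simplex_face U. K (0, (z, t)) = e U (A (z, t)) \<and> K (1, (z, t)) = b' U (z, t)))"
    define R where "R = (\<lambda>U A K. \<forall>V. V \<subseteq> U \<longrightarrow> V \<noteq> {} \<longrightarrow> (\<forall>z\<in>topspace (cube m). \<forall>t\<in>simplex_face V.
         A U (z, t) = g V U (A V (z, t)) \<and> (\<forall>s\<in>{0..1::real}. K U (s, (z, t)) = h V U (K V (s, (z, t))))))"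
    have step: "\<exists>A' K'. P U A' K' \<and> R U (A(U := A')) (K(U := K'))"
      if U: "U \<in> ?N" and PV: "\<And>V. V \<subset> U \<Longrightarrow> V \<noteq> {} \<Longrightarrow> P V (A V) (K V)"
        and RV: "\<And>V. V \<subset> U \<Longrightarrow> V \<noteq> {} \<Longrightarrow> R V A K" for U A K
    proof -
      have fU: "finite U" and U0: "U \<noteq> {}" using U finite_nonempty_subset[OF U] by (auto simp: nonempty_subsets_def)
      have VN: "V \<in> ?N" if "V \<subseteq> U" "V \<noteq> {}" for V using nonempty_subsets_subset[OF U] that by blast
      have AT: "A V (z, t) \<in> topspace (fst (G V))" if "V \<subset> U" "V \<noteq> {}" "z \<in> topspace (cube m)" "t \<in> simplex_face V" for V z t
        using PV[OF that(1,2)] that(3,4) unfolding P_def continuous_map_def by auto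
      have KT: "K V (s, (z, t)) \<in> topspace (fst (H V))" if "V \<subset> U" "V \<noteq> {}" "z \<in> topspace (cube m)" "t \<in> simplex_face V" "s \<in> {0..1}" for V z t s
        using PV[OF that(1,2)] that(3-5) unfolding P_def continuous_map_def by auto
      let ?bA = "\<lambda>V (z, t). g V U (A V (z, t))"
      \<comment> \<open>Off the boundary of the cube, a boundary point of the cell lies over a
        proper face. Its value is read on the smallest such face, the support of \<open>t\<close>,
        and pushed along \<open>g\<close>; by \<open>bAb\<close> any other proper face gives the
        same.\<close>
      define \<alpha> where "\<alpha> = (\<lambda>(z, t). if z \<in> cube_boundary m then a' U (z, t) else ?bA {i. t i \<noteq> 0} (z, t))"
      let ?bK = "\<lambda>V (sz, t). h V U (K V (fst sz, (snd sz, t)))"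
      let ?aK = "\<lambda>(sz, t). b' U (snd sz, t)"
      define \<kappa> where "\<kappa> = (\<lambda>(sz, t). if sz \<in> {0..1} \<times> cube_boundary m then ?aK (sz, t) else ?bK {i. t i \<noteq> 0} (sz, t))"
      have bAa: "?bA V (z, t) = a' U (z, t)" if "V \<subset> U" "V \<noteq> {}" "z \<in> cube_boundary m" "t \<in> simplex_face V" for V z t
        using PV[OF that(1,2)] that a'V[OF VN U] unfolding P_def by auto
      have bAb: "?bA W (z, t) = ?bA V (z, t)" if "V \<subseteq> W" "W \<subset> U" "V \<noteq> {}" "z \<in> topspace (cube m)" "t \<in> simplex_face V" for V W z t
      proof -
        have "A W (z, t) = g V W (A V (z, t))" using RV[of W] that unfolding R_def by blast
        then show ?thesis using ggg[OF U that(1) _ that(3)] AT[of V z t] that by auto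
      qed
      have bKa: "?bK V (sz, t) = ?aK (sz, t)" if "V \<subset> U" "V \<noteq> {}" "sz \<in> {0..1} \<times> cube_boundary m" "t \<in> simplex_face V" for V sz t
      proof -
        from that(3) obtain s z where sz: "sz = (s, z)" "s \<in> {0..1}" "z \<in> cube_boundary m" by auto
        then have "z \<in> topspace (cube m)" using cube_boundary_subset by blast
        then show ?thesis using PV[OF that(1,2)] that sz b'V[OF VN U] unfolding P_def by auto
      qed
      have bKb: "?bK W (sz, t) = ?bK V (sz, t)" if "V \<subseteq> W" "W \<subset> U" "V \<noteq> {}" "sz \<in> topspace (cyl (cube m))" "t \<in> simplex_face V" for V W sz t
      proof -
        from that(4) obtain s z where sz: "sz = (s, z)" "s \<in> {0..1}" "z \<in> topspace (cube m)" by auto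
        have "K W (s, (z, t)) = h V W (K V (s, (z, t)))" using RV[of W] that sz unfolding R_def by blast
        then show ?thesis using hhh[OF U that(1) _ that(3)] KT[of V z t s] that sz by auto
      qed
      have \<alpha>c: "continuous_map (subtopology (cell m U) (cell_boundary m U)) (fst (G U)) \<alpha>"
        unfolding \<alpha>_def cell_boundary_def
      proof (rule paste_cell_boundary[OF fU closedin_cube_boundary a'c[OF U]])
        show "continuous_map (cell m V) (fst (G U)) (?bA V)" if "V \<subset> U" "V \<noteq> {}" for V
        proof -
          have "continuous_map (cell m V) (fst (G V)) (A V)" using PV[OF that] by (simp add: P_def)
          from continuous_map_compose[OF this gc[OF VN U]] that show ?thesis
            by (auto simp: o_def split_beta')
        qed
      qed (use bAa bAb in auto)
      \<comment> \<open>For pasting, the homotopy parameter is grouped with the cube; for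
        \<open>hel\<close> it must be the parameter of the cylinder on the cell.\<close>
      have swap: "homeomorphic_maps (prod_topology (cyl (cube m)) (face_top V)) (cyl (cell m V))
           (\<lambda>(sz, t). (fst sz, (snd sz, t))) (\<lambda>(s, (z, t)). ((s, z), t))" for V
        unfolding homeomorphic_maps_def split_beta'
        by (auto intro!: continuous_map_pairedI continuous_map_fst continuous_map_snd
            continuous_map_compose[OF continuous_map_fst continuous_map_fst, unfolded o_def]
            continuous_map_compose[OF continuous_map_fst continuous_map_snd, unfolded o_def]
            continuous_map_compose[OF continuous_map_snd continuous_map_fst, unfolded o_def]
            continuous_map_compose[OF continuous_map_snd continuous_map_snd, unfolded o_def])
      have \<kappa>c: "continuous_map (subtopology (prod_topology (cyl (cube m)) (face_top U))
          (({0..1} \<times> cube_boundary m) \<times> simplex_face U \<union> topspace (cyl (cube m)) \<times> face_boundary U)) (fst (H U)) \<kappa>"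
        unfolding \<kappa>_def
      proof (rule paste_cell_boundary[OF fU])
        show "closedin (cyl (cube m)) ({0..1} \<times> cube_boundary m)"
          by (rule closedin_base_and_sides[OF closedin_cube_boundary])
        have "continuous_map (prod_topology (subtopology (cyl (cube m)) ({0..1} \<times> cube_boundary m)) (face_top U)) (cell m U)
            (\<lambda>(sz, t). (snd sz, t))"
          unfolding split_beta'
          by (auto intro!: continuous_map_pairedI continuous_map_fst continuous_map_snd
            continuous_map_compose[OF continuous_map_fst continuous_map_subtopology_snd, unfolded o_def])
        from continuous_map_compose[OF this b'c[OF U]]
        show "continuous_map (prod_topology (subtopology (cyl (cube m)) ({0..1} \<times> cube_boundary m)) (face_top U)) (fst (H U)) ?aK"
          by (simp add: o_def split_beta')
        show "continuous_map (prod_topology (cyl (cube m)) (face_top V)) (fst (H U)) (?bK V)" if "V \<subset> U" "V \<noteq> {}" for V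
        proof -
          have "continuous_map (cyl (cell m V)) (fst (H V)) (K V)" using PV[OF that] by (simp add: P_def)
          then have "continuous_map (prod_topology (cyl (cube m)) (face_top V)) (fst (H V))
             (K V \<circ> (\<lambda>(sz, t). (fst sz, (snd sz, t))))"
            using swap[of V] by (auto simp: homeomorphic_maps_def intro: continuous_map_compose)
          from continuous_map_compose[OF this hc[OF VN U]] that show ?thesis
            by (auto simp: o_def split_beta')
        qed
      qed (use bKa bKb in blast)+
      define \<kappa>' where "\<kappa>' = (\<lambda>(s, (z, t)). \<kappa> ((s, z), t))"
      have \<kappa>'c: "continuous_map (cyl (subtopology (cell m U) (cell_boundary m U))) (fst (H U)) \<kappa>'"
      proof -
        have "continuous_map (cyl (cell m U)) (prod_topology (cyl (cube m)) (face_top U)) (\<lambda>(s, (z, t)). ((s, z), t))"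
          using swap[of U] by (simp add: homeomorphic_maps_def)
        then have "continuous_map (cyl (subtopology (cell m U) (cell_boundary m U)))
          (subtopology (prod_topology (cyl (cube m)) (face_top U))
          (({0..1} \<times> cube_boundary m) \<times> simplex_face U \<union> topspace (cyl (cube m)) \<times> face_boundary U))
            (\<lambda>(s, (z, t)). ((s, z), t))"
          unfolding prod_subtopology_right[of unit_interval "cell m U"] continuous_map_in_subtopology
          by (intro conjI continuous_map_from_subtopology, assumption) (auto simp: cell_boundary_def)
        from continuous_map_compose[OF this \<kappa>c] show ?thesis
          by (simp add: \<kappa>'_def o_def split_beta')
      qed
      have hel: "hel (e U) (fst (G U)) (fst (H U)) (cell m U) (cell_boundary m U)"
        by (rule hel_cell[OF weak_equivalence_hel[OF e[OF U]] fU U0])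
      have supp: "{i. t i \<noteq> 0} \<subset> U \<and> {i. t i \<noteq> 0} \<noteq> {} \<and> t \<in> simplex_face {i. t i \<noteq> 0}" if "t \<in> face_boundary U" for t
      proof -
        have "t \<in> simplex_face U" "{i. t i \<noteq> 0} \<noteq> U" using that by (auto simp: face_boundary_def)
        then show ?thesis using simplex_face_support[OF fU, of t] by blast
      qed
      \<comment> \<open>The ends of the boundary homotopy: over the boundary of the cube it is
        constant and \<open>ab\<close> applies; over a proper face the ends of the solution there
        are transported by \<open>nat\<close> and by the compatibility \<open>b'V\<close>.\<close>
      have \<kappa>0: "\<kappa>' (0, x) = e U (\<alpha> x)" and \<kappa>1: "\<kappa>' (1, x) = b' U x" if x: "x \<in> cell_boundary m U" for x
      proof -
        obtain z t where zt: "x = (z, t)" by (cases x)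
        have "\<kappa>' (0, x) = e U (\<alpha> x) \<and> \<kappa>' (1, x) = b' U x"
        proof (cases "z \<in> cube_boundary m")
          case True
          then have "t \<in> simplex_face U" using x zt face_boundary_subset[of U] by (auto simp: cell_boundary_def)
          then show ?thesis using True zt ab[OF U True] by (simp add: \<kappa>'_def \<kappa>_def \<alpha>_def)
        next
          case False
          then have z: "z \<in> topspace (cube m)" and t: "t \<in> face_boundary U" using x zt by (auto simp: cell_boundary_def)
          let ?V = "{i. t i \<noteq> 0}"
          note V = supp[OF t, THEN conjunct1] supp[OF t, THEN conjunct2, THEN conjunct1] supp[OF t, THEN conjunct2, THEN conjunct2]
          have VN': "?V \<in> ?N" "?V \<subseteq> U" using VN V by auto
          have KK: "K ?V (0, (z, t)) = e ?V (A ?V (z, t))" "K ?V (1, (z, t)) = b' ?V (z, t)"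
            using PV[OF V(1,2)] V(3) z unfolding P_def by blast+
          have "h ?V U (K ?V (0, (z, t))) = e U (g ?V U (A ?V (z, t)))"
            unfolding KK(1) by (rule nat[symmetric, OF VN'(1) U VN'(2) AT[OF V(1,2) z V(3)]])
          moreover have "h ?V U (K ?V (1, (z, t))) = b' U (z, t)"
            unfolding KK(2) by (rule b'V[symmetric, OF VN'(1) U VN'(2) z V(3)])
          ultimately show ?thesis using False zt by (simp add: \<kappa>'_def \<kappa>_def \<alpha>_def)
        qed
        then show "\<kappa>' (0, x) = e U (\<alpha> x)" "\<kappa>' (1, x) = b' U x" by auto
      qed
      obtain A' K' where A': "continuous_map (cell m U) (fst (G U)) A'" "\<And>x. x \<in> cell_boundary m U \<Longrightarrow> A' x = \<alpha> x"
        and K': "continuous_map (cyl (cell m U)) (fst (H U)) K'"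
          "\<And>s x. s \<in> {0..1} \<Longrightarrow> x \<in> cell_boundary m U \<Longrightarrow> K' (s, x) = \<kappa>' (s, x)"
          "\<And>x. x \<in> topspace (cell m U) \<Longrightarrow> K' (0, x) = e U (A' x)" "\<And>x. x \<in> topspace (cell m U) \<Longrightarrow> K' (1, x) = b' U x"
      proof (rule helE[OF hel \<alpha>c b'c[OF U] \<kappa>'c], goal_cases)
        case (1 x)
        show ?case by (rule \<kappa>0[OF 1(2)])
      next
        case (2 x)
        show ?case by (rule \<kappa>1[OF 2(2)])
      next
        case (3 A' K')
        show ?case by (rule 3(1)[OF 3(2-7)])
      qed
      have "P U A' K'"
        unfolding P_def
      proof (intro conjI ballI A' K')
        fix z t assume z: "z \<in> cube_boundary m" and t: "t \<in> simplex_face U"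
        then have zt: "(z, t) \<in> cell_boundary m U" by (simp add: cell_boundary_def)
        show "A' (z, t) = a' U (z, t)" using A'(2)[OF zt] z by (simp add: \<alpha>_def)
        show "K' (s, z, t) = b' U (z, t)" if "s \<in> {0..1}" for s
          using K'(2)[OF that zt] z that by (simp add: \<kappa>'_def \<kappa>_def)
      qed auto
      moreover have "R U (A(U := A')) (K(U := K'))"
        unfolding R_def
      proof (intro allI impI ballI)
        fix V z t assume V: "V \<subseteq> U" "V \<noteq> {}" and z: "z \<in> topspace (cube m)" and t: "t \<in> simplex_face V"
        show "(A(U := A')) U (z, t) = g V U ((A(U := A')) V (z, t)) \<and>
            (\<forall>s\<in>{0..1}. (K(U := K')) U (s, (z, t)) = h V U ((K(U := K')) V (s, (z, t))))"
        proof (cases "V = U")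
          case True
          have "A' (z, t) \<in> topspace (fst (G U))" using A'(1) z t True unfolding continuous_map_def by auto
          moreover have "K' (s, z, t) \<in> topspace (fst (H U))" if "s \<in> {0..1}" for s
            using K'(1) z t True that unfolding continuous_map_def by auto
          ultimately show ?thesis using True gid[OF U] hid[OF U] by simp
        next
          case False
          then have VU: "V \<subset> U" using V by blast
          then have "t \<in> face_boundary U" using face_boundary_eq[OF fU] V t by blast
          then have zt: "(z, t) \<in> cell_boundary m U" using z by (simp add: cell_boundary_def)
          have sV: "{i. t i \<noteq> 0} \<subseteq> V" "{i. t i \<noteq> 0} \<noteq> {}" "t \<in> simplex_face {i. t i \<noteq> 0}"
            using simplex_face_support[OF finite_subset[OF V(1) fU] t] by auto
          have "\<alpha> (z, t) = g V U (A V (z, t))"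
            using bAa[OF VU V(2) _ t, of z] bAb[OF sV(1) VU sV(2) z sV(3)] by (simp add: \<alpha>_def)
          moreover have "\<kappa>' (s, (z, t)) = h V U (K V (s, (z, t)))" if "s \<in> {0..1}" for s
            using bKa[OF VU V(2) _ t, of "(s, z)"] bKb[OF sV(1) VU sV(2) _ sV(3), of "(s, z)"] that z
            by (simp add: \<kappa>'_def \<kappa>_def)
          ultimately show ?thesis using A'(2)[OF zt] K'(2)[OF _ zt] False by simp
        qed
      qed
      ultimately show ?thesis by blast
    qed
    \<comment> \<open>Induction on the size of the faces. Treating one face refers only to its
      proper subsets, so all faces of the same size can be treated at once.\<close>
    have "\<exists>A K. \<forall>U\<in>?N. card U \<le> j \<longrightarrow> P U (A U) (K U) \<and> R U A K" for j
    proof (induction j)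
      case 0
      have c: "\<not> card U \<le> 0" if "U \<in> ?N" for U
        using that finite_nonempty_subset[OF that] by (auto simp: nonempty_subsets_def)
      show ?case by (rule exI[of _ undefined], rule exI[of _ undefined]) (use c in blast)
    next
      case (Suc j)
      then obtain A K where AK: "\<And>U. U \<in> ?N \<Longrightarrow> card U \<le> j \<Longrightarrow> P U (A U) (K U) \<and> R U A K" by blast
      have small: "V \<in> ?N \<and> card V \<le> j" if "U \<in> ?N" "card U \<le> Suc j" "V \<subset> U" "V \<noteq> {}" for U V
        using psubset_card_mono[OF finite_nonempty_subset[OF that(1)] that(3)] that(2)
          nonempty_subsets_subset[OF that(1) _ that(4)] that(3) by auto
      have "\<exists>A' K'. P U A' K' \<and> R U (A(U := A')) (K(U := K'))" if "U \<in> ?N" "card U = Suc j" for U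
        using AK small[OF that(1)] that(2) by (intro step that(1)) auto
      then obtain A' K' where A'K': "\<And>U. U \<in> ?N \<Longrightarrow> card U = Suc j \<Longrightarrow> P U (A' U) (K' U) \<and> R U (A(U := A' U)) (K(U := K' U))"
        by metis
      let ?A = "\<lambda>U. if card U = Suc j then A' U else A U" and ?K = "\<lambda>U. if card U = Suc j then K' U else K U"
      have PR: "P U (?A U) (?K U) \<and> R U ?A ?K" if U: "U \<in> ?N" "card U \<le> Suc j" for U
      proof -
        have sm: "card V \<noteq> Suc j" if "V \<subset> U" "V \<noteq> {}" for V using small[OF U that] by simp
        show ?thesis
        proof (cases "card U = Suc j")
          case True
          have AV: "?A V = (A(U := A' U)) V \<and> ?K V = (K(U := K' U)) V" if "V \<subseteq> U" "V \<noteq> {}" for V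
            using sm[of V] that True by (cases "V = U") auto
          \<comment> \<open>\<open>R U\<close> reads the families only at nonempty subsets of
            \<open>U\<close>, where the two versions agree.\<close>
          have "R U ?A ?K = R U (A(U := A' U)) (K(U := K' U))"
            unfolding R_def using AV AV[of U] U(1) by (auto simp: nonempty_subsets_def)
          then show ?thesis using A'K'[OF U(1) True] True by simp
        next
          case False
          then have cU: "card U \<le> j" using U by simp
          have AV: "?A V = A V \<and> ?K V = K V" if "V \<subseteq> U" "V \<noteq> {}" for V
            using sm[of V] that False by (cases "V = U") auto
          have "R U ?A ?K = R U A K"
            unfolding R_def using AV AV[of U] U(1) by (auto simp: nonempty_subsets_def)
          then show ?thesis using AK[OF U(1) cU] False by simp
        qed
      qed
      show ?case by (rule exI[of _ ?A], rule exI[of _ ?K]) (use PR in blast)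
    qed
    from this[of "Suc n"] obtain A K where "\<And>U. U \<in> ?N \<Longrightarrow> card U \<le> Suc n \<Longrightarrow> P U (A U) (K U) \<and> R U A K" by blast
    moreover have "card U \<le> Suc n" if "U \<in> ?N" for U
      using card_mono[of "{..n}" U] that by (auto simp: nonempty_subsets_def)
    ultimately have PU: "P U (A U) (K U)" and RU: "R U A K" if "U \<in> ?N" for U
      using that by auto
    \<comment> \<open>The solutions over all faces are compatible, so they reassemble to a lift into
      the first homotopy limit and a homotopy in the second.\<close>
    define AA where "AA = (\<lambda>z. enc (\<lambda>U\<in>?N. \<lambda>t\<in>simplex_face U. A U (z, t)) :: 'u)"
    define KK where "KK = (\<lambda>sz. enc (\<lambda>U\<in>?N. \<lambda>t\<in>simplex_face U. (\<lambda>((s, z), t). K U (s, (z, t))) (sz, t)) :: 'u)"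
    have "continuous_map (cube m) (fst (cube_holim n G g)) AA"
      unfolding AA_def
    proof (rule continuous_map_into_holim)
      show "k_space (cube m)" by (simp add: compact_imp_k_space compact_space_cube)
      show "continuous_map (cell m U) (fst (G U)) (A U)" if "U \<in> ?N" for U using PU[OF that] by (simp add: P_def)
      show "A V (z, t) = g U V (A U (z, t))"
        if "U \<in> ?N" "V \<in> ?N" "U \<subseteq> V" "z \<in> topspace (cube m)" "t \<in> simplex_face U" for U V z t
        using RU[OF that(2)] that unfolding R_def by (auto simp: nonempty_subsets_def)
    qed
    moreover have "continuous_map (cyl (cube m)) (fst (cube_holim n H h)) KK"
      unfolding KK_def
    proof (rule continuous_map_into_holim)
      show "k_space (cyl (cube m))"
        by (simp add: compact_imp_k_space compact_space_cube compact_space_prod_topology compact_space_subtopology)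
      show "continuous_map (prod_topology (cyl (cube m)) (face_top U)) (fst (H U)) (\<lambda>((s, z), t). K U (s, (z, t)))"
        if "U \<in> ?N" for U
      proof -
        have "continuous_map (prod_topology (cyl (cube m)) (face_top U)) (cyl (cell m U)) (\<lambda>(sz, t). (fst sz, (snd sz, t)))"
          unfolding split_beta'
          by (auto intro!: continuous_map_pairedI continuous_map_fst continuous_map_snd
            continuous_map_compose[OF continuous_map_fst continuous_map_fst, unfolded o_def]
            continuous_map_compose[OF continuous_map_fst continuous_map_snd, unfolded o_def])
        from continuous_map_compose[OF this, of "fst (H U)" "K U"] PU[OF that] show ?thesis
          by (simp add: P_def o_def split_beta')
      qed
      show "(\<lambda>((s, z), t). K V (s, (z, t))) (sz, t) = h U V ((\<lambda>((s, z), t). K U (s, (z, t))) (sz, t))"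
        if "U \<in> ?N" "V \<in> ?N" "U \<subseteq> V" "sz \<in> topspace (cyl (cube m))" "t \<in> simplex_face U" for U V sz t
        using RU[OF that(2)] that unfolding R_def by (cases sz) (auto simp: nonempty_subsets_def)
    qed
    moreover have "AA z = a z" if "z \<in> cube_boundary m" for z
    proof -
      have "a z = enc (\<lambda>U\<in>?N. \<lambda>t\<in>simplex_face U. a' U (z, t))"
        using aa(3)[of z] that unfolding BT by (simp add: a'_def)
      also have "(\<lambda>U\<in>?N. \<lambda>t\<in>simplex_face U. a' U (z, t)) = (\<lambda>U\<in>?N. \<lambda>t\<in>simplex_face U. A U (z, t))"
        using PU that unfolding P_def by (intro restrict_ext) auto
      finally show ?thesis by (simp only: AA_def)
    qed
    moreover have bz: "b z = enc (\<lambda>U\<in>?N. \<lambda>t\<in>simplex_face U. b' U (z, t))" if "z \<in> topspace (cube m)" for z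
      using bb(3)[OF that] by (simp add: b'_def)
    moreover have "KK (s, z) = b z" if "s \<in> {0..1}" "z \<in> cube_boundary m" for s z
    proof -
      have "z \<in> topspace (cube m)" using that cube_boundary_subset by blast
      moreover have "(\<lambda>U\<in>?N. \<lambda>t\<in>simplex_face U. b' U (z, t)) = (\<lambda>U\<in>?N. \<lambda>t\<in>simplex_face U. K U (s, (z, t)))"
        using PU that unfolding P_def by (intro restrict_ext) auto
      ultimately show ?thesis using bz by (simp add: KK_def)
    qed
    moreover have "KK (1, z) = b z" if z: "z \<in> topspace (cube m)" for z
    proof -
      have "(\<lambda>U\<in>?N. \<lambda>t\<in>simplex_face U. b' U (z, t)) = (\<lambda>U\<in>?N. \<lambda>t\<in>simplex_face U. K U (1, (z, t)))"
        using PU that unfolding P_def by (intro restrict_ext) auto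
      then show ?thesis using bz[OF z] by (simp add: KK_def)
    qed
    moreover have "KK (0, z) = cube_map n e (AA z)" if z: "z \<in> topspace (cube m)" for z
    proof -
      have "(\<lambda>U\<in>?N. \<lambda>t\<in>simplex_face U. K U (0, (z, t))) = (\<lambda>U\<in>?N. \<lambda>t\<in>simplex_face U. e U (A U (z, t)))"
        using PU that unfolding P_def by (intro restrict_ext) auto
      also have "\<dots> = (\<lambda>U\<in>?N. \<lambda>t\<in>simplex_face U. e U (dec (AA z) U t))"
        unfolding AA_def dec_enc[OF inj_enc_cube_points] by (intro restrict_ext) auto
      finally show ?thesis by (simp add: KK_def cube_map_def)
    qed
    ultimately show "solv (cube_map n e) (fst (cube_holim n G g)) (fst (cube_holim n H h)) (cube m) (cube_boundary m) a b"
      unfolding solv_def by (intro exI[of _ AA] exI[of _ KK]) auto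
  qed
qed

section \<open>Mapping telescopes\<close>

lemma continuous_map_sum_component:
  assumes "i \<in> I"
  shows "continuous_map (subtopology (sum_topology X I) ({i} \<times> topspace (X i))) (X i) snd"
proof -
  have "openin (subtopology (sum_topology X I) ({i} \<times> topspace (X i)))
      {p \<in> topspace (subtopology (sum_topology X I) ({i} \<times> topspace (X i))). snd p \<in> U}"
    if U: "openin (X i) U" for U
  proof -
    have e: "{p \<in> topspace (subtopology (sum_topology X I) ({i} \<times> topspace (X i))). snd p \<in> U} = {i} \<times> U"
      using openin_subset[OF U] assms by auto
    have "openin (X j) {x. (j, x) \<in> {i} \<times> U}" for j
      using U by (cases "j = i") auto
    then have "openin (sum_topology X I) ({i} \<times> U)"
      using openin_subset[OF U] assms by (auto simp: openin_sum_topology)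
    then show ?thesis
      unfolding e openin_subtopology using openin_subset[OF U] by (intro exI[of _ "{i} \<times> U"]) auto
  qed
  then show ?thesis using assms by (auto simp: continuous_map_def)
qed

lemma openin_sum_component: "i \<in> I \<Longrightarrow> openin (sum_topology X I) ({i} \<times> topspace (X i))"
proof -
  assume i: "i \<in> I"
  have "openin (X j) {x. (j, x) \<in> {i} \<times> topspace (X i)}" for j by (cases "j = i") auto
  then show ?thesis using i by (auto simp: openin_sum_topology)
qed

lemma continuous_map_from_sum:
  assumes "\<And>i. i \<in> I \<Longrightarrow> continuous_map (X i) Y (\<lambda>x. f (i, x))"
  shows "continuous_map (sum_topology X I) Y f"
proof (rule pasting_lemma[where I = I and T = "\<lambda>i. {i} \<times> topspace (X i)" and f = "\<lambda>_. f"])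
  fix i assume i: "i \<in> I"
  show "openin (sum_topology X I) ({i} \<times> topspace (X i))" by (rule openin_sum_component[OF i])
  from continuous_map_compose[OF continuous_map_sum_component[OF i, of X] assms[OF i]]
  show "continuous_map (subtopology (sum_topology X I) ({i} \<times> topspace (X i))) Y f"
    by (rule continuous_map_eq) auto
qed auto

lemma continuous_map_from_prod_sum:
  assumes "\<And>i. i \<in> I \<Longrightarrow> continuous_map (prod_topology A (X i)) Y (\<lambda>(a, x). f (a, (i, x)))"
  shows "continuous_map (prod_topology A (sum_topology X I)) Y f"
proof (rule pasting_lemma[where I = I and T = "\<lambda>i. topspace A \<times> ({i} \<times> topspace (X i))" and f = "\<lambda>_. f"])
  fix i assume i: "i \<in> I"
  show "openin (prod_topology A (sum_topology X I)) (topspace A \<times> ({i} \<times> topspace (X i)))"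
    using openin_sum_component[OF i, of X] by (simp add: openin_prod_Times_iff)
  have "continuous_map (prod_topology A (subtopology (sum_topology X I) ({i} \<times> topspace (X i))))
      (prod_topology A (X i)) (\<lambda>p. (fst p, snd (snd p)))"
    by (intro continuous_map_pairedI continuous_map_fst
        continuous_map_compose[OF continuous_map_snd continuous_map_sum_component[OF i, of X], unfolded o_def])
  from continuous_map_compose[OF this assms[OF i]]
  show "continuous_map (subtopology (prod_topology A (sum_topology X I)) (topspace A \<times> ({i} \<times> topspace (X i)))) Y f"
    unfolding prod_subtopology_right by (rule continuous_map_eq) auto
qed auto

lemma encodable_telescope: "encodable TYPE('u::universe) TYPE(nat \<times> 'u \<times> real)"
  by (intro encodable_prod encodable_nat encodable_self encodable_real)

lemma inj_enc_telescope: "inj (enc :: nat \<times> 'u \<times> real \<Rightarrow> 'u::universe)"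
  by (rule encodable_inj_enc[OF encodable_telescope])

lemma dec_telescope_pt:
  "(dec (telescope_pt z (k, x, t) :: 'u::universe) :: nat \<times> 'u \<times> real)
     = (if t = 1 then (Suc k, z k x, 0) else (k, x, t))"
  unfolding telescope_pt_def by (simp add: dec_enc[OF inj_enc_telescope])

primrec tel_push :: "(nat \<Rightarrow> 'u \<Rightarrow> 'u) \<Rightarrow> nat \<Rightarrow> nat \<Rightarrow> 'u \<Rightarrow> 'u" where
  "tel_push z k 0 x = x"
| "tel_push z k (Suc d) x = z (k + d) (tel_push z k d x)"

lemma tel_push_Suc: "tel_push z k (Suc d) x = tel_push z (Suc k) d (z k x)"
  by (induction d) auto

text \<open>Continuous on the telescope, since the identified points \<open>(k, x, 1)\<close> and
  \<open>(Suc k, z k x, 0)\<close> have equal height.\<close>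

definition tel_height :: "'u::universe \<Rightarrow> real" where
  "tel_height p = (case dec p :: nat \<times> 'u \<times> real of (k, x, t) \<Rightarrow> real k + t)"

text \<open>The point \<open>(k, x, t)\<close> moved upwards to height \<open>\<tau> \<ge> k + t\<close>.\<close>

definition tel_lift :: "(nat \<Rightarrow> 'u \<Rightarrow> 'u) \<Rightarrow> nat \<Rightarrow> 'u \<Rightarrow> real \<Rightarrow> 'u::universe" where
  "tel_lift z k x \<tau> = (let j = nat \<lfloor>\<tau>\<rfloor> in telescope_pt z (j, tel_push z k (j - k) x, \<tau> - j))"

text \<open>The homotopy that pushes a bounded part of the telescope into stage \<open>N\<close>: at
  time \<open>s\<close> the floor has risen to height \<open>s * N\<close>, and points above the
  floor have not moved.\<close>

definition tel_slide :: "(nat \<Rightarrow> 'u \<Rightarrow> 'u) \<Rightarrow> nat \<Rightarrow> real \<times> 'u \<Rightarrow> 'u::universe" where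
  "tel_slide z N = (\<lambda>(s, p). case dec p :: nat \<times> 'u \<times> real of (k, x, t) \<Rightarrow>
     tel_lift z k x (max (real k + t) (s * real N)))"

text \<open>Meant for heights below \<open>N\<close>, where the subtraction is not truncated. It is
  the end position under \<open>tel_slide\<close>, read in stage \<open>N\<close>.\<close>

definition tel_retract :: "(nat \<Rightarrow> 'u \<Rightarrow> 'u) \<Rightarrow> nat \<Rightarrow> 'u \<Rightarrow> 'u::universe" where
  "tel_retract z N p = (case dec p :: nat \<times> 'u \<times> real of (k, x, t) \<Rightarrow> tel_push z k (N - k) x)"

lemma topspace_kprod [simp]: "topspace (kprod A B) = topspace A \<times> topspace B"
  by (simp add: kprod_def)

lemma continuous_map_from_kprod: "continuous_map (prod_topology A B) Y f \<Longrightarrow> continuous_map (kprod A B) Y f"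
  unfolding kprod_def by (rule continuous_map_from_kification)

locale telescope_system =
  fixes Z :: "nat \<Rightarrow> 'u::universe pspace" and z :: "nat \<Rightarrow> 'u \<Rightarrow> 'u"
  assumes z: "\<And>k. continuous_map (fst (Z k)) (fst (Z (Suc k))) (z k)"
begin

abbreviation tel_sum :: "(nat \<times> 'u \<times> real) topology" where
  "tel_sum \<equiv> sum_topology (\<lambda>k. kprod (fst (Z k)) unit_interval) UNIV"

abbreviation Tel :: "'u topology" where
  "Tel \<equiv> fst (telescope Z z)"

lemma Tel_def: "Tel = coinduced tel_sum (telescope_pt z)"
  by (simp add: telescope_def)

lemma continuous_map_tel_push: "continuous_map (fst (Z k)) (fst (Z (k + d))) (tel_push z k d)"
proof (induction d)
  case 0
  have "tel_push z k 0 = id" by (rule ext) simp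
  then show ?case by simp
next
  case (Suc d)
  have "tel_push z k (Suc d) = z (k + d) \<circ> tel_push z k d" by (rule ext) simp
  then show ?case using continuous_map_compose[OF Suc z] by (simp only: add_Suc_right)
qed

text \<open>\<open>telescope_pt\<close> replaces the end of a cylinder by a point at the base of the
  next one, so every point has a representative with \<open>t < 1\<close>, and \<open>dec\<close>
  returns it.\<close>

lemma Tel_pointE:
  assumes "p \<in> topspace Tel"
  obtains k x t where "x \<in> topspace (fst (Z k))" "0 \<le> t" "t < 1" "p = telescope_pt z (k, x, t)"
    "(dec p :: nat \<times> 'u \<times> real) = (k, x, t)"
proof -
  obtain k x t where kxt: "x \<in> topspace (fst (Z k))" "0 \<le> t" "t \<le> 1" "p = telescope_pt z (k, x, t)"
    using assms by (auto simp: Tel_def topspace_coinduced)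
  show ?thesis
  proof (cases "t = 1")
    case True
    have "z k x \<in> topspace (fst (Z (Suc k)))" by (rule continuous_map_in_topspace[OF z kxt(1)])
    moreover have "p = telescope_pt z (Suc k, z k x, 0)"
      unfolding kxt(4) True telescope_pt_def by simp
    moreover have "(dec p :: nat \<times> 'u \<times> real) = (Suc k, z k x, 0)"
      unfolding kxt(4) True by (simp add: dec_telescope_pt)
    ultimately show ?thesis by (intro that[of "z k x" "Suc k" 0]) auto
  next
    case False
    then have "(dec p :: nat \<times> 'u \<times> real) = (k, x, t)" unfolding kxt(4) by (simp add: dec_telescope_pt)
    then show ?thesis using kxt False by (intro that[of x k t]) auto
  qed
qed

lemma continuous_map_telescope_pt:
  "continuous_map (kprod (fst (Z k)) unit_interval) Tel (\<lambda>(x, t). telescope_pt z (k, x, t))"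
proof -
  have "continuous_map (kprod (fst (Z k)) unit_interval) tel_sum (\<lambda>p. (k, p))"
    by (rule continuous_map_component_injection) simp
  from continuous_map_compose[OF this continuous_map_coinduced] show ?thesis
    by (simp add: Tel_def o_def split_beta')
qed

lemma continuous_map_tel_height: "continuous_map Tel euclideanreal tel_height"
  unfolding Tel_def continuous_map_from_coinduced
proof (rule continuous_map_from_sum)
  fix k
  have "continuous_map (kprod (fst (Z k)) unit_interval) euclideanreal (\<lambda>p. real k + snd p)"
    by (intro continuous_map_from_kprod continuous_intros
        continuous_map_unit_interval_real[OF continuous_map_snd]) auto
  then show "continuous_map (kprod (fst (Z k)) unit_interval) euclideanreal
      (\<lambda>p. (tel_height \<circ> telescope_pt z) (k, p))"
    by (rule continuous_map_eq) (auto simp: tel_height_def dec_telescope_pt)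
qed

text \<open>For \<open>t = 1\<close> the chosen representative is \<open>(Suc k, z k x, 0)\<close>.
  Lifting from there gives the same point, because the first step of \<open>tel_push\<close> can be
  split off (\<open>tel_push_Suc\<close>).\<close>

lemma tel_slide_pt:
  assumes "0 \<le> t" "t \<le> 1"
  shows "tel_slide z N (s, telescope_pt z (k, x, t)) = tel_lift z k x (max (real k + t) (s * real N))"
proof (cases "t = 1")
  case True
  let ?\<tau> = "max (real (Suc k)) (s * real N)"
  have "Suc k \<le> nat \<lfloor>?\<tau>\<rfloor>" by (simp add: le_nat_floor)
  then obtain d where d: "nat \<lfloor>?\<tau>\<rfloor> = Suc k + d" using le_Suc_ex by blast
  have "tel_lift z (Suc k) (z k x) ?\<tau> = tel_lift z k x ?\<tau>"
    unfolding tel_lift_def Let_def d using tel_push_Suc[of z k d x] by simp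
  then show ?thesis using True by (simp add: tel_slide_def dec_telescope_pt add.commute)
qed (simp add: tel_slide_def dec_telescope_pt)

text \<open>As the interval is locally compact, continuity may be tested on the product with the
  disjoint union of the cylinders. On one cylinder the target height \<tau> passes through finitely
  many stages, and the formulas on the closed pieces with \<tau> between \<open>j\<close> and
  \<open>j + 1\<close> are pasted.\<close>

lemma continuous_map_tel_slide: "continuous_map (cyl Tel) Tel (tel_slide z N)"
proof -
  let ?T = "\<lambda>(s::real, p). (s, telescope_pt z p)"
  have q: "quotient_map (cyl tel_sum) (cyl Tel) ?T"
    unfolding Tel_def
    by (rule quotient_map_prod_right[OF _ _ quotient_map_coinduced])
      (auto simp: Hausdorff_space_subtopology compact_imp_locally_compact_space compact_space_subtopology)
  have "continuous_map (cyl tel_sum) Tel (tel_slide z N \<circ> ?T)"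
  proof (rule continuous_map_from_prod_sum)
    fix k
    let ?K = "kprod (fst (Z k)) unit_interval"
    define \<tau> where "\<tau> = (\<lambda>w :: real \<times> 'u \<times> real. max (real k + snd (snd w)) (fst w * real N))"
    \<comment> \<open>Heights in the cylinder are at most \<open>k + 1\<close> and the floor is at
      most \<open>N\<close>, so the integral part of \<tau> stays in this range.\<close>
    let ?J = "{k..k + 1 + N}"
    let ?f = "\<lambda>j w. telescope_pt z (j, tel_push z k (j - k) (fst (snd w)), \<tau> w - real j)"
    \<comment> \<open>The pieces map into cylinders, which are k-products. Continuity into a
      k-product is recognised on k-spaces, and closed subspaces of k-spaces are k-spaces.\<close>
    have kK: "k_space (cyl ?K)"
    proof (rule k_space_prod_topology_left)
      show "locally_compact_space unit_interval"
        by (simp add: compact_imp_locally_compact_space compact_space_subtopology)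
      show "Hausdorff_space unit_interval \<or> regular_space unit_interval"
        by (simp add: Hausdorff_space_subtopology)
      show "k_space ?K" unfolding kprod_def by (rule k_space_kification)
    qed
    have sc: "continuous_map (cyl ?K) euclideanreal fst" by (rule continuous_map_cyl_fst)
    have xc: "continuous_map (cyl ?K) (fst (Z k)) (\<lambda>w. fst (snd w))"
      using continuous_map_compose[OF continuous_map_snd continuous_map_from_kprod[OF continuous_map_fst]]
      by (simp add: o_def)
    have tc: "continuous_map (cyl ?K) euclideanreal (\<lambda>w. snd (snd w))"
      using continuous_map_compose[OF continuous_map_snd continuous_map_from_kprod[OF
            continuous_map_unit_interval_real[OF continuous_map_snd]]] by (simp add: o_def)
    have \<tau>c: "continuous_map (cyl ?K) euclideanreal \<tau>"
      unfolding \<tau>_def by (intro continuous_intros sc tc) auto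
    have bnd: "real k \<le> \<tau> w \<and> \<tau> w < real (k + 2 + N)" if "w \<in> topspace (cyl ?K)" for w
    proof -
      have "fst w * real N \<le> 1 * real N" using that by (intro mult_right_mono) auto
      moreover have "0 \<le> snd (snd w)" "snd (snd w) \<le> 1" "0 \<le> fst w" "fst w \<le> 1" using that by auto
      ultimately have "real k \<le> real k + snd (snd w)" "real k + snd (snd w) < real (k + 2 + N)"
        "fst w * real N < real (k + 2 + N)" by auto
      then show ?thesis unfolding \<tau>_def by (simp only: le_max_iff_disj max_less_iff_conj) simp
    qed
    define T where "T = (\<lambda>j::nat. {w \<in> topspace (cyl ?K). real j \<le> \<tau> w} \<inter> {w \<in> topspace (cyl ?K). \<tau> w \<le> real j + 1})"
    \<comment> \<open>At height \<open>j + 1\<close> the end of cylinder \<open>j\<close> and the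
      base of cylinder \<open>j + 1\<close> are the same point.\<close>
    have step: "?f j w = ?f (Suc j) w" if "k \<le> j" "\<tau> w = real j + 1" for j w
    proof -
      from that(1) obtain d where d: "j = k + d" using le_Suc_ex by blast
      show ?thesis unfolding that(2) by (simp add: telescope_pt_def d)
    qed
    have "continuous_map (cyl ?K) Tel (\<lambda>w. tel_lift z k (fst (snd w)) (\<tau> w))"
    proof (rule pasting_lemma_closed[where I = ?J and T = T and f = ?f])
      show clT: "closedin (cyl ?K) (T j)" for j
        unfolding T_def by (intro closedin_Int closedin_real_le \<tau>c) auto
      show "continuous_map (subtopology (cyl ?K) (T j)) Tel (?f j)" if j: "j \<in> ?J" for j
      proof -
        obtain d where d: "j = k + d" using j le_Suc_ex by (metis atLeastAtMost_iff)
        let ?S = "subtopology (cyl ?K) (T j)"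
        have "k_space ?S" by (rule k_space_closed_subtopology[OF kK clT])
        moreover have "continuous_map ?S (fst (Z j)) (\<lambda>w. tel_push z k (j - k) (fst (snd w)))"
          using continuous_map_compose[OF continuous_map_from_subtopology[OF xc] continuous_map_tel_push[of k d]]
          by (simp add: d o_def)
        moreover have "continuous_map ?S unit_interval (\<lambda>w. \<tau> w - real j)"
          unfolding continuous_map_unit_interval
          by (intro conjI continuous_intros continuous_map_from_subtopology \<tau>c) (auto simp: T_def)
        ultimately have "continuous_map ?S (kprod (fst (Z j)) unit_interval)
            (\<lambda>w. (tel_push z k (j - k) (fst (snd w)), \<tau> w - real j))"
          unfolding kprod_def by (simp add: continuous_map_into_kification continuous_map_pairedI)
        from continuous_map_compose[OF this continuous_map_telescope_pt] show ?thesis by (simp add: o_def)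
      qed
      show "?f i w = ?f j w" if ij: "i \<in> ?J" "j \<in> ?J" "w \<in> topspace (cyl ?K) \<inter> T i \<inter> T j" for i j w
      proof -
        have i: "real i \<le> \<tau> w" "\<tau> w \<le> real i + 1" and j: "real j \<le> \<tau> w" "\<tau> w \<le> real j + 1"
          using ij(3) by (auto simp: T_def)
        then have "real i \<le> real j + 1" "real j \<le> real i + 1" by linarith+
        then consider "i = j" | "j = Suc i" | "i = Suc j" by linarith
        then show ?thesis
        proof cases
          case 2
          then have "\<tau> w = real i + 1" using i(2) j(1) by linarith
          then show ?thesis using step[of i w] ij(1) 2 by simp
        next
          case 3
          then have "\<tau> w = real j + 1" using j(2) i(1) by linarith
          then show ?thesis using step[of j w] ij(2) 3 by simp
        qed simp
      qed
      fix w assume w: "w \<in> topspace (cyl ?K)"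
      define j where "j = nat \<lfloor>\<tau> w\<rfloor>"
      have t0: "0 \<le> \<tau> w" using bnd[OF w] by linarith
      then have jt: "real j \<le> \<tau> w" "\<tau> w \<le> real j + 1" unfolding j_def by linarith+
      moreover have "k \<le> j" using bnd[OF w] unfolding j_def by (simp add: le_nat_floor)
      moreover have "j \<le> k + 1 + N" using bnd[OF w] jt by linarith
      ultimately show "\<exists>j. j \<in> ?J \<and> w \<in> T j \<and> tel_lift z k (fst (snd w)) (\<tau> w) = ?f j w"
        using w by (intro exI[of _ j]) (auto simp: T_def tel_lift_def Let_def j_def)
    qed simp
    then show "continuous_map (cyl ?K) Tel (\<lambda>(s, p). (tel_slide z N \<circ> ?T) (s, (k, p)))"
      by (rule continuous_map_eq) (auto simp: tel_slide_pt \<tau>_def)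
  qed
  then show ?thesis using continuous_compose_quotient_map[OF q] by blast
qed

lemma tel_slide_0:
  assumes "p \<in> topspace Tel" shows "tel_slide z N (0, p) = p"
proof -
  obtain k x t where p: "x \<in> topspace (fst (Z k))" "0 \<le> t" "t < 1" "p = telescope_pt z (k, x, t)"
    using assms by (rule Tel_pointE)
  have k: "nat \<lfloor>real k + t\<rfloor> = k" using p by linarith
  have m: "max (real k + t) (0 * real N) = real k + t" using p by simp
  have "tel_slide z N (0, p) = tel_lift z k x (max (real k + t) (0 * real N))"
    unfolding p(4) by (rule tel_slide_pt) (use p in auto)
  then show ?thesis unfolding m tel_lift_def Let_def k by (simp add: p(4))
qed

lemma tel_slide_1:
  assumes "p \<in> topspace Tel" "tel_height p < real N"
  shows "tel_slide z N (1, p) = telescope_pt z (N, tel_retract z N p, 0)"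
proof -
  obtain k x t where p: "x \<in> topspace (fst (Z k))" "0 \<le> t" "t < 1" "p = telescope_pt z (k, x, t)"
    "(dec p :: nat \<times> 'u \<times> real) = (k, x, t)"
    using assms(1) by (rule Tel_pointE)
  then have "real k + t < real N" using assms(2) by (simp add: tel_height_def)
  then have m: "max (real k + t) (1 * real N) = real N" by simp
  have "tel_slide z N (1, p) = tel_lift z k x (max (real k + t) (1 * real N))"
    unfolding p(4) by (rule tel_slide_pt) (use p in auto)
  then show ?thesis unfolding m using p(5) by (simp add: tel_lift_def Let_def tel_retract_def)
qed

text \<open>The bound on the height is strict, so the region is open and the quotient map restricts
  to a quotient map onto it. A representative with \<open>t = 1\<close> has
  \<open>Suc k < N\<close>, so pushing may as well start one stage later.\<close>

lemma continuous_map_tel_retract: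
  "continuous_map (subtopology Tel {p \<in> topspace Tel. tel_height p < real N}) (fst (Z N)) (tel_retract z N)"
proof -
  let ?V = "{p \<in> topspace Tel. tel_height p < real N}"
  let ?W = "{w \<in> topspace tel_sum. telescope_pt z w \<in> ?V}"
  have "openin Tel {p \<in> topspace Tel. tel_height p \<in> {..<real N}}"
    by (rule openin_continuous_map_preimage[OF continuous_map_tel_height]) simp
  then have V: "openin Tel ?V" by simp
  have q: "quotient_map (subtopology tel_sum ?W) (subtopology Tel ?V) (telescope_pt z)"
    by (rule quotient_map_restriction[OF quotient_map_coinduced[of tel_sum "telescope_pt z", folded Tel_def]])
      (use V in auto)
  have W: "real k + t < real N" if "(k, x, t) \<in> ?W" for k x t
    using that by (auto simp: tel_height_def dec_telescope_pt split: if_splits)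
  have ret: "tel_retract z N (telescope_pt z (k, x, t)) = tel_push z k (N - k) x"
    if "(k, x, t) \<in> ?W" for k x t
  proof (cases "t = 1")
    case True
    then have "Suc k < N" using W[OF that] by linarith
    then obtain d where d: "N = Suc k + d" using less_imp_add_positive by (metis add_Suc_right less_imp_le_nat le_Suc_ex)
    then show ?thesis using True tel_push_Suc[of z k d x] by (simp add: tel_retract_def dec_telescope_pt Suc_diff_le)
  qed (simp add: tel_retract_def dec_telescope_pt)
  have "continuous_map (subtopology tel_sum ?W) (fst (Z N)) (tel_retract z N \<circ> telescope_pt z)"
  proof (rule pasting_lemma[where I = "{..N}" and f = "\<lambda>k w. tel_push z k (N - k) (fst (snd w))"
        and T = "\<lambda>k. ?W \<inter> ({k} \<times> topspace (kprod (fst (Z k)) unit_interval))"])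
    fix k assume k: "k \<in> {..N}"
    let ?T = "?W \<inter> ({k} \<times> topspace (kprod (fst (Z k)) unit_interval))"
    have "openin tel_sum ({k} \<times> topspace (kprod (fst (Z k)) unit_interval))"
      using openin_sum_component[of k UNIV "\<lambda>k. kprod (fst (Z k)) unit_interval"] by simp
    then show "openin (subtopology tel_sum ?W) ?T" by (rule openin_subtopology_Int2)
    obtain d where d: "N = k + d" using k le_Suc_ex by (metis atMost_iff)
    have "continuous_map (subtopology tel_sum ({k} \<times> topspace (kprod (fst (Z k)) unit_interval)))
        (fst (Z (k + d))) (tel_push z k d \<circ> (fst \<circ> snd))"
      by (intro continuous_map_compose[OF _ continuous_map_tel_push] continuous_map_compose[OF
            continuous_map_sum_component[of k UNIV "\<lambda>k. kprod (fst (Z k)) unit_interval"]])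
        (auto intro: continuous_map_from_kprod continuous_map_fst)
    from continuous_map_from_subtopology[OF this, of ?W]
    have "continuous_map (subtopology (subtopology tel_sum ({k} \<times> topspace (kprod (fst (Z k)) unit_interval))) ?W)
        (fst (Z N)) (\<lambda>w. tel_push z k (N - k) (fst (snd w)))"
      unfolding d o_def diff_add_inverse .
    then show "continuous_map (subtopology (subtopology tel_sum ?W) ?T) (fst (Z N)) (\<lambda>w. tel_push z k (N - k) (fst (snd w)))"
      by (simp only: subtopology_subtopology Int_ac Int_absorb Int_left_absorb)
  next
    fix w assume "w \<in> topspace (subtopology tel_sum ?W)"
    then obtain k x t where w: "w = (k, x, t)" "(k, x, t) \<in> ?W" "x \<in> topspace (fst (Z k))" "0 \<le> t" "t \<le> 1"
      by (cases w) auto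
    then have "k \<le> N" using W[of k x t] by linarith
    then show "\<exists>j. j \<in> {..N} \<and> w \<in> ?W \<inter> ({j} \<times> topspace (kprod (fst (Z j)) unit_interval))
        \<and> (tel_retract z N \<circ> telescope_pt z) w = tel_push z j (N - j) (fst (snd w))"
      using w ret[of k x t] by (intro exI[of _ k]) auto
  qed auto
  then show ?thesis using continuous_compose_quotient_map[OF q] by blast
qed

text \<open>The heights form a compact, hence bounded, set of reals. This is how compactness
  confines a map to finitely many stages.\<close>

lemma bounded_tel_height:
  assumes "compact_space C" "continuous_map C Tel \<phi>"
  obtains N where "\<And>u. u \<in> topspace C \<Longrightarrow> tel_height (\<phi> u) < real N"
proof -
  have "compactin euclideanreal ((tel_height \<circ> \<phi>) ` topspace C)"
    using assms continuous_map_compose[OF assms(2) continuous_map_tel_height]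
    by (intro image_compactin) (auto simp: compact_space_def)
  then have "bounded ((tel_height \<circ> \<phi>) ` topspace C)" by (simp add: compact_imp_bounded)
  then obtain B where B: "\<And>u. u \<in> topspace C \<Longrightarrow> \<bar>tel_height (\<phi> u)\<bar> \<le> B"
    unfolding bounded_iff by auto
  obtain N :: nat where "B < real N" using reals_Archimedean2 by blast
  then show ?thesis using B by (intro that[of N]) (meson abs_le_D1 le_less_trans)
qed

end

text \<open>\<open>telescope_map\<close> preserves heights, so a bound \<open>N\<close> for
  \<open>b\<close> also bounds \<open>a\<close>. It commutes with \<open>tel_slide\<close>, which
  thus deforms the square into one that factors through stage \<open>N\<close>; there it is solved,
  and \<open>solv_deform_pair\<close> leads back to the original square.\<close>

theorem weak_equivalence_telescope_map:
  fixes Z Z' :: "nat \<Rightarrow> 'u::universe pspace"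
  assumes z: "\<And>k. continuous_map (fst (Z k)) (fst (Z (Suc k))) (z k)"
    and z': "\<And>k. continuous_map (fst (Z' k)) (fst (Z' (Suc k))) (z' k)"
    and h: "\<And>k. weak_equivalence (fst (Z k)) (fst (Z' k)) (h k)"
    and nat: "\<And>k x. x \<in> topspace (fst (Z k)) \<Longrightarrow> h (Suc k) (z k x) = z' k (h k x)"
  shows "weak_equivalence (fst (telescope Z z)) (fst (telescope Z' z')) (telescope_map z' h)"
proof (rule lifting_imp_weak_equivalence)
  interpret S: telescope_system Z z by standard (rule z)
  interpret S': telescope_system Z' z' by standard (rule z')
  have hc: "continuous_map (fst (Z k)) (fst (Z' k)) (h k)" for k using h by (simp add: weak_equivalence_def)
  have tm: "telescope_map z' h (telescope_pt z (k, x, t)) = telescope_pt z' (k, h k x, t)"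
    if "x \<in> topspace (fst (Z k))" for k x t
    using nat[OF that] by (simp add: telescope_map_def dec_telescope_pt) (simp add: telescope_pt_def)
  have push: "h (k + d) (tel_push z k d x) = tel_push z' k d (h k x)"
    "tel_push z k d x \<in> topspace (fst (Z (k + d)))" if "x \<in> topspace (fst (Z k))" for k d x
  proof -
    show "tel_push z k d x \<in> topspace (fst (Z (k + d)))" for d
      by (rule continuous_map_in_topspace[OF S.continuous_map_tel_push that])
    then show "h (k + d) (tel_push z k d x) = tel_push z' k d (h k x)"
      by (induction d) (auto simp: nat)
  qed
  show tmc: "continuous_map S.Tel S'.Tel (telescope_map z' h)"
    unfolding S.Tel_def continuous_map_from_coinduced
  proof (rule continuous_map_from_sum)
    fix k
    have "continuous_map (kprod (fst (Z k)) unit_interval) (kprod (fst (Z' k)) unit_interval) (\<lambda>(x, t). (h k x, t))"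
      unfolding kprod_def
      by (intro continuous_map_kification) (simp add: continuous_map_prod_top hc)
    from continuous_map_compose[OF this S'.continuous_map_telescope_pt]
    show "continuous_map (kprod (fst (Z k)) unit_interval) S'.Tel
        (\<lambda>p. (telescope_map z' h \<circ> telescope_pt z) (k, p))"
      by (rule continuous_map_eq) (auto simp: tm)
  qed
  have tmh: "tel_height (telescope_map z' h p) = tel_height p" if p: "p \<in> topspace S.Tel" for p
  proof -
    obtain k x t where "x \<in> topspace (fst (Z k))" "0 \<le> t" "t < 1" "p = telescope_pt z (k, x, t)"
      using p by (rule S.Tel_pointE)
    then show ?thesis by (simp add: tm tel_height_def dec_telescope_pt)
  qed
  have tms: "telescope_map z' h (tel_slide z N (s, p)) = tel_slide z' N (s, telescope_map z' h p)"
    if p: "p \<in> topspace S.Tel" for N s p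
  proof -
    obtain k x t where kxt: "x \<in> topspace (fst (Z k))" "0 \<le> t" "t < 1" "p = telescope_pt z (k, x, t)"
      using p by (rule S.Tel_pointE)
    define \<tau> where "\<tau> = max (real k + t) (s * real N)"
    have "real k \<le> \<tau>" using kxt(2) by (simp add: \<tau>_def)
    then have "k \<le> nat \<lfloor>\<tau>\<rfloor>" by (rule le_nat_floor)
    then obtain d where d: "nat \<lfloor>\<tau>\<rfloor> = k + d" using le_Suc_ex by blast
    have l: "telescope_map z' h (tel_lift z k x \<tau>) = tel_lift z' k (h k x) \<tau>"
      unfolding tel_lift_def Let_def d by (simp add: tm[OF push(2)[OF kxt(1)]] push(1)[OF kxt(1)])
    have t: "0 \<le> t" "t \<le> 1" using kxt by auto
    show ?thesis
      unfolding kxt(4) tm[OF kxt(1)] S.tel_slide_pt[OF t] S'.tel_slide_pt[OF t] \<tau>_def[symmetric] by (rule l)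
  qed
  have tmr: "h N (tel_retract z N p) = tel_retract z' N (telescope_map z' h p)"
    if p: "p \<in> topspace S.Tel" "tel_height p < real N" for N p
  proof -
    obtain k x t where kxt: "x \<in> topspace (fst (Z k))" "0 \<le> t" "t < 1" "p = telescope_pt z (k, x, t)"
      using p(1) by (rule S.Tel_pointE)
    then have "real k < real N" using p(2) by (simp add: tel_height_def dec_telescope_pt)
    then obtain d where d: "N = k + d" using le_Suc_ex[of k N] by auto
    show ?thesis
      using kxt push(1)[OF kxt(1), of d] by (simp add: tm tel_retract_def dec_telescope_pt d)
  qed
  fix m
  show "lifting (telescope_map z' h) S.Tel S'.Tel (cube m) (cube_boundary m)"
    unfolding lifting_def
  proof (intro allI impI)
    fix a b
    let ?B = "subtopology (cube m) (cube_boundary m)"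
    assume a: "continuous_map ?B S.Tel a" and b: "continuous_map (cube m) S'.Tel b"
      and eq: "\<forall>u\<in>cube_boundary m. telescope_map z' h (a u) = b u"
    have BT: "topspace ?B = cube_boundary m" using cube_boundary_subset[of m] by auto
    have aT: "a u \<in> topspace S.Tel" if "u \<in> cube_boundary m" for u
      using continuous_map_in_topspace[OF a] that unfolding BT by blast
    have bT: "b u \<in> topspace S'.Tel" if "u \<in> topspace (cube m)" for u
      using continuous_map_in_topspace[OF b] that by blast
    obtain N where bN: "\<And>u. u \<in> topspace (cube m) \<Longrightarrow> tel_height (b u) < real N"
      using S'.bounded_tel_height[OF compact_space_cube b] by blast
    have aN: "tel_height (a u) < real N" if u: "u \<in> cube_boundary m" for u
      using bN[of u] tmh[OF aT[OF u]] eq u cube_boundary_subset[of m] by auto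
    define \<alpha> where "\<alpha> = (\<lambda>(s, u). tel_slide z N (s, a u))"
    define \<beta> where "\<beta> = (\<lambda>(s, u). tel_slide z' N (s, b u))"
    have \<alpha>: "continuous_map (cyl ?B) S.Tel \<alpha>"
      using continuous_map_reparam[OF S.continuous_map_tel_slide continuous_map_cyl_fst
          continuous_map_compose[OF continuous_map_snd a], of N]
      by (auto simp: \<alpha>_def split_beta')
    have \<beta>: "continuous_map (cyl (cube m)) S'.Tel \<beta>"
      using continuous_map_reparam[OF S'.continuous_map_tel_slide continuous_map_cyl_fst
          continuous_map_compose[OF continuous_map_snd b], of N]
      by (auto simp: \<beta>_def split_beta')
    have \<alpha>0: "\<alpha> (0, u) = a u" if "u \<in> cube_boundary m" for u
      using S.tel_slide_0[OF aT[OF that]] by (simp add: \<alpha>_def)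
    have "solv (telescope_map z' h) S.Tel S'.Tel (cube m) (cube_boundary m) (\<lambda>u. \<alpha> (0, u)) b"
    proof (rule solv_deform_pair[OF hep_pair_cube hep_pair_cyl_cube tmc b _ \<alpha> \<beta>])
      show "telescope_map z' h (\<alpha> (0, u)) = b u" if "u \<in> cube_boundary m" for u
        using \<alpha>0 eq that by simp
      show "\<beta> (0, u) = b u" if "u \<in> topspace (cube m)" for u
        using S'.tel_slide_0[OF bT[OF that]] by (simp add: \<beta>_def)
      show "\<beta> (s, u) = telescope_map z' h (\<alpha> (s, u))" if "s \<in> {0..1}" "u \<in> cube_boundary m" for s u
        using tms[OF aT[OF that(2)]] eq that by (simp add: \<alpha>_def \<beta>_def)
      have ra: "continuous_map ?B (fst (Z N)) (tel_retract z N \<circ> a)"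
      proof (rule continuous_map_compose[OF _ S.continuous_map_tel_retract])
        show "continuous_map ?B (subtopology S.Tel {p \<in> topspace S.Tel. tel_height p < real N}) a"
          unfolding continuous_map_in_subtopology BT using a aT aN by blast
      qed
      have rb: "continuous_map (cube m) (fst (Z' N)) (tel_retract z' N \<circ> b)"
      proof (rule continuous_map_compose[OF _ S'.continuous_map_tel_retract])
        show "continuous_map (cube m) (subtopology S'.Tel {p \<in> topspace S'.Tel. tel_height p < real N}) b"
          unfolding continuous_map_in_subtopology using b bT bN by blast
      qed
      have "solv (h N) (fst (Z N)) (fst (Z' N)) (cube m) (cube_boundary m) (tel_retract z N \<circ> a) (tel_retract z' N \<circ> b)"
        using hel_imp_lifting[OF weak_equivalence_hel[OF h[of N]], of m] ra rb tmr aT aN eq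
        unfolding lifting_def by (auto simp: o_def)
      then obtain A H where A: "continuous_map (cube m) (fst (Z N)) A" "\<And>u. u \<in> cube_boundary m \<Longrightarrow> A u = tel_retract z N (a u)"
        and H: "continuous_map (cyl (cube m)) (fst (Z' N)) H"
          "\<And>t u. t \<in> {0..1} \<Longrightarrow> u \<in> cube_boundary m \<Longrightarrow> H (t, u) = tel_retract z' N (b u)"
          "\<And>u. u \<in> topspace (cube m) \<Longrightarrow> H (0, u) = h N (A u) \<and> H (1, u) = tel_retract z' N (b u)"
        unfolding solv_def by auto
      define i where "i = (\<lambda>x. telescope_pt z (N, x, 0))"
      define i' where "i' = (\<lambda>x. telescope_pt z' (N, x, 0))"
      have incl: "continuous_map C S.Tel (i \<circ> A)" if "k_space C" "continuous_map C (fst (Z N)) A" for C :: "'x topology" and A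
      proof -
        have "continuous_map C (kprod (fst (Z N)) unit_interval) (\<lambda>x. (A x, 0))"
          unfolding kprod_def continuous_map_into_kification[OF that(1)] using that(2)
          by (intro continuous_map_pairedI) auto
        from continuous_map_compose[OF this S.continuous_map_telescope_pt] show ?thesis by (simp add: o_def i_def)
      qed
      have incl': "continuous_map C S'.Tel (i' \<circ> A)" if "k_space C" "continuous_map C (fst (Z' N)) A" for C :: "'x topology" and A
      proof -
        have "continuous_map C (kprod (fst (Z' N)) unit_interval) (\<lambda>x. (A x, 0))"
          unfolding kprod_def continuous_map_into_kification[OF that(1)] using that(2)
          by (intro continuous_map_pairedI) auto
        from continuous_map_compose[OF this S'.continuous_map_telescope_pt] show ?thesis by (simp add: o_def i'_def)
      qed
      have ks: "k_space (cube m)" "k_space (cyl (cube m))"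
        by (simp_all add: compact_imp_k_space compact_space_cube compact_space_prod_topology compact_space_subtopology)
      have \<beta>1: "\<beta> (1, u) = i' (tel_retract z' N (b u))" if "u \<in> topspace (cube m)" for u
        using S'.tel_slide_1[OF bT[OF that] bN[OF that]] by (simp add: \<beta>_def i'_def)
      have \<alpha>1: "\<alpha> (1, u) = i (tel_retract z N (a u))" if "u \<in> cube_boundary m" for u
        using S.tel_slide_1[OF aT[OF that] aN[OF that]] by (simp add: \<alpha>_def i_def)
      show "solv (telescope_map z' h) S.Tel S'.Tel (cube m) (cube_boundary m) (\<lambda>u. \<alpha> (1, u)) (\<lambda>u. \<beta> (1, u))"
        unfolding solv_def
      proof (intro exI[of _ "i \<circ> A"] exI[of _ "i' \<circ> H"] conjI ballI)
        show "continuous_map (cube m) S.Tel (i \<circ> A)" by (rule incl[OF ks(1) A(1)])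
        show "continuous_map (cyl (cube m)) S'.Tel (i' \<circ> H)" by (rule incl'[OF ks(2) H(1)])
        show "(i \<circ> A) u = \<alpha> (1, u)" if "u \<in> cube_boundary m" for u using A(2) \<alpha>1 that by simp
        show "(i' \<circ> H) (t, u) = \<beta> (1, u)" if "t \<in> {0..1}" "u \<in> cube_boundary m" for t u
          using H(2) \<beta>1 that cube_boundary_subset[of m] by auto
        fix u assume u: "u \<in> topspace (cube m)"
        have "A u \<in> topspace (fst (Z N))" by (rule continuous_map_in_topspace[OF A(1) u])
        then show "(i' \<circ> H) (0, u) = telescope_map z' h ((i \<circ> A) u)"
          using H(3)[OF u] by (simp add: i_def i'_def tm)
        show "(i' \<circ> H) (1, u) = \<beta> (1, u)" using H(3)[OF u] \<beta>1[OF u] by simp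
      qed
    qed
    then show "solv (telescope_map z' h) S.Tel S'.Tel (cube m) (cube_boundary m) a b"
      by (rule solv_cong) (rule \<alpha>0)
  qed
qed

section \<open>Collapsing in k-products\<close>

lemma continuous_map_into_kprod:
  "k_space Z \<Longrightarrow> continuous_map Z (kprod A B) f \<longleftrightarrow> continuous_map Z (prod_topology A B) f"
  unfolding kprod_def by (rule continuous_map_into_kification)

lemma k_space_kprod: "k_space (kprod A B)"
  unfolding kprod_def by (rule k_space_kification)

lemma continuous_map_kprod:
  assumes "continuous_map A A' f" "continuous_map B B' g"
  shows "continuous_map (kprod A B) (kprod A' B') (\<lambda>(a, b). (f a, g b))"
  unfolding kprod_def
  by (intro continuous_map_kification) (simp add: continuous_map_prod_top assms)

lemma Hausdorff_space_kification: "Hausdorff_space X \<Longrightarrow> Hausdorff_space (kification X)"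
  unfolding Hausdorff_space_def by (metis openin_kification_finer topspace_kification)

lemma Hausdorff_space_kprod: "Hausdorff_space A \<Longrightarrow> Hausdorff_space B \<Longrightarrow> Hausdorff_space (kprod A B)"
  unfolding kprod_def by (intro Hausdorff_space_kification) (simp add: Hausdorff_space_prod_topology)

lemma unit_interval_facts:
  "compact_space unit_interval" "Hausdorff_space unit_interval" "locally_compact_space unit_interval"
proof -
  show c: "compact_space unit_interval" by (simp add: compact_space_subtopology)
  show "Hausdorff_space unit_interval" by (simp add: Hausdorff_space_subtopology)
  show "locally_compact_space unit_interval" by (rule compact_imp_locally_compact_space[OF c])
qed

text \<open>\<open>w\<close> descends to the function of the NDR structure and also separates points
  at different levels. Distinct points at the same positive level are separated inside the open set
  \<open>w > 0\<close>, on which \<open>q\<close> is injective. The homotopy \<open>k\<close>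
  descends because it keeps the zero set of \<open>w\<close> inside itself.\<close>

lemma pointed_space_collapse:
  fixes q :: "'a \<Rightarrow> 'u"
  assumes T: "Hausdorff_space T" "k_space T" and w: "continuous_map T unit_interval w"
    and c0: "c0 \<in> topspace T" "w c0 = 0"
    and q: "\<And>x y. x \<in> topspace T \<Longrightarrow> y \<in> topspace T \<Longrightarrow> q x = q y \<longleftrightarrow> x = y \<or> w x = 0 \<and> w y = 0"
    and k: "continuous_map (prod_topology T unit_interval) T k" "\<And>x. x \<in> topspace T \<Longrightarrow> k (x, 0) = x"
      "\<And>x t. x \<in> topspace T \<Longrightarrow> t \<in> {0..1} \<Longrightarrow> w x = 0 \<Longrightarrow> w (k (x, t)) = 0"
      "\<And>x. x \<in> topspace T \<Longrightarrow> w x < 1 \<Longrightarrow> w (k (x, 1)) = 0"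
  shows "pointed_space (coinduced T q, q c0)"
proof -
  let ?Q = "coinduced T q"
  have qm: "quotient_map T ?Q q" by (rule quotient_map_coinduced)
  have TQ: "topspace ?Q = q ` topspace T" by (rule topspace_coinduced)
  have w01: "0 \<le> w x \<and> w x \<le> 1" if "x \<in> topspace T" for x
    using w that by (auto simp: continuous_map_unit_interval)
  have "w x = w y" if "x \<in> topspace T" "y \<in> topspace T" "q x = q y" for x y
    using q[OF that(1,2)] that(3) by auto
  from quotient_map_factor[OF qm w this] obtain u where u: "continuous_map ?Q unit_interval u"
    "\<And>x. x \<in> topspace T \<Longrightarrow> u (q x) = w x" by blast
  have ur: "continuous_map ?Q euclideanreal u" by (rule continuous_map_unit_interval_real[OF u(1)])
  \<comment> \<open>Away from the collapsed set every open set is saturated.\<close>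
  have openq: "openin ?Q (q ` U)" if U: "openin T U" "\<And>x. x \<in> U \<Longrightarrow> w x > 0" for U
  proof -
    have sub: "U \<subseteq> topspace T" by (rule openin_subset[OF U(1)])
    have "{x \<in> topspace T. q x \<in> q ` U} = U"
      using q sub U(2) by (auto simp: subset_iff image_iff) (metis less_irrefl)
    then show ?thesis unfolding openin_coinduced using sub U(1) by auto
  qed
  have "\<exists>U V. openin ?Q U \<and> openin ?Q V \<and> q x \<in> U \<and> q y \<in> V \<and> disjnt U V"
    if xy: "x \<in> topspace T" "y \<in> topspace T" "q x \<noteq> q y" for x y
  proof (cases "w x = w y")
    case False
    obtain U V where UV: "open U" "open V" "w x \<in> U" "w y \<in> V" "U \<inter> V = {}"
      using hausdorff[OF False] by blast
    show ?thesis
    proof (intro exI conjI)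
      show "openin ?Q {p \<in> topspace ?Q. u p \<in> U}" "openin ?Q {p \<in> topspace ?Q. u p \<in> V}"
        using UV by (auto intro!: openin_continuous_map_preimage[OF ur])
    qed (use xy UV u TQ in \<open>auto simp: disjnt_def\<close>)
  next
    case True
    \<comment> \<open>If both levels were 0, the two points would have been identified.\<close>
    then have pos: "w x > 0" "w y > 0" using q[OF xy(1,2)] xy(3) w01[OF xy(1)] w01[OF xy(2)] by force+
    obtain U V where UV: "openin T U" "openin T V" "x \<in> U" "y \<in> V" "disjnt U V"
      using T(1) xy unfolding Hausdorff_space_def by metis
    have P: "openin T {x \<in> topspace T. w x \<in> {0<..}}"
      by (rule openin_continuous_map_preimage[OF continuous_map_unit_interval_real[OF w]]) simp
    let ?P = "{x \<in> topspace T. w x \<in> {0<..}}"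
    have "disjnt (q ` (U \<inter> ?P)) (q ` (V \<inter> ?P))"
      unfolding disjnt_iff
    proof (intro allI notI, elim conjE imageE)
      fix p a b assume "p = q a" "p = q b" "a \<in> U \<inter> ?P" "b \<in> V \<inter> ?P"
      then have "a = b" using q[of a b] by auto
      then show False using UV(5) \<open>a \<in> U \<inter> ?P\<close> \<open>b \<in> V \<inter> ?P\<close> by (auto simp: disjnt_iff)
    qed
    then show ?thesis
      using UV P pos xy by (intro exI[of _ "q ` (U \<inter> ?P)"] exI[of _ "q ` (V \<inter> ?P)"])
        (auto intro!: openq openin_Int)
  qed
  then have H: "Hausdorff_space ?Q" unfolding Hausdorff_space_def TQ by blast
  have kQ: "k_space ?Q" by (rule k_space_quotient_map_image[OF qm T(2)])
  have qm2: "quotient_map (prod_topology T unit_interval) (prod_topology ?Q unit_interval) (\<lambda>(x, t). (q x, t))"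
    by (rule quotient_map_prod_left[OF unit_interval_facts(3) _ qm]) (simp add: unit_interval_facts)
  have kT: "k (x, t) \<in> topspace T" if "x \<in> topspace T" "t \<in> {0..1}" for x t
    by (rule continuous_map_in_topspace[OF k(1)]) (use that in auto)
  have "continuous_map (prod_topology T unit_interval) ?Q (q \<circ> k)"
    by (rule continuous_map_compose[OF k(1) continuous_map_coinduced])
  moreover have "(q \<circ> k) z = (q \<circ> k) z'"
    if "z \<in> topspace (prod_topology T unit_interval)" "z' \<in> topspace (prod_topology T unit_interval)"
      "(\<lambda>(x, t). (q x, t)) z = (\<lambda>(x, t). (q x, t)) z'" for z z'
  proof -
    obtain x t x' t' where z: "z = (x, t)" "z' = (x', t')" by (cases z, cases z')
    have xt: "x \<in> topspace T" "x' \<in> topspace T" "t \<in> {0..1}" "t = t'" "q x = q x'" using that z by auto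
    then consider "x = x'" | "w x = 0" "w x' = 0" using q by blast
    then show ?thesis
    proof cases
      case 2
      then have "w (k (x, t)) = 0" "w (k (x', t)) = 0" using k(3) xt by auto
      then show ?thesis using q[OF kT kT] xt z by simp
    qed (use z xt in simp)
  qed
  ultimately obtain h where h: "continuous_map (prod_topology ?Q unit_interval) ?Q h"
    "\<And>z. z \<in> topspace (prod_topology T unit_interval) \<Longrightarrow> h ((\<lambda>(x, t). (q x, t)) z) = (q \<circ> k) z"
    using quotient_map_factor[OF qm2, of ?Q "q \<circ> k"] by blast
  have hq: "h (q x, t) = q (k (x, t))" if "x \<in> topspace T" "t \<in> {0..1}" for x t
    using h(2)[of "(x, t)"] that by simp
  have "nondegenerate (?Q, q c0)"
    unfolding nondegenerate_def fst_conv snd_conv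
  proof (intro exI[of _ u] exI[of _ h] conjI ballI)
    show "{x \<in> topspace ?Q. u x = 0} = {q c0}"
      using c0 u q[OF _ c0(1)] unfolding TQ by auto
    show "h (p, 0) = p" if "p \<in> topspace ?Q" for p
      using that hq k(2) unfolding TQ by auto
    show "h (q c0, t) = q c0" if "t \<in> {0..1}" for t
    proof -
      have "w (k (c0, t)) = 0" by (rule k(3)[OF c0(1) that c0(2)])
      then show ?thesis using hq[OF c0(1) that] q[OF kT[OF c0(1) that] c0(1)] c0(2) by simp
    qed
    show "u p < 1 \<longrightarrow> h (p, 1) = q c0" if "p \<in> topspace ?Q" for p
    proof
      assume "u p < 1"
      obtain x where x: "x \<in> topspace T" "p = q x" using \<open>p \<in> topspace ?Q\<close> TQ by auto
      then have "w (k (x, 1)) = 0" using k(4) u \<open>u p < 1\<close> by simp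
      moreover have "k (x, 1) \<in> topspace T" by (rule kT[OF x(1)]) simp
      ultimately show "h (p, 1) = q c0" using hq[OF x(1), of 1] x q[of "k (x, 1)" c0] c0 by simp
    qed
  qed (use u(1) h(1) in auto)
  then show ?thesis unfolding pointed_space_def using c0 TQ H kQ by auto
qed

section \<open>Nondegenerate basepoints of smash products and joins\<close>

lemma pointed_spaceD:
  assumes "pointed_space X"
  shows "snd X \<in> topspace (fst X)" "Hausdorff_space (fst X)" "k_space (fst X)" "nondegenerate X"
  using assms by (auto simp: pointed_space_def)

text \<open>Both the smash product and the join are obtained from a product \<open>X \<times> D\<close> by collapsing
  \<open>* \<times> D\<close> and \<open>X \<times> D\<^sub>0\<close>.\<close>

definition half_pt :: "'u pspace \<Rightarrow> 'd set \<Rightarrow> 'u \<Rightarrow> 'd \<Rightarrow> 'u::universe" where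
  "half_pt X D0 x s = enc (if x = snd X \<or> s \<in> D0 then None else Some (x, s))"

text \<open>In contrast to the usual NDR pairs, \<open>D0\<close> is only carried into itself and
  not fixed pointwise, because it is going to be collapsed. Intersecting with the carrier lets
  \<open>D0\<close> be given by a condition on arbitrary functions, as for the tips of a
  cone.\<close>

definition ndr :: "'d topology \<Rightarrow> 'd set \<Rightarrow> bool" where
  "ndr D D0 \<longleftrightarrow> (\<exists>v j. continuous_map D unit_interval v \<and> {s \<in> topspace D. v s = 0} = D0 \<inter> topspace D
     \<and> continuous_map (prod_topology D unit_interval) D j \<and> (\<forall>s\<in>topspace D. j (s, 0) = s)
     \<and> (\<forall>s\<in>D0 \<inter> topspace D. \<forall>t\<in>{0..1}. j (s, t) \<in> D0)
     \<and> (\<forall>s\<in>topspace D. v s < 1 \<longrightarrow> j (s, 1) \<in> D0))"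

lemma nondegenerate_ndr: "pointed_space X \<Longrightarrow> ndr (fst X) {snd X}"
  unfolding pointed_space_def nondegenerate_def ndr_def
  by (elim conjE exE, rename_tac u h, rule_tac x = u in exI, rule_tac x = h in exI) auto

lemma half_pt_eq_iff:
  fixes X :: "'u::universe pspace" and s s' :: 'd
  assumes "encodable TYPE('u) TYPE(('u \<times> 'd) option)"
  shows "half_pt X D0 x s = half_pt X D0 x' s' \<longleftrightarrow> x = x' \<and> s = s' \<or>
     (x = snd X \<or> s \<in> D0) \<and> (x' = snd X \<or> s' \<in> D0)"
proof -
  have "inj (enc :: ('u \<times> 'd) option \<Rightarrow> 'u)" by (rule encodable_inj_enc[OF assms])
  then show ?thesis unfolding half_pt_def by (auto simp: inj_eq)
qed

text \<open>The minimum of the two functions vanishes exactly on the collapsed set, which the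
  product of the two homotopies preserves. Where the minimum is below 1, one of the two coordinates
  ends in its subspace. Since only invariance of the collapsed set is asked, this plain product
  formula suffices.\<close>

lemma pointed_space_half:
  fixes X :: "'u::universe pspace" and D :: "'d topology"
  assumes enc: "encodable TYPE('u) TYPE(('u \<times> 'd) option)"
    and X: "pointed_space X" and D: "Hausdorff_space D" "topspace D \<noteq> {}" and n: "ndr D D0"
  shows "pointed_space (coinduced (kprod (fst X) D) (\<lambda>(x, s). half_pt X D0 x s), enc (None :: ('u \<times> 'd) option))"
proof -
  obtain u h where u: "continuous_map (fst X) unit_interval u" "{x \<in> topspace (fst X). u x = 0} = {snd X}"
    and h: "continuous_map (prod_topology (fst X) unit_interval) (fst X) h" "\<forall>x\<in>topspace (fst X). h (x, 0) = x"
      "\<forall>t\<in>{0..1}. h (snd X, t) = snd X" "\<forall>x\<in>topspace (fst X). u x < 1 \<longrightarrow> h (x, 1) = snd X"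
    using pointed_spaceD(4)[OF X] unfolding nondegenerate_def by blast
  obtain v j where v: "continuous_map D unit_interval v" "{s \<in> topspace D. v s = 0} = D0 \<inter> topspace D"
    and j: "continuous_map (prod_topology D unit_interval) D j" "\<forall>s\<in>topspace D. j (s, 0) = s"
      "\<forall>s\<in>D0 \<inter> topspace D. \<forall>t\<in>{0..1}. j (s, t) \<in> D0" "\<forall>s\<in>topspace D. v s < 1 \<longrightarrow> j (s, 1) \<in> D0"
    using n unfolding ndr_def by blast
  obtain d where d: "d \<in> topspace D" using D(2) by blast
  let ?T = "kprod (fst X) D"
  define w where "w = (\<lambda>(x, s). min (u x) (v s))"
  define k where "k = (\<lambda>((x, s), t). (h (x, t), j (s, t)))"
  note xX = pointed_spaceD(1)[OF X]
  have u01: "0 \<le> u x \<and> u x \<le> 1" if "x \<in> topspace (fst X)" for x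
    using u(1) that by (auto simp: continuous_map_unit_interval)
  have v01: "0 \<le> v s \<and> v s \<le> 1" if "s \<in> topspace D" for s
    using v(1) that by (auto simp: continuous_map_unit_interval)
  have u0: "u x = 0 \<longleftrightarrow> x = snd X" if "x \<in> topspace (fst X)" for x using u(2) that by blast
  have v0: "v s = 0 \<longleftrightarrow> s \<in> D0" if "s \<in> topspace D" for s using v(2) that by blast
  have w0: "w (x, s) = 0 \<longleftrightarrow> x = snd X \<or> s \<in> D0" if "x \<in> topspace (fst X)" "s \<in> topspace D" for x s
    using u01[OF that(1)] v01[OF that(2)] u0[OF that(1)] v0[OF that(2)] by (auto simp: w_def min_def)
  have hT: "h (x, t) \<in> topspace (fst X)" if "x \<in> topspace (fst X)" "t \<in> {0..1}" for x t
    by (rule continuous_map_in_topspace[OF h(1)]) (use that in auto)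
  have jT: "j (s, t) \<in> topspace D" if "s \<in> topspace D" "t \<in> {0..1}" for s t
    by (rule continuous_map_in_topspace[OF j(1)]) (use that in auto)
  have "pointed_space (coinduced ?T (\<lambda>(x, s). half_pt X D0 x s), (\<lambda>(x, s). half_pt X D0 x s) (snd X, d))"
  proof (rule pointed_space_collapse[where w = w and k = k])
    show "Hausdorff_space ?T" by (rule Hausdorff_space_kprod[OF pointed_spaceD(2)[OF X] D(1)])
    show "k_space ?T" by (rule k_space_kprod)
    have "continuous_map ?T euclideanreal (\<lambda>z. min (u (fst z)) (v (snd z)))"
      by (intro continuous_map_from_kprod continuous_intros
          continuous_map_compose[OF continuous_map_fst continuous_map_unit_interval_real[OF u(1)], unfolded o_def]
          continuous_map_compose[OF continuous_map_snd continuous_map_unit_interval_real[OF v(1)], unfolded o_def])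
    then show "continuous_map ?T unit_interval w"
      unfolding continuous_map_unit_interval w_def using u01 v01
      by (auto simp: split_beta' topspace_kprod min_def)
    have kk: "k_space (prod_topology ?T unit_interval)"
      by (rule k_space_prod_topology_right[OF k_space_kprod unit_interval_facts(3)]) (simp add: unit_interval_facts)
    have c: "continuous_map (prod_topology ?T unit_interval) (fst X) (\<lambda>z. fst (fst z))"
      "continuous_map (prod_topology ?T unit_interval) D (\<lambda>z. snd (fst z))"
      by (intro continuous_map_compose[OF continuous_map_fst continuous_map_from_kprod[OF continuous_map_fst], unfolded o_def]
          continuous_map_compose[OF continuous_map_fst continuous_map_from_kprod[OF continuous_map_snd], unfolded o_def])+
    have "continuous_map (prod_topology ?T unit_interval) (prod_topology (fst X) unit_interval) (\<lambda>z. (fst (fst z), snd z))"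
      "continuous_map (prod_topology ?T unit_interval) (prod_topology D unit_interval) (\<lambda>z. (snd (fst z), snd z))"
      by (intro continuous_map_pairedI c continuous_map_snd)+
    from this(1)[THEN continuous_map_compose, OF h(1)] this(2)[THEN continuous_map_compose, OF j(1)]
    show "continuous_map (prod_topology ?T unit_interval) ?T k"
      unfolding continuous_map_into_kprod[OF kk] k_def split_beta' by (intro continuous_map_pairedI) (simp_all add: o_def)
    show "(snd X, d) \<in> topspace ?T" using xX d by (simp add: topspace_kprod)
    show "w (snd X, d) = 0" using w0[OF xX d] by simp
    show "(\<lambda>(x, s). half_pt X D0 x s) z = (\<lambda>(x, s). half_pt X D0 x s) z' \<longleftrightarrow> z = z' \<or> w z = 0 \<and> w z' = 0"
      if "z \<in> topspace ?T" "z' \<in> topspace ?T" for z z'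
      using that w0 half_pt_eq_iff[OF enc, of X D0] by (cases z; cases z') (auto simp: topspace_kprod)
    show "k (z, 0) = z" if "z \<in> topspace ?T" for z
      using that h(2) j(2) by (cases z) (auto simp: k_def topspace_kprod)
    show "w (k (z, t)) = 0" if "z \<in> topspace ?T" "t \<in> {0..1}" "w z = 0" for z t
      using that h(3) j(3) w0 hT jT by (cases z) (auto simp: k_def topspace_kprod)
    show "w (k (z, 1)) = 0" if z: "z \<in> topspace ?T" "w z < 1" for z
    proof -
      obtain x s where xs: "z = (x, s)" "x \<in> topspace (fst X)" "s \<in> topspace D"
        using z(1) by (auto simp: topspace_kprod)
      then have "u x < 1 \<or> v s < 1" using z(2) by (auto simp: w_def min_def split: if_splits)
      then have "h (x, 1) = snd X \<or> j (s, 1) \<in> D0" using h(4) j(4) xs by blast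
      then show ?thesis using w0[OF hT[OF xs(2)] jT[OF xs(3)], of 1 1] by (simp add: k_def xs(1))
    qed
  qed
  then show ?thesis by (simp add: half_pt_def)
qed

lemma encodable_smash: "encodable TYPE('u::universe) TYPE(('u \<times> 'u) option)"
  by (intro encodable_option encodable_prod encodable_self)

lemma encodable_join: "encodable TYPE('u::universe) TYPE(('u \<times> (nat \<Rightarrow> real)) option)"
  by (intro encodable_option encodable_prod encodable_self encodable_nat_fun encodable_real)

lemma smash_pt_half: "smash_pt X Y = half_pt X {snd Y}"
  by (intro ext) (simp add: smash_pt_def half_pt_def)

lemma join_pt_half: "join_pt X = half_pt X {s. \<exists>u. s u = 1}"
  by (intro ext) (simp add: join_pt_def half_pt_def)

lemma pointed_space_smash:
  fixes X Y :: "'u::universe pspace"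
  assumes "pointed_space X" "pointed_space Y" shows "pointed_space (smash X Y)"
  unfolding smash_def smash_pt_half
  by (rule pointed_space_half[OF encodable_smash assms(1) pointed_spaceD(2)[OF assms(2)]
        _ nondegenerate_ndr[OF assms(2)]]) (use pointed_spaceD(1)[OF assms(2)] in auto)

lemma topspace_cone_star: "topspace (cone_star U) =
    insert (\<lambda>_. 0) {(\<lambda>i. if i = u then r else 0) | u r. u \<in> U \<and> 0 \<le> r \<and> r \<le> 1}"
  by (simp add: cone_star_def)

lemma Hausdorff_space_cone_star: "Hausdorff_space (cone_star U)"
  unfolding cone_star_def
  by (intro Hausdorff_space_subtopology) (simp add: Hausdorff_space_product_topology)

lemma cone_star_zero: "(\<lambda>_. 0) \<in> topspace (cone_star U)"
  by (simp add: topspace_cone_star)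

lemma ndr_cone_star:
  assumes U: "finite U" shows "ndr (cone_star U) {s. \<exists>u. s u = 1}"
proof -
  let ?D = "cone_star U"
  \<comment> \<open>Distance from the cone point: at most one coordinate is nonzero, and the sum
    reads it off. The tips are the level 1.\<close>
  define \<rho> where "\<rho> = (\<lambda>s :: nat \<Rightarrow> real. sum s U)"
  have sumU: "(\<Sum>i\<in>U. if i = u then r else 0) = r" if "u \<in> U" for u and r :: real
    using U that by simp
  have comp: "continuous_map ?D euclideanreal (\<lambda>s. s i)" for i
    unfolding cone_star_def by (intro continuous_map_from_subtopology continuous_map_powertop_component)
  have \<rho>c: "continuous_map ?D euclideanreal \<rho>" unfolding \<rho>_def by (intro continuous_map_sum U comp)
  have cases: "(s = (\<lambda>_. 0) \<and> \<rho> s = 0) \<or> (\<exists>u r. u \<in> U \<and> 0 \<le> r \<and> r \<le> 1 \<and> s = (\<lambda>i. if i = u then r else 0) \<and> \<rho> s = r)"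
    if "s \<in> topspace ?D" for s
  proof -
    from that consider "s = (\<lambda>_. 0)" | u r where "u \<in> U" "0 \<le> r" "r \<le> 1" "s = (\<lambda>i. if i = u then r else 0)"
      unfolding topspace_cone_star by blast
    then show ?thesis
    proof cases
      case (2 u r)
      then have "\<rho> s = r" unfolding \<rho>_def by (simp only: sumU)
      with 2 show ?thesis by blast
    qed (simp add: \<rho>_def)
  qed
  have \<rho>01: "0 \<le> \<rho> s \<and> \<rho> s \<le> 1" if "s \<in> topspace ?D" for s using cases[OF that] by auto
  have tip: "(\<exists>u. s u = 1) \<longleftrightarrow> \<rho> s = 1" if "s \<in> topspace ?D" for s
    using cases[OF that]
  proof (elim disjE exE conjE)
    fix u r assume "s = (\<lambda>i. if i = u then r else 0)" "\<rho> s = r"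
    then have "s u = \<rho> s" "\<And>i. i \<noteq> u \<Longrightarrow> s i = 0" by simp_all
    then show ?thesis by (metis zero_neq_one)
  qed simp
  \<comment> \<open>Radial stretching by the factor \<open>1 + t\<close>, stopped at the tips. At
    time 1 everything with \<rho> at least 1/2 has arrived, which is why the function used below is
    \<open>2 * (1 - \<rho> s)\<close>, truncated at 1.\<close>
  define c where "c = (\<lambda>z :: (nat \<Rightarrow> real) \<times> real. (1 + snd z) / max 1 (\<rho> (fst z) * (1 + snd z)))"
  define j where "j = (\<lambda>z. (\<lambda>i. fst z i * c z))"
  have c: "0 \<le> c (s, t) \<and> \<rho> s * c (s, t) \<le> 1" if "s \<in> topspace ?D" "t \<in> {0..1}" for s t
  proof -
    have m: "max 1 (\<rho> s * (1 + t)) > 0" by simp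
    have "0 \<le> c (s, t)" using that by (simp add: c_def)
    moreover have "\<rho> s * c (s, t) = (\<rho> s * (1 + t)) / max 1 (\<rho> s * (1 + t))" by (simp add: c_def)
    moreover have "\<dots> \<le> 1" using m by (simp add: pos_divide_le_eq)
    ultimately show ?thesis by simp
  qed
  have jT: "j (s, t) \<in> topspace ?D \<and> \<rho> (j (s, t)) = \<rho> s * c (s, t)" if st: "s \<in> topspace ?D" "t \<in> {0..1}" for s t
    using cases[OF st(1)]
  proof (elim disjE exE conjE)
    assume "s = (\<lambda>_. 0)"
    then show ?thesis by (simp add: j_def cone_star_zero \<rho>_def)
  next
    fix u r assume ur: "u \<in> U" "0 \<le> r" "r \<le> 1" "s = (\<lambda>i. if i = u then r else 0)" "\<rho> s = r"
    have e: "j (s, t) = (\<lambda>i. if i = u then r * c (s, t) else 0)" by (auto simp: j_def ur(4))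
    have "0 \<le> r * c (s, t)" "r * c (s, t) \<le> 1" using c[OF st] ur by auto
    then have "j (s, t) \<in> topspace ?D" unfolding e topspace_cone_star using ur(1) by blast
    moreover have "\<rho> (j (s, t)) = r * c (s, t)" unfolding e \<rho>_def by (rule sumU[OF ur(1)])
    ultimately show ?thesis using ur(5) by simp
  qed
  have full: "\<rho> s * c (s, t) = 1" if "1 \<le> \<rho> s * (1 + t)" for s t
  proof -
    have m: "max 1 (\<rho> s * (1 + t)) = \<rho> s * (1 + t)" "\<rho> s * (1 + t) \<noteq> 0" using that by auto
    then show ?thesis unfolding c_def fst_conv snd_conv m(1) times_divide_eq_right by (rule_tac divide_self)
  qed
  let ?P = "prod_topology ?D unit_interval"
  have tc: "continuous_map ?P euclideanreal snd" by (rule continuous_map_unit_interval_real[OF continuous_map_snd])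
  have \<rho>c': "continuous_map ?P euclideanreal (\<lambda>z. \<rho> (fst z))"
    using continuous_map_compose[OF continuous_map_fst \<rho>c] by (simp add: o_def)
  have cc: "continuous_map ?P euclideanreal c"
    unfolding c_def by (intro continuous_intros tc \<rho>c') auto
  have "continuous_map ?P (powertop_real UNIV) j"
    unfolding continuous_map_componentwise_UNIV j_def
    by (intro allI continuous_intros cc continuous_map_compose[OF continuous_map_fst comp, unfolded o_def])
  then have jc: "continuous_map ?P ?D j"
    using jT unfolding cone_star_def continuous_map_in_subtopology by (auto simp: Pi_iff)
  show ?thesis
    unfolding ndr_def
  proof (intro exI[of _ "\<lambda>s. min 1 (2 * (1 - \<rho> s))"] exI[of _ j] conjI ballI impI jc)
    show "continuous_map ?D unit_interval (\<lambda>s. min 1 (2 * (1 - \<rho> s)))"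
      unfolding continuous_map_unit_interval using \<rho>01 by (auto intro!: continuous_intros \<rho>c)
    show "{s \<in> topspace ?D. min 1 (2 * (1 - \<rho> s)) = 0} = {s. \<exists>u. s u = 1} \<inter> topspace ?D"
    proof -
      have "min 1 (2 * (1 - r)) = 0 \<longleftrightarrow> r = 1" for r :: real by (auto simp: min_def)
      then show ?thesis using tip by blast
    qed
    show "j (s, 0) = s" if "s \<in> topspace ?D" for s
      using \<rho>01[OF that] by (simp add: j_def c_def)
    show "j (s, t) \<in> {s. \<exists>u. s u = 1}" if "s \<in> {s. \<exists>u. s u = 1} \<inter> topspace ?D" "t \<in> {0..1}" for s t
    proof -
      have "\<rho> s = 1" using tip that by blast
      then show ?thesis using jT[of s t] full[of s t] tip[of "j (s, t)"] that by simp
    qed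
    show "j (s, 1) \<in> {s. \<exists>u. s u = 1}" if "s \<in> topspace ?D" "min 1 (2 * (1 - \<rho> s)) < 1" for s
      using jT[of s 1] full[of s 1] tip[of "j (s, 1)"] that by (simp add: min_less_iff_disj)
  qed
qed

lemma pointed_space_pjoin:
  fixes X :: "'u::universe pspace"
  assumes "pointed_space X" "finite U" shows "pointed_space (pjoin X U)"
  unfolding pjoin_def join_pt_half
  by (rule pointed_space_half[OF encodable_join assms(1) Hausdorff_space_cone_star _ ndr_cone_star[OF assms(2)]])
    (use cone_star_zero in blast)

lemma pointed_space_finite_set_ob: "pointed_space (ob finite_set_ob n :: 'u::universe pspace)"
proof -
  let ?D = "discrete_topology (enc ` {..n}) :: 'u topology"
  have "nondegenerate (?D, enc (0::nat))"
    unfolding nondegenerate_def fst_conv snd_conv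
    by (intro exI[of _ "\<lambda>x. if x = enc (0::nat) then 0 else 1"] exI[of _ fst])
      (auto simp: continuous_map_unit_interval continuous_map_fst)
  then show ?thesis
    by (auto simp: finite_set_ob_def pointed_space_def k_space_discrete_topology Hausdorff_space_discrete_topology)
qed

section \<open>Functoriality of smash products and joins\<close>

lemma inj_enc_smash: "inj (enc :: ('u \<times> 'u) option \<Rightarrow> 'u::universe)"
  by (rule encodable_inj_enc[OF encodable_smash])

lemma inj_enc_join: "inj (enc :: ('u \<times> (nat \<Rightarrow> real)) option \<Rightarrow> 'u::universe)"
  by (rule encodable_inj_enc[OF encodable_join])

lemma dec_smash_pt: "(dec (smash_pt X Y x y :: 'u::universe) :: ('u \<times> 'u) option)
    = (if x = snd X \<or> y = snd Y then None else Some (x, y))"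
  unfolding smash_pt_def by (rule dec_enc[OF inj_enc_smash])

lemma dec_join_pt: "(dec (join_pt X x s :: 'u::universe) :: ('u \<times> (nat \<Rightarrow> real)) option)
    = (if x = snd X \<or> (\<exists>u. s u = 1) then None else Some (x, s))"
  unfolding join_pt_def by (rule dec_enc[OF inj_enc_join])

lemma smash_pt_eq_iff:
  "smash_pt X Y x y = smash_pt X Y x' y' \<longleftrightarrow> x = x' \<and> y = y' \<or> (x = snd X \<or> y = snd Y) \<and> (x' = snd X \<or> y' = snd Y)"
  unfolding smash_pt_half half_pt_eq_iff[OF encodable_smash] by simp

lemma join_pt_eq_iff:
  "join_pt X x s = join_pt X x' s' \<longleftrightarrow> x = x' \<and> s = s' \<or> (x = snd X \<or> (\<exists>u. s u = 1)) \<and> (x' = snd X \<or> (\<exists>u. s' u = 1))"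
  unfolding join_pt_half half_pt_eq_iff[OF encodable_join] by simp

lemma smash_pt_base: "x = snd X \<or> y = snd Y \<Longrightarrow> smash_pt X Y x y = snd (smash X Y)"
  by (simp add: smash_pt_def smash_def)

lemma join_pt_base: "x = snd X \<or> (\<exists>u. s u = 1) \<Longrightarrow> join_pt X x s = snd (pjoin X U)"
  by (simp add: join_pt_def pjoin_def)

lemma topspace_smash: "topspace (fst (smash X Y)) = (\<lambda>(x, y). smash_pt X Y x y) ` (topspace (fst X) \<times> topspace (fst Y))"
  by (simp add: smash_def topspace_coinduced topspace_kprod)

lemma topspace_pjoin: "topspace (fst (pjoin X U)) = (\<lambda>(x, s). join_pt X x s) ` (topspace (fst X) \<times> topspace (cone_star U))"
  by (simp add: pjoin_def topspace_coinduced topspace_kprod)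

lemma smash_pt_in: "x \<in> topspace (fst X) \<Longrightarrow> y \<in> topspace (fst Y) \<Longrightarrow> smash_pt X Y x y \<in> topspace (fst (smash X Y))"
  unfolding topspace_smash by auto

lemma join_pt_in: "x \<in> topspace (fst X) \<Longrightarrow> s \<in> topspace (cone_star U) \<Longrightarrow> join_pt X x s \<in> topspace (fst (pjoin X U))"
  unfolding topspace_pjoin by auto

lemma smash_pt_eq_base_iff: "smash_pt X Y x y = snd (smash X Y) \<longleftrightarrow> x = snd X \<or> y = snd Y"
  using smash_pt_eq_iff[of X Y x y "snd X" "snd Y"] smash_pt_base[of "snd X" X "snd Y" Y] by auto

lemma join_pt_eq_base_iff: "join_pt X x s = snd (pjoin X U) \<longleftrightarrow> x = snd X \<or> (\<exists>u. s u = 1)"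
  using join_pt_eq_iff[of X x s "snd X" s] join_pt_base[of "snd X" X s U] by auto

text \<open>\<open>pmaps\<close> asks for extensional functions, which \<open>id\<close> in general
  is not; but the structure maps of the cube in \<open>goodwillie_T\<close> are formed with
  \<open>id\<close>. The lemmas on joins and smash products are therefore stated for this weaker
  notion.\<close>

definition pointed_map :: "'u pspace \<Rightarrow> 'u pspace \<Rightarrow> ('u \<Rightarrow> 'u) \<Rightarrow> bool" where
  "pointed_map X Y f \<longleftrightarrow> continuous_map (fst X) (fst Y) f \<and> f (snd X) = snd Y"

lemma pmaps_pointed_map: "f \<in> pmaps X Y \<Longrightarrow> pointed_map X Y f"
  by (simp add: pmaps_def pointed_map_def)

lemma pointed_map_id: "pointed_map X X id"
  by (simp add: pointed_map_def)

lemma pointed_map_in: "pointed_map X Y f \<Longrightarrow> x \<in> topspace (fst X) \<Longrightarrow> f x \<in> topspace (fst Y)"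
  unfolding pointed_map_def by (blast intro: continuous_map_in_topspace)

lemma restrict_pmaps: "pointed_map X Y f \<Longrightarrow> snd X \<in> topspace (fst X) \<Longrightarrow> (\<lambda>x\<in>topspace (fst X). f x) \<in> pmaps X Y"
  by (auto simp: pmaps_def pointed_map_def intro: continuous_map_eq)

lemma smash_map_pt:
  assumes "pointed_map Y Y' g" "x \<in> topspace (fst X)" "y \<in> topspace (fst Y)"
  shows "mor (smash_functor X) Y Y' g (smash_pt X Y x y) = smash_pt X Y' x (g y)"
  using assms smash_pt_in[OF assms(2,3)] unfolding smash_functor_def
  by (auto simp: dec_smash_pt pointed_map_def smash_pt_base)

lemma join_map_pt:
  assumes "pointed_map X Y f" "x \<in> topspace (fst X)" "s \<in> topspace (cone_star U)"
  shows "join_map X U Y f (join_pt X x s) = join_pt Y (f x) s"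
proof -
  have "join_map X U Y f (join_pt X x s) = (case if x = snd X \<or> (\<exists>u. s u = 1) then None else Some (x, s) of
      None \<Rightarrow> enc (None :: ('a \<times> (nat \<Rightarrow> real)) option) | Some (x, s) \<Rightarrow> join_pt Y (f x) s)"
    using join_pt_in[OF assms(2,3)] by (simp add: join_map_def dec_join_pt)
  also have "\<dots> = join_pt Y (f x) s"
    using assms(1) by (auto simp: pointed_map_def join_pt_def)
  finally show ?thesis .
qed

lemma smash_map_pmaps:
  assumes X: "pointed_space X" and Y: "pointed_space Y" and g: "pointed_map Y Y' g"
  shows "mor (smash_functor X) Y Y' g \<in> pmaps (smash X Y) (smash X Y')"
proof -
  let ?m = "mor (smash_functor X) Y Y' g"
  have "continuous_map (kprod (fst X) (fst Y)) (kprod (fst X) (fst Y')) (\<lambda>(x, y). (x, g y))"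
    using g by (intro continuous_map_kprod) (auto simp: pointed_map_def)
  from continuous_map_compose[OF this continuous_map_coinduced[of _ "\<lambda>(x, y). smash_pt X Y' x y"]]
  have "continuous_map (kprod (fst X) (fst Y)) (fst (smash X Y')) (?m \<circ> (\<lambda>(x, y). smash_pt X Y x y))"
    unfolding smash_def fst_conv by (rule continuous_map_eq) (auto simp: smash_map_pt[OF g] topspace_kprod)
  then have "continuous_map (fst (smash X Y)) (fst (smash X Y')) ?m"
    unfolding smash_def[of X Y] fst_conv continuous_map_from_coinduced .
  moreover have "?m (snd (smash X Y)) = snd (smash X Y')"
    using smash_map_pt[OF g pointed_spaceD(1)[OF X] pointed_spaceD(1)[OF Y]] by (simp add: smash_pt_base)
  moreover have "?m \<in> extensional (topspace (fst (smash X Y)))" by (simp add: smash_functor_def)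
  ultimately show ?thesis by (simp add: pmaps_def)
qed

lemma cone_star_mono: "U \<subseteq> V \<Longrightarrow> topspace (cone_star U) \<subseteq> topspace (cone_star V)"
  unfolding topspace_cone_star by blast

lemma continuous_map_cone_star: "U \<subseteq> V \<Longrightarrow> continuous_map (cone_star U) (cone_star V) (\<lambda>s. s)"
  using cone_star_mono[of U V] topspace_cone_star[of V] unfolding cone_star_def
  by (auto simp: continuous_map_in_subtopology subset_iff)

lemma join_map_pmaps:
  assumes X: "pointed_space X" and f: "pointed_map X Y f" and UV: "U \<subseteq> V"
  shows "join_map X U Y f \<in> pmaps (pjoin X U) (pjoin Y V)"
proof -
  let ?m = "join_map X U Y f"
  have "continuous_map (kprod (fst X) (cone_star U)) (kprod (fst Y) (cone_star V)) (\<lambda>(x, s). (f x, s))"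
    using f UV by (intro continuous_map_kprod continuous_map_cone_star) (auto simp: pointed_map_def)
  from continuous_map_compose[OF this continuous_map_coinduced[of _ "\<lambda>(x, s). join_pt Y x s"]]
  have "continuous_map (kprod (fst X) (cone_star U)) (fst (pjoin Y V)) (?m \<circ> (\<lambda>(x, s). join_pt X x s))"
    unfolding pjoin_def fst_conv by (rule continuous_map_eq) (auto simp: join_map_pt[OF f] topspace_kprod)
  then have "continuous_map (fst (pjoin X U)) (fst (pjoin Y V)) ?m"
    unfolding pjoin_def[of X U] fst_conv continuous_map_from_coinduced .
  moreover have "?m (snd (pjoin X U)) = snd (pjoin Y V)"
    using join_map_pt[OF f pointed_spaceD(1)[OF X] cone_star_zero[of U]] f
      join_pt_base[of "snd X" X "\<lambda>_. 0" U] join_pt_base[of "snd Y" Y "\<lambda>_. 0" V] by (simp add: pointed_map_def)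
  moreover have "?m \<in> extensional (topspace (fst (pjoin X U)))" by (simp add: join_map_def)
  ultimately show ?thesis by (simp add: pmaps_def)
qed

lemma join_incl_pmaps:
  assumes X: "pointed_space X" shows "join_incl X \<in> pmaps X (pjoin X U)"
proof -
  have "continuous_map (fst X) (kprod (fst X) (cone_star U)) (\<lambda>x. (x, \<lambda>_. 0))"
    unfolding continuous_map_into_kprod[OF pointed_spaceD(3)[OF X]]
    by (intro continuous_map_pairedI) (auto simp: cone_star_zero)
  from continuous_map_compose[OF this continuous_map_coinduced[of _ "\<lambda>(x, s). join_pt X x s"]]
  have "continuous_map (fst X) (fst (pjoin X U)) (join_incl X)"
    unfolding pjoin_def fst_conv by (rule continuous_map_eq) (auto simp: join_incl_def)
  then show ?thesis
    using pointed_spaceD(1)[OF X] join_pt_base[of "snd X" X "\<lambda>_. 0" U] by (simp add: pmaps_def join_incl_def)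
qed

lemma pjoin_pointE:
  assumes "a \<in> topspace (fst (pjoin X U))"
  obtains x s where "x \<in> topspace (fst X)" "s \<in> topspace (cone_star U)" "a = join_pt X x s"
  using assms unfolding topspace_pjoin by auto

lemma smash_pointE:
  assumes "a \<in> topspace (fst (smash X Y))"
  obtains x y where "x \<in> topspace (fst X)" "y \<in> topspace (fst Y)" "a = smash_pt X Y x y"
  using assms unfolding topspace_smash by auto

lemma pmaps_eqI:
  assumes "f \<in> pmaps X Y" "g \<in> pmaps X Z" "\<And>x. x \<in> topspace (fst X) \<Longrightarrow> f x = g x"
  shows "f = g"
  using assms by (auto simp: pmaps_def intro: extensionalityI)

lemma pmaps_compose:
  assumes "f \<in> pmaps X Y" "g \<in> pmaps Y Z" "snd X \<in> topspace (fst X)"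
  shows "compose (topspace (fst X)) g f \<in> pmaps X Z"
  using assms continuous_map_compose[of "fst X" "fst Y" f "fst Z" g]
  by (auto simp: pmaps_def compose_def o_def intro: continuous_map_eq)

lemma Idn_pmaps: "snd X \<in> topspace (fst X) \<Longrightarrow> Idn Spaces X \<in> pmaps X X"
  by (auto simp: Spaces_def pmaps_def intro: continuous_map_eq[OF continuous_map_id])

lemma is_functor_smash:
  fixes X :: "'u::universe pspace"
  assumes X: "pointed_space X" shows "is_functor Spaces (smash_functor X)"
  unfolding is_functor_def
proof (intro conjI ballI)
  fix Y :: "'u pspace" assume "Y \<in> Obj Spaces"
  then have Y: "pointed_space Y" by (simp add: Spaces_def)
  show "pointed_space (ob (smash_functor X) Y)"
    by (simp add: smash_functor_def pointed_space_smash[OF X Y])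
  have I: "Idn Spaces Y \<in> pmaps Y Y" by (rule Idn_pmaps[OF pointed_spaceD(1)[OF Y]])
  show "mor (smash_functor X) Y Y (Idn Spaces Y) = Idn Spaces (ob (smash_functor X) Y)"
  proof (rule pmaps_eqI)
    show "mor (smash_functor X) Y Y (Idn Spaces Y) \<in> pmaps (smash X Y) (smash X Y)"
      by (rule smash_map_pmaps[OF X Y pmaps_pointed_map[OF I]])
    show "Idn Spaces (ob (smash_functor X) Y) \<in> pmaps (smash X Y) (smash X Y)"
      using Idn_pmaps[OF pointed_spaceD(1)[OF pointed_space_smash[OF X Y]]] by (simp add: smash_functor_def)
    fix a assume a: "a \<in> topspace (fst (smash X Y))"
    then obtain x y where xy: "x \<in> topspace (fst X)" "y \<in> topspace (fst Y)" "a = smash_pt X Y x y"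
      by (rule smash_pointE)
    have "Idn Spaces (ob (smash_functor X) Y) a = a" using a by (simp add: Spaces_def smash_functor_def)
    moreover have "Idn Spaces Y y = y" using xy by (simp add: Spaces_def)
    ultimately show "mor (smash_functor X) Y Y (Idn Spaces Y) a = Idn Spaces (ob (smash_functor X) Y) a"
      using smash_map_pt[OF pmaps_pointed_map[OF I] xy(1,2)] xy(3) by simp
  qed
next
  fix Y Y' :: "'u pspace" and g assume "Y \<in> Obj Spaces" "Y' \<in> Obj Spaces" "g \<in> Hom Spaces Y Y'"
  then have "mor (smash_functor X) Y Y' g \<in> pmaps (smash X Y) (smash X Y')"
    by (intro smash_map_pmaps[OF X] pmaps_pointed_map) (auto simp: Spaces_def)
  then show "mor (smash_functor X) Y Y' g \<in> pmaps (ob (smash_functor X) Y) (ob (smash_functor X) Y')"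
    by (simp add: smash_functor_def)
next
  fix Y Y' Y'' :: "'u pspace" and g h assume *: "Y \<in> Obj Spaces" "Y' \<in> Obj Spaces" "Y'' \<in> Obj Spaces" "g \<in> Hom Spaces Y Y'" "h \<in> Hom Spaces Y' Y''"
  then have Y: "pointed_space Y" "pointed_space Y'" and g: "g \<in> pmaps Y Y'" and h: "h \<in> pmaps Y' Y''"
    by (auto simp: Spaces_def)
  have hg: "compose (topspace (fst Y)) h g \<in> pmaps Y Y''" by (rule pmaps_compose[OF g h pointed_spaceD(1)[OF Y(1)]])
  let ?S = "smash_functor X"
  have m: "mor ?S Y Y' g \<in> pmaps (smash X Y) (smash X Y')" "mor ?S Y' Y'' h \<in> pmaps (smash X Y') (smash X Y'')"
    using smash_map_pmaps[OF X Y(1) pmaps_pointed_map[OF g]] smash_map_pmaps[OF X Y(2) pmaps_pointed_map[OF h]] by auto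
  have "mor ?S Y Y'' (compose (topspace (fst Y)) h g) = compose (topspace (fst (smash X Y))) (mor ?S Y' Y'' h) (mor ?S Y Y' g)"
  proof (rule pmaps_eqI[OF smash_map_pmaps[OF X Y(1) pmaps_pointed_map[OF hg]]])
    show "compose (topspace (fst (smash X Y))) (mor ?S Y' Y'' h) (mor ?S Y Y' g) \<in> pmaps (smash X Y) (smash X Y'')"
      by (rule pmaps_compose[OF m pointed_spaceD(1)[OF pointed_space_smash[OF X Y(1)]]])
    fix a assume a: "a \<in> topspace (fst (smash X Y))"
    then obtain x y where xy: "x \<in> topspace (fst X)" "y \<in> topspace (fst Y)" "a = smash_pt X Y x y"
      by (rule smash_pointE)
    have gy: "g y \<in> topspace (fst Y')" by (rule pointed_map_in[OF pmaps_pointed_map[OF g] xy(2)])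
    show "mor ?S Y Y'' (compose (topspace (fst Y)) h g) a = compose (topspace (fst (smash X Y))) (mor ?S Y' Y'' h) (mor ?S Y Y' g) a"
      unfolding compose_eq[OF a] unfolding xy(3) smash_map_pt[OF pmaps_pointed_map[OF hg] xy(1,2)]
        smash_map_pt[OF pmaps_pointed_map[OF g] xy(1,2)] smash_map_pt[OF pmaps_pointed_map[OF h] xy(1) gy]
      by (simp add: compose_eq[OF xy(2)])
  qed
  then show "mor ?S Y Y'' (Cmp Spaces Y Y' Y'' h g)
      = Cmp Spaces (ob ?S Y) (ob ?S Y') (ob ?S Y'') (mor ?S Y' Y'' h) (mor ?S Y Y' g)"
    by (simp add: Spaces_def smash_functor_def)
qed

section \<open>The homeomorphisms \<open>X \<and> (A * U) \<cong> (X \<and> A) * U\<close> and \<open>X \<and> S\<^sup>0 \<cong> X\<close>\<close>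

text \<open>Open sets of a k-product are tested on compact sets \<open>K\<close>. Replacing
  \<open>A\<close> by the projection of \<open>K\<close>, which is compact Hausdorff, leads to the
  classical case: the product with a locally compact Hausdorff space preserves quotient
  maps.\<close>

lemma quotient_map_kprod_right:
  assumes A: "Hausdorff_space A" and B: "k_space B" and q: "quotient_map B B' q"
  shows "quotient_map (kprod A B) (kprod A B') (\<lambda>(a, b). (a, q b))"
proof -
  have qc: "continuous_map B B' q" and qs: "q ` topspace B = topspace B'"
    using q by (auto simp: quotient_imp_continuous_map quotient_imp_surjective_map)
  have c: "continuous_map (kprod A B) (kprod A B') (\<lambda>(a, b). (a, q b))"
    by (rule continuous_map_kprod[OF _ qc]) simp
  have "openin (kprod A B') W"
    if W: "W \<subseteq> topspace (kprod A B')" and pre: "openin (kprod A B) {z \<in> topspace (kprod A B). (\<lambda>(a, b). (a, q b)) z \<in> W}" for W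
    unfolding kprod_def openin_kification
  proof (intro conjI allI impI)
    show "W \<subseteq> topspace (prod_topology A B')" using W by (simp add: topspace_kprod)
    fix K assume K: "compactin (prod_topology A B') K"
    have KT: "K \<subseteq> topspace A \<times> topspace B'" using compactin_subset_topspace[OF K] by simp
    define K1 where "K1 = fst ` K"
    have K1: "compactin A K1" unfolding K1_def by (rule image_compactin[OF K continuous_map_fst])
    have K1A: "K1 \<subseteq> topspace A" by (rule compactin_subset_topspace[OF K1])
    let ?S = "subtopology A K1"
    have S: "compact_space ?S" "Hausdorff_space ?S" "locally_compact_space ?S"
      using K1 A by (auto simp: compact_space_subtopology Hausdorff_space_subtopology intro: compact_imp_locally_compact_space)
    have qS: "quotient_map (prod_topology ?S B) (prod_topology ?S B') (\<lambda>(a, b). (a, q b))"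
      by (rule quotient_map_prod_right[OF S(3) _ q]) (simp add: S)
    have kS: "k_space (prod_topology ?S B)" by (rule k_space_prod_topology_left[OF S(3) _ B]) (simp add: S)
    have "continuous_map (prod_topology ?S B) (kprod A B) (\<lambda>z. z)"
      unfolding continuous_map_into_kprod[OF kS] continuous_map_pairwise o_def
      by (auto intro: continuous_map_into_fulltopology continuous_map_fst continuous_map_snd)
    from openin_continuous_map_preimage[OF this pre]
    moreover have "{z \<in> topspace (prod_topology ?S B). z \<in> {z \<in> topspace (kprod A B). (\<lambda>(a, b). (a, q b)) z \<in> W}}
        = {z \<in> topspace (prod_topology ?S B). (\<lambda>(a, b). (a, q b)) z \<in> W \<inter> K1 \<times> topspace B'}"
    proof -
      have "z \<in> topspace (kprod A B) \<and> (\<lambda>(a, b). (a, q b)) z \<in> K1 \<times> topspace B'"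
        if "z \<in> topspace (prod_topology ?S B)" for z
        using that qs by (cases z) (auto simp: topspace_kprod)
      then show ?thesis by blast
    qed
    ultimately have "openin (prod_topology ?S B) {z \<in> topspace (prod_topology ?S B). (\<lambda>(a, b). (a, q b)) z \<in> W \<inter> K1 \<times> topspace B'}"
      by simp
    moreover have "W \<inter> K1 \<times> topspace B' \<subseteq> topspace (prod_topology ?S B')" using K1A by auto
    ultimately have "openin (prod_topology ?S B') (W \<inter> K1 \<times> topspace B')"
      using qS unfolding quotient_map_def by blast
    then obtain V where V: "openin (prod_topology A B') V" "W \<inter> K1 \<times> topspace B' = V \<inter> K1 \<times> topspace B'"
      unfolding prod_topology_subtopology openin_subtopology by auto
    have "K \<subseteq> K1 \<times> topspace B'" using KT by (force simp: K1_def)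
    then have "K \<inter> W = V \<inter> K" using V(2) by blast
    then show "openin (subtopology (prod_topology A B') K) (K \<inter> W)"
      unfolding openin_subtopology using V(1) by blast
  qed
  moreover have "(\<lambda>(a, b). (a, q b)) ` topspace (kprod A B) = topspace (kprod A B')"
    unfolding topspace_kprod qs[symmetric] by force
  ultimately show ?thesis
    unfolding quotient_map_def using openin_continuous_map_preimage[OF c] by blast
qed

lemma homeomorphic_maps_kprod_swap: "homeomorphic_maps (kprod A B) (kprod B A) (\<lambda>(a, b). (b, a)) (\<lambda>(b, a). (a, b))"
  unfolding homeomorphic_maps_def kprod_def split_beta'
  by (auto intro!: continuous_map_kification continuous_map_pairedI continuous_map_fst continuous_map_snd)

lemma quotient_map_kprod_left:
  assumes A: "Hausdorff_space A" and B: "k_space B" and q: "quotient_map B B' q"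
  shows "quotient_map (kprod B A) (kprod B' A) (\<lambda>(b, a). (q b, a))"
proof -
  have s: "quotient_map (kprod C D) (kprod D C) (\<lambda>(c, d). (d, c))" for C :: "'x topology" and D :: "'y topology"
    using homeomorphic_maps_kprod_swap[of C D] homeomorphic_map_maps[of "kprod C D" "kprod D C"]
    unfolding homeomorphic_map_def by blast
  have "quotient_map (kprod B A) (kprod B' A) ((\<lambda>(a, b). (b, a)) \<circ> ((\<lambda>(a, b). (a, q b)) \<circ> (\<lambda>(b, a). (a, b))))"
    by (intro quotient_map_compose[OF quotient_map_compose[OF s quotient_map_kprod_right[OF A B q]] s])
  also have "(\<lambda>(a, b). (b, a)) \<circ> ((\<lambda>(a, b). (a, q b)) \<circ> (\<lambda>(b, a). (a, b))) = (\<lambda>(b, a). (q b, a))" by auto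
  finally show ?thesis .
qed

lemma homeomorphic_maps_kprod_assoc:
  "homeomorphic_maps (kprod A (kprod B C)) (kprod (kprod A B) C) (\<lambda>(a, (b, c)). ((a, b), c)) (\<lambda>((a, b), c). (a, (b, c)))"
  unfolding homeomorphic_maps_def
proof (intro conjI)
  have f: "continuous_map (kprod D E) D fst" "continuous_map (kprod D E) E snd" for D :: "'x topology" and E :: "'y topology"
    by (intro continuous_map_from_kprod continuous_map_fst continuous_map_snd)+
  show "continuous_map (kprod A (kprod B C)) (kprod (kprod A B) C) (\<lambda>(a, (b, c)). ((a, b), c))"
    unfolding continuous_map_into_kprod[OF k_space_kprod] split_beta'
    by (intro continuous_map_pairedI, unfold continuous_map_into_kprod[OF k_space_kprod])
      (intro continuous_map_pairedI f continuous_map_compose[OF f(2) f(1), unfolded o_def]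
        continuous_map_compose[OF f(2) f(2), unfolded o_def])+
  show "continuous_map (kprod (kprod A B) C) (kprod A (kprod B C)) (\<lambda>((a, b), c). (a, (b, c)))"
    unfolding continuous_map_into_kprod[OF k_space_kprod] split_beta'
    by (intro continuous_map_pairedI, unfold continuous_map_into_kprod[OF k_space_kprod])
      (intro continuous_map_pairedI f continuous_map_compose[OF f(1) f(1), unfolded o_def]
        continuous_map_compose[OF f(1) f(2), unfolded o_def])+
qed (auto simp: topspace_kprod)

lemma join_assoc_pt:
  assumes "x \<in> topspace (fst X)" "y \<in> topspace (fst A)" "s \<in> topspace (cone_star U)"
  shows "join_assoc X A U (smash_pt X (pjoin A U) x (join_pt A y s)) = join_pt (smash X A) (smash_pt X A x y) s"
proof -
  have T: "smash_pt X (pjoin A U) x (join_pt A y s) \<in> topspace (fst (smash X (pjoin A U)))"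
    by (intro smash_pt_in join_pt_in assms)
  show ?thesis
  proof (cases "x = snd X \<or> y = snd A \<or> (\<exists>u. s u = 1)")
    case True
    then have "x = snd X \<or> join_pt A y s = snd (pjoin A U)" by (auto simp: join_pt_eq_base_iff)
    then have "(dec (smash_pt X (pjoin A U) x (join_pt A y s)) :: ('a \<times> 'a) option) = None"
      by (simp add: dec_smash_pt)
    moreover have "join_pt (smash X A) (smash_pt X A x y) s = snd (pjoin (smash X A) U)"
      using True by (auto simp: join_pt_eq_base_iff smash_pt_eq_base_iff)
    ultimately show ?thesis using T by (simp add: join_assoc_def)
  next
    case False
    then have "join_pt A y s \<noteq> snd (pjoin A U)" by (simp add: join_pt_eq_base_iff)
    then have "(dec (smash_pt X (pjoin A U) x (join_pt A y s)) :: ('a \<times> 'a) option) = Some (x, join_pt A y s)"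
      using False by (simp add: dec_smash_pt)
    then show ?thesis using T False by (simp add: join_assoc_def dec_join_pt)
  qed
qed

text \<open>Up to reassociation both sides are quotients of the same triple k-product of
  \<open>X\<close>, \<open>A\<close> and the cone, and both collapse exactly the triples with a
  basepoint or a tip among their entries. The induced map is therefore an injective quotient
  map.\<close>

lemma join_assoc_homeomorphic:
  assumes X: "pointed_space X" and A: "pointed_space A" and U: "finite U"
  shows "homeomorphic_map (fst (smash X (pjoin A U))) (fst (pjoin (smash X A) U)) (join_assoc X A U)"
    and "join_assoc X A U \<in> pmaps (smash X (pjoin A U)) (pjoin (smash X A) U)"
proof -
  let ?c = "cone_star U"
  let ?Q1 = "(\<lambda>(x, b). smash_pt X (pjoin A U) x b) \<circ> (\<lambda>(x, p). (x, (\<lambda>(y, s). join_pt A y s) p))"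
  let ?Q2 = "(\<lambda>(b, s). join_pt (smash X A) b s) \<circ> (\<lambda>(p, s). ((\<lambda>(x, y). smash_pt X A x y) p, s))"
  let ?\<alpha> = "\<lambda>(x, (y, s)). ((x, y), s)"
  note HX = pointed_spaceD(2)[OF X]
  have q1: "quotient_map (kprod (fst X) (kprod (fst A) ?c)) (fst (smash X (pjoin A U))) ?Q1"
    unfolding smash_def fst_conv
    by (intro quotient_map_compose[OF _ quotient_map_coinduced] quotient_map_kprod_right[OF HX k_space_kprod])
      (simp add: pjoin_def quotient_map_coinduced)
  have q2: "quotient_map (kprod (kprod (fst X) (fst A)) ?c) (fst (pjoin (smash X A) U)) ?Q2"
    unfolding pjoin_def fst_conv
    by (intro quotient_map_compose[OF _ quotient_map_coinduced]
        quotient_map_kprod_left[OF Hausdorff_space_cone_star k_space_kprod])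
      (simp add: smash_def quotient_map_coinduced)
  have "homeomorphic_map (kprod (fst X) (kprod (fst A) ?c)) (kprod (kprod (fst X) (fst A)) ?c) ?\<alpha>"
    using homeomorphic_maps_kprod_assoc homeomorphic_map_maps by blast
  then have "quotient_map (kprod (fst X) (kprod (fst A) ?c)) (fst (pjoin (smash X A) U)) (?Q2 \<circ> ?\<alpha>)"
    by (intro quotient_map_compose[OF _ q2]) (simp add: homeomorphic_map_def)
  then have qq: "quotient_map (kprod (fst X) (kprod (fst A) ?c)) (fst (pjoin (smash X A) U)) (join_assoc X A U \<circ> ?Q1)"
    by (rule quotient_map_eq) (auto simp: topspace_kprod join_assoc_pt)
  then have ac: "continuous_map (fst (smash X (pjoin A U))) (fst (pjoin (smash X A) U)) (join_assoc X A U)"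
    using continuous_compose_quotient_map[OF q1 quotient_imp_continuous_map] by blast
  have "quotient_map (fst (smash X (pjoin A U))) (fst (pjoin (smash X A) U)) (join_assoc X A U)"
    by (rule quotient_map_from_composition[OF quotient_imp_continuous_map[OF q1] ac qq])
  moreover have "inj_on (join_assoc X A U) (topspace (fst (smash X (pjoin A U))))"
  proof (rule inj_onI)
    fix a a' assume "a \<in> topspace (fst (smash X (pjoin A U)))" "a' \<in> topspace (fst (smash X (pjoin A U)))"
      and eq: "join_assoc X A U a = join_assoc X A U a'"
    then obtain x y s x' y' s' where p: "x \<in> topspace (fst X)" "y \<in> topspace (fst A)" "s \<in> topspace ?c"
      "a = smash_pt X (pjoin A U) x (join_pt A y s)"
      "x' \<in> topspace (fst X)" "y' \<in> topspace (fst A)" "s' \<in> topspace ?c"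
      "a' = smash_pt X (pjoin A U) x' (join_pt A y' s')"
      by (elim smash_pointE pjoin_pointE) metis
    have "join_pt (smash X A) (smash_pt X A x y) s = join_pt (smash X A) (smash_pt X A x' y') s'"
      using eq p by (simp add: join_assoc_pt)
    then show "a = a'"
      unfolding p(4,8) join_pt_eq_iff smash_pt_eq_iff smash_pt_eq_base_iff join_pt_eq_base_iff by blast
  qed
  ultimately show "homeomorphic_map (fst (smash X (pjoin A U))) (fst (pjoin (smash X A) U)) (join_assoc X A U)"
    by (simp add: homeomorphic_map_def)
  have "join_assoc X A U (snd (smash X (pjoin A U))) = snd (pjoin (smash X A) U)"
    using join_assoc_pt[OF pointed_spaceD(1)[OF X] pointed_spaceD(1)[OF A] cone_star_zero[of U]]
    by (simp add: smash_pt_base join_pt_base[of _ _ _ U])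
  then show "join_assoc X A U \<in> pmaps (smash X (pjoin A U)) (pjoin (smash X A) U)"
    using ac by (simp add: pmaps_def join_assoc_def)
qed

text \<open>With \<open>f\<close> and \<open>U \<subseteq> V\<close> both general, this covers the
  structure maps of the cube as well as the maps induced by \<open>f\<close> at one vertex.\<close>

lemma join_assoc_natural:
  assumes X: "pointed_space X" and A: "pointed_space A" and f: "pointed_map A B f" and UV: "U \<subseteq> V"
    and a: "a \<in> topspace (fst (smash X (pjoin A U)))"
  shows "join_assoc X B V (mor (smash_functor X) (pjoin A U) (pjoin B V) (join_map A U B f) a)
       = join_map (smash X A) U (smash X B) (mor (smash_functor X) A B f) (join_assoc X A U a)"
proof -
  obtain x b where xb: "x \<in> topspace (fst X)" "b \<in> topspace (fst (pjoin A U))" "a = smash_pt X (pjoin A U) x b"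
    using a by (rule smash_pointE)
  obtain y s where ys: "y \<in> topspace (fst A)" "s \<in> topspace (cone_star U)" "b = join_pt A y s"
    using xb(2) by (rule pjoin_pointE)
  have sV: "s \<in> topspace (cone_star V)" using ys(2) cone_star_mono[OF UV] by blast
  have m: "pointed_map (pjoin A U) (pjoin B V) (join_map A U B f)"
    by (rule pmaps_pointed_map[OF join_map_pmaps[OF A f UV]])
  have g: "pointed_map (smash X A) (smash X B) (mor (smash_functor X) A B f)"
    by (rule pmaps_pointed_map[OF smash_map_pmaps[OF X A f]])
  have "mor (smash_functor X) (pjoin A U) (pjoin B V) (join_map A U B f) a
      = smash_pt X (pjoin B V) x (join_map A U B f b)"
    unfolding xb(3) by (rule smash_map_pt[OF m xb(1,2)])
  moreover have "join_map A U B f b = join_pt B (f y) s"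
    unfolding ys(3) by (rule join_map_pt[OF f ys(1,2)])
  moreover have "join_assoc X A U a = join_pt (smash X A) (smash_pt X A x y) s"
    unfolding xb(3) ys(3) by (rule join_assoc_pt[OF xb(1) ys(1,2)])
  ultimately show ?thesis
    using join_assoc_pt[OF xb(1) pointed_map_in[OF f ys(1)] sV]
      join_map_pt[OF g smash_pt_in[OF xb(1) ys(1)] ys(2)] smash_map_pt[OF f xb(1) ys(1)] by simp
qed

text \<open>Compatibility with \<open>T_unit\<close>: both inclusions put a point at cone parameter
  0.\<close>

lemma join_assoc_incl:
  assumes A: "pointed_space A" and a: "a \<in> topspace (fst (smash X A))"
  shows "join_assoc X A U (mor (smash_functor X) A (pjoin A U) (join_incl A) a) = join_incl (smash X A) a"
proof -
  obtain x y where xy: "x \<in> topspace (fst X)" "y \<in> topspace (fst A)" "a = smash_pt X A x y"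
    using a by (rule smash_pointE)
  show ?thesis
    using a join_assoc_pt[OF xy(1,2) cone_star_zero[of U]]
    unfolding xy(3) smash_map_pt[OF pmaps_pointed_map[OF join_incl_pmaps[OF A, of U]] xy(1,2)]
    by (simp add: join_incl_def xy(2))
qed

lemma inj_enc_nat: "inj (enc :: nat \<Rightarrow> 'u::universe)"
  by (rule encodable_inj_enc[OF encodable_nat])

lemma smash_unit_homeomorphic:
  fixes X :: "'u::universe pspace"
  assumes X: "pointed_space X"
  shows "homeomorphic_map (fst (smash X S0)) (fst X) (smash_unit X)"
    and "smash_unit X \<in> pmaps (smash X S0) X"
proof -
  define e0 e1 :: 'u where "e0 = enc (0::nat)" and "e1 = enc (1::nat)"
  have e01: "e0 \<noteq> e1" unfolding e0_def e1_def
  proof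
    assume "(enc (0::nat) :: 'u) = enc (1::nat)"
    then have "(0::nat) = 1" by (rule injD[OF inj_enc_nat])
    then show False by simp
  qed
  have "{..1::nat} = {0, 1}" by auto
  then have S0: "S0 = (discrete_topology {e0, e1}, e0)"
    by (simp add: S0_def finite_set_ob_def e0_def e1_def)
  have TS0: "topspace (fst (S0 :: 'u pspace)) = {e0, e1}"
    unfolding S0 fst_conv by (rule topspace_discrete_topology)
  have up: "smash_unit X (smash_pt X S0 x b) = (if b = e0 then snd X else x)"
    if "x \<in> topspace (fst X)" "b \<in> {e0, e1}" for x b
    using smash_pt_in[of x X b S0] that by (auto simp: smash_unit_def dec_smash_pt S0)
  have "continuous_map (prod_topology (fst X) (discrete_topology {e0, e1})) (fst X) (\<lambda>(x, b). if b = e0 then snd X else x)"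
  \<comment> \<open>The second factor is discrete, so continuity may be checked on its two
    slices.\<close>
  proof (rule pasting_lemma[where I = "{e0, e1}" and T = "\<lambda>b. topspace (fst X) \<times> {b}" and f = "\<lambda>b (x, c). if b = e0 then snd X else x"])
    show "continuous_map (subtopology (prod_topology (fst X) (discrete_topology {e0, e1})) (topspace (fst X) \<times> {b})) (fst X)
        (\<lambda>(x, c). if b = e0 then snd X else x)" for b
      using pointed_spaceD(1)[OF X] by (cases "b = e0") (auto simp: split_beta' intro: continuous_map_from_subtopology continuous_map_fst)
  qed (auto simp: openin_prod_Times_iff)
  then have "continuous_map (kprod (fst X) (fst S0)) (fst X) (\<lambda>(x, b). if b = e0 then snd X else x)"
    by (intro continuous_map_from_kprod) (simp add: S0)
  then have "continuous_map (kprod (fst X) (fst S0)) (fst X) (smash_unit X \<circ> (\<lambda>(x, b). smash_pt X S0 x b))"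
    by (rule continuous_map_eq) (use TS0 in \<open>auto simp: topspace_kprod up\<close>)
  then have c: "continuous_map (fst (smash X S0)) (fst X) (smash_unit X)"
    by (simp add: smash_def continuous_map_from_coinduced)
  \<comment> \<open>The inverse puts \<open>x\<close> over \<open>e1\<close>, the point of the
    0-sphere other than the basepoint.\<close>
  have "continuous_map (fst X) (kprod (fst X) (fst S0)) (\<lambda>x. (x, e1))"
    unfolding continuous_map_into_kprod[OF pointed_spaceD(3)[OF X]]
    by (intro continuous_map_pairedI) (auto simp: S0)
  from continuous_map_compose[OF this continuous_map_coinduced[of _ "\<lambda>(x, b). smash_pt X S0 x b"]]
  have d: "continuous_map (fst X) (fst (smash X S0)) (\<lambda>x. smash_pt X S0 x e1)"
    by (simp add: smash_def o_def)
  have "homeomorphic_maps (fst (smash X S0)) (fst X) (smash_unit X) (\<lambda>x. smash_pt X S0 x e1)"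
    unfolding homeomorphic_maps_def
  proof (intro conjI ballI c d)
    show "smash_unit X (smash_pt X S0 x e1) = x" if "x \<in> topspace (fst X)" for x
      using up[OF that, of e1] e01 by simp
    fix a assume "a \<in> topspace (fst (smash X S0))"
    then obtain x b where xb: "x \<in> topspace (fst X)" "b \<in> topspace (fst S0)" "a = smash_pt X S0 x b"
      by (rule smash_pointE)
    then have "b \<in> {e0, e1}" by (simp add: S0)
    then show "smash_pt X S0 (smash_unit X a) e1 = a"
      using xb up[of x b] by (auto simp: smash_pt_eq_iff S0)
  qed
  then show "homeomorphic_map (fst (smash X S0)) (fst X) (smash_unit X)" using homeomorphic_map_maps by blast
  have "smash_unit X (snd (smash X S0)) = snd X"
    using up[OF pointed_spaceD(1)[OF X], of e0] by (simp add: smash_pt_base)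
  then show "smash_unit X \<in> pmaps (smash X S0) X" using c by (simp add: pmaps_def smash_unit_def)
qed

section \<open>Functoriality of the left Kan extension\<close>

text \<open>Weaker than \<open>is_functor Spaces\<close>: the values are plain topological spaces,
  and the equations hold at points of the carriers. In this form functoriality is passed on by
  \<open>LKan\<close> and \<open>goodwillie_T\<close>.\<close>

definition top_functor :: "'u space_functor \<Rightarrow> bool" where
  "top_functor F \<longleftrightarrow>
     (\<forall>X Y f. pointed_space X \<longrightarrow> pointed_space Y \<longrightarrow> f \<in> pmaps X Y \<longrightarrow>
        continuous_map (fst (ob F X)) (fst (ob F Y)) (mor F X Y f))
   \<and> (\<forall>X. pointed_space X \<longrightarrow> (\<forall>a\<in>topspace (fst (ob F X)). mor F X X (Idn Spaces X) a = a))
   \<and> (\<forall>X Y Z f g. pointed_space X \<longrightarrow> pointed_space Y \<longrightarrow> pointed_space Z \<longrightarrow> f \<in> pmaps X Y \<longrightarrow> g \<in> pmaps Y Z \<longrightarrow>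
        (\<forall>a\<in>topspace (fst (ob F X)). mor F X Z (compose (topspace (fst X)) g f) a = mor F Y Z g (mor F X Y f a)))"

lemma top_functorD:
  assumes "top_functor F"
  shows "\<And>X Y f. pointed_space X \<Longrightarrow> pointed_space Y \<Longrightarrow> f \<in> pmaps X Y \<Longrightarrow>
        continuous_map (fst (ob F X)) (fst (ob F Y)) (mor F X Y f)"
    and "\<And>X a. pointed_space X \<Longrightarrow> a \<in> topspace (fst (ob F X)) \<Longrightarrow> mor F X X (Idn Spaces X) a = a"
    and "\<And>X Y Z f g a. pointed_space X \<Longrightarrow> pointed_space Y \<Longrightarrow> pointed_space Z \<Longrightarrow> f \<in> pmaps X Y \<Longrightarrow> g \<in> pmaps Y Z \<Longrightarrow>
        a \<in> topspace (fst (ob F X)) \<Longrightarrow> mor F X Z (compose (topspace (fst X)) g f) a = mor F Y Z g (mor F X Y f a)"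
  using assms unfolding top_functor_def by blast+

lemma spaces_functorD:
  assumes "is_functor Spaces F"
  shows "\<And>X. pointed_space X \<Longrightarrow> pointed_space (ob F X)"
    and "\<And>X Y f. pointed_space X \<Longrightarrow> pointed_space Y \<Longrightarrow> f \<in> pmaps X Y \<Longrightarrow> mor F X Y f \<in> pmaps (ob F X) (ob F Y)"
    and "\<And>X. pointed_space X \<Longrightarrow> mor F X X (Idn Spaces X) = Idn Spaces (ob F X)"
    and "\<And>X Y Z f g. pointed_space X \<Longrightarrow> pointed_space Y \<Longrightarrow> pointed_space Z \<Longrightarrow> f \<in> pmaps X Y \<Longrightarrow> g \<in> pmaps Y Z \<Longrightarrow>
        mor F X Z (compose (topspace (fst X)) g f) = compose (topspace (fst (ob F X))) (mor F Y Z g) (mor F X Y f)"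
  using assms unfolding is_functor_def by (auto simp: Spaces_def)

lemma top_functor_spaces_functor:
  fixes F :: "'u space_functor"
  assumes F: "is_functor Spaces F" shows "top_functor F"
  unfolding top_functor_def
proof (intro conjI allI impI ballI)
  fix X Y :: "'u pspace" and f assume *: "pointed_space X" "pointed_space Y" "f \<in> pmaps X Y"
  show "continuous_map (fst (ob F X)) (fst (ob F Y)) (mor F X Y f)"
    using spaces_functorD(2)[OF F *] by (simp add: pmaps_def)
next
  fix X :: "'u pspace" and a assume "pointed_space X" "a \<in> topspace (fst (ob F X))"
  then show "mor F X X (Idn Spaces X) a = a"
    using spaces_functorD(3)[OF F] by (simp add: Spaces_def)
next
  fix X Y Z :: "'u pspace" and f g a
  assume "pointed_space X" "pointed_space Y" "pointed_space Z" "f \<in> pmaps X Y" "g \<in> pmaps Y Z"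
    and a: "a \<in> topspace (fst (ob F X))"
  from spaces_functorD(4)[OF F this(1-5)] show "mor F X Z (compose (topspace (fst X)) g f) a = mor F Y Z g (mor F X Y f a)"
    using a by (simp add: compose_eq)
qed

lemma functor_mor:
  "is_functor C D \<Longrightarrow> x \<in> Obj C \<Longrightarrow> y \<in> Obj C \<Longrightarrow> a \<in> Hom C x y \<Longrightarrow> mor D x y a \<in> pmaps (ob D x) (ob D y)"
  unfolding is_functor_def by blast

lemma is_functor_after:
  assumes F: "is_functor Spaces F" and D: "is_functor C D"
  shows "is_functor C (after_functor F D)"
  unfolding is_functor_def
proof (intro conjI ballI)
  have Dob: "pointed_space (ob D x)" if "x \<in> Obj C" for x using D that by (simp add: is_functor_def)
  have Dmor: "mor D x y a \<in> pmaps (ob D x) (ob D y)" if "x \<in> Obj C" "y \<in> Obj C" "a \<in> Hom C x y" for x y a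
    using D that by (simp add: is_functor_def)
  show "pointed_space (ob (after_functor F D) x)" if "x \<in> Obj C" for x
    using spaces_functorD(1)[OF F Dob[OF that]] by (simp add: after_functor_def)
  show "mor (after_functor F D) x y a \<in> pmaps (ob (after_functor F D) x) (ob (after_functor F D) y)"
    if "x \<in> Obj C" "y \<in> Obj C" "a \<in> Hom C x y" for x y a
    using spaces_functorD(2)[OF F Dob Dob Dmor] that by (simp add: after_functor_def)
  show "mor (after_functor F D) x x (Idn C x) = Idn Spaces (ob (after_functor F D) x)" if "x \<in> Obj C" for x
    using spaces_functorD(3)[OF F Dob[OF that]] D that by (simp add: after_functor_def is_functor_def)
  show "mor (after_functor F D) x z (Cmp C x y z b a)
          = Cmp Spaces (ob (after_functor F D) x) (ob (after_functor F D) y) (ob (after_functor F D) z)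
              (mor (after_functor F D) y z b) (mor (after_functor F D) x y a)"
    if "x \<in> Obj C" "y \<in> Obj C" "z \<in> Obj C" "a \<in> Hom C x y" "b \<in> Hom C y z" for x y z a b
  proof -
    have "mor D x z (Cmp C x y z b a) = compose (topspace (fst (ob D x))) (mor D y z b) (mor D x y a)"
      using D that by (simp add: is_functor_def Spaces_def)
    then show ?thesis
      using spaces_functorD(4)[OF F Dob Dob Dob Dmor Dmor] that by (simp add: after_functor_def Spaces_def)
  qed
qed

lemma dec_enc_nat: "dec (enc n :: 'u::universe) = (n :: nat)"
  by (rule dec_enc[OF inj_enc_nat])

lemma finite_set_ob_simps:
  "fst (ob finite_set_ob n :: 'u::universe pspace) = discrete_topology (enc ` {..n})"
  "snd (ob finite_set_ob n :: 'u pspace) = enc (0::nat)"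
  "mor finite_set_ob m n f = (\<lambda>x\<in>enc ` {..m}. enc (f (dec x)) :: 'u)"
  by (simp_all add: finite_set_ob_def)

lemma is_functor_finite_set_ob: "is_functor Fin (finite_set_ob :: (nat, nat \<Rightarrow> nat, 'u::universe) pfunctor)"
  unfolding is_functor_def
proof (intro conjI ballI)
  fix n
  show "pointed_space (ob finite_set_ob n :: 'u pspace)" by (rule pointed_space_finite_set_ob)
  show "mor finite_set_ob n n (Idn Fin n) = Idn Spaces (ob finite_set_ob n :: 'u pspace)"
    by (auto simp: finite_set_ob_simps Spaces_def Fin_def dec_enc_nat intro!: restrict_ext)
next
  fix m n f assume "f \<in> Hom Fin m n"
  then show "mor finite_set_ob m n f \<in> pmaps (ob finite_set_ob m :: 'u pspace) (ob finite_set_ob n)"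
    by (auto simp: pmaps_def finite_set_ob_simps Fin_def dec_enc_nat PiE_iff)
next
  fix l m n f g assume "f \<in> Hom Fin l m" "g \<in> Hom Fin m n"
  then show "mor finite_set_ob l n (Cmp Fin l m n g f)
      = Cmp Spaces (ob finite_set_ob l :: 'u pspace) (ob finite_set_ob m) (ob finite_set_ob n)
          (mor finite_set_ob m n g) (mor finite_set_ob l m f)"
    by (auto simp: finite_set_ob_simps Spaces_def Fin_def dec_enc_nat PiE_iff compose_def intro!: restrict_ext)
qed

section \<open>Representatives of points of a realization\<close>

lemma realization_pt_eq:
  assumes "equivclp (realization_rel Z pull) a b"
  shows "realization_pt Z pull a = realization_pt Z pull b"
proof -
  have "equivclp (realization_rel Z pull) a = equivclp (realization_rel Z pull) b"
    using assms by (intro ext iffI) (meson equivclp_sym equivclp_trans)+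
  then show ?thesis by (simp add: realization_pt_def)
qed

lemma dec_realization_pt:
  assumes "inj (enc :: nat \<times> 'b \<times> (nat \<Rightarrow> real) \<Rightarrow> 'u::universe)"
  shows "equivclp (realization_rel Z pull) a (dec (realization_pt Z pull a :: 'u) :: nat \<times> 'b \<times> (nat \<Rightarrow> real))"
  unfolding realization_pt_def dec_enc[OF assms] by (rule someI[of _ a]) (rule equivclp_refl)

text \<open>Maps out of a realization are given by formulas in the chosen representative.
  Independence of the choice follows once the formula respects the generating relation, up to the
  equivalence in the target.\<close>

lemma equivclp_map:
  assumes "equivclp R a b" "\<And>x y. R x y \<Longrightarrow> equivclp R' (\<Phi> x) (\<Phi> y)"
  shows "equivclp R' (\<Phi> a) (\<Phi> b)"
  using assms(1)
proof (induction rule: equivclp_induct)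
  case base
  show ?case by (rule equivclp_refl)
next
  case (step y z)
  have "equivclp R' (\<Phi> y) (\<Phi> z)"
    using step(2) assms(2) by (meson equivclp_sym)
  with step(3) show ?case by (rule equivclp_trans)
qed

locale kan_extension =
  fixes H :: "'u::universe space_functor"
  assumes H: "is_functor Spaces H"
begin

abbreviation D :: "(nat, nat \<Rightarrow> nat, 'u) pfunctor" where
  "D \<equiv> after_functor H finite_set_ob"

abbreviation level :: "'u pspace \<Rightarrow> nat \<Rightarrow> (nat, nat \<Rightarrow> nat, 'u, nat \<Rightarrow> 'u) bar_elt topology" where
  "level Y \<equiv> bar_level Fin D (fin_maps Y)"

abbreviation pull :: "nat \<Rightarrow> nat \<Rightarrow> (nat \<Rightarrow> nat) \<Rightarrow> (nat, nat \<Rightarrow> nat, 'u, nat \<Rightarrow> 'u) bar_elt \<Rightarrow> (nat, nat \<Rightarrow> nat, 'u, nat \<Rightarrow> 'u) bar_elt" where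
  "pull \<equiv> bar_pull D fin_maps_pull"

abbreviation total :: "'u pspace \<Rightarrow> (nat \<times> (nat, nat \<Rightarrow> nat, 'u, nat \<Rightarrow> 'u) bar_elt \<times> (nat \<Rightarrow> real)) topology" where
  "total Y \<equiv> sum_topology (\<lambda>k. kprod (level Y k) (simplex_top k)) UNIV"

lemma D_functor: "is_functor Fin D"
  by (rule is_functor_after[OF H is_functor_finite_set_ob])

lemma D_mor: "f \<in> Hom Fin m n \<Longrightarrow> mor D m n f \<in> pmaps (ob D m) (ob D n)"
  using D_functor by (simp add: is_functor_def Fin_def)

lemma D_comp: "f \<in> Hom Fin l m \<Longrightarrow> g \<in> Hom Fin m n \<Longrightarrow> y \<in> topspace (fst (ob D l)) \<Longrightarrow>
    mor D l n (Cmp Fin l m n g f) y = mor D m n g (mor D l m f y)"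
  using D_functor unfolding is_functor_def by (auto simp: Spaces_def Fin_def compose_eq)

lemma D_mor_base: "f \<in> Hom Fin m n \<Longrightarrow> mor D m n f (snd (ob D m)) = snd (ob D n)"
  using D_mor by (simp add: pmaps_def)

lemma D_mor_in: "f \<in> Hom Fin m n \<Longrightarrow> y \<in> topspace (fst (ob D m)) \<Longrightarrow> mor D m n f y \<in> topspace (fst (ob D n))"
  using pointed_map_in[OF pmaps_pointed_map[OF D_mor]] .

lemma inj_enc_bar: "inj (enc :: nat \<times> (nat, nat \<Rightarrow> nat, 'u, nat \<Rightarrow> 'u) bar_elt \<times> (nat \<Rightarrow> real) \<Rightarrow> 'u)"
  by (intro encodable_inj_enc encodable_prod encodable_option encodable_nat encodable_nat_fun encodable_real encodable_self)

lemma topspace_fin_maps: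
  "topspace (fin_maps Y n) = {g \<in> {..n} \<rightarrow>\<^sub>E topspace (fst Y). g 0 = snd Y}"
  by (auto simp: fin_maps_def)

lemma topspace_level: "topspace (level Y k) = wedge_pt D ` (SIGMA s:nerve Fin k. topspace (fst (ob D (fst s 0))) \<times> topspace (fin_maps Y (fst s k)))"
  by (simp add: bar_level_def topspace_coinduced topspace_kprod o_def)

lemma levelE:
  assumes "v \<in> topspace (level Y k)"
  obtains p c y g where "(p, c) \<in> nerve Fin k" "y \<in> topspace (fst (ob D (p 0)))" "g \<in> topspace (fin_maps Y (p k))"
    "v = wedge_pt D ((p, c), y, g)"
  using assms unfolding topspace_level by auto

lemma nerve_hom: "(p, c) \<in> nerve Fin k \<Longrightarrow> i \<le> j \<Longrightarrow> j \<le> k \<Longrightarrow> c i j \<in> Hom Fin (p i) (p j)"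
  by (simp add: nerve_def)

lemma nerve_comp: "(p, c) \<in> nerve Fin k \<Longrightarrow> i \<le> j \<Longrightarrow> j \<le> l \<Longrightarrow> l \<le> k \<Longrightarrow>
    c i l = Cmp Fin (p i) (p j) (p l) (c j l) (c i j)"
  by (simp add: nerve_def)

definition push :: "('u \<Rightarrow> 'u) \<Rightarrow> nat \<Rightarrow> (nat, nat \<Rightarrow> nat, 'u, nat \<Rightarrow> 'u) bar_elt \<Rightarrow> (nat, nat \<Rightarrow> nat, 'u, nat \<Rightarrow> 'u) bar_elt" where
  "push f k = map_option (\<lambda>(s, y, g). (s, y, compose {..fst s k} f g))"

definition push_total :: "('u \<Rightarrow> 'u) \<Rightarrow> nat \<times> (nat, nat \<Rightarrow> nat, 'u, nat \<Rightarrow> 'u) bar_elt \<times> (nat \<Rightarrow> real)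
    \<Rightarrow> nat \<times> (nat, nat \<Rightarrow> nat, 'u, nat \<Rightarrow> 'u) bar_elt \<times> (nat \<Rightarrow> real)" where
  "push_total f = (\<lambda>(k, v, t). (k, push f k v, t))"

lemma push_wedge_pt: "push f k (wedge_pt D (s, y, g)) = wedge_pt D (s, y, compose {..fst s k} f g)"
  by (simp add: push_def wedge_pt_def)

lemma continuous_map_fin_maps:
  assumes f: "f \<in> pmaps Y Y'"
  shows "continuous_map (fin_maps Y n) (fin_maps Y' n) (compose {..n} f)"
  unfolding fin_maps_def
proof (rule continuous_map_kification)
  let ?S = "subtopology (product_topology (\<lambda>_. fst Y) {..n}) {g. g 0 = snd Y}"
  have fc: "continuous_map (fst Y) (fst Y') f" "f (snd Y) = snd Y'" using f by (auto simp: pmaps_def)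
  have "continuous_map ?S (product_topology (\<lambda>_. fst Y') {..n}) (compose {..n} f)"
    unfolding continuous_map_componentwise
  proof (intro conjI ballI)
    fix i assume i: "i \<in> {..n}"
    have "continuous_map ?S (fst Y) (\<lambda>g. g i)"
      by (intro continuous_map_from_subtopology continuous_map_product_projection i)
    from continuous_map_compose[OF this fc(1)] show "continuous_map ?S (fst Y') (\<lambda>g. compose {..n} f g i)"
      using i by (simp add: compose_eq o_def)
  qed (auto simp: compose_def)
  then show "continuous_map ?S (subtopology (product_topology (\<lambda>_. fst Y') {..n}) {g. g 0 = snd Y'}) (compose {..n} f)"
    using fc(2) by (auto simp: continuous_map_in_subtopology compose_def)
qed

lemma continuous_map_push:
  assumes f: "f \<in> pmaps Y Y'"
  shows "continuous_map (level Y k) (level Y' k) (push f k)"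
  unfolding bar_level_def[of Fin D "fin_maps Y"] continuous_map_from_coinduced
proof (rule continuous_map_from_sum)
  fix s assume s: "s \<in> nerve Fin k"
  let ?A = "\<lambda>Y. kprod (fst (ob D (fst s 0))) (fin_maps Y (fst s k))"
  have "continuous_map (?A Y) (?A Y') (\<lambda>(y, g). (y, compose {..fst s k} f g))"
    by (intro continuous_map_kprod continuous_map_fin_maps[OF f]) simp
  moreover have "continuous_map (?A Y') (sum_topology (\<lambda>s. kprod (fst (ob D (fst s 0))) (fin_maps Y' (fst s k))) (nerve Fin k)) (\<lambda>p. (s, p))"
    by (rule continuous_map_component_injection[OF s])
  moreover have "continuous_map (sum_topology (\<lambda>s. kprod (fst (ob D (fst s 0))) (fin_maps Y' (fst s k))) (nerve Fin k)) (level Y' k) (wedge_pt D)"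
    unfolding bar_level_def by (rule continuous_map_coinduced)
  ultimately have "continuous_map (?A Y) (level Y' k) (wedge_pt D \<circ> ((\<lambda>p. (s, p)) \<circ> (\<lambda>(y, g). (y, compose {..fst s k} f g))))"
    by (intro continuous_map_compose)
  then show "continuous_map (?A Y) (level Y' k) (\<lambda>x. (push f k \<circ> wedge_pt D) (s, x))"
    by (rule continuous_map_eq) (auto simp: push_wedge_pt)
qed

text \<open>\<open>bar_pull\<close> is defined by cases on whether the point is the basepoint. Since
  arrows preserve basepoints, one formula on representatives covers both cases.\<close>

lemma pull_wedge_pt:
  assumes s: "(p, c) \<in> nerve Fin k" and y: "y \<in> topspace (fst (ob D (p 0)))"
    and \<theta>: "mono_on {..m} \<theta>" "\<theta> ` {..m} \<subseteq> {..k}"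
  shows "pull m k \<theta> (wedge_pt D ((p, c), y, g)) = wedge_pt D (chain_pull m \<theta> (p, c),
         mor D (p 0) (p (\<theta> 0)) (c 0 (\<theta> 0)) y, compose {..p (\<theta> m)} g (c (\<theta> m) k))"
proof (cases "y = snd (ob D (p 0))")
  case True
  have "c 0 (\<theta> 0) \<in> Hom Fin (p 0) (p (\<theta> 0))" using \<theta>(2) by (intro nerve_hom[OF s]) auto
  then have "mor D (p 0) (p (\<theta> 0)) (c 0 (\<theta> 0)) y = snd (ob D (p (\<theta> 0)))" unfolding True by (rule D_mor_base)
  then show ?thesis using True by (simp add: wedge_pt_def bar_pull_def chain_pull_def)
qed (simp add: wedge_pt_def bar_pull_def fin_maps_pull_def)

text \<open>\<open>push\<close> composes with \<open>f\<close> on the left, a simplicial operator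
  with an arrow on the right. The arrow takes values in the index range of the last object, so the
  restrictions made by \<open>compose\<close> do not interfere.\<close>

lemma push_pull:
  assumes v: "v \<in> topspace (level Y k)" and \<theta>: "mono_on {..m} \<theta>" "\<theta> ` {..m} \<subseteq> {..k}"
  shows "push f m (pull m k \<theta> v) = pull m k \<theta> (push f k v)"
proof -
  obtain p c y g where s: "(p, c) \<in> nerve Fin k" "y \<in> topspace (fst (ob D (p 0)))" "v = wedge_pt D ((p, c), y, g)"
    using v by (rule levelE)
  have "c (\<theta> m) k \<in> Hom Fin (p (\<theta> m)) (p k)" using \<theta>(2) by (intro nerve_hom[OF s(1)]) auto
  then have "c (\<theta> m) k i \<le> p k" if "i \<le> p (\<theta> m)" for i using that by (auto simp: Fin_def PiE_iff)
  then have "compose {..p (\<theta> m)} f (compose {..p (\<theta> m)} g (c (\<theta> m) k))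
      = compose {..p (\<theta> m)} (compose {..p k} f g) (c (\<theta> m) k)"
    by (auto simp: compose_def fun_eq_iff)
  then show ?thesis
    unfolding s(3) pull_wedge_pt[OF s(1,2) \<theta>] push_wedge_pt fst_conv
    by (simp add: chain_pull_def)
qed

lemma push_in: "f \<in> pmaps Y Y' \<Longrightarrow> v \<in> topspace (level Y k) \<Longrightarrow> push f k v \<in> topspace (level Y' k)"
  by (rule continuous_map_in_topspace[OF continuous_map_push])

lemma LKan_pt_push:
  assumes f: "f \<in> pmaps Y Y'" and eq: "equivclp (realization_rel (level Y) pull) a b"
  shows "LKan_pt H Y' (push_total f a) = LKan_pt H Y' (push_total f b)"
  unfolding LKan_pt_def bar_pt_def
proof (rule realization_pt_eq, rule equivclp_map[OF eq])
  fix x y assume "realization_rel (level Y) pull x y"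
  then obtain m k \<theta> v t where *: "mono_on {..m} \<theta>" "\<theta> ` {..m} \<subseteq> {..k}" "v \<in> topspace (level Y k)"
    "t \<in> standard_simplex m" "x = (m, pull m k \<theta> v, t)" "y = (k, v, simplex_push m \<theta> t)"
    unfolding realization_rel_def by blast
  have "realization_rel (level Y') pull (push_total f x) (push_total f y)"
    unfolding realization_rel_def
    by (rule exI[of _ m], rule exI[of _ k], rule exI[of _ \<theta>], rule exI[of _ "push f k v"], rule exI[of _ t])
      (use * push_in[OF f *(3)] push_pull[OF *(3,1,2)] in \<open>simp add: push_total_def\<close>)
  then show "equivclp (realization_rel (level Y') pull) (push_total f x) (push_total f y)"
    by (rule r_into_equivclp)
qed

lemma LKan_ob: "fst (ob (LKan H) Y) = coinduced (total Y) (LKan_pt H Y)"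
  by (simp add: LKan_def Let_def bar_construction_def realization_def LKan_pt_def bar_pt_def)

lemma topspace_LKan: "topspace (fst (ob (LKan H) Y)) = LKan_pt H Y ` topspace (total Y)"
  unfolding LKan_ob by (rule topspace_coinduced)

lemma LKan_pointE:
  assumes "a \<in> topspace (fst (ob (LKan H) Y))"
  obtains k p c y g t where "(p, c) \<in> nerve Fin k" "y \<in> topspace (fst (ob D (p 0)))" "g \<in> topspace (fin_maps Y (p k))"
    "t \<in> topspace (simplex_top k)" "a = LKan_pt H Y (k, wedge_pt D ((p, c), y, g), t)"
proof -
  obtain k v t where kvt: "v \<in> topspace (level Y k)" "t \<in> topspace (simplex_top k)" "a = LKan_pt H Y (k, v, t)"
    using assms unfolding topspace_LKan by (auto simp: topspace_kprod)
  obtain p c y g where "(p, c) \<in> nerve Fin k" "y \<in> topspace (fst (ob D (p 0)))" "g \<in> topspace (fin_maps Y (p k))"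
    "v = wedge_pt D ((p, c), y, g)"
    using kvt(1) by (rule levelE)
  then show ?thesis using kvt by (intro that[of p c k y g t]) auto
qed

lemma LKan_pt_in:
  assumes "(p, c) \<in> nerve Fin k" "y \<in> topspace (fst (ob D (p 0)))" "g \<in> topspace (fin_maps Y (p k))"
    "t \<in> topspace (simplex_top k)"
  shows "LKan_pt H Y (k, wedge_pt D ((p, c), y, g), t) \<in> topspace (fst (ob (LKan H) Y))"
  unfolding topspace_LKan topspace_sum_topology
  by (rule imageI) (use assms in \<open>auto simp: topspace_kprod topspace_level intro!: imageI\<close>)

lemma dec_LKan_pt: "equivclp (realization_rel (level Y) pull) a (dec (LKan_pt H Y a))"
  unfolding LKan_pt_def bar_pt_def by (rule dec_realization_pt[OF inj_enc_bar])

text \<open>The definition applies \<open>f\<close> to the representative chosen by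
  \<open>dec\<close>; \<open>LKan_pt_push\<close> permits any other one.\<close>

lemma LKan_mor:
  assumes f: "f \<in> pmaps Y Y'" and a: "LKan_pt H Y a \<in> topspace (fst (ob (LKan H) Y))"
  shows "mor (LKan H) Y Y' f (LKan_pt H Y a) = LKan_pt H Y' (push_total f a)"
proof -
  have "mor (LKan H) Y Y' f = (\<lambda>a\<in>topspace (fst (ob (LKan H) Y)). LKan_pt H Y' (push_total f (dec a)))"
    unfolding LKan_def Let_def pfunctor.select_convs push_total_def push_def by (simp add: split_beta')
  then have "mor (LKan H) Y Y' f (LKan_pt H Y a) = LKan_pt H Y' (push_total f (dec (LKan_pt H Y a)))"
    using a by simp
  also have "\<dots> = LKan_pt H Y' (push_total f a)"
    by (rule LKan_pt_push[OF f dec_LKan_pt, symmetric])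
  finally show ?thesis .
qed

lemma LKan_mor_pt:
  assumes f: "f \<in> pmaps Y Y'" and "(p, c) \<in> nerve Fin k" "y \<in> topspace (fst (ob D (p 0)))" "g \<in> topspace (fin_maps Y (p k))"
    "t \<in> topspace (simplex_top k)"
  shows "mor (LKan H) Y Y' f (LKan_pt H Y (k, wedge_pt D ((p, c), y, g), t))
      = LKan_pt H Y' (k, wedge_pt D ((p, c), y, compose {..p k} f g), t)"
  using LKan_mor[OF f LKan_pt_in[OF assms(2-)]] by (simp add: push_total_def push_wedge_pt)

lemma compose_fin_maps: 
  assumes "f \<in> pmaps Y Y'" "g \<in> topspace (fin_maps Y n)"
  shows "compose {..n} f g \<in> topspace (fin_maps Y' n)"
  by (rule continuous_map_in_topspace[OF continuous_map_fin_maps[OF assms(1)] assms(2)])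

lemma top_functor_LKan: "top_functor (LKan H)"
  unfolding top_functor_def
proof (intro conjI allI impI ballI)
  fix Y Y' :: "'u pspace" and f assume f: "f \<in> pmaps Y Y'"
  have "continuous_map (total Y) (fst (ob (LKan H) Y')) (mor (LKan H) Y Y' f \<circ> LKan_pt H Y)"
  proof (rule continuous_map_from_sum)
    fix k
    let ?A = "\<lambda>Y. kprod (level Y k) (simplex_top k)"
    have "continuous_map (?A Y) (?A Y') (\<lambda>(v, t). (push f k v, t))"
      by (intro continuous_map_kprod continuous_map_push[OF f]) simp
    moreover have "continuous_map (?A Y') (total Y') (\<lambda>p. (k, p))"
      by (rule continuous_map_component_injection) simp
    moreover have "continuous_map (total Y') (fst (ob (LKan H) Y')) (LKan_pt H Y')"
      unfolding LKan_ob by (rule continuous_map_coinduced)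
    ultimately have "continuous_map (?A Y) (fst (ob (LKan H) Y')) (LKan_pt H Y' \<circ> ((\<lambda>p. (k, p)) \<circ> (\<lambda>(v, t). (push f k v, t))))"
      by (intro continuous_map_compose)
    then show "continuous_map (?A Y) (fst (ob (LKan H) Y')) (\<lambda>x. (mor (LKan H) Y Y' f \<circ> LKan_pt H Y) (k, x))"
    proof (rule continuous_map_eq)
      fix x assume x: "x \<in> topspace (?A Y)"
      obtain v t where vt: "x = (v, t)" by (cases x)
      have "LKan_pt H Y (k, v, t) \<in> topspace (fst (ob (LKan H) Y))"
        unfolding topspace_LKan using x vt by (intro imageI) auto
      from LKan_mor[OF f this] show "(LKan_pt H Y' \<circ> ((\<lambda>p. (k, p)) \<circ> (\<lambda>(v, t). (push f k v, t)))) x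
          = (mor (LKan H) Y Y' f \<circ> LKan_pt H Y) (k, x)"
        by (simp add: vt push_total_def)
    qed
  qed
  then show "continuous_map (fst (ob (LKan H) Y)) (fst (ob (LKan H) Y')) (mor (LKan H) Y Y' f)"
    unfolding LKan_ob[of Y] continuous_map_from_coinduced .
next
  fix Y :: "'u pspace" and a assume Y: "pointed_space Y" and a: "a \<in> topspace (fst (ob (LKan H) Y))"
  obtain k p c y g t where *: "(p, c) \<in> nerve Fin k" "y \<in> topspace (fst (ob D (p 0)))" "g \<in> topspace (fin_maps Y (p k))"
    "t \<in> topspace (simplex_top k)" "a = LKan_pt H Y (k, wedge_pt D ((p, c), y, g), t)"
    using a by (rule LKan_pointE)
  have "compose {..p k} (Idn Spaces Y) g = g"
    using *(3) by (auto simp: compose_def topspace_fin_maps Spaces_def PiE_iff extensional_def fun_eq_iff)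
  then show "mor (LKan H) Y Y (Idn Spaces Y) a = a"
    unfolding *(5) LKan_mor_pt[OF Idn_pmaps[OF pointed_spaceD(1)[OF Y]] *(1-4)] by simp
next
  fix X Y Z :: "'u pspace" and f g a
  assume X: "pointed_space X" and f: "f \<in> pmaps X Y" and g: "g \<in> pmaps Y Z" and a: "a \<in> topspace (fst (ob (LKan H) X))"
  obtain k p c y w t where *: "(p, c) \<in> nerve Fin k" "y \<in> topspace (fst (ob D (p 0)))" "w \<in> topspace (fin_maps X (p k))"
    "t \<in> topspace (simplex_top k)" "a = LKan_pt H X (k, wedge_pt D ((p, c), y, w), t)"
    using a by (rule LKan_pointE)
  have "compose {..p k} (compose (topspace (fst X)) g f) w = compose {..p k} g (compose {..p k} f w)"
    using *(3) by (auto simp: compose_def topspace_fin_maps PiE_iff fun_eq_iff)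
  then show "mor (LKan H) X Z (compose (topspace (fst X)) g f) a = mor (LKan H) Y Z g (mor (LKan H) X Y f a)"
    unfolding *(5) LKan_mor_pt[OF pmaps_compose[OF f g pointed_spaceD(1)[OF X]] *(1-4)] LKan_mor_pt[OF f *(1-4)]
      LKan_mor_pt[OF g *(1,2) compose_fin_maps[OF f *(3)] *(4)] by simp
qed

section \<open>The counit of the left Kan extension\<close>

definition fin_map_ext :: "nat \<Rightarrow> (nat \<Rightarrow> 'u) \<Rightarrow> 'u \<Rightarrow> 'u" where
  "fin_map_ext n g = (\<lambda>x\<in>enc ` {..n}. g (dec x))"

lemma fin_map_ext_pmaps:
  assumes "g \<in> topspace (fin_maps Y n)" shows "fin_map_ext n g \<in> pmaps (ob finite_set_ob n) Y"
  using assms by (auto simp: pmaps_def fin_map_ext_def finite_set_ob_simps topspace_fin_maps dec_enc_nat PiE_iff)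

lemma fin_map_ext_compose:
  assumes "f \<in> Hom Fin m n"
  shows "fin_map_ext m (compose {..m} g f)
     = compose (topspace (fst (ob finite_set_ob m))) (fin_map_ext n g) (mor finite_set_ob m n f)"
  using assms by (auto simp: fin_map_ext_def compose_def finite_set_ob_simps dec_enc_nat Fin_def PiE_iff intro!: restrict_ext)

text \<open>The coend relation: an arrow of finite sets may be absorbed either into the map to
  \<open>Y\<close> or into the coefficient. This makes the evaluation of a coefficient along a map
  well defined.\<close>

lemma fin_map_ext_mor:
  assumes f: "f \<in> Hom Fin m n" and g: "g \<in> topspace (fin_maps Y n)" and Y: "pointed_space Y"
    and y: "y \<in> topspace (fst (ob D m))"
  shows "mor H (ob finite_set_ob m) Y (fin_map_ext m (compose {..m} g f)) y
     = mor H (ob finite_set_ob n) Y (fin_map_ext n g) (mor D m n f y)"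
proof -
  have m: "mor finite_set_ob m n f \<in> pmaps (ob finite_set_ob m :: 'u pspace) (ob finite_set_ob n)"
    by (rule functor_mor[OF is_functor_finite_set_ob _ _ f]) (simp_all add: Fin_def)
  from spaces_functorD(4)[OF H pointed_space_finite_set_ob pointed_space_finite_set_ob Y m fin_map_ext_pmaps[OF g]]
  show ?thesis
    unfolding fin_map_ext_compose[OF f] using y by (simp add: after_functor_def compose_eq)
qed

definition counit_total :: "'u pspace \<Rightarrow> nat \<times> (nat, nat \<Rightarrow> nat, 'u, nat \<Rightarrow> 'u) bar_elt \<times> (nat \<Rightarrow> real) \<Rightarrow> 'u" where
  "counit_total Y = (\<lambda>(k, v, t). case v of None \<Rightarrow> snd (ob H Y)
      | Some ((p, c), y, g) \<Rightarrow> mor H (ob finite_set_ob (p 0)) Y (\<lambda>x\<in>enc ` {..p 0}. g (c 0 k (dec x))) y)"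

text \<open>Carrying the coefficient first to the last object of the chain, and then to
  \<open>Y\<close>, gives a formula that is valid for the basepoint too and in which the simplicial
  operators can be followed.\<close>

lemma counit_total_wedge_pt:
  assumes Y: "pointed_space Y"
    and s: "(p, c) \<in> nerve Fin k" "y \<in> topspace (fst (ob D (p 0)))" "g \<in> topspace (fin_maps Y (p k))"
  shows "counit_total Y (k, wedge_pt D ((p, c), y, g), t)
     = mor H (ob finite_set_ob (p k)) Y (fin_map_ext (p k) g) (mor D (p 0) (p k) (c 0 k) y)"
proof -
  have c: "c 0 k \<in> Hom Fin (p 0) (p k)" by (rule nerve_hom[OF s(1)]) auto
  show ?thesis
  proof (cases "y = snd (ob D (p 0))")
    case True
    have "mor H (ob finite_set_ob (p k)) Y (fin_map_ext (p k) g) \<in> pmaps (ob H (ob finite_set_ob (p k))) (ob H Y)"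
      by (rule spaces_functorD(2)[OF H pointed_space_finite_set_ob Y fin_map_ext_pmaps[OF s(3)]])
    then have "mor H (ob finite_set_ob (p k)) Y (fin_map_ext (p k) g) (snd (ob D (p k))) = snd (ob H Y)"
      by (simp add: pmaps_def after_functor_def)
    then show ?thesis using True D_mor_base[OF c] by (simp add: counit_total_def wedge_pt_def)
  next
    case False
    have "(\<lambda>x\<in>enc ` {..p 0}. g (c 0 k (dec x))) = fin_map_ext (p 0) (compose {..p 0} g (c 0 k))"
      by (auto simp: fin_map_ext_def compose_def dec_enc_nat intro!: restrict_ext)
    then show ?thesis
      using False fin_map_ext_mor[OF c s(3) Y s(2)] by (simp add: counit_total_def wedge_pt_def)
  qed
qed

lemma chain_pull_nerve:
  assumes s: "(p, c) \<in> nerve Fin k" and \<theta>: "mono_on {..m} \<theta>" "\<theta> ` {..m} \<subseteq> {..k}"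
  shows "chain_pull m \<theta> (p, c) \<in> nerve Fin m"
proof -
  have \<theta>m: "\<theta> i \<le> \<theta> j" "\<theta> j \<le> k" if "i \<le> j" "j \<le> m" for i j
    using that \<theta> by (auto simp: mono_on_def)
  have id: "c i i = Idn Fin (p i)" if "i \<le> k" for i using s that by (simp add: nerve_def)
  show ?thesis
    unfolding nerve_def chain_pull_def fst_conv snd_conv mem_Collect_eq case_prod_conv
  proof (intro conjI allI impI)
    show "(\<lambda>i\<in>{..m}. p (\<theta> i)) \<in> {..m} \<rightarrow>\<^sub>E Obj Fin" by (simp add: Fin_def)
  next
    fix i j assume "i \<le> j \<and> j \<le> m"
    then show "(if i \<le> j \<and> j \<le> m then c (\<theta> i) (\<theta> j) else undefined)
        \<in> Hom Fin ((\<lambda>i\<in>{..m}. p (\<theta> i)) i) ((\<lambda>i\<in>{..m}. p (\<theta> i)) j)"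
      using nerve_hom[OF s \<theta>m[of i j]] by simp
  next
    fix i assume "i \<le> m"
    then show "(if i \<le> i \<and> i \<le> m then c (\<theta> i) (\<theta> i) else undefined) = Idn Fin ((\<lambda>i\<in>{..m}. p (\<theta> i)) i)"
      using id[OF \<theta>m(2)[of i i]] by simp
  next
    fix i j l assume "i \<le> j \<and> j \<le> l \<and> l \<le> m"
    then show "(if i \<le> l \<and> l \<le> m then c (\<theta> i) (\<theta> l) else undefined)
        = Cmp Fin ((\<lambda>i\<in>{..m}. p (\<theta> i)) i) ((\<lambda>i\<in>{..m}. p (\<theta> i)) j) ((\<lambda>i\<in>{..m}. p (\<theta> i)) l)
            (if j \<le> l \<and> l \<le> m then c (\<theta> j) (\<theta> l) else undefined)
            (if i \<le> j \<and> j \<le> m then c (\<theta> i) (\<theta> j) else undefined)"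
      using nerve_comp[OF s \<theta>m(1)[of i j] \<theta>m[of j l]] by simp
  qed auto
qed

text \<open>A simplicial operator only splits the passage from 0 to \<open>k\<close> at
  \<open>\<theta> 0\<close> and \<open>\<theta> m\<close>, and puts the last segment into the map to
  \<open>Y\<close>. Functoriality joins the segments again, and \<open>fin_map_ext_mor\<close>
  brings the last one back.\<close>

lemma counit_total_rel:
  assumes Y: "pointed_space Y" and r: "realization_rel (level Y) pull a b"
  shows "counit_total Y a = counit_total Y b"
proof -
  obtain m k \<theta> v t where *: "mono_on {..m} \<theta>" "\<theta> ` {..m} \<subseteq> {..k}" "v \<in> topspace (level Y k)"
    "a = (m, pull m k \<theta> v, t)" "b = (k, v, simplex_push m \<theta> t)"
    using r unfolding realization_rel_def by blast
  obtain p c y g where s: "(p, c) \<in> nerve Fin k" "y \<in> topspace (fst (ob D (p 0)))" "g \<in> topspace (fin_maps Y (p k))"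
      "v = wedge_pt D ((p, c), y, g)"
    using *(3) by (rule levelE)
  have \<theta>k: "\<theta> 0 \<le> \<theta> m" "\<theta> m \<le> k" "\<theta> 0 \<le> k" using *(1,2) by (auto simp: mono_on_def)
  have c0: "c 0 (\<theta> 0) \<in> Hom Fin (p 0) (p (\<theta> 0))" and c1: "c (\<theta> 0) (\<theta> m) \<in> Hom Fin (p (\<theta> 0)) (p (\<theta> m))"
    and c2: "c (\<theta> m) k \<in> Hom Fin (p (\<theta> m)) (p k)" and c3: "c 0 (\<theta> m) \<in> Hom Fin (p 0) (p (\<theta> m))"
    using \<theta>k by (auto intro!: nerve_hom[OF s(1)])
  obtain p' c' where pc': "chain_pull m \<theta> (p, c) = (p', c')" by (cases "chain_pull m \<theta> (p, c)")
  have pc: "p' 0 = p (\<theta> 0)" "p' m = p (\<theta> m)" "c' 0 m = c (\<theta> 0) (\<theta> m)"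
    using pc' by (auto simp: chain_pull_def)
  let ?y = "mor D (p 0) (p (\<theta> 0)) (c 0 (\<theta> 0)) y" and ?g = "compose {..p (\<theta> m)} g (c (\<theta> m) k)"
  have y': "?y \<in> topspace (fst (ob D (p' 0)))" unfolding pc by (rule D_mor_in[OF c0 s(2)])
  have g': "?g \<in> topspace (fin_maps Y (p' m))"
    using s(3) c2 unfolding pc by (auto simp: topspace_fin_maps compose_def PiE_iff Fin_def)
  have "counit_total Y a = mor H (ob finite_set_ob (p' m)) Y (fin_map_ext (p' m) ?g) (mor D (p' 0) (p' m) (c' 0 m) ?y)"
    unfolding *(4) s(4) pull_wedge_pt[OF s(1,2) *(1,2)] pc'
    by (rule counit_total_wedge_pt[OF Y chain_pull_nerve[OF s(1) *(1,2), unfolded pc'] y' g'])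
  also have "mor D (p' 0) (p' m) (c' 0 m) ?y = mor D (p 0) (p (\<theta> m)) (c 0 (\<theta> m)) y"
    unfolding pc D_comp[OF c0 c1 s(2), symmetric] using \<theta>k nerve_comp[OF s(1), of 0 "\<theta> 0" "\<theta> m"] by simp
  also have "mor H (ob finite_set_ob (p' m)) Y (fin_map_ext (p' m) ?g) (mor D (p 0) (p (\<theta> m)) (c 0 (\<theta> m)) y)
      = mor H (ob finite_set_ob (p k)) Y (fin_map_ext (p k) g) (mor D (p (\<theta> m)) (p k) (c (\<theta> m) k) (mor D (p 0) (p (\<theta> m)) (c 0 (\<theta> m)) y))"
    unfolding pc by (rule fin_map_ext_mor[OF c2 s(3) Y D_mor_in[OF c3 s(2)]])
  also have "mor D (p (\<theta> m)) (p k) (c (\<theta> m) k) (mor D (p 0) (p (\<theta> m)) (c 0 (\<theta> m)) y) = mor D (p 0) (p k) (c 0 k) y"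
    unfolding D_comp[OF c3 c2 s(2), symmetric] using \<theta>k nerve_comp[OF s(1), of 0 "\<theta> m" k] by simp
  also have "mor H (ob finite_set_ob (p k)) Y (fin_map_ext (p k) g) (mor D (p 0) (p k) (c 0 k) y) = counit_total Y b"
    unfolding *(5) s(4) by (rule counit_total_wedge_pt[OF Y s(1-3), symmetric])
  finally show ?thesis .
qed

text \<open>The counit is computed from the representative chosen by \<open>dec\<close>; invariance
  along chains of the generating relation allows any representative.\<close>

lemma LKan_counit_pt:
  assumes Y: "pointed_space Y"
  shows "LKan_counit H Y (LKan_pt H Y a) = counit_total Y a"
proof -
  have "LKan_counit H Y b = counit_total Y (dec b)" for b
    by (simp add: LKan_counit_def counit_total_def)
  moreover have "counit_total Y a = counit_total Y (dec (LKan_pt H Y a))"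
    using dec_LKan_pt[of Y a]
  proof (induction rule: equivclp_induct)
    case (step y z)
    then show ?case using counit_total_rel[OF Y] by metis
  qed auto
  ultimately show ?thesis by simp
qed

lemma LKan_counit_natural:
  assumes Y: "pointed_space Y" and Y': "pointed_space Y'" and f: "f \<in> pmaps Y Y'"
    and a: "a \<in> topspace (fst (ob (LKan H) Y))"
  shows "LKan_counit H Y' (mor (LKan H) Y Y' f a) = mor H Y Y' f (LKan_counit H Y a)"
proof -
  obtain k p c y g t where *: "(p, c) \<in> nerve Fin k" "y \<in> topspace (fst (ob D (p 0)))" "g \<in> topspace (fin_maps Y (p k))"
    "t \<in> topspace (simplex_top k)" "a = LKan_pt H Y (k, wedge_pt D ((p, c), y, g), t)"
    using a by (rule LKan_pointE)
  have c: "c 0 k \<in> Hom Fin (p 0) (p k)" by (rule nerve_hom[OF *(1)]) auto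
  have "fin_map_ext (p k) (compose {..p k} f g) = compose (topspace (fst (ob finite_set_ob (p k)))) f (fin_map_ext (p k) g)"
    by (auto simp: fin_map_ext_def compose_def finite_set_ob_simps dec_enc_nat intro!: restrict_ext)
  moreover have "mor D (p 0) (p k) (c 0 k) y \<in> topspace (fst (ob H (ob finite_set_ob (p k))))"
    using D_mor_in[OF c *(2)] by (simp add: after_functor_def)
  ultimately have "mor H (ob finite_set_ob (p k)) Y' (fin_map_ext (p k) (compose {..p k} f g)) (mor D (p 0) (p k) (c 0 k) y)
      = mor H Y Y' f (mor H (ob finite_set_ob (p k)) Y (fin_map_ext (p k) g) (mor D (p 0) (p k) (c 0 k) y))"
    using spaces_functorD(4)[OF H pointed_space_finite_set_ob Y Y' fin_map_ext_pmaps[OF *(3)] f]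
    by (simp add: compose_eq)
  then show ?thesis
    unfolding *(5) LKan_mor_pt[OF f *(1-4)] LKan_counit_pt[OF Y] LKan_counit_pt[OF Y']
      counit_total_wedge_pt[OF Y *(1-3)] counit_total_wedge_pt[OF Y' *(1,2) compose_fin_maps[OF f *(3)]] .
qed

end

section \<open>Pointwise rules for homotopy limits; k-spaces; maps that agree on the carrier\<close>

lemma cube_holim_point:
  fixes G :: "nat set \<Rightarrow> 'u::universe pspace"
  assumes a: "a \<in> topspace (fst (cube_holim n G g))"
  shows "\<And>U t. U \<in> nonempty_subsets n \<Longrightarrow> t \<in> simplex_face U \<Longrightarrow> dec a U t \<in> topspace (fst (G U))"
    and "a = enc (\<lambda>U\<in>nonempty_subsets n. \<lambda>t\<in>simplex_face U. dec a U t :: 'u)"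
proof -
  note p = continuous_map_from_holim[of "fst (cube_holim n G g)" n G g id, OF continuous_map_id]
  show "dec a U t \<in> topspace (fst (G U))" if "U \<in> nonempty_subsets n" "t \<in> simplex_face U" for U t
    using continuous_map_in_topspace[OF p(1)[OF that(1)], of "(a, t)"] a that(2) by simp
  show "a = enc (\<lambda>U\<in>nonempty_subsets n. \<lambda>t\<in>simplex_face U. dec a U t :: 'u)" using p(3)[OF a] by simp
qed

lemma cube_map_cong:
  assumes "a \<in> topspace (fst (cube_holim n G g))"
    and "\<And>U x. U \<in> nonempty_subsets n \<Longrightarrow> x \<in> topspace (fst (G U)) \<Longrightarrow> e U x = e' U x"
  shows "cube_map n e a = cube_map n e' a"
  using cube_holim_point(1)[OF assms(1)] assms(2)
  unfolding cube_map_def by (intro arg_cong[of _ _ enc] restrict_ext) blast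

lemma cube_map_compose: "cube_map n e (cube_map n e' a) = cube_map n (\<lambda>U x. e U (e' U x)) a"
  unfolding cube_map_def dec_enc[OF inj_enc_cube_points]
  by (intro arg_cong[of _ _ enc] restrict_ext) simp

lemma cube_map_id:
  assumes "a \<in> topspace (fst (cube_holim n G g))"
    and "\<And>U x. U \<in> nonempty_subsets n \<Longrightarrow> x \<in> topspace (fst (G U)) \<Longrightarrow> e U x = x"
  shows "cube_map n e a = a"
proof -
  have "cube_map n e a = cube_map n (\<lambda>U x. x) a" by (rule cube_map_cong[OF assms])
  then show ?thesis using cube_holim_point(2)[OF assms(1)] by (simp add: cube_map_def)
qed

lemma k_space_cube_holim: "k_space (fst (cube_holim n G g))"
  unfolding cube_holim_def fst_conv by (rule k_space_quotient_map_image[OF quotient_map_coinduced]) simp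

text \<open>The identity into the k-ification is continuous on each summand, hence on the sum, which
  thus already has the k-ified topology.\<close>

lemma k_space_sum_topology:
  assumes "\<And>i. i \<in> I \<Longrightarrow> k_space (X i)" shows "k_space (sum_topology X I)"
proof -
  let ?S = "sum_topology X I"
  have "continuous_map ?S (kification ?S) (\<lambda>x. x)"
  proof (rule continuous_map_from_sum)
    fix i assume i: "i \<in> I"
    show "continuous_map (X i) (kification ?S) (\<lambda>x. (i, x))"
      unfolding continuous_map_into_kification[OF assms[OF i]] by (rule continuous_map_component_injection[OF i])
  qed
  moreover have "continuous_map (kification ?S) ?S (\<lambda>x. x)"
    by (rule continuous_map_from_kification) simp
  ultimately have "homeomorphic_maps ?S (kification ?S) (\<lambda>x. x) (\<lambda>x. x)"
    by (simp add: homeomorphic_maps_def)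
  then have "quotient_map (kification ?S) ?S (\<lambda>x. x)"
    using homeomorphic_maps_sym homeomorphic_maps_map homeomorphic_map_def by metis
  then show ?thesis by (rule k_space_quotient_map_image) simp
qed

lemma weak_equivalence_in_topspace:
  "weak_equivalence X Y f \<Longrightarrow> x \<in> topspace X \<Longrightarrow> f x \<in> topspace Y"
  unfolding weak_equivalence_def by (blast intro: continuous_map_in_topspace)

text \<open>\<open>f\<close> and \<open>f'\<close> may differ outside the carrier, so that
  \<open>pi_map\<close> is formed with different functions. The lifting criterion sees only values
  on the carrier.\<close>

lemma weak_equivalence_cong:
  assumes w: "weak_equivalence X Y f" and eq: "\<And>x. x \<in> topspace X \<Longrightarrow> f x = f' x"
  shows "weak_equivalence X Y f'"
proof (rule lifting_imp_weak_equivalence)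
  have c: "continuous_map X Y f" and l: "lifting f X Y (cube n) (cube_boundary n)" for n
    using w unfolding weak_equivalence_iff_lifting by auto
  show "continuous_map X Y f'" by (rule continuous_map_eq[OF c eq])
  show "lifting f' X Y (cube n) (cube_boundary n)" for n
    unfolding lifting_def
  proof (intro allI impI)
    fix a b assume a: "continuous_map (subtopology (cube n) (cube_boundary n)) X a" and b: "continuous_map (cube n) Y b"
      and ab: "\<forall>x\<in>cube_boundary n. f' (a x) = b x"
    have "f (a x) = b x" if "x \<in> cube_boundary n" for x
      using continuous_map_in_topspace[OF a, of x] that cube_boundary_subset[of n] eq ab by auto
    then have "solv f X Y (cube n) (cube_boundary n) a b" using l a b unfolding lifting_def by blast
    then obtain A H where A: "continuous_map (cube n) X A" "\<forall>x\<in>cube_boundary n. A x = a x"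
      and H: "continuous_map (cyl (cube n)) Y H" "\<forall>t\<in>{0..1}. \<forall>x\<in>cube_boundary n. H (t, x) = b x"
        "\<forall>x\<in>topspace (cube n). H (0, x) = f (A x) \<and> H (1, x) = b x"
      unfolding solv_def by blast
    have "f (A x) = f' (A x)" if "x \<in> topspace (cube n)" for x
      by (rule eq[OF continuous_map_in_topspace[OF A(1) that]])
    then show "solv f' X Y (cube n) (cube_boundary n) a b"
      unfolding solv_def using A H by (intro exI[of _ A] exI[of _ H]) simp
  qed
qed

section \<open>Natural weak equivalences and \<open>T\<^sub>n\<close>\<close>

text \<open>Extensional maps that agree on the carrier are equal, so an equation between points of
  \<open>A\<close> and \<open>C\<close> becomes one between the induced maps.\<close>

lemma top_functor_comp:
  assumes F: "top_functor F" and P: "pointed_space A" "pointed_space B" "pointed_space C"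
    and f: "f \<in> pmaps A B" and g: "g \<in> pmaps B C" and h: "h \<in> pmaps A C"
    and eq: "\<And>x. x \<in> topspace (fst A) \<Longrightarrow> g (f x) = h x" and a: "a \<in> topspace (fst (ob F A))"
  shows "mor F B C g (mor F A B f a) = mor F A C h a"
proof -
  have "compose (topspace (fst A)) g f = h"
    by (rule pmaps_eqI[OF pmaps_compose[OF f g pointed_spaceD(1)[OF P(1)]] h]) (simp add: compose_eq eq)
  then show ?thesis using top_functorD(3)[OF F P f g a] by simp
qed

lemma top_functor_square:
  assumes F: "top_functor F" and P: "pointed_space A" "pointed_space B" "pointed_space C" "pointed_space D"
    and f: "f \<in> pmaps A B" "g \<in> pmaps B D" "f' \<in> pmaps A C" "g' \<in> pmaps C D"
    and eq: "\<And>x. x \<in> topspace (fst A) \<Longrightarrow> g (f x) = g' (f' x)" and a: "a \<in> topspace (fst (ob F A))"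
  shows "mor F B D g (mor F A B f a) = mor F C D g' (mor F A C f' a)"
proof -
  have "compose (topspace (fst A)) g' f' \<in> pmaps A D" by (rule pmaps_compose[OF f(3,4) pointed_spaceD(1)[OF P(1)]])
  from top_functor_comp[OF F P(1,2,4) f(1,2) this _ a] show ?thesis
    using top_functorD(3)[OF F P(1,3,4) f(3,4) a] by (simp add: compose_eq eq)
qed

lemma top_functor_ident:
  assumes F: "top_functor F" and A: "pointed_space A" and f: "f \<in> pmaps A A"
    and eq: "\<And>x. x \<in> topspace (fst A) \<Longrightarrow> f x = x" and a: "a \<in> topspace (fst (ob F A))"
  shows "mor F A A f a = a"
proof -
  have "f = Idn Spaces A"
    by (rule pmaps_eqI[OF f Idn_pmaps[OF pointed_spaceD(1)[OF A]]]) (simp add: Spaces_def eq)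
  then show ?thesis using top_functorD(2)[OF F A a] by simp
qed

text \<open>Made extensional, the inverse is a morphism of pointed spaces, and functoriality makes
  the two induced maps inverse to each other.\<close>

lemma weak_equivalence_mor_homeomorphic:
  assumes F: "top_functor F" and X: "pointed_space X" and Y: "pointed_space Y"
    and f: "f \<in> pmaps X Y" and h: "homeomorphic_map (fst X) (fst Y) f"
  shows "weak_equivalence (fst (ob F X)) (fst (ob F Y)) (mor F X Y f)"
proof -
  obtain g' where g': "homeomorphic_maps (fst X) (fst Y) f g'" using h homeomorphic_map_maps by blast
  define g where "g = (\<lambda>y\<in>topspace (fst Y). g' y)"
  have X0: "snd X \<in> topspace (fst X)" and Y0: "snd Y \<in> topspace (fst Y)" by (rule pointed_spaceD(1)[OF X] pointed_spaceD(1)[OF Y])+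
  have f0: "f (snd X) = snd Y" using f by (simp add: pmaps_def)
  have "g' (snd Y) = snd X" using g' X0 f0 unfolding homeomorphic_maps_def by metis
  then have g: "g \<in> pmaps Y X"
    unfolding g_def using g' Y0 by (intro restrict_pmaps) (auto simp: pointed_map_def homeomorphic_maps_def)
  have fY: "x \<in> topspace (fst X) \<Longrightarrow> f x \<in> topspace (fst Y)" for x
    by (rule pointed_map_in[OF pmaps_pointed_map[OF f]])
  have gf: "x \<in> topspace (fst X) \<Longrightarrow> g (f x) = x" and fg: "y \<in> topspace (fst Y) \<Longrightarrow> f (g y) = y" for x y
    using g' fY[of x] by (auto simp: g_def homeomorphic_maps_def)
  have "homeomorphic_maps (fst (ob F X)) (fst (ob F Y)) (mor F X Y f) (mor F Y X g)"
    unfolding homeomorphic_maps_def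
  proof (intro conjI ballI)
    show "continuous_map (fst (ob F X)) (fst (ob F Y)) (mor F X Y f)" by (rule top_functorD(1)[OF F X Y f])
    show "continuous_map (fst (ob F Y)) (fst (ob F X)) (mor F Y X g)" by (rule top_functorD(1)[OF F Y X g])
    fix a assume a: "a \<in> topspace (fst (ob F X))"
    have "mor F Y X g (mor F X Y f a) = mor F X X (Idn Spaces X) a"
      by (rule top_functor_comp[OF F X Y X f g Idn_pmaps[OF X0] _ a]) (simp add: Spaces_def gf)
    then show "mor F Y X g (mor F X Y f a) = a" using top_functorD(2)[OF F X a] by simp
  next
    fix a assume a: "a \<in> topspace (fst (ob F Y))"
    have "mor F X Y f (mor F Y X g a) = mor F Y Y (Idn Spaces Y) a"
      by (rule top_functor_comp[OF F Y X Y g f Idn_pmaps[OF Y0] _ a]) (simp add: Spaces_def fg)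
    then show "mor F X Y f (mor F Y X g a) = a" using top_functorD(2)[OF F Y a] by simp
  qed
  then show ?thesis by (rule homeomorphic_weak_equivalence)
qed

text \<open>The k-space condition is what makes \<open>T_unit\<close> continuous: its target carries
  a k-ified topology.\<close>

definition k_functor :: "'u space_functor \<Rightarrow> bool" where
  "k_functor F \<longleftrightarrow> top_functor F \<and> (\<forall>X. pointed_space X \<longrightarrow> k_space (fst (ob F X)))"

definition natural_equivalence :: "'u space_functor \<Rightarrow> 'u space_functor \<Rightarrow> ('u pspace \<Rightarrow> 'u \<Rightarrow> 'u) \<Rightarrow> bool" where
  "natural_equivalence F G \<eta> \<longleftrightarrow>
     (\<forall>X. pointed_space X \<longrightarrow> weak_equivalence (fst (ob F X)) (fst (ob G X)) (\<eta> X))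
   \<and> (\<forall>X Y f. pointed_space X \<longrightarrow> pointed_space Y \<longrightarrow> f \<in> pmaps X Y \<longrightarrow>
        (\<forall>a\<in>topspace (fst (ob F X)). \<eta> Y (mor F X Y f a) = mor G X Y f (\<eta> X a)))"

lemma natural_equivalenceD:
  assumes "natural_equivalence F G \<eta>"
  shows "\<And>X. pointed_space X \<Longrightarrow> weak_equivalence (fst (ob F X)) (fst (ob G X)) (\<eta> X)"
    and "\<And>X Y f a. pointed_space X \<Longrightarrow> pointed_space Y \<Longrightarrow> f \<in> pmaps X Y \<Longrightarrow> a \<in> topspace (fst (ob F X))
      \<Longrightarrow> \<eta> Y (mor F X Y f a) = mor G X Y f (\<eta> X a)"
    and "\<And>X a. pointed_space X \<Longrightarrow> a \<in> topspace (fst (ob F X)) \<Longrightarrow> \<eta> X a \<in> topspace (fst (ob G X))"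
proof -
  show w: "weak_equivalence (fst (ob F X)) (fst (ob G X)) (\<eta> X)" if "pointed_space X" for X
    using assms that unfolding natural_equivalence_def by blast
  show "\<eta> Y (mor F X Y f a) = mor G X Y f (\<eta> X a)"
    if "pointed_space X" "pointed_space Y" "f \<in> pmaps X Y" "a \<in> topspace (fst (ob F X))" for X Y f a
    using assms that unfolding natural_equivalence_def by blast
  show "\<eta> X a \<in> topspace (fst (ob G X))" if "pointed_space X" "a \<in> topspace (fst (ob F X))" for X a
    by (rule weak_equivalence_in_topspace[OF w[OF that(1)] that(2)])
qed

lemma top_functor_after_smash:
  assumes F: "top_functor F" and X: "pointed_space X"
  shows "top_functor (after_functor F (smash_functor X))"
proof -
  note s = spaces_functorD[OF is_functor_smash[OF X]]
  show ?thesis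
    unfolding top_functor_def
  proof (intro conjI allI impI ballI)
    fix A B :: "'a pspace" and f assume *: "pointed_space A" "pointed_space B" "f \<in> pmaps A B"
    show "continuous_map (fst (ob (after_functor F (smash_functor X)) A)) (fst (ob (after_functor F (smash_functor X)) B))
        (mor (after_functor F (smash_functor X)) A B f)"
      using top_functorD(1)[OF F s(1)[OF *(1)] s(1)[OF *(2)] s(2)[OF *]] by (simp add: after_functor_def)
  next
    fix A :: "'a pspace" and a assume "pointed_space A" "a \<in> topspace (fst (ob (after_functor F (smash_functor X)) A))"
    then show "mor (after_functor F (smash_functor X)) A A (Idn Spaces A) a = a"
      using top_functorD(2)[OF F s(1)] s(3) by (simp add: after_functor_def)
  next
    fix A B C :: "'a pspace" and f g a
    assume *: "pointed_space A" "pointed_space B" "pointed_space C" "f \<in> pmaps A B" "g \<in> pmaps B C"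
      "a \<in> topspace (fst (ob (after_functor F (smash_functor X)) A))"
    show "mor (after_functor F (smash_functor X)) A C (compose (topspace (fst A)) g f) a
        = mor (after_functor F (smash_functor X)) B C g (mor (after_functor F (smash_functor X)) A B f a)"
      using top_functorD(3)[OF F s(1) s(1) s(1) s(2) s(2)] * s(4)[OF *(1-5)] by (simp add: after_functor_def)
  qed
qed

lemma join_map_id_pmaps: "pointed_space X \<Longrightarrow> U \<subseteq> V \<Longrightarrow> join_map X U X id \<in> pmaps (pjoin X U) (pjoin X V)"
  by (rule join_map_pmaps[OF _ pointed_map_id])

lemma join_map_compose:
  assumes f: "pointed_map X Y f" and g: "pointed_map Y Z g" and h: "pointed_map X Z h" and UV: "U \<subseteq> V"
    and eq: "\<And>x. x \<in> topspace (fst X) \<Longrightarrow> g (f x) = h x" and a: "a \<in> topspace (fst (pjoin X U))"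
  shows "join_map Y V Z g (join_map X U Y f a) = join_map X U Z h a"
proof -
  obtain x s where xs: "x \<in> topspace (fst X)" "s \<in> topspace (cone_star U)" "a = join_pt X x s"
    using a by (rule pjoin_pointE)
  have "s \<in> topspace (cone_star V)" using xs(2) cone_star_mono[OF UV] by blast
  then show ?thesis
    unfolding xs(3) join_map_pt[OF f xs(1,2)] join_map_pt[OF h xs(1,2)]
    using join_map_pt[OF g pointed_map_in[OF f xs(1)]] eq[OF xs(1)] by simp
qed

lemma join_map_ident:
  assumes f: "pointed_map X X f" and eq: "\<And>x. x \<in> topspace (fst X) \<Longrightarrow> f x = x" and a: "a \<in> topspace (fst (pjoin X U))"
  shows "join_map X U X f a = a"
proof -
  obtain x s where xs: "x \<in> topspace (fst X)" "s \<in> topspace (cone_star U)" "a = join_pt X x s"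
    using a by (rule pjoin_pointE)
  show ?thesis unfolding xs(3) join_map_pt[OF f xs(1,2)] by (simp add: eq[OF xs(1)])
qed

lemma join_map_incl:
  assumes f: "pointed_map X Y f" and x: "x \<in> topspace (fst X)"
  shows "join_map X U Y f (join_incl X x) = join_incl Y (f x)"
  using join_map_pt[OF f x cone_star_zero[of U]] pointed_map_in[OF f x] x by (simp add: join_incl_def)

lemma pointed_space_join: "pointed_space X \<Longrightarrow> U \<in> nonempty_subsets n \<Longrightarrow> pointed_space (pjoin X U)"
  by (rule pointed_space_pjoin[OF _ finite_nonempty_subset])

section \<open>Functoriality of \<open>goodwillie_T\<close> and its unit\<close>

abbreviation join_cube_mor :: "'u::universe space_functor \<Rightarrow> 'u pspace \<Rightarrow> nat set \<Rightarrow> nat set \<Rightarrow> 'u \<Rightarrow> 'u" where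
  "join_cube_mor F X \<equiv> \<lambda>U V. mor F (pjoin X U) (pjoin X V) (join_map X U X id)"

lemma goodwillie_T_ob: "ob (goodwillie_T n F) X = cube_holim n (\<lambda>U. ob F (pjoin X U)) (join_cube_mor F X)"
  by (simp add: goodwillie_T_def Let_def)

lemma goodwillie_T_mor:
  "a \<in> topspace (fst (ob (goodwillie_T n F) X)) \<Longrightarrow>
    mor (goodwillie_T n F) X Y f a = cube_map n (\<lambda>U. mor F (pjoin X U) (pjoin Y U) (join_map X U Y f)) a"
  by (simp add: goodwillie_T_def Let_def)

lemma punctured_cube_join:
  assumes F: "top_functor F" and X: "pointed_space X"
  shows "punctured_cube n (\<lambda>U. ob F (pjoin X U)) (join_cube_mor F X)"
  unfolding punctured_cube_def
proof (intro conjI ballI impI)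
  note P = pointed_space_join[OF X]
  show "continuous_map (fst (ob F (pjoin X U))) (fst (ob F (pjoin X V))) (join_cube_mor F X U V)"
    if "U \<in> nonempty_subsets n" "V \<in> nonempty_subsets n" "U \<subseteq> V" for U V
    by (rule top_functorD(1)[OF F P[OF that(1)] P[OF that(2)] join_map_id_pmaps[OF X that(3)]])
  show "join_cube_mor F X U U x = x" if "U \<in> nonempty_subsets n" "x \<in> topspace (fst (ob F (pjoin X U)))" for U x
    by (rule top_functor_ident[OF F P[OF that(1)] join_map_id_pmaps[OF X subset_refl] _ that(2)])
      (rule join_map_ident[OF pointed_map_id], simp_all)
  show "join_cube_mor F X V W (join_cube_mor F X U V x) = join_cube_mor F X U W x"
    if "U \<in> nonempty_subsets n" "V \<in> nonempty_subsets n" "W \<in> nonempty_subsets n" "U \<subseteq> V" "V \<subseteq> W"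
      "x \<in> topspace (fst (ob F (pjoin X U)))" for U V W x
    by (rule top_functor_comp[OF F P[OF that(1)] P[OF that(2)] P[OF that(3)] join_map_id_pmaps[OF X that(4)]
          join_map_id_pmaps[OF X that(5)] join_map_id_pmaps[OF X order_trans[OF that(4,5)]] _ that(6)])
      (rule join_map_compose[OF pointed_map_id pointed_map_id pointed_map_id that(4)], simp_all)
qed

lemma join_cube_natural:
  assumes F: "top_functor F" and X: "pointed_space X" and Y: "pointed_space Y" and f: "f \<in> pmaps X Y"
    and U: "U \<in> nonempty_subsets n" and V: "V \<in> nonempty_subsets n" and UV: "U \<subseteq> V"
    and x: "x \<in> topspace (fst (ob F (pjoin X U)))"
  shows "mor F (pjoin X V) (pjoin Y V) (join_map X V Y f) (join_cube_mor F X U V x)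
    = join_cube_mor F Y U V (mor F (pjoin X U) (pjoin Y U) (join_map X U Y f) x)"
proof (rule top_functor_square[OF F pointed_space_join[OF X U] pointed_space_join[OF X V] pointed_space_join[OF Y U]
      pointed_space_join[OF Y V] _ _ _ _ _ x])
  have f': "pointed_map X Y f" by (rule pmaps_pointed_map[OF f])
  show "join_map X U X id \<in> pmaps (pjoin X U) (pjoin X V)" "join_map Y U Y id \<in> pmaps (pjoin Y U) (pjoin Y V)"
    by (rule join_map_id_pmaps[OF _ UV], rule X Y)+
  show "join_map X V Y f \<in> pmaps (pjoin X V) (pjoin Y V)" "join_map X U Y f \<in> pmaps (pjoin X U) (pjoin Y U)"
    by (rule join_map_pmaps[OF X f' subset_refl])+
  fix y assume y: "y \<in> topspace (fst (pjoin X U))"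
  have "join_map X V Y f (join_map X U X id y) = join_map X U Y f y"
    by (rule join_map_compose[OF pointed_map_id f' f' UV _ y]) simp
  also have "\<dots> = join_map Y U Y id (join_map X U Y f y)"
    by (rule join_map_compose[OF f' pointed_map_id f' subset_refl _ y, symmetric]) simp
  finally show "join_map X V Y f (join_map X U X id y) = join_map Y U Y id (join_map X U Y f y)" .
qed

lemma continuous_map_goodwillie_T:
  assumes F: "top_functor F" and X: "pointed_space X" and Y: "pointed_space Y" and f: "f \<in> pmaps X Y"
  shows "continuous_map (fst (ob (goodwillie_T n F) X)) (fst (ob (goodwillie_T n F) Y))
      (cube_map n (\<lambda>U. mor F (pjoin X U) (pjoin Y U) (join_map X U Y f)))"
  unfolding goodwillie_T_ob
proof (rule continuous_map_cube_map)
  fix U assume U: "U \<in> nonempty_subsets n"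
  show "continuous_map (fst (ob F (pjoin X U))) (fst (ob F (pjoin Y U)))
      (mor F (pjoin X U) (pjoin Y U) (join_map X U Y f))"
    by (rule top_functorD(1)[OF F pointed_space_join[OF X U] pointed_space_join[OF Y U]
          join_map_pmaps[OF X pmaps_pointed_map[OF f] subset_refl]])
  fix V x assume "V \<in> nonempty_subsets n" "U \<subseteq> V" "x \<in> topspace (fst (ob F (pjoin X U)))"
  then show "mor F (pjoin X V) (pjoin Y V) (join_map X V Y f) (join_cube_mor F X U V x)
      = join_cube_mor F Y U V (mor F (pjoin X U) (pjoin Y U) (join_map X U Y f) x)"
    by (rule join_cube_natural[OF F X Y f U])
qed

text \<open>Identities and composites are checked separately at each vertex of the cube, thanks to
  \<open>cube_map_compose\<close>. The values are k-spaces because \<open>cube_holim\<close> ends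
  with a k-ification.\<close>

lemma k_functor_goodwillie_T:
  assumes F: "top_functor F" shows "k_functor (goodwillie_T n F)"
  unfolding k_functor_def top_functor_def
proof (intro conjI allI impI ballI)
  fix X Y :: "'a pspace" and f assume "pointed_space X" "pointed_space Y" "f \<in> pmaps X Y"
  from continuous_map_goodwillie_T[OF F this]
  show "continuous_map (fst (ob (goodwillie_T n F) X)) (fst (ob (goodwillie_T n F) Y)) (mor (goodwillie_T n F) X Y f)"
    by (rule continuous_map_eq) (simp add: goodwillie_T_mor)
next
  fix X :: "'a pspace" and a assume X: "pointed_space X" and a: "a \<in> topspace (fst (ob (goodwillie_T n F) X))"
  have i: "pointed_map X X (Idn Spaces X)" by (rule pmaps_pointed_map[OF Idn_pmaps[OF pointed_spaceD(1)[OF X]]])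
  show "mor (goodwillie_T n F) X X (Idn Spaces X) a = a"
    unfolding goodwillie_T_mor[OF a]
  proof (rule cube_map_id[OF a[unfolded goodwillie_T_ob]])
    fix U x assume U: "U \<in> nonempty_subsets n" and x: "x \<in> topspace (fst (ob F (pjoin X U)))"
    show "mor F (pjoin X U) (pjoin X U) (join_map X U X (Idn Spaces X)) x = x"
      by (rule top_functor_ident[OF F pointed_space_join[OF X U] join_map_pmaps[OF X i subset_refl] _ x])
        (rule join_map_ident[OF i], simp_all add: Spaces_def)
  qed
next
  fix X Y Z :: "'a pspace" and f g a
  assume X: "pointed_space X" and Y: "pointed_space Y" and Z: "pointed_space Z" and f: "f \<in> pmaps X Y" and g: "g \<in> pmaps Y Z"
    and a: "a \<in> topspace (fst (ob (goodwillie_T n F) X))"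
  let ?T = "goodwillie_T n F" and ?gf = "compose (topspace (fst X)) g f"
  let ?J = "\<lambda>X Y f U. mor F (pjoin X U) (pjoin Y U) (join_map X U Y f)"
  note P = pointed_space_join[where n = n]
  have gf: "?gf \<in> pmaps X Z" by (rule pmaps_compose[OF f g pointed_spaceD(1)[OF X]])
  note p = pmaps_pointed_map[OF f] pmaps_pointed_map[OF g] pmaps_pointed_map[OF gf]
  have c: "continuous_map (fst (ob ?T X)) (fst (ob ?T Y)) (cube_map n (?J X Y f))"
    by (rule continuous_map_goodwillie_T[OF F X Y f])
  have "mor ?T Y Z g (mor ?T X Y f a) = cube_map n (?J Y Z g) (cube_map n (?J X Y f) a)"
    using goodwillie_T_mor[OF continuous_map_in_topspace[OF c a]] goodwillie_T_mor[OF a] by simp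
  also have "\<dots> = cube_map n (?J X Z ?gf) a"
    unfolding cube_map_compose
  proof (rule cube_map_cong[OF a[unfolded goodwillie_T_ob]])
    fix U x assume U: "U \<in> nonempty_subsets n" and x: "x \<in> topspace (fst (ob F (pjoin X U)))"
    show "?J Y Z g U (?J X Y f U x) = ?J X Z ?gf U x"
      by (rule top_functor_comp[OF F P[OF X U] P[OF Y U] P[OF Z U] join_map_pmaps[OF X p(1) subset_refl]
            join_map_pmaps[OF Y p(2) subset_refl] join_map_pmaps[OF X p(3) subset_refl] _ x])
        (rule join_map_compose[OF p subset_refl], simp_all add: compose_eq)
  qed
  finally show "mor ?T X Z ?gf a = mor ?T Y Z g (mor ?T X Y f a)" using goodwillie_T_mor[OF a] by simp
next
  fix X :: "'a pspace"
  show "k_space (fst (ob (goodwillie_T n F) X))" unfolding goodwillie_T_ob by (rule k_space_cube_holim)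
qed

lemma k_functor_top: "k_functor F \<Longrightarrow> top_functor F"
  by (simp add: k_functor_def)

lemma k_functor_T_iter: "k_functor F \<Longrightarrow> k_functor (T_iter n k F)"
  by (induction k) (auto simp: k_functor_goodwillie_T k_functor_top)

text \<open>The unit gives families that are constant on each simplex. They are compatible because
  enlarging the set fixes the copy of \<open>X\<close> inside the join.\<close>

lemma continuous_map_T_unit:
  assumes F: "k_functor F" and X: "pointed_space X"
  shows "continuous_map (fst (ob F X)) (fst (ob (goodwillie_T n F) X)) (T_unit n F X)"
proof -
  note F' = k_functor_top[OF F] and P = pointed_space_join[OF X, where n = n]
  have i: "join_incl X \<in> pmaps X (pjoin X U)" for U by (rule join_incl_pmaps[OF X])
  have "continuous_map (fst (ob F X)) (fst (ob (goodwillie_T n F) X))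
      (\<lambda>y. enc (\<lambda>U\<in>nonempty_subsets n. \<lambda>t\<in>simplex_face U. (mor F X (pjoin X U) (join_incl X) \<circ> fst) (y, t)))"
    unfolding goodwillie_T_ob
  proof (rule continuous_map_into_holim)
    show "k_space (fst (ob F X))" using F X unfolding k_functor_def by blast
    show "continuous_map (prod_topology (fst (ob F X)) (face_top U)) (fst (ob F (pjoin X U)))
        (mor F X (pjoin X U) (join_incl X) \<circ> fst)" if "U \<in> nonempty_subsets n" for U
      by (rule continuous_map_compose[OF continuous_map_fst top_functorD(1)[OF F' X P[OF that] i]])
    fix U V y t assume UV: "U \<in> nonempty_subsets n" "V \<in> nonempty_subsets n" "U \<subseteq> V" and y: "y \<in> topspace (fst (ob F X))"
    have "join_cube_mor F X U V (mor F X (pjoin X U) (join_incl X) y) = mor F X (pjoin X V) (join_incl X) y"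
      by (rule top_functor_comp[OF F' X P[OF UV(1)] P[OF UV(2)] i join_map_id_pmaps[OF X UV(3)] i _ y])
        (simp add: join_map_incl[OF pointed_map_id])
    then show "(mor F X (pjoin X V) (join_incl X) \<circ> fst) (y, t)
        = join_cube_mor F X U V ((mor F X (pjoin X U) (join_incl X) \<circ> fst) (y, t))" by simp
  qed
  then show ?thesis by (rule continuous_map_eq) (simp add: T_unit_def)
qed

lemma T_unit_natural:
  assumes F: "k_functor F" and X: "pointed_space X" and Y: "pointed_space Y" and f: "f \<in> pmaps X Y"
    and y: "y \<in> topspace (fst (ob F X))"
  shows "mor (goodwillie_T n F) X Y f (T_unit n F X y) = T_unit n F Y (mor F X Y f y)"
  unfolding goodwillie_T_mor[OF continuous_map_in_topspace[OF continuous_map_T_unit[OF F X] y]]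
  unfolding cube_map_def T_unit_def dec_enc[OF inj_enc_cube_points]
proof (intro arg_cong[of _ _ enc] restrict_ext, simp)
  fix U assume U: "U \<in> nonempty_subsets n"
  note P = pointed_space_join[OF X U] pointed_space_join[OF Y U] and f' = pmaps_pointed_map[OF f]
  show "mor F (pjoin X U) (pjoin Y U) (join_map X U Y f) (mor F X (pjoin X U) (join_incl X) y)
      = mor F Y (pjoin Y U) (join_incl Y) (mor F X Y f y)"
    by (rule top_functor_square[OF k_functor_top[OF F] X P(1) Y P(2) join_incl_pmaps[OF X]
          join_map_pmaps[OF X f' subset_refl] f join_incl_pmaps[OF Y] _ y]) (rule join_map_incl[OF f'])
qed

text \<open>Compatibility with the unit is a condition at each vertex; used for natural
  transformations and for the shift.\<close>

lemma cube_map_T_unit: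
  assumes "\<And>U. U \<in> nonempty_subsets n \<Longrightarrow>
      e U (mor F X (pjoin X U) (join_incl X) y) = mor G Z (pjoin Z U) (join_incl Z) z"
  shows "cube_map n e (T_unit n F X y) = T_unit n G Z z"
  unfolding cube_map_def T_unit_def dec_enc[OF inj_enc_cube_points]
  by (intro arg_cong[of _ _ enc] restrict_ext) (simp add: assms)

text \<open>Naturality of \<eta> enters three times: for the structure maps of the cube, for the
  maps induced by maps of spaces, and for the inclusions into joins.\<close>

lemma natural_equivalence_T:
  assumes F: "k_functor F" and G: "k_functor G" and \<eta>: "natural_equivalence F G \<eta>"
  shows "natural_equivalence (goodwillie_T n F) (goodwillie_T n G) (\<lambda>X. cube_map n (\<lambda>U. \<eta> (pjoin X U)))"
    and "\<And>X y. pointed_space X \<Longrightarrow> y \<in> topspace (fst (ob F X)) \<Longrightarrow>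
      cube_map n (\<lambda>U. \<eta> (pjoin X U)) (T_unit n F X y) = T_unit n G X (\<eta> X y)"
proof -
  note P = pointed_space_join[where n = n] and F' = k_functor_top[OF F] and G' = k_functor_top[OF G]
  have w: "weak_equivalence (fst (ob (goodwillie_T n F) X)) (fst (ob (goodwillie_T n G) X)) (cube_map n (\<lambda>U. \<eta> (pjoin X U)))"
    if X: "pointed_space X" for X
    unfolding goodwillie_T_ob
    by (rule weak_equivalence_cube_map[OF punctured_cube_join[OF F' X] punctured_cube_join[OF G' X]
          natural_equivalenceD(1)[OF \<eta> P[OF X]]],
        assumption, rule natural_equivalenceD(2)[OF \<eta> P[OF X] P[OF X] join_map_id_pmaps[OF X]])
  show "natural_equivalence (goodwillie_T n F) (goodwillie_T n G) (\<lambda>X. cube_map n (\<lambda>U. \<eta> (pjoin X U)))"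
    unfolding natural_equivalence_def
  proof (intro conjI allI impI ballI w)
    fix X Y f a assume X: "pointed_space X" and Y: "pointed_space Y" and f: "f \<in> pmaps X Y"
      and a: "a \<in> topspace (fst (ob (goodwillie_T n F) X))"
    have "cube_map n (\<lambda>U. \<eta> (pjoin X U)) a \<in> topspace (fst (ob (goodwillie_T n G) X))"
      by (rule weak_equivalence_in_topspace[OF w[OF X] a])
    from goodwillie_T_mor[OF this] goodwillie_T_mor[OF a]
    show "cube_map n (\<lambda>U. \<eta> (pjoin Y U)) (mor (goodwillie_T n F) X Y f a)
        = mor (goodwillie_T n G) X Y f (cube_map n (\<lambda>U. \<eta> (pjoin X U)) a)"
    proof (simp only: cube_map_compose, intro cube_map_cong[OF a[unfolded goodwillie_T_ob]])
      fix U x assume U: "U \<in> nonempty_subsets n" and x: "x \<in> topspace (fst (ob F (pjoin X U)))"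
      show "\<eta> (pjoin Y U) (mor F (pjoin X U) (pjoin Y U) (join_map X U Y f) x)
          = mor G (pjoin X U) (pjoin Y U) (join_map X U Y f) (\<eta> (pjoin X U) x)"
        by (rule natural_equivalenceD(2)[OF \<eta> P[OF X U] P[OF Y U] join_map_pmaps[OF X pmaps_pointed_map[OF f] subset_refl] x])
    qed
  qed
  show "cube_map n (\<lambda>U. \<eta> (pjoin X U)) (T_unit n F X y) = T_unit n G X (\<eta> X y)"
    if X: "pointed_space X" and y: "y \<in> topspace (fst (ob F X))" for X y
    by (rule cube_map_T_unit) (rule natural_equivalenceD(2)[OF \<eta> X P[OF X] join_incl_pmaps[OF X] y])
qed

lemma natural_equivalence_T_iter:
  assumes F: "k_functor F" and G: "k_functor G" and \<eta>: "natural_equivalence F G \<eta>"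
  shows "natural_equivalence (T_iter n k F) (T_iter n k G) (T_iter_trans n k \<eta>)"
proof (induction k)
  case 0
  have "T_iter_trans n 0 \<eta> = \<eta>" by (rule ext) simp
  then show ?case using \<eta> by simp
next
  case (Suc k)
  have "T_iter_trans n (Suc k) \<eta> = (\<lambda>X. cube_map n (\<lambda>U. T_iter_trans n k \<eta> (pjoin X U)))" by (rule ext) simp
  then show ?case
    using natural_equivalence_T(1)[OF k_functor_T_iter[OF F] k_functor_T_iter[OF G] Suc, of n] by simp
qed

lemma weak_equivalence_P_trans:
  assumes F: "k_functor F" and G: "k_functor G" and \<eta>: "natural_equivalence F G \<eta>" and X: "pointed_space X"
  shows "weak_equivalence (fst (ob (goodwillie_P n F) X)) (fst (ob (goodwillie_P n G) X)) (P_trans n G \<eta> X)"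
proof -
  note kF = k_functor_T_iter[OF F, where n = n] and kG = k_functor_T_iter[OF G, where n = n]
  note w = natural_equivalence_T_iter[OF F G \<eta>, where n = n]
  have "weak_equivalence (fst (telescope (\<lambda>k. ob (T_iter n k F) X) (T_seq n F X)))
     (fst (telescope (\<lambda>k. ob (T_iter n k G) X) (T_seq n G X))) (telescope_map (T_seq n G X) (\<lambda>k. T_iter_trans n k \<eta> X))"
  proof (rule weak_equivalence_telescope_map)
    show "continuous_map (fst (ob (T_iter n k F) X)) (fst (ob (T_iter n (Suc k) F) X)) (T_seq n F X k)"
      and "continuous_map (fst (ob (T_iter n k G) X)) (fst (ob (T_iter n (Suc k) G) X)) (T_seq n G X k)" for k
      using continuous_map_T_unit[OF kF X] continuous_map_T_unit[OF kG X] by simp_all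
    show "weak_equivalence (fst (ob (T_iter n k F) X)) (fst (ob (T_iter n k G) X)) (T_iter_trans n k \<eta> X)" for k
      by (rule natural_equivalenceD(1)[OF w X])
    show "T_iter_trans n (Suc k) \<eta> X (T_seq n F X k y) = T_seq n G X k (T_iter_trans n k \<eta> X y)"
      if "y \<in> topspace (fst (ob (T_iter n k F) X))" for k y
      using natural_equivalence_T(2)[OF kF kG w X that] by simp
  qed
  then show ?thesis by (simp add: goodwillie_P_def Let_def P_trans_def)
qed

lemma weak_equivalence_P_homeomorphic:
  assumes F: "k_functor F" and X: "pointed_space X" and Y: "pointed_space Y"
    and f: "f \<in> pmaps X Y" and h: "homeomorphic_map (fst X) (fst Y) f"
  shows "weak_equivalence (fst (ob (goodwillie_P n F) X)) (fst (ob (goodwillie_P n F) Y)) (mor (goodwillie_P n F) X Y f)"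
proof -
  note kF = k_functor_T_iter[OF F, where n = n]
  have "weak_equivalence (fst (telescope (\<lambda>k. ob (T_iter n k F) X) (T_seq n F X)))
     (fst (telescope (\<lambda>k. ob (T_iter n k F) Y) (T_seq n F Y))) (telescope_map (T_seq n F Y) (\<lambda>k. mor (T_iter n k F) X Y f))"
  proof (rule weak_equivalence_telescope_map)
    show "continuous_map (fst (ob (T_iter n k F) X)) (fst (ob (T_iter n (Suc k) F) X)) (T_seq n F X k)"
      and "continuous_map (fst (ob (T_iter n k F) Y)) (fst (ob (T_iter n (Suc k) F) Y)) (T_seq n F Y k)" for k
      using continuous_map_T_unit[OF kF X] continuous_map_T_unit[OF kF Y] by simp_all
    show "weak_equivalence (fst (ob (T_iter n k F) X)) (fst (ob (T_iter n k F) Y)) (mor (T_iter n k F) X Y f)" for k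
      by (rule weak_equivalence_mor_homeomorphic[OF k_functor_top[OF kF] X Y f h])
    show "mor (T_iter n (Suc k) F) X Y f (T_seq n F X k y) = T_seq n F Y k (mor (T_iter n k F) X Y f y)"
      if "y \<in> topspace (fst (ob (T_iter n k F) X))" for k y
      using T_unit_natural[OF kF X Y f that] by simp
  qed
  from weak_equivalence_cong[OF this] show ?thesis by (simp add: goodwillie_P_def Let_def)
qed

section \<open>The shift \<open>T\<^sub>n\<^sup>k (F\<^sub>X) A \<simeq> T\<^sub>n\<^sup>k F (X \<and> A)\<close>\<close>

lemma smash_map_ident:
  assumes f: "pointed_map A A f" and eq: "\<And>x. x \<in> topspace (fst A) \<Longrightarrow> f x = x" and a: "a \<in> topspace (fst (smash X A))"
  shows "mor (smash_functor X) A A f a = a"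
proof -
  obtain x y where xy: "x \<in> topspace (fst X)" "y \<in> topspace (fst A)" "a = smash_pt X A x y"
    using a by (rule smash_pointE)
  show ?thesis unfolding xy(3) smash_map_pt[OF f xy(1,2)] by (simp add: eq[OF xy(2)])
qed

lemma join_map_cong:
  assumes f: "pointed_map X Y f" "pointed_map X Y f'" and eq: "\<And>x. x \<in> topspace (fst X) \<Longrightarrow> f x = f' x"
    and a: "a \<in> topspace (fst (pjoin X U))"
  shows "join_map X U Y f a = join_map X U Y f' a"
proof -
  obtain x s where xs: "x \<in> topspace (fst X)" "s \<in> topspace (cone_star U)" "a = join_pt X x s"
    using a by (rule pjoin_pointE)
  show ?thesis unfolding xs(3) join_map_pt[OF f(1) xs(1,2)] join_map_pt[OF f(2) xs(1,2)] by (simp add: eq[OF xs(1)])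
qed

text \<open>One induction step of the shift: \<open>G\<close> stands for an iterate applied to the
  shifted functor, \<open>F\<close> for the same iterate of the original functor, and \<sigma> for
  the identification reached so far.\<close>

locale smash_shift_step =
  fixes n :: nat and F G :: "'u::universe space_functor" and X :: "'u pspace" and \<sigma> :: "'u pspace \<Rightarrow> 'u \<Rightarrow> 'u"
  assumes X: "pointed_space X" and F: "k_functor F" and G: "k_functor G"
    and \<sigma>: "natural_equivalence G (after_functor F (smash_functor X)) \<sigma>"
begin

abbreviation shift :: "'u pspace \<Rightarrow> nat set \<Rightarrow> 'u \<Rightarrow> 'u" where
  "shift A U \<equiv> mor F (smash X (pjoin A U)) (pjoin (smash X A) U) (join_assoc X A U) \<circ> \<sigma> (pjoin A U)"

lemma \<sigma>_weak: "pointed_space A \<Longrightarrow> weak_equivalence (fst (ob G A)) (fst (ob F (smash X A))) (\<sigma> A)"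
  using natural_equivalenceD(1)[OF \<sigma>] by (simp add: after_functor_def smash_functor_def)

lemma \<sigma>_in: "pointed_space A \<Longrightarrow> a \<in> topspace (fst (ob G A)) \<Longrightarrow> \<sigma> A a \<in> topspace (fst (ob F (smash X A)))"
  using natural_equivalenceD(3)[OF \<sigma>] by (simp add: after_functor_def smash_functor_def)

lemma \<sigma>_natural: "pointed_space A \<Longrightarrow> pointed_space B \<Longrightarrow> f \<in> pmaps A B \<Longrightarrow> a \<in> topspace (fst (ob G A)) \<Longrightarrow>
    \<sigma> B (mor G A B f a) = mor F (smash X A) (smash X B) (mor (smash_functor X) A B f) (\<sigma> A a)"
  using natural_equivalenceD(2)[OF \<sigma>] by (simp add: after_functor_def smash_functor_def)

lemma shift_weak:
  assumes A: "pointed_space A" and U: "U \<in> nonempty_subsets n"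
  shows "weak_equivalence (fst (ob G (pjoin A U))) (fst (ob F (pjoin (smash X A) U))) (shift A U)"
proof -
  have P: "pointed_space (pjoin A U)" by (rule pointed_space_join[OF A U])
  note h = join_assoc_homeomorphic[OF X A finite_nonempty_subset[OF U]]
  show ?thesis
    by (rule weak_equivalence_compose[OF \<sigma>_weak[OF P] weak_equivalence_mor_homeomorphic[OF k_functor_top[OF F]
          pointed_space_smash[OF X P] pointed_space_join[OF pointed_space_smash[OF X A] U] h(2,1)]])
qed

text \<open>Covers the structure maps of the cube (\<open>f\<close> the identity) and the maps
  induced by \<open>f\<close> (\<open>U = V\<close>). The cube over the smash product is formed with
  \<open>id\<close>, which agrees with the map induced by \<open>id\<close> only on the carrier;
  hence the separate \<open>g\<close>.\<close>

lemma shift_natural: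
  assumes A: "pointed_space A" and B: "pointed_space B" and f: "pointed_map A B f"
    and U: "U \<in> nonempty_subsets n" and V: "V \<in> nonempty_subsets n" and UV: "U \<subseteq> V"
    and g: "pointed_map (smash X A) (smash X B) g"
    and eq: "\<And>a. a \<in> topspace (fst (smash X A)) \<Longrightarrow> mor (smash_functor X) A B f a = g a"
    and x: "x \<in> topspace (fst (ob G (pjoin A U)))"
  shows "shift B V (mor G (pjoin A U) (pjoin B V) (join_map A U B f) x)
    = mor F (pjoin (smash X A) U) (pjoin (smash X B) V) (join_map (smash X A) U (smash X B) g) (shift A U x)"
proof -
  note PA = pointed_space_join[OF A U] and PB = pointed_space_join[OF B V]
  note SA = pointed_space_smash[OF X A] and SB = pointed_space_smash[OF X B]
  note hA = join_assoc_homeomorphic[OF X A finite_nonempty_subset[OF U]]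
  note hB = join_assoc_homeomorphic[OF X B finite_nonempty_subset[OF V]]
  have j: "join_map A U B f \<in> pmaps (pjoin A U) (pjoin B V)" by (rule join_map_pmaps[OF A f UV])
  have m: "mor (smash_functor X) (pjoin A U) (pjoin B V) (join_map A U B f) \<in> pmaps (smash X (pjoin A U)) (smash X (pjoin B V))"
    by (rule smash_map_pmaps[OF X PA pmaps_pointed_map[OF j]])
  have s: "pointed_map (smash X A) (smash X B) (mor (smash_functor X) A B f)"
    by (rule pmaps_pointed_map[OF smash_map_pmaps[OF X A f]])
  have "mor F (smash X (pjoin B V)) (pjoin (smash X B) V) (join_assoc X B V)
       (mor F (smash X (pjoin A U)) (smash X (pjoin B V)) (mor (smash_functor X) (pjoin A U) (pjoin B V) (join_map A U B f)) (\<sigma> (pjoin A U) x))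
     = mor F (pjoin (smash X A) U) (pjoin (smash X B) V) (join_map (smash X A) U (smash X B) g)
       (mor F (smash X (pjoin A U)) (pjoin (smash X A) U) (join_assoc X A U) (\<sigma> (pjoin A U) x))"
  proof (rule top_functor_square[OF k_functor_top[OF F] pointed_space_smash[OF X PA] pointed_space_smash[OF X PB]
        pointed_space_join[OF SA U] pointed_space_join[OF SB V] m hB(2) hA(2) join_map_pmaps[OF SA g UV] _ \<sigma>_in[OF PA x]])
    fix a assume a: "a \<in> topspace (fst (smash X (pjoin A U)))"
    have "join_assoc X A U a \<in> topspace (fst (pjoin (smash X A) U))"
      by (rule pointed_map_in[OF pmaps_pointed_map[OF hA(2)] a])
    from join_map_cong[OF s g eq this]
    show "join_assoc X B V (mor (smash_functor X) (pjoin A U) (pjoin B V) (join_map A U B f) a)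
        = join_map (smash X A) U (smash X B) g (join_assoc X A U a)"
      using join_assoc_natural[OF X A f UV a] by simp
  qed
  then show ?thesis using \<sigma>_natural[OF PA PB j x] by simp
qed

lemma natural_equivalence_shift:
  "natural_equivalence (goodwillie_T n G) (after_functor (goodwillie_T n F) (smash_functor X)) (\<lambda>A. cube_map n (shift A))"
  unfolding natural_equivalence_def
proof (intro conjI allI impI ballI)
  have w: "weak_equivalence (fst (ob (goodwillie_T n G) A)) (fst (ob (goodwillie_T n F) (smash X A))) (cube_map n (shift A))"
    if A: "pointed_space A" for A
    unfolding goodwillie_T_ob
    by (rule weak_equivalence_cube_map[OF punctured_cube_join[OF k_functor_top[OF G] A]
          punctured_cube_join[OF k_functor_top[OF F] pointed_space_smash[OF X A]] shift_weak[OF A]],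
        assumption, rule shift_natural[OF A A pointed_map_id _ _ _ pointed_map_id])
      (simp_all add: smash_map_ident[OF pointed_map_id])
  {
    fix A :: "'u pspace" assume A: "pointed_space A"
    show "weak_equivalence (fst (ob (goodwillie_T n G) A)) (fst (ob (after_functor (goodwillie_T n F) (smash_functor X)) A))
        (cube_map n (shift A))"
      using w[OF A] by (simp add: after_functor_def smash_functor_def)
  }
  fix A B :: "'u pspace" and f a
  assume A: "pointed_space A" and B: "pointed_space B" and f: "f \<in> pmaps A B"
    and a: "a \<in> topspace (fst (ob (goodwillie_T n G) A))"
  let ?m = "mor (smash_functor X) A B f"
  have f': "pointed_map A B f" by (rule pmaps_pointed_map[OF f])
  have m: "pointed_map (smash X A) (smash X B) ?m"
    by (rule pmaps_pointed_map[OF smash_map_pmaps[OF X A f']])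
  have "cube_map n (shift A) a \<in> topspace (fst (ob (goodwillie_T n F) (smash X A)))"
    by (rule weak_equivalence_in_topspace[OF w[OF A] a])
  from goodwillie_T_mor[OF this] goodwillie_T_mor[OF a]
  have "cube_map n (shift B) (mor (goodwillie_T n G) A B f a)
      = mor (goodwillie_T n F) (smash X A) (smash X B) ?m (cube_map n (shift A) a)"
  proof (simp only: cube_map_compose, intro cube_map_cong[OF a[unfolded goodwillie_T_ob]])
    fix U x assume U: "U \<in> nonempty_subsets n" and x: "x \<in> topspace (fst (ob G (pjoin A U)))"
    show "shift B U (mor G (pjoin A U) (pjoin B U) (join_map A U B f) x)
        = mor F (pjoin (smash X A) U) (pjoin (smash X B) U) (join_map (smash X A) U (smash X B) ?m) (shift A U x)"
      by (rule shift_natural[OF A B f' U U subset_refl m refl x])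
  qed
  then show "cube_map n (shift B) (mor (goodwillie_T n G) A B f a)
      = mor (after_functor (goodwillie_T n F) (smash_functor X)) A B f (cube_map n (shift A) a)"
    by (simp add: after_functor_def smash_functor_def)
qed

lemma shift_T_unit:
  assumes A: "pointed_space A" and y: "y \<in> topspace (fst (ob G A))"
  shows "cube_map n (shift A) (T_unit n G A y) = T_unit n F (smash X A) (\<sigma> A y)"
proof (rule cube_map_T_unit)
  fix U assume U: "U \<in> nonempty_subsets n"
  note PA = pointed_space_join[OF A U] and SA = pointed_space_smash[OF X A]
  have i: "join_incl A \<in> pmaps A (pjoin A U)" by (rule join_incl_pmaps[OF A])
  have "shift A U (mor G A (pjoin A U) (join_incl A) y)
      = mor F (smash X (pjoin A U)) (pjoin (smash X A) U) (join_assoc X A U)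
         (mor F (smash X A) (smash X (pjoin A U)) (mor (smash_functor X) A (pjoin A U) (join_incl A)) (\<sigma> A y))"
    using \<sigma>_natural[OF A PA i y] by simp
  also have "\<dots> = mor F (smash X A) (pjoin (smash X A) U) (join_incl (smash X A)) (\<sigma> A y)"
    by (rule top_functor_comp[OF k_functor_top[OF F] SA pointed_space_smash[OF X PA] pointed_space_join[OF SA U]
          smash_map_pmaps[OF X A pmaps_pointed_map[OF i]] join_assoc_homeomorphic(2)[OF X A finite_nonempty_subset[OF U]]
          join_incl_pmaps[OF SA] join_assoc_incl[OF A] \<sigma>_in[OF A y]])
  finally show "shift A U (mor G A (pjoin A U) (join_incl A) y)
      = mor F (smash X A) (pjoin (smash X A) U) (join_incl (smash X A)) (\<sigma> A y)" .
qed

end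

lemma k_functor_smash_shift:
  assumes "k_functor F" "pointed_space X" shows "k_functor (smash_shift F X)"
proof -
  have "fst (ob (after_functor F (smash_functor X)) A) = fst (ob F (smash X A))" for A
    by (simp add: after_functor_def smash_functor_def)
  then show ?thesis
    using top_functor_after_smash[of F X] pointed_space_smash[of X] assms unfolding k_functor_def smash_shift_def by metis
qed

lemma natural_equivalence_T_iter_shift:
  assumes F: "k_functor F" and X: "pointed_space X"
  shows "natural_equivalence (T_iter n k (smash_shift F X)) (after_functor (T_iter n k F) (smash_functor X)) (T_iter_shift n k F X)"
proof (induction k)
  case 0
  have "weak_equivalence Z Z id" for Z :: "'a topology"
    by (rule homeomorphic_weak_equivalence[of _ _ _ id]) (simp add: homeomorphic_maps_id)
  moreover have "T_iter_shift n 0 F X = (\<lambda>A. id)" by (rule ext) simp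
  ultimately show ?case by (simp add: natural_equivalence_def smash_shift_def del: T_iter_shift.simps id_apply) simp
next
  case (Suc k)
  interpret smash_shift_step n "T_iter n k F" "T_iter n k (smash_shift F X)" X "T_iter_shift n k F X"
    by (rule smash_shift_step.intro[OF X k_functor_T_iter[OF F] k_functor_T_iter[OF k_functor_smash_shift[OF F X]] Suc])
  have "T_iter_shift n (Suc k) F X = (\<lambda>A. cube_map n (shift A))" by (rule ext) simp
  then show ?case using natural_equivalence_shift by simp
qed

text \<open>The shifts on all stages commute with the units and give an equivalence of telescopes,
  with target the value at the smash product with the 0-sphere. The homeomorphism
  \<open>smash_unit\<close> leads from there to \<open>X\<close>.\<close>

lemma weak_equivalence_P_shift:
  assumes F: "k_functor F" and X: "pointed_space X"
  shows "weak_equivalence (fst (ob (goodwillie_P n (smash_shift F X)) S0)) (fst (ob (goodwillie_P n F) X)) (P_shift n F X)"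
proof -
  let ?G = "smash_shift F X"
  have S: "pointed_space (S0 :: 'a pspace)" unfolding S0_def by (rule pointed_space_finite_set_ob)
  note XS = pointed_space_smash[OF X S]
  note kF = k_functor_T_iter[OF F, where n = n] and kG = k_functor_T_iter[OF k_functor_smash_shift[OF F X], where n = n]
  have "weak_equivalence (fst (telescope (\<lambda>k. ob (T_iter n k ?G) S0) (T_seq n ?G S0)))
     (fst (telescope (\<lambda>k. ob (T_iter n k F) (smash X S0)) (T_seq n F (smash X S0))))
     (telescope_map (T_seq n F (smash X S0)) (\<lambda>k. T_iter_shift n k F X S0))"
  proof (rule weak_equivalence_telescope_map)
    fix k
    interpret smash_shift_step n "T_iter n k F" "T_iter n k ?G" X "T_iter_shift n k F X"
      by (rule smash_shift_step.intro[OF X kF kG natural_equivalence_T_iter_shift[OF F X]])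
    show "continuous_map (fst (ob (T_iter n k ?G) S0)) (fst (ob (T_iter n (Suc k) ?G) S0)) (T_seq n ?G S0 k)"
      and "continuous_map (fst (ob (T_iter n k F) (smash X S0))) (fst (ob (T_iter n (Suc k) F) (smash X S0))) (T_seq n F (smash X S0) k)"
      using continuous_map_T_unit[OF kG S] continuous_map_T_unit[OF kF XS] by simp_all
    show "weak_equivalence (fst (ob (T_iter n k ?G) S0)) (fst (ob (T_iter n k F) (smash X S0))) (T_iter_shift n k F X S0)"
      by (rule \<sigma>_weak[OF S])
    show "T_iter_shift n (Suc k) F X S0 (T_seq n ?G S0 k y) = T_seq n F (smash X S0) k (T_iter_shift n k F X S0 y)"
      if "y \<in> topspace (fst (ob (T_iter n k ?G) S0))" for y
      using shift_T_unit[OF S that] by simp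
  qed
  then have "weak_equivalence (fst (ob (goodwillie_P n ?G) S0)) (fst (ob (goodwillie_P n F) (smash X S0)))
     (telescope_map (T_seq n F (smash X S0)) (\<lambda>k. T_iter_shift n k F X S0))"
    by (simp add: goodwillie_P_def Let_def)
  then show ?thesis
    unfolding P_shift_def
    by (rule weak_equivalence_compose[OF _ weak_equivalence_P_homeomorphic[OF F XS X smash_unit_homeomorphic(2,1)[OF X]]])
qed

lemma k_functor_spaces_functor:
  assumes F: "is_functor Spaces F" shows "k_functor F"
  using top_functor_spaces_functor[OF F] pointed_spaceD(3)[OF spaces_functorD(1)[OF F]] by (simp add: k_functor_def)

lemma k_functor_LKan:
  assumes H: "is_functor Spaces H" shows "k_functor (LKan H)"
proof -
  interpret kan_extension H by standard (rule H)
  have "k_space (fst (ob (LKan H) Y))" for Y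
    unfolding LKan_ob by (rule k_space_quotient_map_image[OF quotient_map_coinduced k_space_sum_topology]) (rule k_space_kprod)
  then show ?thesis using top_functor_LKan by (simp add: k_functor_def)
qed

theorem proposition3p10:
  fixes F :: "'u::universe space_functor" and X :: "'u pspace"
  assumes "admissible F"
    and "pointed_space X"
    and "\<And>Y. pointed_space Y \<Longrightarrow>
      weak_equivalence (fst (ob (LKan (smash_shift F X)) Y)) (fst (ob (smash_shift F X) Y))
        (LKan_counit (smash_shift F X) Y)"
  shows "\<forall>n. weak_equivalence (fst (P_alg n F X)) (fst (ob (goodwillie_P n F) X)) (P_alg_map n F X)"
proof
  fix n
  let ?H = "smash_shift F X"
  have F: "is_functor Spaces F" using assms(1) by (simp add: admissible_def)
  have H: "is_functor Spaces ?H"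
    unfolding smash_shift_def by (rule is_functor_after[OF F is_functor_smash[OF assms(2)]])
  interpret kan_extension ?H by standard (rule H)
  have S: "pointed_space (S0 :: 'u pspace)" unfolding S0_def by (rule pointed_space_finite_set_ob)
  \<comment> \<open>The value of \<open>goodwillie_P\<close> at \<open>S0\<close> is built from the
    values at iterated joins of \<open>S0\<close> with finite sets, so the equivalence is used at
    these spaces and not only at \<open>S0\<close>.\<close>
  have "natural_equivalence (LKan ?H) ?H (LKan_counit ?H)"
    unfolding natural_equivalence_def using assms(3) LKan_counit_natural by blast
  from weak_equivalence_P_trans[OF k_functor_LKan[OF H] k_functor_spaces_functor[OF H] this S]
    weak_equivalence_P_shift[OF k_functor_spaces_functor[OF F] assms(2)]
  show "weak_equivalence (fst (P_alg n F X)) (fst (ob (goodwillie_P n F) X)) (P_alg_map n F X)"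
    unfolding P_alg_def P_alg_map_def by (rule weak_equivalence_compose)
qed

end
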